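(* Let $\mathcal{E}$ be a locally presentable and locally cartesian closed category equipped with a functorial cylinder $I\otimes(-)$ with contractions and connections such that $I\otimes(-)$ has a right adjoint. Let $(\mathsf{C},\mathsf{F_t})$ be a suitable algebraic weak factorization system on $\mathcal{E}$, cofibrantly generated by a small category of maps $u\colon\mathcal{I}\to\mathcal{E}^\to$. Let $\mathcal{I}_\otimes=\mathcal{I}+\mathcal{I}$ with functor $u_\otimes\colon\mathcal{I}_\otimes\to\mathcal{E}^\to$ given by $i\mapsto\delta^0\hat\otimes u_i$ on the first summand and $i\mapsto\delta^1\hat\otimes u_i$ on the second, and let $(\mathsf{C_t},\mathsf{F})$ be the cofibrantly generated algebraic weak factorization system with $\mathsf{F}\text{-}\mathsf{Map}=(\mathcal{I}_\otimes)^{\pitchfork}$ and $\mathsf{C_t}\text{-}\mathsf{map}={}^{\pitchfork}((\mathcal{I}_\otimes)^{\pitchfork})$. Then $(\mathsf{C_t},\mathsf{F})$ satisfies the functorial Frobenius condition.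
   Context: A functorial cylinder on $\mathcal{E}$ is an endofunctor $I\otimes(-)$ with natural transformations $\delta^0\otimes(-),\delta^1\otimes(-)\colon \mathrm{Id}\to I\otimes(-)$. It has contractions if there is a natural transformation $\varepsilon\otimes(-)\colon I\otimes(-)\to\mathrm{Id}$ with $(\varepsilon\otimes X)\circ(\delta^k\otimes X)=\mathrm{id}_X$ for $k=0,1$. It then has connections if for $k\in\{0,1\}$ there is a natural $c^k\otimes(-)\colon I\otimes I\otimes(-)\to I\otimes(-)$ such that $(c^k\otimes X)\circ(\delta^k\otimes I\otimes X)=(\delta^k\otimes X)\circ(\varepsilon\otimes X)=(c^k\otimes X)\circ(I\otimes\delta^k\otimes X)$ and $(c^k\otimes X)\circ(\delta^{1-k}\otimes I\otimes X)=\mathrm{id}_{I\otimes X}=(c^k\otimes X)\circ(I\otimes\delta^{1-k}\otimes X)$; here $\delta^k\otimes I\otimes X$ is the component at $I\otimes X$, and $I\otimes\delta^k\otimes X$ is $I\otimes(-)$ applied to the component at $X$. For $i\colon A\to B$ the Leibniz product $\delta^k\hat\otimes i\colon (I\otimes A)+_A B\to I\otimes B$ is the map out of the pushout of $\delta^k\otimes A$ and $i$ induced by $I\otimes i$ and $\delta^k\otimes B$; this is a functor $\mathcal{E}^\to\to\mathcal{E}^\to$. For $u\colon\mathcal{I}\to\mathcal{E}^\to$ with values $u_i\colon A_i\to B_i$, a right $\mathcal{I}$-map is a map $f\colon X\to Y$ with a function $\phi$ assigning to each $i$ and square $(s,t)\colon u_i\to f$ a diagonal filler $\phi(i,s,t)\colon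 B_i\to X$, such that for $\sigma\colon i\to j$ with $u_\sigma=(a,b)$ and $(s,t)\colon u_j\to f$ one has $\phi(j,s,t)\circ b=\phi(i,s\circ a,t\circ b)$; morphisms are squares commuting with fillers. $\mathcal{I}^{\pitchfork}$ is the category of right $\mathcal{I}$-maps over $\mathcal{E}^\to$, and ${}^{\pitchfork}\mathcal{I}$ the dually defined category of left $\mathcal{I}$-maps. An algebraic weak factorization system (awfs) $(\mathsf{L},\mathsf{R})$ is a functorial factorization $f=\mathsf{R}f\circ\mathsf{L}f$ together with a comultiplication $\mathsf{L}\to\mathsf{L}\mathsf{L}$ and a multiplication $\mathsf{R}\mathsf{R}\to\mathsf{R}$ making the copointed endofunctor $\mathsf{L}$ of $\mathcal{E}^\to$ a comonad and the pointed endofunctor $\mathsf{R}$ of $\mathcal{E}^\to$ a monad, such that the canonical $\mathsf{L}\mathsf{R}\to\mathsf{R}\mathsf{L}$ is a distributive law. $\mathsf{L}\text{-}\mathsf{map}$ is the category of coalgebras for the copointed endofunctor $\mathsf{L}$, $\mathsf{R}\text{-}\mathsf{map}$ that of algebras for the pointed endofunctor $\mathsf{R}$, and $\mathsf{R}\text{-}\mathsf{Map}$ that of algebras for the monad $\mathsf{R}$; one has $\mathsf{L}\text{-}\mathsf{map}={}^{\pitchfork}(\mathsf{R}\text{-}\mathsf{Map})$. The awfs is algebraically-free on $u\colon\mathcal{I}\to\mathcal{E}^\to$ if $\mathsf{R}\text{-}\mathsf{Map}\cong\mathcal{I}^{\pitchfork}$ over $\mathcal{E}^\to$, and cofibrantly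 generated (by $u$) if it is algebraically-free on some $u$ with $\mathcal{I}$ small. For an awfs $(\mathsf{C},\mathsf{F_t})$ put $\mathsf{Cof}=\mathsf{C}\text{-}\mathsf{map}$. It is suitable if: (S1) it is cofibrantly generated; (S2) the functor $\mathcal{E}\to\mathcal{E}^\to$, $X\mapsto(0\to X)$, factors through $\mathsf{Cof}\to\mathcal{E}^\to$; (S3) the pullback functor $P\colon\mathcal{E}^\to\times_{\mathcal{E}}\mathcal{E}^\to\to\mathcal{E}^\to$, $(g,h)\mapsto h^*(g)$, on pairs with common codomain lifts to a functor $\mathsf{Cof}\times_{\mathcal{E}}\mathcal{E}^\to\to\mathsf{Cof}$; (S4) for $k\in\{0,1\}$ the functor $\delta^k\hat\otimes(-)$ lifts to a functor $\mathsf{Cof}\to\mathsf{Cof}$. An awfs $(\mathsf{L},\mathsf{R})$ satisfies the functorial Frobenius condition if $P$ lifts, along the forgetful functors, to a functor $\mathsf{L}\text{-}\mathsf{map}\times_{\mathcal{E}}\mathsf{R}\text{-}\mathsf{map}\to\mathsf{L}\text{-}\mathsf{map}$. *)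

theory Defs
  imports Main "HOL-Library.FuncSet"
begin

section \<open>Categories, functors, natural transformations\<close>

record ('o, 'a) cat =
  Ob :: "'o set"
  Ar :: "'a set"
  Dom :: "'a \<Rightarrow> 'o"
  Cod :: "'a \<Rightarrow> 'o"
  Id :: "'o \<Rightarrow> 'a"
  Comp :: "'a \<Rightarrow> 'a \<Rightarrow> 'a"  (infixr "\<cdot>\<index>" 70)

definition hom :: "('o, 'a) cat \<Rightarrow> 'o \<Rightarrow> 'o \<Rightarrow> 'a set" where
  "hom C X Y = {f \<in> Ar C. Dom C f = X \<and> Cod C f = Y}"

locale category =
  fixes C :: "('o, 'a) cat" (structure)
  assumes Dom_Ob: "f \<in> Ar C \<Longrightarrow> Dom C f \<in> Ob C"
    and Cod_Ob: "f \<in> Ar C \<Longrightarrow> Cod C f \<in> Ob C"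
    and Id_hom: "X \<in> Ob C \<Longrightarrow> Id C X \<in> hom C X X"
    and Comp_hom: "f \<in> hom C X Y \<Longrightarrow> g \<in> hom C Y Z \<Longrightarrow> g \<cdot> f \<in> hom C X Z"
    and Id_left: "f \<in> hom C X Y \<Longrightarrow> Id C Y \<cdot> f = f"
    and Id_right: "f \<in> hom C X Y \<Longrightarrow> f \<cdot> Id C X = f"
    and Comp_assoc: "f \<in> hom C W X \<Longrightarrow> g \<in> hom C X Y \<Longrightarrow> h \<in> hom C Y Z \<Longrightarrow>
      (h \<cdot> g) \<cdot> f = h \<cdot> (g \<cdot> f)"

record ('o, 'a, 'p, 'b) fctr =
  FO :: "'o \<Rightarrow> 'p"
  FA :: "'a \<Rightarrow> 'b"

definition is_functor :: "('o, 'a) cat \<Rightarrow> ('p, 'b) cat \<Rightarrow> ('o, 'a, 'p, 'b) fctr \<Rightarrow> bool" where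
  "is_functor C D F \<longleftrightarrow>
     (\<forall>X\<in>Ob C. FO F X \<in> Ob D) \<and>
     (\<forall>f\<in>Ar C. FA F f \<in> hom D (FO F (Dom C f)) (FO F (Cod C f))) \<and>
     (\<forall>X\<in>Ob C. FA F (Id C X) = Id D (FO F X)) \<and>
     (\<forall>f\<in>Ar C. \<forall>g\<in>Ar C. Cod C f = Dom C g \<longrightarrow>
        FA F (g \<cdot>\<^bsub>C\<^esub> f) = FA F g \<cdot>\<^bsub>D\<^esub> FA F f)"

definition fid :: "('o, 'a, 'o, 'a) fctr" where
  "fid = \<lparr>FO = (\<lambda>X. X), FA = (\<lambda>f. f)\<rparr>"

definition fcomp :: "('p, 'b, 'q, 'c) fctr \<Rightarrow> ('o, 'a, 'p, 'b) fctr \<Rightarrow> ('o, 'a, 'q, 'c) fctr" where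
  "fcomp G F = \<lparr>FO = (\<lambda>X. FO G (FO F X)), FA = (\<lambda>f. FA G (FA F f))\<rparr>"

definition fprod :: "('o, 'a, 'p, 'b) fctr \<Rightarrow> ('q, 'c, 'r, 'd) fctr \<Rightarrow>
    ('o \<times> 'q, 'a \<times> 'c, 'p \<times> 'r, 'b \<times> 'd) fctr" where
  "fprod F G = \<lparr>FO = map_prod (FO F) (FO G), FA = map_prod (FA F) (FA G)\<rparr>"

text \<open>Equality of functors on a category, disregarding values outside its objects and arrows.\<close>

definition feq :: "('o, 'a) cat \<Rightarrow> ('o, 'a, 'p, 'b) fctr \<Rightarrow> ('o, 'a, 'p, 'b) fctr \<Rightarrow> bool" where
  "feq C F G \<longleftrightarrow> (\<forall>X\<in>Ob C. FO F X = FO G X) \<and> (\<forall>f\<in>Ar C. FA F f = FA G f)"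

definition nat_trans :: "('o, 'a) cat \<Rightarrow> ('p, 'b) cat \<Rightarrow>
    ('o, 'a, 'p, 'b) fctr \<Rightarrow> ('o, 'a, 'p, 'b) fctr \<Rightarrow> ('o \<Rightarrow> 'b) \<Rightarrow> bool" where
  "nat_trans C D F G \<alpha> \<longleftrightarrow>
     (\<forall>X\<in>Ob C. \<alpha> X \<in> hom D (FO F X) (FO G X)) \<and>
     (\<forall>f\<in>Ar C. \<alpha> (Cod C f) \<cdot>\<^bsub>D\<^esub> FA F f = FA G f \<cdot>\<^bsub>D\<^esub> \<alpha> (Dom C f))"

definition has_right_adjoint :: "('o, 'a) cat \<Rightarrow> ('p, 'b) cat \<Rightarrow> ('o, 'a, 'p, 'b) fctr \<Rightarrow> bool" where
  "has_right_adjoint C D F \<longleftrightarrow>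
     (\<exists>G \<eta> \<epsilon>. is_functor D C G \<and>
        nat_trans C C fid (fcomp G F) \<eta> \<and>
        nat_trans D D (fcomp F G) fid \<epsilon> \<and>
        (\<forall>X\<in>Ob C. \<epsilon> (FO F X) \<cdot>\<^bsub>D\<^esub> FA F (\<eta> X) = Id D (FO F X)) \<and>
        (\<forall>Y\<in>Ob D. FA G (\<epsilon> Y) \<cdot>\<^bsub>C\<^esub> \<eta> (FO G Y) = Id C (FO G Y)))"

definition lifts :: "('o, 'a) cat \<Rightarrow> ('p, 'b) cat \<Rightarrow> ('o, 'a, 'q, 'c) fctr \<Rightarrow>
    ('p, 'b, 'r, 'd) fctr \<Rightarrow> ('q, 'c, 'r, 'd) fctr \<Rightarrow> bool" where
  "lifts C D U V F \<longleftrightarrow> (\<exists>F'. is_functor C D F' \<and> feq C (fcomp V F') (fcomp F U))"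

definition iso_over :: "('o, 'a) cat \<Rightarrow> ('p, 'b) cat \<Rightarrow> ('o, 'a, 'q, 'c) fctr \<Rightarrow>
    ('p, 'b, 'q, 'c) fctr \<Rightarrow> bool" where
  "iso_over C D U V \<longleftrightarrow>
     (\<exists>F G. is_functor C D F \<and> is_functor D C G \<and>
        feq C (fcomp G F) fid \<and> feq D (fcomp F G) fid \<and> feq C (fcomp V F) U)"

section \<open>Constructions on categories\<close>

definition sum_cat :: "('o, 'a) cat \<Rightarrow> ('p, 'b) cat \<Rightarrow> ('o + 'p, 'a + 'b) cat" where
  "sum_cat C D =
     \<lparr>Ob = Ob C <+> Ob D, Ar = Ar C <+> Ar D,
      Dom = map_sum (Dom C) (Dom D), Cod = map_sum (Cod C) (Cod D), Id = map_sum (Id C) (Id D),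
      Comp = (\<lambda>g f. case (g, f) of
        (Inl g, Inl f) \<Rightarrow> Inl (g \<cdot>\<^bsub>C\<^esub> f) | (Inr g, Inr f) \<Rightarrow> Inr (g \<cdot>\<^bsub>D\<^esub> f) | _ \<Rightarrow> undefined)\<rparr>"

definition fcopair :: "('o, 'a, 'q, 'c) fctr \<Rightarrow> ('p, 'b, 'q, 'c) fctr \<Rightarrow>
    ('o + 'p, 'a + 'b, 'q, 'c) fctr" where
  "fcopair F G = \<lparr>FO = case_sum (FO F) (FO G), FA = case_sum (FA F) (FA G)\<rparr>"

text \<open>The strict pullback of categories along \<open>F\<close> and \<open>G\<close>.\<close>

definition fib_prod :: "('o, 'a) cat \<Rightarrow> ('p, 'b) cat \<Rightarrow> ('o, 'a, 'q, 'c) fctr \<Rightarrow>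
    ('p, 'b, 'q, 'c) fctr \<Rightarrow> ('o \<times> 'p, 'a \<times> 'b) cat" where
  "fib_prod C D F G =
     \<lparr>Ob = {(X, Y). X \<in> Ob C \<and> Y \<in> Ob D \<and> FO F X = FO G Y},
      Ar = {(f, g). f \<in> Ar C \<and> g \<in> Ar D \<and> FA F f = FA G g},
      Dom = map_prod (Dom C) (Dom D), Cod = map_prod (Cod C) (Cod D), Id = map_prod (Id C) (Id D),
      Comp = (\<lambda>(f', g') (f, g). (f' \<cdot>\<^bsub>C\<^esub> f, g' \<cdot>\<^bsub>D\<^esub> g))\<rparr>"

text \<open>An arrow \<open>(f, (s, t), g)\<close> of the arrow category is the square with top \<open>s\<close>, bottom \<open>t\<close>,
  left side \<open>f\<close> and right side \<open>g\<close>.\<close>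

type_synonym 'a square = "'a \<times> ('a \<times> 'a) \<times> 'a"

definition top_of :: "'a square \<Rightarrow> 'a" where
  "top_of q = fst (fst (snd q))"

definition bot_of :: "'a square \<Rightarrow> 'a" where
  "bot_of q = snd (fst (snd q))"

definition is_square :: "('o, 'a) cat \<Rightarrow> 'a \<Rightarrow> 'a \<Rightarrow> 'a \<Rightarrow> 'a \<Rightarrow> bool" where
  "is_square E f s t g \<longleftrightarrow> f \<in> Ar E \<and> g \<in> Ar E \<and>
     s \<in> hom E (Dom E f) (Dom E g) \<and> t \<in> hom E (Cod E f) (Cod E g) \<and> g \<cdot>\<^bsub>E\<^esub> s = t \<cdot>\<^bsub>E\<^esub> f"

definition arrow_cat :: "('o, 'a) cat \<Rightarrow> ('a, 'a square) cat" where
  "arrow_cat E =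
     \<lparr>Ob = Ar E, Ar = {(f, (s, t), g). is_square E f s t g},
      Dom = (\<lambda>(f, _, g). f), Cod = (\<lambda>(f, _, g). g),
      Id = (\<lambda>f. (f, (Id E (Dom E f), Id E (Cod E f)), f)),
      Comp = (\<lambda>(_, (s', t'), h) (f, (s, t), _). (f, (s' \<cdot>\<^bsub>E\<^esub> s, t' \<cdot>\<^bsub>E\<^esub> t), h))\<rparr>"

definition cod_fun :: "('o, 'a) cat \<Rightarrow> ('a, 'a square, 'o, 'a) fctr" where
  "cod_fun E = \<lparr>FO = Cod E, FA = bot_of\<rparr>"

text \<open>An arrow \<open>(g, m, h)\<close> of the slice over \<open>X\<close> is \<open>m\<close>, regarded as a map from \<open>g\<close> to \<open>h\<close>.\<close>

definition slice :: "('o, 'a) cat \<Rightarrow> 'o \<Rightarrow> ('a, 'a \<times> 'a \<times> 'a) cat" where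
  "slice E X =
     \<lparr>Ob = {g \<in> Ar E. Cod E g = X},
      Ar = {(g, m, h). g \<in> Ar E \<and> Cod E g = X \<and> h \<in> Ar E \<and> Cod E h = X \<and>
              m \<in> hom E (Dom E g) (Dom E h) \<and> h \<cdot>\<^bsub>E\<^esub> m = g},
      Dom = (\<lambda>(g, _, h). g), Cod = (\<lambda>(g, _, h). h),
      Id = (\<lambda>g. (g, Id E (Dom E g), g)),
      Comp = (\<lambda>(_, n, k) (g, m, _). (g, n \<cdot>\<^bsub>E\<^esub> m, k))\<rparr>"

text \<open>The category whose objects are the pairs \<open>(X, s) \<in> S\<close> of an object \<open>X\<close> of \<open>C\<close> and a structure
  \<open>s\<close> on it, and whose arrows are the arrows of \<open>C\<close> that preserve structure in the sense of \<open>H\<close>.\<close>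

type_synonym ('o, 'a, 's) str_arr = "('o \<times> 's) \<times> 'a \<times> ('o \<times> 's)"

definition str_cat :: "('o, 'a) cat \<Rightarrow> ('o \<times> 's) set \<Rightarrow> ('o \<times> 's \<Rightarrow> 'a \<Rightarrow> 'o \<times> 's \<Rightarrow> bool) \<Rightarrow>
    ('o \<times> 's, ('o, 'a, 's) str_arr) cat" where
  "str_cat C S H =
     \<lparr>Ob = S,
      Ar = {(X, m, Y). X \<in> S \<and> Y \<in> S \<and> m \<in> hom C (fst X) (fst Y) \<and> H X m Y},
      Dom = (\<lambda>(X, _, Y). X), Cod = (\<lambda>(X, _, Y). Y),
      Id = (\<lambda>X. (X, Id C (fst X), X)),
      Comp = (\<lambda>(_, n, Z) (X, m, _). (X, n \<cdot>\<^bsub>C\<^esub> m, Z))\<rparr>"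

definition forget :: "('o \<times> 's, ('o, 'a, 's) str_arr, 'o, 'a) fctr" where
  "forget = \<lparr>FO = fst, FA = (\<lambda>(_, m, _). m)\<rparr>"

section \<open>Limits and colimits\<close>

definition is_initial :: "('o, 'a) cat \<Rightarrow> 'o \<Rightarrow> bool" where
  "is_initial E z \<longleftrightarrow> z \<in> Ob E \<and> (\<forall>X\<in>Ob E. \<exists>!m. m \<in> hom E z X)"

definition is_terminal :: "('o, 'a) cat \<Rightarrow> 'o \<Rightarrow> bool" where
  "is_terminal E z \<longleftrightarrow> z \<in> Ob E \<and> (\<forall>X\<in>Ob E. \<exists>!m. m \<in> hom E X z)"

definition is_pullback :: "('o, 'a) cat \<Rightarrow> 'a \<Rightarrow> 'a \<Rightarrow> 'a \<Rightarrow> 'a \<Rightarrow> bool" where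
  "is_pullback E g h p q \<longleftrightarrow>
     p \<in> Ar E \<and> q \<in> Ar E \<and> Dom E p = Dom E q \<and> Cod E p = Dom E g \<and> Cod E q = Dom E h \<and>
     g \<cdot>\<^bsub>E\<^esub> p = h \<cdot>\<^bsub>E\<^esub> q \<and>
     (\<forall>Z\<in>Ob E. \<forall>x\<in>hom E Z (Dom E g). \<forall>y\<in>hom E Z (Dom E h). g \<cdot>\<^bsub>E\<^esub> x = h \<cdot>\<^bsub>E\<^esub> y \<longrightarrow>
        (\<exists>!w. w \<in> hom E Z (Dom E p) \<and> p \<cdot>\<^bsub>E\<^esub> w = x \<and> q \<cdot>\<^bsub>E\<^esub> w = y))"

definition is_pushout :: "('o, 'a) cat \<Rightarrow> 'a \<Rightarrow> 'a \<Rightarrow> 'a \<Rightarrow> 'a \<Rightarrow> bool" where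
  "is_pushout E g h p q \<longleftrightarrow>
     p \<in> Ar E \<and> q \<in> Ar E \<and> Cod E p = Cod E q \<and> Dom E p = Cod E g \<and> Dom E q = Cod E h \<and>
     p \<cdot>\<^bsub>E\<^esub> g = q \<cdot>\<^bsub>E\<^esub> h \<and>
     (\<forall>Z\<in>Ob E. \<forall>x\<in>hom E (Cod E g) Z. \<forall>y\<in>hom E (Cod E h) Z. x \<cdot>\<^bsub>E\<^esub> g = y \<cdot>\<^bsub>E\<^esub> h \<longrightarrow>
        (\<exists>!w. w \<in> hom E (Cod E p) Z \<and> w \<cdot>\<^bsub>E\<^esub> p = x \<and> w \<cdot>\<^bsub>E\<^esub> q = y))"

definition cocone :: "('i, 'j) cat \<Rightarrow> ('o, 'a) cat \<Rightarrow> ('i, 'j, 'o, 'a) fctr \<Rightarrow> 'o \<Rightarrow> ('i \<Rightarrow> 'a) \<Rightarrow> bool" where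
  "cocone J E D X \<iota> \<longleftrightarrow> X \<in> Ob E \<and> (\<forall>j\<in>Ob J. \<iota> j \<in> hom E (FO D j) X) \<and>
     (\<forall>\<sigma>\<in>Ar J. \<iota> (Cod J \<sigma>) \<cdot>\<^bsub>E\<^esub> FA D \<sigma> = \<iota> (Dom J \<sigma>))"

definition is_colimit :: "('i, 'j) cat \<Rightarrow> ('o, 'a) cat \<Rightarrow> ('i, 'j, 'o, 'a) fctr \<Rightarrow> 'o \<Rightarrow> ('i \<Rightarrow> 'a) \<Rightarrow> bool" where
  "is_colimit J E D X \<iota> \<longleftrightarrow> cocone J E D X \<iota> \<and>
     (\<forall>Y \<gamma>. cocone J E D Y \<gamma> \<longrightarrow> (\<exists>!m. m \<in> hom E X Y \<and> (\<forall>j\<in>Ob J. m \<cdot>\<^bsub>E\<^esub> \<iota> j = \<gamma> j)))"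

unbundle cardinal_syntax

section \<open>Smallness and local presentability\<close>

text \<open>Sizes are relative to a cardinal \<open>\<kappa>\<close>: a set is small if its cardinality is below \<open>\<kappa>\<close>. For
  inaccessible \<open>\<kappa>\<close> these are the sets isomorphic to an element of the Grothendieck universe
  determined by \<open>\<kappa>\<close>. That \<open>\<kappa>\<close> is a strong limit need not be imposed: a locally small category
  with small coproducts in which some hom-set has two elements forces it.
  Since \<open>\<kappa>\<close> is an order on a subset of \<open>'k\<close>, every small category is isomorphic to one
  with objects and arrows in \<open>'k\<close>, and every cardinal below \<open>\<kappa>\<close> is represented on \<open>'k\<close>.\<close>

definition universe_card :: "'k rel \<Rightarrow> bool" where
  "universe_card \<kappa> \<longleftrightarrow> Card_order \<kappa> \<and> natLeq <o \<kappa> \<and> regularCard \<kappa>"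

definition small :: "'k rel \<Rightarrow> 'x set \<Rightarrow> bool" where
  "small \<kappa> A \<longleftrightarrow> |A| <o \<kappa>"

definition small_cat :: "'k rel \<Rightarrow> ('i, 'j) cat \<Rightarrow> bool" where
  "small_cat \<kappa> J \<longleftrightarrow> category J \<and> small \<kappa> (Ob J) \<and> small \<kappa> (Ar J)"

definition locally_small :: "'k rel \<Rightarrow> ('o, 'a) cat \<Rightarrow> bool" where
  "locally_small \<kappa> E \<longleftrightarrow> (\<forall>X\<in>Ob E. \<forall>Y\<in>Ob E. small \<kappa> (hom E X Y))"

definition cocomplete :: "'k rel \<Rightarrow> ('o, 'a) cat \<Rightarrow> bool" where
  "cocomplete \<kappa> E \<longleftrightarrow> (\<forall>(J :: ('k, 'k) cat) D. small_cat \<kappa> J \<and> is_functor J E D \<longrightarrow>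
     (\<exists>X \<iota>. is_colimit J E D X \<iota>))"

definition filtered :: "'k rel \<Rightarrow> ('i, 'j) cat \<Rightarrow> bool" where
  "filtered \<rho> J \<longleftrightarrow> (\<forall>(K :: ('k, 'k) cat) D. category K \<and> |Ar K| <o \<rho> \<and> is_functor K J D \<longrightarrow>
     (\<exists>x \<iota>. cocone K J D x \<iota>))"

text \<open>The subsets of \<open>'x\<close> with functions between them. Colimits of hom-sets are tested in this
  category; this is no restriction, because two-element sets suffice as targets.\<close>

definition set_cat :: "('x set, 'x set \<times> ('x \<Rightarrow> 'x) \<times> 'x set) cat" where
  "set_cat =
     \<lparr>Ob = UNIV, Ar = {(A, f, B). f \<in> A \<rightarrow>\<^sub>E B},
      Dom = (\<lambda>(A, _, B). A), Cod = (\<lambda>(A, _, B). B),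
      Id = (\<lambda>A. (A, restrict (\<lambda>x. x) A, A)),
      Comp = (\<lambda>(_, g, C) (A, f, _). (A, compose A g f, C))\<rparr>"

definition hom_fun :: "('o, 'a) cat \<Rightarrow> 'o \<Rightarrow> ('o, 'a, 'a set, 'a set \<times> ('a \<Rightarrow> 'a) \<times> 'a set) fctr" where
  "hom_fun E X =
     \<lparr>FO = hom E X,
      FA = (\<lambda>f. (hom E X (Dom E f), \<lambda>g\<in>hom E X (Dom E f). f \<cdot>\<^bsub>E\<^esub> g, hom E X (Cod E f)))\<rparr>"

definition presentable :: "'k rel \<Rightarrow> 'k rel \<Rightarrow> ('o, 'a) cat \<Rightarrow> 'o \<Rightarrow> bool" where
  "presentable \<kappa> \<rho> E X \<longleftrightarrow> X \<in> Ob E \<and>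
     (\<forall>(J :: ('k, 'k) cat) D Y \<iota>.
        small_cat \<kappa> J \<and> filtered \<rho> J \<and> is_functor J E D \<and> is_colimit J E D Y \<iota> \<longrightarrow>
        is_colimit J set_cat (fcomp (hom_fun E X) D) (FO (hom_fun E X) Y) (\<lambda>j. FA (hom_fun E X) (\<iota> j)))"

definition locally_presentable :: "'k rel \<Rightarrow> ('o, 'a) cat \<Rightarrow> bool" where
  "locally_presentable \<kappa> E \<longleftrightarrow> category E \<and> locally_small \<kappa> E \<and> cocomplete \<kappa> E \<and>
     (\<exists>\<rho> :: 'k rel. Card_order \<rho> \<and> natLeq \<le>o \<rho> \<and> regularCard \<rho> \<and> \<rho> <o \<kappa> \<and>
       (\<exists>A. small \<kappa> A \<and> (\<forall>X\<in>A. presentable \<kappa> \<rho> E X) \<and>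
         (\<forall>X\<in>Ob E. \<exists>(J :: ('k, 'k) cat) D \<iota>. small_cat \<kappa> J \<and> filtered \<rho> J \<and> is_functor J E D \<and>
            (\<forall>j\<in>Ob J. FO D j \<in> A) \<and> is_colimit J E D X \<iota>)))"

section \<open>Chosen initial object, pullbacks and pushouts\<close>

text \<open>For a cospan \<open>(g, h)\<close>, the projections \<open>pb1 g h\<close> and \<open>pb2 g h\<close> go to the domains of \<open>g\<close> and \<open>h\<close>;
  for a span \<open>(g, h)\<close>, the injections \<open>po1 g h\<close> and \<open>po2 g h\<close> come from the codomains of \<open>g\<close> and \<open>h\<close>.\<close>

record ('o, 'a) chosen =
  zero :: 'o
  pb1 :: "'a \<Rightarrow> 'a \<Rightarrow> 'a"
  pb2 :: "'a \<Rightarrow> 'a \<Rightarrow> 'a"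
  po1 :: "'a \<Rightarrow> 'a \<Rightarrow> 'a"
  po2 :: "'a \<Rightarrow> 'a \<Rightarrow> 'a"

definition chosen_pullbacks :: "('o, 'a) cat \<Rightarrow> ('a \<Rightarrow> 'a \<Rightarrow> 'a) \<Rightarrow> ('a \<Rightarrow> 'a \<Rightarrow> 'a) \<Rightarrow> bool" where
  "chosen_pullbacks E p q \<longleftrightarrow>
     (\<forall>g\<in>Ar E. \<forall>h\<in>Ar E. Cod E g = Cod E h \<longrightarrow> is_pullback E g h (p g h) (q g h))"

definition chosen_pushouts :: "('o, 'a) cat \<Rightarrow> ('a \<Rightarrow> 'a \<Rightarrow> 'a) \<Rightarrow> ('a \<Rightarrow> 'a \<Rightarrow> 'a) \<Rightarrow> bool" where
  "chosen_pushouts E p q \<longleftrightarrow>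
     (\<forall>g\<in>Ar E. \<forall>h\<in>Ar E. Dom E g = Dom E h \<longrightarrow> is_pushout E g h (p g h) (q g h))"

definition is_chosen :: "('o, 'a) cat \<Rightarrow> ('o, 'a) chosen \<Rightarrow> bool" where
  "is_chosen E ch \<longleftrightarrow> is_initial E (zero ch) \<and>
     chosen_pullbacks E (pb1 ch) (pb2 ch) \<and> chosen_pushouts E (po1 ch) (po2 ch)"

definition initial_fun :: "('o, 'a) cat \<Rightarrow> 'o \<Rightarrow> ('o, 'a, 'a, 'a square) fctr" where
  "initial_fun E z =
     (let b = (\<lambda>X. THE m. m \<in> hom E z X)
      in \<lparr>FO = b, FA = (\<lambda>f. (b (Dom E f), (Id E z, f), b (Cod E f)))\<rparr>)"

text \<open>The functor \<open>P\<close> from pairs of maps with common codomain, sending \<open>(g, h)\<close>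
  to the base change of \<open>g\<close> along \<open>h\<close>.\<close>

definition pullback_fun :: "('o, 'a) cat \<Rightarrow> ('a \<Rightarrow> 'a \<Rightarrow> 'a) \<Rightarrow> ('a \<Rightarrow> 'a \<Rightarrow> 'a) \<Rightarrow>
    ('a \<times> 'a, 'a square \<times> 'a square, 'a, 'a square) fctr" where
  "pullback_fun E p q =
     \<lparr>FO = (\<lambda>(g, h). q g h),
      FA = (\<lambda>((g, (a, _), g'), (h, (c, _), h')).
        (q g h,
         (THE w. w \<in> hom E (Dom E (p g h)) (Dom E (p g' h')) \<and>
            p g' h' \<cdot>\<^bsub>E\<^esub> w = a \<cdot>\<^bsub>E\<^esub> p g h \<and> q g' h' \<cdot>\<^bsub>E\<^esub> w = c \<cdot>\<^bsub>E\<^esub> q g h, c),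
         q g' h'))\<rparr>"

definition base_change :: "('o, 'a) cat \<Rightarrow> ('a \<Rightarrow> 'a \<Rightarrow> 'a) \<Rightarrow> ('a \<Rightarrow> 'a \<Rightarrow> 'a) \<Rightarrow> 'a \<Rightarrow>
    ('a, 'a \<times> 'a \<times> 'a, 'a, 'a \<times> 'a \<times> 'a) fctr" where
  "base_change E p q f =
     \<lparr>FO = (\<lambda>g. q g f),
      FA = (\<lambda>(g, m, h).
        (q g f,
         THE w. w \<in> hom E (Dom E (p g f)) (Dom E (p h f)) \<and>
           p h f \<cdot>\<^bsub>E\<^esub> w = m \<cdot>\<^bsub>E\<^esub> p g f \<and> q h f \<cdot>\<^bsub>E\<^esub> w = q g f,
         q h f))\<rparr>"

text \<open>Finite limits (a terminal object and pullbacks), and a right adjoint to each base change functor.\<close>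

definition locally_cartesian_closed :: "('o, 'a) cat \<Rightarrow> bool" where
  "locally_cartesian_closed E \<longleftrightarrow> category E \<and> (\<exists>z. is_terminal E z) \<and>
     (\<exists>p q. chosen_pullbacks E p q \<and>
        (\<forall>f\<in>Ar E. has_right_adjoint (slice E (Cod E f)) (slice E (Dom E f)) (base_change E p q f)))"

section \<open>Functorial cylinders and Leibniz products\<close>

text \<open>The two endpoint inclusions are \<open>\<delta> k\<close> for \<open>k \<in> {0, 1}\<close>.\<close>

definition functorial_cylinder ::
  "('o, 'a) cat \<Rightarrow> ('o, 'a, 'o, 'a) fctr \<Rightarrow> (nat \<Rightarrow> 'o \<Rightarrow> 'a) \<Rightarrow> bool" where
  "functorial_cylinder E I \<delta> \<longleftrightarrow> is_functor E E I \<and> (\<forall>k\<in>{0, 1}. nat_trans E E fid I (\<delta> k))"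

definition contraction ::
  "('o, 'a) cat \<Rightarrow> ('o, 'a, 'o, 'a) fctr \<Rightarrow> (nat \<Rightarrow> 'o \<Rightarrow> 'a) \<Rightarrow> ('o \<Rightarrow> 'a) \<Rightarrow> bool" where
  "contraction E I \<delta> \<epsilon> \<longleftrightarrow> nat_trans E E I fid \<epsilon> \<and>
     (\<forall>k\<in>{0, 1}. \<forall>X\<in>Ob E. \<epsilon> X \<cdot>\<^bsub>E\<^esub> \<delta> k X = Id E X)"

definition connections :: "('o, 'a) cat \<Rightarrow> ('o, 'a, 'o, 'a) fctr \<Rightarrow> (nat \<Rightarrow> 'o \<Rightarrow> 'a) \<Rightarrow>
    ('o \<Rightarrow> 'a) \<Rightarrow> (nat \<Rightarrow> 'o \<Rightarrow> 'a) \<Rightarrow> bool" where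
  "connections E I \<delta> \<epsilon> c \<longleftrightarrow>
     (\<forall>k\<in>{0, 1}. nat_trans E E (fcomp I I) I (c k) \<and>
       (\<forall>X\<in>Ob E.
          c k X \<cdot>\<^bsub>E\<^esub> \<delta> k (FO I X) = \<delta> k X \<cdot>\<^bsub>E\<^esub> \<epsilon> X \<and>
          c k X \<cdot>\<^bsub>E\<^esub> FA I (\<delta> k X) = \<delta> k X \<cdot>\<^bsub>E\<^esub> \<epsilon> X \<and>
          c k X \<cdot>\<^bsub>E\<^esub> \<delta> (1 - k) (FO I X) = Id E (FO I X) \<and>
          c k X \<cdot>\<^bsub>E\<^esub> FA I (\<delta> (1 - k) X) = Id E (FO I X)))"

text \<open>The functor \<open>i \<mapsto> d \<otimes> i\<close> for one endpoint inclusion \<open>d\<close>; the pushout is that of \<open>d A\<close> and \<open>i\<close>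
  with \<open>A\<close> the domain of \<open>i\<close>.\<close>

definition leibniz :: "('o, 'a) cat \<Rightarrow> ('o, 'a) chosen \<Rightarrow> ('o, 'a, 'o, 'a) fctr \<Rightarrow> ('o \<Rightarrow> 'a) \<Rightarrow>
    ('a, 'a square, 'a, 'a square) fctr" where
  "leibniz E ch I d =
     (let p = (\<lambda>i. po1 ch (d (Dom E i)) i);
          q = (\<lambda>i. po2 ch (d (Dom E i)) i);
          l = (\<lambda>i. THE w. w \<in> hom E (Cod E (p i)) (FO I (Cod E i)) \<and>
                 w \<cdot>\<^bsub>E\<^esub> p i = FA I i \<and> w \<cdot>\<^bsub>E\<^esub> q i = d (Cod E i))
      in \<lparr>FO = l,
          FA = (\<lambda>(i, (s, t), j).
            (l i,
             (THE w. w \<in> hom E (Cod E (p i)) (Cod E (p j)) \<and>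
                w \<cdot>\<^bsub>E\<^esub> p i = p j \<cdot>\<^bsub>E\<^esub> FA I s \<and> w \<cdot>\<^bsub>E\<^esub> q i = q j \<cdot>\<^bsub>E\<^esub> t, FA I t),
             l j))\<rparr>)"

section \<open>Left and right maps\<close>

text \<open>A filling function \<open>\<phi>\<close> is only defined on (indices and) squares, so its values elsewhere are
  pinned to \<open>undefined\<close>; otherwise a map would carry many copies of the same structure and
  isomorphisms with categories of algebras would be out of reach.\<close>

definition right_str :: "('o, 'a) cat \<Rightarrow> ('i, 'j) cat \<Rightarrow> ('i, 'j, 'a, 'a square) fctr \<Rightarrow>
    'a \<Rightarrow> ('i \<Rightarrow> 'a \<Rightarrow> 'a \<Rightarrow> 'a) \<Rightarrow> bool" where
  "right_str E J u f \<phi> \<longleftrightarrow>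
     (\<forall>i s t. if i \<in> Ob J \<and> is_square E (FO u i) s t f
        then \<phi> i s t \<in> hom E (Cod E (FO u i)) (Dom E f) \<and>
             \<phi> i s t \<cdot>\<^bsub>E\<^esub> FO u i = s \<and> f \<cdot>\<^bsub>E\<^esub> \<phi> i s t = t
        else \<phi> i s t = undefined) \<and>
     (\<forall>\<sigma>\<in>Ar J. \<forall>s t. is_square E (FO u (Cod J \<sigma>)) s t f \<longrightarrow>
        \<phi> (Cod J \<sigma>) s t \<cdot>\<^bsub>E\<^esub> bot_of (FA u \<sigma>) =
        \<phi> (Dom J \<sigma>) (s \<cdot>\<^bsub>E\<^esub> top_of (FA u \<sigma>)) (t \<cdot>\<^bsub>E\<^esub> bot_of (FA u \<sigma>)))"

definition right_maps :: "('o, 'a) cat \<Rightarrow> ('i, 'j) cat \<Rightarrow> ('i, 'j, 'a, 'a square) fctr \<Rightarrow>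
    ('a \<times> ('i \<Rightarrow> 'a \<Rightarrow> 'a \<Rightarrow> 'a), ('a, 'a square, 'i \<Rightarrow> 'a \<Rightarrow> 'a \<Rightarrow> 'a) str_arr) cat" where
  "right_maps E J u = str_cat (arrow_cat E)
     {(f, \<phi>). f \<in> Ar E \<and> right_str E J u f \<phi>}
     (\<lambda>(f, \<phi>) m (g, \<psi>). \<forall>i\<in>Ob J. \<forall>s t. is_square E (FO u i) s t f \<longrightarrow>
        top_of m \<cdot>\<^bsub>E\<^esub> \<phi> i s t = \<psi> i (top_of m \<cdot>\<^bsub>E\<^esub> s) (bot_of m \<cdot>\<^bsub>E\<^esub> t))"

definition left_str :: "('o, 'a) cat \<Rightarrow> ('i, 'j) cat \<Rightarrow> ('i, 'j, 'a, 'a square) fctr \<Rightarrow>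
    'a \<Rightarrow> ('i \<Rightarrow> 'a \<Rightarrow> 'a \<Rightarrow> 'a) \<Rightarrow> bool" where
  "left_str E J v f \<phi> \<longleftrightarrow>
     (\<forall>j s t. if j \<in> Ob J \<and> is_square E f s t (FO v j)
        then \<phi> j s t \<in> hom E (Cod E f) (Dom E (FO v j)) \<and>
             \<phi> j s t \<cdot>\<^bsub>E\<^esub> f = s \<and> FO v j \<cdot>\<^bsub>E\<^esub> \<phi> j s t = t
        else \<phi> j s t = undefined) \<and>
     (\<forall>\<sigma>\<in>Ar J. \<forall>s t. is_square E f s t (FO v (Dom J \<sigma>)) \<longrightarrow>
        top_of (FA v \<sigma>) \<cdot>\<^bsub>E\<^esub> \<phi> (Dom J \<sigma>) s t =
        \<phi> (Cod J \<sigma>) (top_of (FA v \<sigma>) \<cdot>\<^bsub>E\<^esub> s) (bot_of (FA v \<sigma>) \<cdot>\<^bsub>E\<^esub> t))"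

definition left_maps :: "('o, 'a) cat \<Rightarrow> ('i, 'j) cat \<Rightarrow> ('i, 'j, 'a, 'a square) fctr \<Rightarrow>
    ('a \<times> ('i \<Rightarrow> 'a \<Rightarrow> 'a \<Rightarrow> 'a), ('a, 'a square, 'i \<Rightarrow> 'a \<Rightarrow> 'a \<Rightarrow> 'a) str_arr) cat" where
  "left_maps E J v = str_cat (arrow_cat E)
     {(f, \<phi>). f \<in> Ar E \<and> left_str E J v f \<phi>}
     (\<lambda>(f, \<phi>) m (g, \<psi>). \<forall>j\<in>Ob J. \<forall>s t. is_square E g s t (FO v j) \<longrightarrow>
        \<psi> j s t \<cdot>\<^bsub>E\<^esub> bot_of m = \<phi> j (s \<cdot>\<^bsub>E\<^esub> top_of m) (t \<cdot>\<^bsub>E\<^esub> bot_of m))"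

section \<open>Monads, comonads, distributive laws\<close>

definition monad :: "('o, 'a) cat \<Rightarrow> ('o, 'a, 'o, 'a) fctr \<Rightarrow> ('o \<Rightarrow> 'a) \<Rightarrow> ('o \<Rightarrow> 'a) \<Rightarrow> bool" where
  "monad C T \<eta> \<mu> \<longleftrightarrow> is_functor C C T \<and> nat_trans C C fid T \<eta> \<and> nat_trans C C (fcomp T T) T \<mu> \<and>
     (\<forall>X\<in>Ob C.
        \<mu> X \<cdot>\<^bsub>C\<^esub> \<eta> (FO T X) = Id C (FO T X) \<and>
        \<mu> X \<cdot>\<^bsub>C\<^esub> FA T (\<eta> X) = Id C (FO T X) \<and>
        \<mu> X \<cdot>\<^bsub>C\<^esub> \<mu> (FO T X) = \<mu> X \<cdot>\<^bsub>C\<^esub> FA T (\<mu> X))"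

definition comonad :: "('o, 'a) cat \<Rightarrow> ('o, 'a, 'o, 'a) fctr \<Rightarrow> ('o \<Rightarrow> 'a) \<Rightarrow> ('o \<Rightarrow> 'a) \<Rightarrow> bool" where
  "comonad C T \<epsilon> \<delta> \<longleftrightarrow> is_functor C C T \<and> nat_trans C C T fid \<epsilon> \<and> nat_trans C C T (fcomp T T) \<delta> \<and>
     (\<forall>X\<in>Ob C.
        \<epsilon> (FO T X) \<cdot>\<^bsub>C\<^esub> \<delta> X = Id C (FO T X) \<and>
        FA T (\<epsilon> X) \<cdot>\<^bsub>C\<^esub> \<delta> X = Id C (FO T X) \<and>
        \<delta> (FO T X) \<cdot>\<^bsub>C\<^esub> \<delta> X = FA T (\<delta> X) \<cdot>\<^bsub>C\<^esub> \<delta> X)"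

text \<open>A distributive law \<open>l : L R \<rightarrow> R L\<close> of the comonad \<open>L\<close> over the monad \<open>R\<close>.\<close>

definition distributive_law :: "('o, 'a) cat \<Rightarrow>
    ('o, 'a, 'o, 'a) fctr \<Rightarrow> ('o \<Rightarrow> 'a) \<Rightarrow> ('o \<Rightarrow> 'a) \<Rightarrow>
    ('o, 'a, 'o, 'a) fctr \<Rightarrow> ('o \<Rightarrow> 'a) \<Rightarrow> ('o \<Rightarrow> 'a) \<Rightarrow> ('o \<Rightarrow> 'a) \<Rightarrow> bool" where
  "distributive_law C L \<epsilon> \<delta> R \<eta> \<mu> l \<longleftrightarrow> nat_trans C C (fcomp L R) (fcomp R L) l \<and>
     (\<forall>X\<in>Ob C.
        l X \<cdot>\<^bsub>C\<^esub> FA L (\<eta> X) = \<eta> (FO L X) \<and>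
        FA R (\<epsilon> X) \<cdot>\<^bsub>C\<^esub> l X = \<epsilon> (FO R X) \<and>
        l X \<cdot>\<^bsub>C\<^esub> FA L (\<mu> X) = \<mu> (FO L X) \<cdot>\<^bsub>C\<^esub> (FA R (l X) \<cdot>\<^bsub>C\<^esub> l (FO R X)) \<and>
        FA R (\<delta> X) \<cdot>\<^bsub>C\<^esub> l X = l (FO L X) \<cdot>\<^bsub>C\<^esub> (FA L (l X) \<cdot>\<^bsub>C\<^esub> \<delta> (FO R X)))"

definition copointed_coalgs :: "('o, 'a) cat \<Rightarrow> ('o, 'a, 'o, 'a) fctr \<Rightarrow> ('o \<Rightarrow> 'a) \<Rightarrow>
    ('o \<times> 'a, ('o, 'a, 'a) str_arr) cat" where
  "copointed_coalgs C T \<epsilon> = str_cat C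
     {(X, c). X \<in> Ob C \<and> c \<in> hom C X (FO T X) \<and> \<epsilon> X \<cdot>\<^bsub>C\<^esub> c = Id C X}
     (\<lambda>(X, c) m (Y, d). FA T m \<cdot>\<^bsub>C\<^esub> c = d \<cdot>\<^bsub>C\<^esub> m)"

definition pointed_algs :: "('o, 'a) cat \<Rightarrow> ('o, 'a, 'o, 'a) fctr \<Rightarrow> ('o \<Rightarrow> 'a) \<Rightarrow>
    ('o \<times> 'a, ('o, 'a, 'a) str_arr) cat" where
  "pointed_algs C T \<eta> = str_cat C
     {(X, c). X \<in> Ob C \<and> c \<in> hom C (FO T X) X \<and> c \<cdot>\<^bsub>C\<^esub> \<eta> X = Id C X}
     (\<lambda>(X, c) m (Y, d). m \<cdot>\<^bsub>C\<^esub> c = d \<cdot>\<^bsub>C\<^esub> FA T m)"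

definition monad_algs :: "('o, 'a) cat \<Rightarrow> ('o, 'a, 'o, 'a) fctr \<Rightarrow> ('o \<Rightarrow> 'a) \<Rightarrow> ('o \<Rightarrow> 'a) \<Rightarrow>
    ('o \<times> 'a, ('o, 'a, 'a) str_arr) cat" where
  "monad_algs C T \<eta> \<mu> = str_cat C
     {(X, c). X \<in> Ob C \<and> c \<in> hom C (FO T X) X \<and> c \<cdot>\<^bsub>C\<^esub> \<eta> X = Id C X \<and> c \<cdot>\<^bsub>C\<^esub> \<mu> X = c \<cdot>\<^bsub>C\<^esub> FA T c}
     (\<lambda>(X, c) m (Y, d). m \<cdot>\<^bsub>C\<^esub> c = d \<cdot>\<^bsub>C\<^esub> FA T m)"

section \<open>Algebraic weak factorization systems\<close>

text \<open>The factorization of \<open>f\<close> is \<open>facR f \<circ> facL f\<close>, and \<open>facK\<close> sends a square from \<open>f\<close> to \<open>g\<close> to the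
  induced map between the middle objects; \<open>comult f\<close> and \<open>mult f\<close> are the components at \<open>f\<close> of
  \<open>L \<rightarrow> L L\<close> and \<open>R R \<rightarrow> R\<close>.\<close>

record 'a awfs_data =
  facL :: "'a \<Rightarrow> 'a"
  facR :: "'a \<Rightarrow> 'a"
  facK :: "'a square \<Rightarrow> 'a"
  comult :: "'a \<Rightarrow> 'a square"
  mult :: "'a \<Rightarrow> 'a square"

definition L_fun :: "'a awfs_data \<Rightarrow> ('a, 'a square, 'a, 'a square) fctr" where
  "L_fun W = \<lparr>FO = facL W, FA = (\<lambda>(f, (s, t), g). (facL W f, (s, facK W (f, (s, t), g)), facL W g))\<rparr>"

definition R_fun :: "'a awfs_data \<Rightarrow> ('a, 'a square, 'a, 'a square) fctr" where
  "R_fun W = \<lparr>FO = facR W, FA = (\<lambda>(f, (s, t), g). (facR W f, (facK W (f, (s, t), g), t), facR W g))\<rparr>"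

definition counit :: "('o, 'a) cat \<Rightarrow> 'a awfs_data \<Rightarrow> 'a \<Rightarrow> 'a square" where
  "counit E W f = (facL W f, (Id E (Dom E f), facR W f), f)"

definition unit :: "('o, 'a) cat \<Rightarrow> 'a awfs_data \<Rightarrow> 'a \<Rightarrow> 'a square" where
  "unit E W f = (f, (facL W f, Id E (Cod E f)), facR W f)"

text \<open>The canonical map \<open>L R f \<rightarrow> R L f\<close>.\<close>

definition canonical_law :: "'a awfs_data \<Rightarrow> 'a \<Rightarrow> 'a square" where
  "canonical_law W f =
     (facL W (facR W f), (bot_of (comult W f), top_of (mult W f)), facR W (facL W f))"

definition functorial_factorization :: "('o, 'a) cat \<Rightarrow> 'a awfs_data \<Rightarrow> bool" where
  "functorial_factorization E W \<longleftrightarrow>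
     (\<forall>f\<in>Ar E. facL W f \<in> Ar E \<and> facR W f \<in> Ar E \<and>
        Dom E (facL W f) = Dom E f \<and> Cod E (facL W f) = Dom E (facR W f) \<and>
        Cod E (facR W f) = Cod E f \<and> facR W f \<cdot>\<^bsub>E\<^esub> facL W f = f) \<and>
     is_functor (arrow_cat E) (arrow_cat E) (L_fun W) \<and>
     is_functor (arrow_cat E) (arrow_cat E) (R_fun W)"

definition awfs :: "('o, 'a) cat \<Rightarrow> 'a awfs_data \<Rightarrow> bool" where
  "awfs E W \<longleftrightarrow> functorial_factorization E W \<and>
     comonad (arrow_cat E) (L_fun W) (counit E W) (comult W) \<and>
     monad (arrow_cat E) (R_fun W) (unit E W) (mult W) \<and>
     distributive_law (arrow_cat E) (L_fun W) (counit E W) (comult W)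
       (R_fun W) (unit E W) (mult W) (canonical_law W)"

text \<open>The categories \<open>L\<close>-map, \<open>R\<close>-map (for the copointed and pointed endofunctors) and \<open>R\<close>-Map
  (for the monad), respectively.\<close>

definition L_maps :: "('o, 'a) cat \<Rightarrow> 'a awfs_data \<Rightarrow>
    ('a \<times> 'a square, ('a, 'a square, 'a square) str_arr) cat" where
  "L_maps E W = copointed_coalgs (arrow_cat E) (L_fun W) (counit E W)"

definition R_maps :: "('o, 'a) cat \<Rightarrow> 'a awfs_data \<Rightarrow>
    ('a \<times> 'a square, ('a, 'a square, 'a square) str_arr) cat" where
  "R_maps E W = pointed_algs (arrow_cat E) (R_fun W) (unit E W)"

definition R_Maps :: "('o, 'a) cat \<Rightarrow> 'a awfs_data \<Rightarrow>
    ('a \<times> 'a square, ('a, 'a square, 'a square) str_arr) cat" where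
  "R_Maps E W = monad_algs (arrow_cat E) (R_fun W) (unit E W) (mult W)"

definition algebraically_free :: "('o, 'a) cat \<Rightarrow> 'a awfs_data \<Rightarrow> ('i, 'j) cat \<Rightarrow>
    ('i, 'j, 'a, 'a square) fctr \<Rightarrow> bool" where
  "algebraically_free E W J u \<longleftrightarrow> iso_over (R_Maps E W) (right_maps E J u) forget forget"

definition generates :: "'k rel \<Rightarrow> ('o, 'a) cat \<Rightarrow> 'a awfs_data \<Rightarrow> ('i, 'j) cat \<Rightarrow>
    ('i, 'j, 'a, 'a square) fctr \<Rightarrow> bool" where
  "generates \<kappa> E W J u \<longleftrightarrow>
     small_cat \<kappa> J \<and> is_functor J (arrow_cat E) u \<and> algebraically_free E W J u"

definition cofibrantly_generated :: "'k rel \<Rightarrow> ('o, 'a) cat \<Rightarrow> 'a awfs_data \<Rightarrow> bool" where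
  "cofibrantly_generated \<kappa> E W \<longleftrightarrow> (\<exists>(J :: ('k, 'k) cat) u. generates \<kappa> E W J u)"

section \<open>Suitable systems and the functorial Frobenius condition\<close>

definition suitable :: "'k rel \<Rightarrow> ('o, 'a) cat \<Rightarrow> ('o, 'a) chosen \<Rightarrow> ('o, 'a, 'o, 'a) fctr \<Rightarrow>
    (nat \<Rightarrow> 'o \<Rightarrow> 'a) \<Rightarrow> 'a awfs_data \<Rightarrow> bool" where
  "suitable \<kappa> E ch I \<delta> W \<longleftrightarrow>
     cofibrantly_generated \<kappa> E W \<and>
     (\<exists>F. is_functor E (L_maps E W) F \<and> feq E (fcomp forget F) (initial_fun E (zero ch))) \<and>
     lifts (fib_prod (L_maps E W) (arrow_cat E) (fcomp (cod_fun E) forget) (cod_fun E)) (L_maps E W)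
       (fprod forget fid) forget (pullback_fun E (pb1 ch) (pb2 ch)) \<and>
     (\<forall>k\<in>{0, 1}. lifts (L_maps E W) (L_maps E W) forget forget (leibniz E ch I (\<delta> k)))"

definition functorial_frobenius :: "('o, 'a) cat \<Rightarrow> ('o, 'a) chosen \<Rightarrow> 'a awfs_data \<Rightarrow> bool" where
  "functorial_frobenius E ch W \<longleftrightarrow>
     lifts (fib_prod (L_maps E W) (R_maps E W)
         (fcomp (cod_fun E) forget) (fcomp (cod_fun E) forget)) (L_maps E W)
       (fprod forget forget) forget (pullback_fun E (pb1 ch) (pb2 ch))"

definition tensor_gen :: "('o, 'a) cat \<Rightarrow> ('o, 'a) chosen \<Rightarrow> ('o, 'a, 'o, 'a) fctr \<Rightarrow>
    (nat \<Rightarrow> 'o \<Rightarrow> 'a) \<Rightarrow> ('i, 'j, 'a, 'a square) fctr \<Rightarrow> ('i + 'i, 'j + 'j, 'a, 'a square) fctr" where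
  "tensor_gen E ch I \<delta> u =
     fcopair (fcomp (leibniz E ch I (\<delta> 0)) u) (fcomp (leibniz E ch I (\<delta> 1)) u)"

end

theory Submission
  imports Defs
begin

text \<open>
  Call the maps with natural fillers for the generators \<open>\<I>\<^sub>\<otimes>\<close> right maps, and the maps with natural fillers
  against all right maps left maps. The left maps are the coalgebras of \<open>C\<^sub>t\<close>, and every algebra for the pointed
  endofunctor \<open>F\<close> is a right map, since it fills against coalgebras. So the task is to make the
  pullback of a left map along a right map a left map, functorially. Functors over the arrow
  category are choices of structures that arrows preserve (\<open>lifts_str_catI\<close>, \<open>lifts_str_cat_ex\<close>), so
  all that has to be done is to construct fillers and to show that they are natural.

  First, it is enough to treat the generators. Let \<open>p\<close> be a right map with codomain \<open>B\<close>. Base change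
  along \<open>p\<close> has a right adjoint, so a right map \<open>r\<close> over the domain of \<open>p\<close> has a pushforward
  \<open>\<pi>\<close> over \<open>B\<close>. A filler for a generator against \<open>\<pi>\<close> is, by transposition, a filler for its
  pullback along a right map against \<open>r\<close>. Hence, if pullbacks of generators along right maps have
  natural fillers, then \<open>\<pi>\<close> is a right map (\<open>push_map_RM\<close>). A left map \<open>g\<close> over \<open>B\<close> then fills
  against \<open>\<pi>\<close>, and transposing back gives a filler for the pullback of \<open>g\<close> along \<open>p\<close> against \<open>r\<close>.
  These fillers are natural because two pushforwards that are related by a square from \<open>p\<close> to \<open>p'\<close> are
  connected by a span of morphisms of right maps (\<open>comparison_right_mor\<close>, \<open>left_fill_natural\<close>).

  Second, the generators \<open>\<delta>\<^sup>k \<otimes> u\<^sub>i\<close> (Leibniz product) are cofibrations by (S4), and the connections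
  make them strong homotopy equivalences (\<open>leibniz_strong_equiv\<close>). Both properties survive pullback
  along a right map \<open>p\<close>: the first by (S3), the second because the homotopy on the codomain can be
  lifted along \<open>p\<close> (\<open>lift_homotopy\<close>, \<open>pb_strong_equiv\<close>). The lifting is a filling against an endpoint
  inclusion \<open>Y \<rightarrow> I \<otimes> Y\<close>, which is, up to isomorphism, the Leibniz product of an endpoint with the
  cofibration \<open>0 \<rightarrow> Y\<close> of (S2).

  Third, a cofibration \<open>f\<close> that is a strong homotopy equivalence is a retract of \<open>\<delta>\<^sup>k \<otimes> f\<close> in the arrow
  category, so it has fillers against right maps (\<open>equiv_fill\<close>) as soon as \<open>\<delta>\<^sup>k \<otimes> f\<close> has them. For
  the latter, transpose along the adjunction between Leibniz product and pullback exponential: the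
  exponential of a right map fills against the generators \<open>u\<^sub>i\<close> of \<open>C\<close> (\<open>exp_map\<close>), hence is an
  algebra for the monad \<open>F\<^sub>t\<close> and fills against all coalgebras of \<open>C\<close> (\<open>cyl_fill\<close>).
\<close>

section \<open>Composition and pullbacks\<close>

context category begin

lemma comp_Ar [simp]: "\<lbrakk>f \<in> Ar C; g \<in> Ar C; Cod C f = Dom C g\<rbrakk> \<Longrightarrow> g \<cdot> f \<in> Ar C"
  and comp_Dom [simp]: "\<lbrakk>f \<in> Ar C; g \<in> Ar C; Cod C f = Dom C g\<rbrakk> \<Longrightarrow> Dom C (g \<cdot> f) = Dom C f"
  and comp_Cod [simp]: "\<lbrakk>f \<in> Ar C; g \<in> Ar C; Cod C f = Dom C g\<rbrakk> \<Longrightarrow> Cod C (g \<cdot> f) = Cod C g"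
  using Comp_hom[of f "Dom C f" "Cod C f" g "Cod C g"] by (auto simp: hom_def)

lemma comp_assoc [simp]:
  "\<lbrakk>f \<in> Ar C; g \<in> Ar C; h \<in> Ar C; Cod C f = Dom C g; Cod C g = Dom C h\<rbrakk>
   \<Longrightarrow> (h \<cdot> g) \<cdot> f = h \<cdot> (g \<cdot> f)"
  using Comp_assoc[of f "Dom C f" "Cod C f" g "Cod C g" h "Cod C h"] by (auto simp: hom_def)

lemma id_Ar [simp]: "X \<in> Ob C \<Longrightarrow> Id C X \<in> Ar C"
  and id_Dom [simp]: "X \<in> Ob C \<Longrightarrow> Dom C (Id C X) = X"
  and id_Cod [simp]: "X \<in> Ob C \<Longrightarrow> Cod C (Id C X) = X"
  using Id_hom[of X] by (auto simp: hom_def)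

lemma id_comp [simp]: "\<lbrakk>f \<in> Ar C; Cod C f = Y\<rbrakk> \<Longrightarrow> Id C Y \<cdot> f = f"
  and comp_id [simp]: "\<lbrakk>f \<in> Ar C; Dom C f = X\<rbrakk> \<Longrightarrow> f \<cdot> Id C X = f"
  using Id_left[of f "Dom C f" "Cod C f"] Id_right[of f "Dom C f" "Cod C f"] by (auto simp: hom_def)

declare Dom_Ob [simp] Cod_Ob [simp]

lemma hom_Ob: "f \<in> hom C X Y \<Longrightarrow> X \<in> Ob C" "f \<in> hom C X Y \<Longrightarrow> Y \<in> Ob C"
  by (auto simp: hom_def)

text \<open>Composites are normalized to right-nested form; there, an equation between composites
  only becomes a rewrite rule for non-final positions after composing it with a further arrow.\<close>

lemma comp_eq_ext:
  "\<lbrakk>g \<cdot> s = h; s \<in> Ar C; g \<in> Ar C; Cod C s = Dom C g; x \<in> Ar C; Cod C x = Dom C s\<rbrakk>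
   \<Longrightarrow> g \<cdot> (s \<cdot> x) = h \<cdot> x"
  using comp_assoc[of x s g] by simp

lemma comp_sq:
  "\<lbrakk>g \<cdot> s = t \<cdot> f; s \<in> Ar C; g \<in> Ar C; Cod C s = Dom C g; f \<in> Ar C; t \<in> Ar C; Cod C f = Dom C t;
    x \<in> Ar C; Cod C x = Dom C s; Cod C x = Dom C f\<rbrakk> \<Longrightarrow> g \<cdot> (s \<cdot> x) = t \<cdot> (f \<cdot> x)"
  using comp_assoc[of x s g] comp_assoc[of x f t] by simp

end

definition pb_map :: "('o, 'a) cat \<Rightarrow> 'a \<Rightarrow> 'a \<Rightarrow> 'o \<Rightarrow> 'a \<Rightarrow> 'a \<Rightarrow> 'a" where
  "pb_map E p q Z x y = (THE w. w \<in> hom E Z (Dom E p) \<and> p \<cdot>\<^bsub>E\<^esub> w = x \<and> q \<cdot>\<^bsub>E\<^esub> w = y)"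

context category begin

lemma pb_map:
  assumes "is_pullback C g h p q" "x \<in> hom C Z (Dom C g)" "y \<in> hom C Z (Dom C h)" "g \<cdot> x = h \<cdot> y"
  shows "pb_map C p q Z x y \<in> hom C Z (Dom C p)"
    and "p \<cdot> pb_map C p q Z x y = x" and "q \<cdot> pb_map C p q Z x y = y"
proof -
  have "Z \<in> Ob C" using assms(2) hom_Ob by blast
  then have "\<exists>!w. w \<in> hom C Z (Dom C p) \<and> p \<cdot> w = x \<and> q \<cdot> w = y"
    using assms unfolding is_pullback_def by blast
  from theI'[OF this] show "pb_map C p q Z x y \<in> hom C Z (Dom C p)"
    "p \<cdot> pb_map C p q Z x y = x" "q \<cdot> pb_map C p q Z x y = y"
    by (auto simp: pb_map_def)
qed

lemma pullback_D:
  assumes "is_pullback C g h p q"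
  shows "p \<in> hom C (Dom C p) (Dom C g)" "q \<in> hom C (Dom C p) (Dom C h)" "g \<cdot> p = h \<cdot> q"
  using assms by (auto simp: is_pullback_def hom_def)

lemma pullback_eqI:
  assumes P: "is_pullback C g h p q" and G: "g \<in> Ar C" "h \<in> Ar C" "Cod C g = Cod C h"
    and w: "w \<in> hom C Z (Dom C p)" "w' \<in> hom C Z (Dom C p)"
    and e: "p \<cdot> w = p \<cdot> w'" "q \<cdot> w = q \<cdot> w'"
  shows "w = w'"
proof -
  note D = pullback_D[OF P]
  have Z: "Z \<in> Ob C" using w hom_Ob by blast
  have 1: "p \<cdot> w \<in> hom C Z (Dom C g)" "q \<cdot> w \<in> hom C Z (Dom C h)"
    using w D by (auto simp: hom_def)
  have 2: "g \<cdot> (p \<cdot> w) = h \<cdot> (q \<cdot> w)"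
    using w D G comp_eq_ext[OF D(3), of w] by (simp add: hom_def)
  have "\<exists>!v. v \<in> hom C Z (Dom C p) \<and> p \<cdot> v = p \<cdot> w \<and> q \<cdot> v = q \<cdot> w"
    using P Z 1 2 unfolding is_pullback_def by blast
  then show ?thesis using w e by auto
qed

lemma pb_map_eqI:
  assumes "is_pullback C g h p q" "g \<in> Ar C" "h \<in> Ar C" "Cod C g = Cod C h"
    and "w \<in> hom C Z (Dom C p)" "p \<cdot> w = x" "q \<cdot> w = y"
  shows "pb_map C p q Z x y = w"
proof -
  note D = pullback_D[OF assms(1)]
  have xy: "x \<in> hom C Z (Dom C g)" "y \<in> hom C Z (Dom C h)" 
    using D assms(2-) by (auto simp: hom_def)
  have e: "g \<cdot> x = h \<cdot> y"
    using comp_eq_ext[OF D(3), of w] D assms(2-) by (auto simp: hom_def)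
  show ?thesis
    using pullback_eqI[OF assms(1-4) pb_map(1)[OF assms(1) xy e] assms(5)]
      pb_map(2,3)[OF assms(1) xy e] assms(6,7) by auto
qed

lemma pullback_paste:
  assumes P: "is_pullback C b p x y" and Q: "is_pullback C a x v w"
    and T: "b \<in> Ar C" "p \<in> Ar C" "Cod C b = Cod C p" "a \<in> Ar C" "Cod C a = Dom C b"
  shows "is_pullback C (b \<cdot> a) p v (y \<cdot> w)"
proof -
  note D = pullback_D[OF P] pullback_D[OF Q]
  have xC: "x \<in> Ar C" "Cod C a = Cod C x" using D T by (auto simp: hom_def)
  have eq: "(b \<cdot> a) \<cdot> v = p \<cdot> (y \<cdot> w)"
    using D T comp_eq_ext[OF D(3), of w] by (simp add: hom_def)
  have ex: "\<exists>!k. k \<in> hom C Z (Dom C v) \<and> v \<cdot> k = s \<and> (y \<cdot> w) \<cdot> k = t"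
    if s: "s \<in> hom C Z (Dom C (b \<cdot> a))" and t: "t \<in> hom C Z (Dom C p)" and e: "(b \<cdot> a) \<cdot> s = p \<cdot> t" for Z s t
  proof -
    have as: "a \<cdot> s \<in> hom C Z (Dom C b)" and s': "s \<in> hom C Z (Dom C a)" and bas: "b \<cdot> (a \<cdot> s) = p \<cdot> t"
      using s t e T by (auto simp: hom_def)
    define k0 where "k0 = pb_map C x y Z (a \<cdot> s) t"
    note k0 = pb_map[OF P as t bas, folded k0_def]
    have k0': "k0 \<in> hom C Z (Dom C x)" using k0 by simp
    define k where "k = pb_map C v w Z s k0"
    note k = pb_map[OF Q s' k0' k0(2)[symmetric], folded k_def]
    show ?thesis
    proof (rule ex1I[of _ k])
      show "k \<in> hom C Z (Dom C v) \<and> v \<cdot> k = s \<and> (y \<cdot> w) \<cdot> k = t"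
        using k k0 D T by (auto simp: hom_def)
    next
      fix l assume l: "l \<in> hom C Z (Dom C v) \<and> v \<cdot> l = s \<and> (y \<cdot> w) \<cdot> l = t"
      have wl: "w \<cdot> l \<in> hom C Z (Dom C x)" using l D by (auto simp: hom_def)
      have "x \<cdot> (w \<cdot> l) = a \<cdot> s" using comp_sq[OF D(6), of l] l D T by (auto simp: hom_def)
      moreover have "y \<cdot> (w \<cdot> l) = t" using l D by (auto simp: hom_def)
      ultimately have "w \<cdot> l = k0"
        using pullback_eqI[OF P T(1-3) wl k0'] k0 by simp
      then show "l = k"
        using pullback_eqI[OF Q T(4) xC(1) xC(2) _ k(1), of l] l k by auto
    qed
  qed
  have "v \<in> Ar C" "y \<cdot> w \<in> Ar C" "Dom C v = Dom C (y \<cdot> w)" "Cod C v = Dom C (b \<cdot> a)" "Cod C (y \<cdot> w) = Dom C p"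
    using D T by (auto simp: hom_def)
  then show ?thesis using eq ex unfolding is_pullback_def by blast
qed

end

section \<open>Functors into categories of structured objects\<close>

lemma str_cat_simps [simp]:
  "Ob (str_cat C S H) = S"
  "(X, m, Y) \<in> Ar (str_cat C S H) \<longleftrightarrow> X \<in> S \<and> Y \<in> S \<and> m \<in> hom C (fst X) (fst Y) \<and> H X m Y"
  "Dom (str_cat C S H) (X, m, Y) = X" "Cod (str_cat C S H) (X, m, Y) = Y"
  "Id (str_cat C S H) X = (X, Id C (fst X), X)"
  "Comp (str_cat C S H) (Y', n, Z) (X, m, Y) = (X, n \<cdot>\<^bsub>C\<^esub> m, Z)"
  by (auto simp: str_cat_def)

lemma forget_simps [simp]: "FO forget X = fst X" "FA forget (X, m, Y) = m"
  by (auto simp: forget_def)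

lemma fcomp_simps [simp]: "FO (fcomp G F) X = FO G (FO F X)" "FA (fcomp G F) f = FA G (FA F f)"
  by (auto simp: fcomp_def)

lemma fid_simps [simp]: "FO fid X = X" "FA fid f = f"
  by (auto simp: fid_def)

lemma fprod_simps [simp]: "FO (fprod F G) (X, Y) = (FO F X, FO G Y)" "FA (fprod F G) (f, g) = (FA F f, FA G g)"
  by (auto simp: fprod_def)

text \<open>The part of the category axioms that the definition of a functor refers to; it passes to
  fibre products at once.\<close>

definition typed_cat :: "('o, 'a) cat \<Rightarrow> bool" where
  "typed_cat C \<longleftrightarrow>
     (\<forall>f\<in>Ar C. Dom C f \<in> Ob C \<and> Cod C f \<in> Ob C) \<and>
     (\<forall>X\<in>Ob C. Dom C (Id C X) = X \<and> Cod C (Id C X) = X) \<and>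
     (\<forall>f\<in>Ar C. \<forall>g\<in>Ar C. Cod C f = Dom C g \<longrightarrow>
        Dom C (g \<cdot>\<^bsub>C\<^esub> f) = Dom C f \<and> Cod C (g \<cdot>\<^bsub>C\<^esub> f) = Cod C g)"

lemma (in category) typed_cat: "typed_cat C"
  by (simp add: typed_cat_def)

lemma typed_cat_str_cat [simp]: "typed_cat (str_cat C S H)"
  by (auto simp: typed_cat_def)

lemma typed_cat_fib_prod:
  assumes "typed_cat C" "typed_cat D"
    and F: "\<And>f. f \<in> Ar C \<Longrightarrow> FA F f \<in> hom Z (FO F (Dom C f)) (FO F (Cod C f))"
    and G: "\<And>g. g \<in> Ar D \<Longrightarrow> FA G g \<in> hom Z (FO G (Dom D g)) (FO G (Cod D g))"
  shows "typed_cat (fib_prod C D F G)"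
proof -
  have "FO F (Dom C f) = FO G (Dom D g) \<and> FO F (Cod C f) = FO G (Cod D g)"
    if "f \<in> Ar C" "g \<in> Ar D" "FA F f = FA G g" for f g
    using F[OF that(1)] G[OF that(2)] that(3) by (auto simp: hom_def)
  then show ?thesis using assms(1,2) by (auto simp: typed_cat_def fib_prod_def)
qed

text \<open>Arrows of \<open>str_cat D S H\<close> are arrows of \<open>D\<close> with a property. Therefore a functor into it that lies
  over a given one is determined by a choice of structures, and every choice that is preserved by
  arrows will do.\<close>

lemma lifts_str_catI:
  assumes F: "is_functor C D (fcomp F U)"
    and S: "\<And>X. X \<in> Ob C \<Longrightarrow> (FO F (FO U X), \<Phi> X) \<in> S"
    and H: "\<And>f. f \<in> Ar C \<Longrightarrow> H (FO F (FO U (Dom C f)), \<Phi> (Dom C f)) (FA F (FA U f))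
              (FO F (FO U (Cod C f)), \<Phi> (Cod C f))"
    and C: "typed_cat C"
  shows "lifts C (str_cat D S H) U forget F"
proof -
  define o' where "o' = (\<lambda>X. (FO F (FO U X), \<Phi> X))"
  define F' where "F' = \<lparr>FO = o', FA = (\<lambda>f. (o' (Dom C f), FA F (FA U f), o' (Cod C f)))\<rparr>"
  have "is_functor C (str_cat D S H) F'"
    using F S H C unfolding is_functor_def F'_def o'_def typed_cat_def 
    by (auto simp: hom_def[of "str_cat D S H"])
  moreover have "feq C (fcomp forget F') (fcomp F U)"
    by (simp add: feq_def F'_def o'_def)
  ultimately show ?thesis unfolding lifts_def by blast
qed

lemma lifts_str_cat_ex:
  assumes "lifts C B U forget F" and B: "B = str_cat D S H" and C: "typed_cat C"
  shows "\<exists>\<Phi>. (\<forall>X\<in>Ob C. (FO F (FO U X), \<Phi> X) \<in> Ob B) \<and>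
    (\<forall>f\<in>Ar C. ((FO F (FO U (Dom C f)), \<Phi> (Dom C f)), FA F (FA U f), (FO F (FO U (Cod C f)), \<Phi> (Cod C f))) \<in> Ar B)"
proof -
  from assms(1) obtain F' where F': "is_functor C B F'" "feq C (fcomp forget F') (fcomp F U)"
    unfolding lifts_def by blast
  have o: "(FO F (FO U X), snd (FO F' X)) = FO F' X" if "X \<in> Ob C" for X
    using F'(2) that by (auto simp: feq_def prod_eq_iff)
  have "((FO F (FO U (Dom C f)), snd (FO F' (Dom C f))), FA F (FA U f),
      (FO F (FO U (Cod C f)), snd (FO F' (Cod C f)))) \<in> Ar B" if f: "f \<in> Ar C" for f
  proof -
    have a: "FA F' f \<in> hom B (FO F' (Dom C f)) (FO F' (Cod C f))"
      using F'(1) f by (auto simp: is_functor_def)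
    have b: "FA forget (FA F' f) = FA F (FA U f)" using F'(2) f by (auto simp: feq_def)
    obtain X m Y where m: "FA F' f = (X, m, Y)" by (cases "FA F' f")
    have "(FO F' (Dom C f), FA F (FA U f), FO F' (Cod C f)) \<in> Ar B"
      using a b unfolding m B by (auto simp: hom_def)
    then show ?thesis using o C f by (simp add: typed_cat_def)
  qed
  then show ?thesis
    using o F'(1) by (intro exI[of _ "\<lambda>X. snd (FO F' X)"]) (auto simp: is_functor_def)
qed

text \<open>The preceding lemma for a functor between two categories of structured objects.\<close>

lemma lifts_between_str_cats_ex:
  assumes "lifts A B forget forget F" and A: "A = str_cat C S' H'" and B: "B = str_cat D S H"
  shows "\<exists>\<Phi>. (\<forall>X\<in>Ob A. (FO F (fst X), \<Phi> X) \<in> Ob B) \<and>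
    (\<forall>X m Y. (X, m, Y) \<in> Ar A \<longrightarrow> ((FO F (fst X), \<Phi> X), FA F m, (FO F (fst Y), \<Phi> Y)) \<in> Ar B)"
proof -
  have "typed_cat A" by (simp add: A)
  from lifts_str_cat_ex[OF assms(1) B this, unfolded forget_simps(1)] obtain \<Phi> where
    "\<forall>X\<in>Ob A. (FO F (fst X), \<Phi> X) \<in> Ob B"
    "\<forall>f\<in>Ar A. ((FO F (fst (Dom A f)), \<Phi> (Dom A f)), FA F (FA forget f),
       (FO F (fst (Cod A f)), \<Phi> (Cod A f))) \<in> Ar B" by blast
  note \<Phi> = this(1) bspec[OF this(2)]
  have "((FO F (fst X), \<Phi> X), FA F m, (FO F (fst Y), \<Phi> Y)) \<in> Ar B" if "(X, m, Y) \<in> Ar A" for X m Y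
    using \<Phi>(2)[OF that] by (simp add: A)
  then show ?thesis using \<Phi>(1) by (intro exI[of _ \<Phi>]) simp
qed

text \<open>The inverse \<open>G\<close> also lies over the base category, because \<open>U G = V F G = V\<close>.\<close>

lemma iso_over_lifts:
  assumes "iso_over C D U V"
  shows "lifts C D U V fid" "lifts D C V U fid"
proof -
  from assms obtain F G where FG: "is_functor C D F" "is_functor D C G" "feq C (fcomp G F) fid"
    "feq D (fcomp F G) fid" "feq C (fcomp V F) U" unfolding iso_over_def by blast
  have 1: "FO G X \<in> Ob C" if "X \<in> Ob D" for X using FG(2) that by (auto simp: is_functor_def)
  have 2: "FA G f \<in> Ar C" if "f \<in> Ar D" for f using FG(2) that by (auto simp: is_functor_def hom_def)
  have "feq D (fcomp U G) V"
    unfolding feq_def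
  proof safe
    fix X assume X: "X \<in> Ob D"
    show "FO (fcomp U G) X = FO V X" using FG(4,5) 1[OF X] X by (auto simp: feq_def)
  next
    fix f assume f: "f \<in> Ar D"
    show "FA (fcomp U G) f = FA V f" using FG(4,5) 2[OF f] f by (auto simp: feq_def)
  qed
  then show "lifts C D U V fid" "lifts D C V U fid" 
    using FG unfolding lifts_def feq_def by (auto intro!: exI[of _ F] exI[of _ G])
qed

section \<open>The arrow category\<close>

lemma arrow_cat_simps [simp]:
  "Ob (arrow_cat E) = Ar E" "(f, (s, t), g) \<in> Ar (arrow_cat E) \<longleftrightarrow> is_square E f s t g"
  "Dom (arrow_cat E) (f, st, g) = f" "Cod (arrow_cat E) (f, st, g) = g"
  "Id (arrow_cat E) f = (f, (Id E (Dom E f), Id E (Cod E f)), f)"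
  "Comp (arrow_cat E) (g', (s', t'), h) (f, (s, t), g) = (f, (s' \<cdot>\<^bsub>E\<^esub> s, t' \<cdot>\<^bsub>E\<^esub> t), h)"
  by (auto simp: arrow_cat_def)

lemma top_bot_simps [simp]: "top_of (f, (s, t), g) = s" "bot_of (f, (s, t), g) = t"
  by (auto simp: top_of_def bot_of_def)

lemma arrow_cat_homE:
  assumes "m \<in> hom (arrow_cat E) f g"
  obtains s t where "m = (f, (s, t), g)" "is_square E f s t g"
  using assms by (cases m) (auto simp: hom_def)

lemma arrow_cat_hom: "(f', (s, t), g') \<in> hom (arrow_cat E) f g \<longleftrightarrow> f' = f \<and> g' = g \<and> is_square E f s t g"
  by (auto simp: hom_def)

lemma is_square_D:
  assumes "is_square E f s t g"
  shows "f \<in> Ar E" "g \<in> Ar E" "s \<in> Ar E" "t \<in> Ar E" "Dom E s = Dom E f" "Cod E s = Dom E g"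
    "Dom E t = Cod E f" "Cod E t = Cod E g" "g \<cdot>\<^bsub>E\<^esub> s = t \<cdot>\<^bsub>E\<^esub> f"
  using assms by (auto simp: is_square_def hom_def)

lemma is_squareI:
  assumes "f \<in> Ar E" "g \<in> Ar E" "s \<in> Ar E" "t \<in> Ar E" "Dom E s = Dom E f" "Cod E s = Dom E g"
    "Dom E t = Cod E f" "Cod E t = Cod E g" "g \<cdot>\<^bsub>E\<^esub> s = t \<cdot>\<^bsub>E\<^esub> f"
  shows "is_square E f s t g"
  using assms by (auto simp: is_square_def hom_def)

context category begin

lemma square_comp: "is_square C f (s' \<cdot> s) (t' \<cdot> t) h" if "is_square C f s t g" "is_square C g s' t' h"
proof (rule is_squareI)
  note D = that[THEN is_square_D(1)] that[THEN is_square_D(2)] that[THEN is_square_D(3)] that[THEN is_square_D(4)]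
    that[THEN is_square_D(5)] that[THEN is_square_D(6)] that[THEN is_square_D(7)] that[THEN is_square_D(8)]
  show "h \<cdot> (s' \<cdot> s) = (t' \<cdot> t) \<cdot> f" 
    using D comp_sq[OF is_square_D(9)[OF that(2)], of s] is_square_D(9)[OF that(1)] by simp
qed (use that[THEN is_square_D(1)] that[THEN is_square_D(2)] that[THEN is_square_D(3)] that[THEN is_square_D(4)]
    that[THEN is_square_D(5)] that[THEN is_square_D(6)] that[THEN is_square_D(7)] that[THEN is_square_D(8)] in simp_all)

lemma square_id: "f \<in> Ar C \<Longrightarrow> is_square C f (Id C (Dom C f)) (Id C (Cod C f)) f"
  by (rule is_squareI) auto

lemma category_arrow_cat: "category (arrow_cat C)"
proof
  fix f X Y g Z assume "f \<in> hom (arrow_cat C) X Y" "g \<in> hom (arrow_cat C) Y Z"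
  then show "g \<cdot>\<^bsub>arrow_cat C\<^esub> f \<in> hom (arrow_cat C) X Z"
    by (elim arrow_cat_homE) (simp add: arrow_cat_hom square_comp)
next
  fix f g h W X Y Z assume a: "f \<in> hom (arrow_cat C) W X" "g \<in> hom (arrow_cat C) X Y" "h \<in> hom (arrow_cat C) Y Z"
  from a obtain s t where f: "f = (W, (s, t), X)" "is_square C W s t X" by (elim arrow_cat_homE)
  from a obtain s' t' where g: "g = (X, (s', t'), Y)" "is_square C X s' t' Y" by (elim arrow_cat_homE)
  from a obtain s'' t'' where h: "h = (Y, (s'', t''), Z)" "is_square C Y s'' t'' Z" by (elim arrow_cat_homE)
  show "(h \<cdot>\<^bsub>arrow_cat C\<^esub> g) \<cdot>\<^bsub>arrow_cat C\<^esub> f = h \<cdot>\<^bsub>arrow_cat C\<^esub> g \<cdot>\<^bsub>arrow_cat C\<^esub> f"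
    using f g h by (auto simp: is_square_def hom_def)
qed (auto elim!: arrow_cat_homE simp: arrow_cat_hom square_id dest: is_square_D simp: hom_def is_square_def)

end

section \<open>Left and right maps\<close>

type_synonym ('a, 'i) lifting_map = "'a \<times> ('i \<Rightarrow> 'a \<Rightarrow> 'a \<Rightarrow> 'a)"

definition fills :: "('o, 'a) cat \<Rightarrow> 'a \<Rightarrow> 'a \<Rightarrow> 'a \<Rightarrow> 'a \<Rightarrow> 'a \<Rightarrow> bool" where
  "fills E f s t g d \<longleftrightarrow> d \<in> hom E (Cod E f) (Dom E g) \<and> d \<cdot>\<^bsub>E\<^esub> f = s \<and> g \<cdot>\<^bsub>E\<^esub> d = t"

definition right_mor :: "('o, 'a) cat \<Rightarrow> ('i, 'j) cat \<Rightarrow> ('i, 'j, 'a, 'a square) fctr \<Rightarrow>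
    ('a, 'i) lifting_map \<Rightarrow> 'a \<Rightarrow> 'a \<Rightarrow> ('a, 'i) lifting_map \<Rightarrow> bool" where
  "right_mor E J u X a b Y \<longleftrightarrow> X \<in> Ob (right_maps E J u) \<and> Y \<in> Ob (right_maps E J u) \<and>
     is_square E (fst X) a b (fst Y) \<and>
     (\<forall>i\<in>Ob J. \<forall>s t. is_square E (FO u i) s t (fst X) \<longrightarrow>
        a \<cdot>\<^bsub>E\<^esub> snd X i s t = snd Y i (a \<cdot>\<^bsub>E\<^esub> s) (b \<cdot>\<^bsub>E\<^esub> t))"

definition left_mor :: "('o, 'a) cat \<Rightarrow> ('i, 'j) cat \<Rightarrow> ('i, 'j, 'a, 'a square) fctr \<Rightarrow>
    ('a, 'i) lifting_map \<Rightarrow> 'a \<Rightarrow> 'a \<Rightarrow> ('a, 'i) lifting_map \<Rightarrow> bool" where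
  "left_mor E J v X a b Y \<longleftrightarrow> X \<in> Ob (left_maps E J v) \<and> Y \<in> Ob (left_maps E J v) \<and>
     is_square E (fst X) a b (fst Y) \<and>
     (\<forall>j\<in>Ob J. \<forall>s t. is_square E (fst Y) s t (FO v j) \<longrightarrow>
        snd Y j s t \<cdot>\<^bsub>E\<^esub> b = snd X j (s \<cdot>\<^bsub>E\<^esub> a) (t \<cdot>\<^bsub>E\<^esub> b))"

lemma right_maps_Ar:
  "(X, m, Y) \<in> Ar (right_maps E J u) \<longleftrightarrow> (\<exists>a b. m = (fst X, (a, b), fst Y) \<and> right_mor E J u X a b Y)"
  by (cases X; cases Y; cases m)
    (auto simp: right_maps_def right_mor_def arrow_cat_hom)

lemma left_maps_Ar:
  "(X, m, Y) \<in> Ar (left_maps E J u) \<longleftrightarrow> (\<exists>a b. m = (fst X, (a, b), fst Y) \<and> left_mor E J u X a b Y)"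
  by (cases X; cases Y; cases m)
    (auto simp: left_maps_def left_mor_def arrow_cat_hom)

lemma right_maps_Dom_Cod [simp]:
  "Dom (right_maps E J u) (X, m, Y) = X" "Cod (right_maps E J u) (X, m, Y) = Y"
  "Dom (left_maps E J u) (X, m, Y) = X" "Cod (left_maps E J u) (X, m, Y) = Y"
  by (auto simp: right_maps_def left_maps_def split: prod.splits)

lemma right_map_Ar: "X \<in> Ob (right_maps E J u) \<Longrightarrow> fst X \<in> Ar E"
  by (auto simp: right_maps_def)

lemma right_map_fills:
  "\<lbrakk>X \<in> Ob (right_maps E J u); i \<in> Ob J; is_square E (FO u i) s t (fst X)\<rbrakk>
    \<Longrightarrow> fills E (FO u i) s t (fst X) (snd X i s t)"
  unfolding right_maps_def right_str_def fills_def by force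

lemma right_map_natural:
  "\<lbrakk>X \<in> Ob (right_maps E J u); \<sigma> \<in> Ar J; is_square E (FO u (Cod J \<sigma>)) s t (fst X)\<rbrakk>
    \<Longrightarrow> snd X (Cod J \<sigma>) s t \<cdot>\<^bsub>E\<^esub> bot_of (FA u \<sigma>) =
        snd X (Dom J \<sigma>) (s \<cdot>\<^bsub>E\<^esub> top_of (FA u \<sigma>)) (t \<cdot>\<^bsub>E\<^esub> bot_of (FA u \<sigma>))"
  unfolding right_maps_def right_str_def by auto

lemma right_mor_fill:
  "\<lbrakk>right_mor E J u X a b Y; i \<in> Ob J; is_square E (FO u i) s t (fst X)\<rbrakk> \<Longrightarrow>
    a \<cdot>\<^bsub>E\<^esub> snd X i s t = snd Y i (a \<cdot>\<^bsub>E\<^esub> s) (b \<cdot>\<^bsub>E\<^esub> t)"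
  by (auto simp: right_mor_def)

lemma left_map_Ar: "X \<in> Ob (left_maps E J u) \<Longrightarrow> fst X \<in> Ar E"
  by (auto simp: left_maps_def)

lemma left_map_fills:
  "\<lbrakk>X \<in> Ob (left_maps E J v); j \<in> Ob J; is_square E (fst X) s t (FO v j)\<rbrakk>
    \<Longrightarrow> fills E (fst X) s t (FO v j) (snd X j s t)"
  unfolding left_maps_def left_str_def fills_def by force

lemma left_map_natural:
  "\<lbrakk>X \<in> Ob (left_maps E J v); \<sigma> \<in> Ar J; is_square E (fst X) s t (FO v (Dom J \<sigma>))\<rbrakk>
    \<Longrightarrow> top_of (FA v \<sigma>) \<cdot>\<^bsub>E\<^esub> snd X (Dom J \<sigma>) s t =
        snd X (Cod J \<sigma>) (top_of (FA v \<sigma>) \<cdot>\<^bsub>E\<^esub> s) (bot_of (FA v \<sigma>) \<cdot>\<^bsub>E\<^esub> t)"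
  unfolding left_maps_def left_str_def by auto

lemma left_mor_fill:
  "\<lbrakk>left_mor E J u X a b Y; i \<in> Ob J; is_square E (fst Y) s t (FO u i)\<rbrakk> \<Longrightarrow>
    snd Y i s t \<cdot>\<^bsub>E\<^esub> b = snd X i (s \<cdot>\<^bsub>E\<^esub> a) (t \<cdot>\<^bsub>E\<^esub> b)"
  by (auto simp: left_mor_def)

lemma functor_square:
  assumes "is_functor J (arrow_cat E) u" "\<sigma> \<in> Ar J"
  shows "is_square E (FO u (Dom J \<sigma>)) (top_of (FA u \<sigma>)) (bot_of (FA u \<sigma>)) (FO u (Cod J \<sigma>))"
    and "FA u \<sigma> = (FO u (Dom J \<sigma>), (top_of (FA u \<sigma>), bot_of (FA u \<sigma>)), FO u (Cod J \<sigma>))"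
proof -
  have "FA u \<sigma> \<in> hom (arrow_cat E) (FO u (Dom J \<sigma>)) (FO u (Cod J \<sigma>))"
    using assms by (auto simp: is_functor_def)
  then obtain s t where "FA u \<sigma> = (FO u (Dom J \<sigma>), (s, t), FO u (Cod J \<sigma>))"
    "is_square E (FO u (Dom J \<sigma>)) s t (FO u (Cod J \<sigma>))" by (rule arrow_cat_homE)
  then show "is_square E (FO u (Dom J \<sigma>)) (top_of (FA u \<sigma>)) (bot_of (FA u \<sigma>)) (FO u (Cod J \<sigma>))"
    "FA u \<sigma> = (FO u (Dom J \<sigma>), (top_of (FA u \<sigma>), bot_of (FA u \<sigma>)), FO u (Cod J \<sigma>))" by auto
qed

text \<open>Structures of left and right maps are \<open>undefined\<close> away from squares, so a filling function given
  by a formula has to be cut down to the squares first.\<close>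

definition right_restr :: "('o, 'a) cat \<Rightarrow> ('i, 'j) cat \<Rightarrow> ('i, 'j, 'a, 'a square) fctr \<Rightarrow> 'a \<Rightarrow>
    ('i \<Rightarrow> 'a \<Rightarrow> 'a \<Rightarrow> 'a) \<Rightarrow> 'i \<Rightarrow> 'a \<Rightarrow> 'a \<Rightarrow> 'a" where
  "right_restr E J u f \<phi> i s t = (if i \<in> Ob J \<and> is_square E (FO u i) s t f then \<phi> i s t else undefined)"

definition left_restr :: "('o, 'a) cat \<Rightarrow> ('i, 'j) cat \<Rightarrow> ('i, 'j, 'a, 'a square) fctr \<Rightarrow> 'a \<Rightarrow>
    ('i \<Rightarrow> 'a \<Rightarrow> 'a \<Rightarrow> 'a) \<Rightarrow> 'i \<Rightarrow> 'a \<Rightarrow> 'a \<Rightarrow> 'a" where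
  "left_restr E J u f \<phi> j s t = (if j \<in> Ob J \<and> is_square E f s t (FO u j) then \<phi> j s t else undefined)"

lemma (in category) right_map_restrI:
  assumes "category J" "is_functor J (arrow_cat C) u" "f \<in> Ar C"
    and fill: "\<And>i s t. \<lbrakk>i \<in> Ob J; is_square C (FO u i) s t f\<rbrakk> \<Longrightarrow> fills C (FO u i) s t f (\<phi> i s t)"
    and nat: "\<And>\<sigma> s t. \<lbrakk>\<sigma> \<in> Ar J; is_square C (FO u (Cod J \<sigma>)) s t f\<rbrakk> \<Longrightarrow>
      \<phi> (Cod J \<sigma>) s t \<cdot> bot_of (FA u \<sigma>) = \<phi> (Dom J \<sigma>) (s \<cdot> top_of (FA u \<sigma>)) (t \<cdot> bot_of (FA u \<sigma>))"
  shows "(f, right_restr C J u f \<phi>) \<in> Ob (right_maps C J u)"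
proof -
  interpret J: category J by fact
  have "right_restr C J u f \<phi> (Cod J \<sigma>) s t \<cdot> bot_of (FA u \<sigma>) =
      right_restr C J u f \<phi> (Dom J \<sigma>) (s \<cdot> top_of (FA u \<sigma>)) (t \<cdot> bot_of (FA u \<sigma>))"
    if s: "\<sigma> \<in> Ar J" and q: "is_square C (FO u (Cod J \<sigma>)) s t f" for \<sigma> s t
    using nat[OF s q] square_comp[OF functor_square(1)[OF assms(2) s] q] s q
    by (simp add: right_restr_def)
  then show ?thesis using fill assms(3)
    by (auto simp: right_maps_def right_str_def fills_def right_restr_def)
qed

lemma (in category) left_map_restrI:
  assumes "typed_cat J" "is_functor J (arrow_cat C) u" "f \<in> Ar C"
    and fill: "\<And>i s t. \<lbrakk>i \<in> Ob J; is_square C f s t (FO u i)\<rbrakk> \<Longrightarrow> fills C f s t (FO u i) (\<phi> i s t)"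
    and nat: "\<And>\<sigma> s t. \<lbrakk>\<sigma> \<in> Ar J; is_square C f s t (FO u (Dom J \<sigma>))\<rbrakk> \<Longrightarrow>
      top_of (FA u \<sigma>) \<cdot> \<phi> (Dom J \<sigma>) s t = \<phi> (Cod J \<sigma>) (top_of (FA u \<sigma>) \<cdot> s) (bot_of (FA u \<sigma>) \<cdot> t)"
  shows "(f, left_restr C J u f \<phi>) \<in> Ob (left_maps C J u)"
proof -
  have "top_of (FA u \<sigma>) \<cdot> left_restr C J u f \<phi> (Dom J \<sigma>) s t =
      left_restr C J u f \<phi> (Cod J \<sigma>) (top_of (FA u \<sigma>) \<cdot> s) (bot_of (FA u \<sigma>) \<cdot> t)"
    if s: "\<sigma> \<in> Ar J" and q: "is_square C f s t (FO u (Dom J \<sigma>))" for \<sigma> s t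
    using nat[OF s q] square_comp[OF q functor_square(1)[OF assms(2) s]] s q assms(1)
    by (simp add: left_restr_def typed_cat_def)
  then show ?thesis using fill assms(3)
    by (auto simp: left_maps_def left_str_def fills_def left_restr_def)
qed

lemma fills_D: "fills E f s t g d \<Longrightarrow> d \<in> Ar E" "fills E f s t g d \<Longrightarrow> Dom E d = Cod E f"
  "fills E f s t g d \<Longrightarrow> Cod E d = Dom E g" "fills E f s t g d \<Longrightarrow> d \<cdot>\<^bsub>E\<^esub> f = s" "fills E f s t g d \<Longrightarrow> g \<cdot>\<^bsub>E\<^esub> d = t"
  by (auto simp: fills_def hom_def)

lemma fillsI: "\<lbrakk>d \<in> Ar E; Dom E d = Cod E f; Cod E d = Dom E g; d \<cdot>\<^bsub>E\<^esub> f = s; g \<cdot>\<^bsub>E\<^esub> d = t\<rbrakk> \<Longrightarrow> fills E f s t g d"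
  by (auto simp: fills_def hom_def)

lemma right_mor_D: "right_mor E J u X a b Y \<Longrightarrow> X \<in> Ob (right_maps E J u)"
  "right_mor E J u X a b Y \<Longrightarrow> Y \<in> Ob (right_maps E J u)"
  "right_mor E J u X a b Y \<Longrightarrow> is_square E (fst X) a b (fst Y)"
  by (auto simp: right_mor_def)

lemma left_mor_D: "left_mor E J u X a b Y \<Longrightarrow> X \<in> Ob (left_maps E J u)"
  "left_mor E J u X a b Y \<Longrightarrow> Y \<in> Ob (left_maps E J u)"
  "left_mor E J u X a b Y \<Longrightarrow> is_square E (fst X) a b (fst Y)"
  by (auto simp: left_mor_def)

context category begin

lemma right_mor_id:
  assumes "X \<in> Ob (right_maps C J u)" "is_functor J (arrow_cat C) u"
  shows "right_mor C J u X (Id C (Dom C (fst X))) (Id C (Cod C (fst X))) X"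
proof -
  have X: "fst X \<in> Ar C" using right_map_Ar[OF assms(1)] .
  have "Id C (Dom C (fst X)) \<cdot> snd X i s t = snd X i (Id C (Dom C (fst X)) \<cdot> s) (Id C (Cod C (fst X)) \<cdot> t)"
    if "i \<in> Ob J" "is_square C (FO u i) s t (fst X)" for i s t
    using fills_D(1-3)[OF right_map_fills[OF assms(1) that]] is_square_D[OF that(2)] by simp
  then show ?thesis using assms X square_id[OF X] by (auto simp: right_mor_def)
qed

lemma right_mor_comp:
  assumes "is_functor J (arrow_cat C) u" and m: "right_mor C J u X a b Y" and n: "right_mor C J u Y a' b' Z"
  shows "right_mor C J u X (a' \<cdot> a) (b' \<cdot> b) Z"
  unfolding right_mor_def
proof (intro conjI ballI allI impI)
  show "X \<in> Ob (right_maps C J u)" "Z \<in> Ob (right_maps C J u)" using m n by (auto simp: right_mor_def)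
  show "is_square C (fst X) (a' \<cdot> a) (b' \<cdot> b) (fst Z)"
    using right_mor_D(3)[OF m] right_mor_D(3)[OF n] square_comp by blast
  fix i s t assume i: "i \<in> Ob J" and q: "is_square C (FO u i) s t (fst X)"
  note q' = square_comp[OF q right_mor_D(3)[OF m]]
  note f = fills_D[OF right_map_fills[OF right_mor_D(1)[OF m] i q]]
  note d = is_square_D[OF right_mor_D(3)[OF m]] is_square_D[OF right_mor_D(3)[OF n]] is_square_D[OF q]
  have "(a' \<cdot> a) \<cdot> snd X i s t = a' \<cdot> (a \<cdot> snd X i s t)" using f d by simp
  also have "\<dots> = snd Z i (a' \<cdot> (a \<cdot> s)) (b' \<cdot> (b \<cdot> t))"
    using right_mor_fill[OF m i q] right_mor_fill[OF n i q'] by simp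
  also have "\<dots> = snd Z i ((a' \<cdot> a) \<cdot> s) ((b' \<cdot> b) \<cdot> t)" using d by simp
  finally show "(a' \<cdot> a) \<cdot> snd X i s t = snd Z i ((a' \<cdot> a) \<cdot> s) ((b' \<cdot> b) \<cdot> t)" .
qed

end

section \<open>The pullback functor on arrows\<close>

locale pb_category = category E for E :: "('o, 'a) cat" (structure) +
  fixes pb1 pb2 :: "'a \<Rightarrow> 'a \<Rightarrow> 'a"
  assumes pullbacks: "chosen_pullbacks E pb1 pb2"
begin

definition pair :: "'a \<Rightarrow> 'a \<Rightarrow> 'a \<Rightarrow> 'a \<Rightarrow> 'a" where
  "pair g h x y = pb_map E (pb1 g h) (pb2 g h) (Dom E x) x y"

lemma pb: "\<lbrakk>g \<in> Ar E; h \<in> Ar E; Cod E g = Cod E h\<rbrakk> \<Longrightarrow> is_pullback E g h (pb1 g h) (pb2 g h)"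
  using pullbacks by (auto simp: chosen_pullbacks_def)

lemma pb_typing [simp]:
  assumes "g \<in> Ar E" "h \<in> Ar E" "Cod E g = Cod E h"
  shows "pb1 g h \<in> Ar E" "pb2 g h \<in> Ar E" "Dom E (pb2 g h) = Dom E (pb1 g h)"
    "Cod E (pb1 g h) = Dom E g" "Cod E (pb2 g h) = Dom E h"
  using pullback_D[OF pb[OF assms]] by (auto simp: hom_def)

lemma pb_comm:
  assumes "g \<in> Ar E" "h \<in> Ar E" "Cod E g = Cod E h"
  shows "g \<cdot> pb1 g h = h \<cdot> pb2 g h"
  using pullback_D[OF pb[OF assms]] by auto

lemma pb_comm_ext:
  assumes "g \<in> Ar E" "h \<in> Ar E" "Cod E g = Cod E h" "x \<in> Ar E" "Cod E x = Dom E (pb1 g h)"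
  shows "g \<cdot> (pb1 g h \<cdot> x) = h \<cdot> (pb2 g h \<cdot> x)"
  using assms comp_sq[OF pb_comm[OF assms(1-3)]] by simp

lemma pair:
  assumes "g \<in> Ar E" "h \<in> Ar E" "Cod E g = Cod E h" "x \<in> Ar E" "y \<in> Ar E" "Cod E x = Dom E g" "Cod E y = Dom E h"
    "Dom E x = Dom E y" "g \<cdot> x = h \<cdot> y"
  shows "pair g h x y \<in> Ar E" "Dom E (pair g h x y) = Dom E x" "Cod E (pair g h x y) = Dom E (pb1 g h)"
    "pb1 g h \<cdot> pair g h x y = x" "pb2 g h \<cdot> pair g h x y = y"
proof -
  have "x \<in> hom E (Dom E x) (Dom E g)" "y \<in> hom E (Dom E x) (Dom E h)" using assms by (auto simp: hom_def)
  from pb_map[OF pb[OF assms(1-3)] this assms(9), folded pair_def]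
  show "pair g h x y \<in> Ar E" "Dom E (pair g h x y) = Dom E x" "Cod E (pair g h x y) = Dom E (pb1 g h)"
    "pb1 g h \<cdot> pair g h x y = x" "pb2 g h \<cdot> pair g h x y = y"
    by (auto simp: hom_def)
qed

lemma pb_eqI:
  assumes "g \<in> Ar E" "h \<in> Ar E" "Cod E g = Cod E h" "w \<in> Ar E" "w' \<in> Ar E" "Dom E w = Dom E w'"
    "Cod E w = Dom E (pb1 g h)" "Cod E w' = Dom E (pb1 g h)"
    "pb1 g h \<cdot> w = pb1 g h \<cdot> w'" "pb2 g h \<cdot> w = pb2 g h \<cdot> w'"
  shows "w = w'"
  by (rule pullback_eqI[OF pb[OF assms(1-3)] assms(1-3), of _ "Dom E w"]) (use assms in \<open>auto simp: hom_def\<close>)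

lemma pair_unique:
  assumes "g \<in> Ar E" "h \<in> Ar E" "Cod E g = Cod E h" "w \<in> Ar E" "Cod E w = Dom E (pb1 g h)"
    "pb1 g h \<cdot> w = x" "pb2 g h \<cdot> w = y"
  shows "pair g h x y = w"
  unfolding pair_def using assms
  by (intro pb_map_eqI[OF pb[OF assms(1-3)] assms(1-3)]) (auto simp: hom_def)

lemma pair_comp:
  assumes "g \<in> Ar E" "h \<in> Ar E" "Cod E g = Cod E h" "x \<in> Ar E" "y \<in> Ar E" "Cod E x = Dom E g" "Cod E y = Dom E h"
    "Dom E x = Dom E y" "g \<cdot> x = h \<cdot> y" "v \<in> Ar E" "Cod E v = Dom E x"
  shows "pair g h x y \<cdot> v = pair g h (x \<cdot> v) (y \<cdot> v)"
  using assms pair[OF assms(1-9)] comp_eq_ext[OF pair(4)[OF assms(1-9)], of v] comp_eq_ext[OF pair(5)[OF assms(1-9)], of v]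
  by (intro pair_unique[symmetric]) auto

definition pb_arr :: "'a \<Rightarrow> 'a \<Rightarrow> 'a \<Rightarrow> 'a \<Rightarrow> 'a \<Rightarrow> 'a \<Rightarrow> 'a" where
  "pb_arr g h a c g' h' = pair g' h' (a \<cdot> pb1 g h) (c \<cdot> pb2 g h)"

lemma pb_arr:
  assumes "is_square E g a b g'" "is_square E h c b h'" "Cod E g = Cod E h"
  shows "pb_arr g h a c g' h' \<in> Ar E" "Dom E (pb_arr g h a c g' h') = Dom E (pb1 g h)"
    "Cod E (pb_arr g h a c g' h') = Dom E (pb1 g' h')"
    "pb1 g' h' \<cdot> pb_arr g h a c g' h' = a \<cdot> pb1 g h" "pb2 g' h' \<cdot> pb_arr g h a c g' h' = c \<cdot> pb2 g h"
    "is_square E (pb2 g h) (pb_arr g h a c g' h') c (pb2 g' h')"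
proof -
  note D = is_square_D[OF assms(1)] is_square_D[OF assms(2)]
  have e: "g' \<cdot> (a \<cdot> pb1 g h) = h' \<cdot> (c \<cdot> pb2 g h)"
    using D assms(3) comp_sq[OF D(9), of "pb1 g h"] comp_sq[OF D(18), of "pb2 g h"] pb_comm[of g h] by simp
  have "Cod E g' = Cod E h'" using D by simp
  note P = pair[OF D(2) D(11) this _ _ _ _ _ e, folded pb_arr_def]
  show "pb_arr g h a c g' h' \<in> Ar E" "Dom E (pb_arr g h a c g' h') = Dom E (pb1 g h)"
    "Cod E (pb_arr g h a c g' h') = Dom E (pb1 g' h')"
    "pb1 g' h' \<cdot> pb_arr g h a c g' h' = a \<cdot> pb1 g h" "pb2 g' h' \<cdot> pb_arr g h a c g' h' = c \<cdot> pb2 g h"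
    using P D assms(3) by simp_all
  then show "is_square E (pb2 g h) (pb_arr g h a c g' h') c (pb2 g' h')"
    using D assms(3) by (intro is_squareI) simp_all
qed

lemma pb_arr_unique:
  assumes "is_square E g a b g'" "is_square E h c b h'" "Cod E g = Cod E h"
    "w \<in> Ar E" "Dom E w = Dom E (pb1 g h)" "Cod E w = Dom E (pb1 g' h')"
    "pb1 g' h' \<cdot> w = a \<cdot> pb1 g h" "pb2 g' h' \<cdot> w = c \<cdot> pb2 g h"
  shows "pb_arr g h a c g' h' = w"
  unfolding pb_arr_def
  using is_square_D[OF assms(1)] is_square_D[OF assms(2)] assms(3-) by (intro pair_unique) auto

lemma pullback_fun_FO [simp]: "FO (pullback_fun E pb1 pb2) (g, h) = pb2 g h"
  by (simp add: pullback_fun_def)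

lemma pullback_fun_FA:
  assumes "is_square E g a b g'" "is_square E h c b h'" "Cod E g = Cod E h"
  shows "FA (pullback_fun E pb1 pb2) ((g, (a, b), g'), (h, (c, b), h')) =
    (pb2 g h, (pb_arr g h a c g' h', c), pb2 g' h')"
proof -
  have "Dom E (a \<cdot> pb1 g h) = Dom E (pb1 g h)"
    using is_square_D[OF assms(1)] is_square_D[OF assms(2)] assms(3) by simp
  then show ?thesis by (simp add: pullback_fun_def pb_arr_def pair_def pb_map_def)
qed

lemma pb_arr_id:
  assumes "g \<in> Ar E" "h \<in> Ar E" "Cod E g = Cod E h"
  shows "pb_arr g h (Id E (Dom E g)) (Id E (Dom E h)) g h = Id E (Dom E (pb1 g h))"
  using assms square_id[OF assms(1)] square_id[OF assms(2)] by (intro pb_arr_unique) auto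

lemma pb_arr_comp:
  assumes "is_square E g a b g'" "is_square E h c b h'" "Cod E g = Cod E h"
    "is_square E g' a' b' g''" "is_square E h' c' b' h''"
  shows "pb_arr g' h' a' c' g'' h'' \<cdot> pb_arr g h a c g' h' = pb_arr g h (a' \<cdot> a) (c' \<cdot> c) g'' h''"
proof -
  note D = is_square_D[OF assms(1)] is_square_D[OF assms(2)] is_square_D[OF assms(4)] is_square_D[OF assms(5)]
  have c: "Cod E g' = Cod E h'" using D by simp
  note P = pb_arr[OF assms(1-3)] pb_arr[OF assms(4,5) c]
  show ?thesis
    by (rule pb_arr_unique[symmetric, OF square_comp[OF assms(1,4)] square_comp[OF assms(2,5)] assms(3)])
      (use P D assms(3) c comp_sq[OF P(10), of "pb_arr g h a c g' h'"] comp_sq[OF P(11), of "pb_arr g h a c g' h'"] in simp_all)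
qed

end

lemma is_pullback_sym: "is_pullback E g h p q \<Longrightarrow> is_pullback E h g q p"
  unfolding is_pullback_def by (auto; metis)

section \<open>Base change of right maps\<close>

locale pb_right = pb_category E pb1 pb2 for E :: "('o, 'a) cat" (structure) and pb1 pb2 +
  fixes K :: "('i, 'j) cat" and v :: "('i, 'j, 'a, 'a square) fctr"
  assumes K: "category K" and v: "is_functor K (arrow_cat E) v"
begin

abbreviation "RM \<equiv> Ob (right_maps E K v)"
abbreviation "rmor \<equiv> right_mor E K v"

lemma v_Ar [simp]: "i \<in> Ob K \<Longrightarrow> FO v i \<in> Ar E"
  using v by (auto simp: is_functor_def)

text \<open>A filler against a base change is forced: its second component is the bottom side, and if the
  projection to \<open>X\<close> is to be a morphism of right maps, then its first component is the filler
  against \<open>X\<close>.\<close>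

definition base_change_fill :: "('a, 'i) lifting_map \<Rightarrow> 'a \<Rightarrow> 'i \<Rightarrow> 'a \<Rightarrow> 'a \<Rightarrow> 'a" where
  "base_change_fill X t i s y = pair (fst X) t (snd X i (pb1 (fst X) t \<cdot> s) (t \<cdot> y)) y"

definition base_change_map :: "('a, 'i) lifting_map \<Rightarrow> 'a \<Rightarrow> ('a, 'i) lifting_map" where
  "base_change_map X t = (pb2 (fst X) t, right_restr E K v (pb2 (fst X) t) (base_change_fill X t))"

lemma fst_base_change_map [simp]: "fst (base_change_map X t) = pb2 (fst X) t"
  by (simp add: base_change_map_def)

context
  fixes X t assumes X: "X \<in> RM" and t: "t \<in> Ar E" "Cod E t = Cod E (fst X)"
begin

lemma base_change_square: "is_square E (pb2 (fst X) t) (pb1 (fst X) t) t (fst X)"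
  using right_map_Ar[OF X] t pb_comm[of "fst X" t] by (intro is_squareI) auto

lemma base_change_fill:
  assumes i: "i \<in> Ob K" and q: "is_square E (FO v i) s y (pb2 (fst X) t)"
  shows "fills E (FO v i) s y (pb2 (fst X) t) (base_change_fill X t i s y)"
    and "pb1 (fst X) t \<cdot> base_change_fill X t i s y = snd X i (pb1 (fst X) t \<cdot> s) (t \<cdot> y)"
proof -
  note f = right_map_fills[OF X i square_comp[OF q base_change_square]]
  note D = is_square_D[OF q] fills_D[OF f] right_map_Ar[OF X] t
  have P: "pair (fst X) t (snd X i (pb1 (fst X) t \<cdot> s) (t \<cdot> y)) y \<in> Ar E"
    "Dom E (pair (fst X) t (snd X i (pb1 (fst X) t \<cdot> s) (t \<cdot> y)) y) = Cod E (FO v i)"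
    "Cod E (pair (fst X) t (snd X i (pb1 (fst X) t \<cdot> s) (t \<cdot> y)) y) = Dom E (pb1 (fst X) t)"
    "pb1 (fst X) t \<cdot> pair (fst X) t (snd X i (pb1 (fst X) t \<cdot> s) (t \<cdot> y)) y = snd X i (pb1 (fst X) t \<cdot> s) (t \<cdot> y)"
    "pb2 (fst X) t \<cdot> pair (fst X) t (snd X i (pb1 (fst X) t \<cdot> s) (t \<cdot> y)) y = y"
    using D pair[of "fst X" t "snd X i (pb1 (fst X) t \<cdot> s) (t \<cdot> y)" y] by simp_all
  show "pb1 (fst X) t \<cdot> base_change_fill X t i s y = snd X i (pb1 (fst X) t \<cdot> s) (t \<cdot> y)"
    using P by (simp add: base_change_fill_def)
  show "fills E (FO v i) s y (pb2 (fst X) t) (base_change_fill X t i s y)"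
    unfolding base_change_fill_def
  proof (rule fillsI)
    show "pair (fst X) t (snd X i (pb1 (fst X) t \<cdot> s) (t \<cdot> y)) y \<cdot> FO v i = s"
      by (rule pb_eqI[of "fst X" t])
        (use P D in \<open>simp_all add: comp_eq_ext[OF P(4)] comp_eq_ext[OF P(5)]\<close>)
  qed (use P D in simp_all)
qed

lemma base_change_map_RM: "base_change_map X t \<in> RM"
  unfolding base_change_map_def
proof (rule right_map_restrI[OF K v])
  show "pb2 (fst X) t \<in> Ar E" using right_map_Ar[OF X] t by simp
  show "fills E (FO v i) s y (pb2 (fst X) t) (base_change_fill X t i s y)"
    if "i \<in> Ob K" "is_square E (FO v i) s y (pb2 (fst X) t)" for i s y
    using base_change_fill[OF that] by simp
next
  interpret K: category K by (fact K)
  fix \<sigma> s y assume s: "\<sigma> \<in> Ar K" and q: "is_square E (FO v (Cod K \<sigma>)) s y (pb2 (fst X) t)"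
  note V = functor_square(1)[OF v s]
  note q' = square_comp[OF V q]
  have o: "Cod K \<sigma> \<in> Ob K" "Dom K \<sigma> \<in> Ob K" using s by auto
  note f = base_change_fill[OF o(1) q] base_change_fill[OF o(2) q']
  note D = is_square_D[OF q] is_square_D[OF V] fills_D[OF f(1)] fills_D[OF f(3)] right_map_Ar[OF X] t
  show "base_change_fill X t (Cod K \<sigma>) s y \<cdot> bot_of (FA v \<sigma>) =
       base_change_fill X t (Dom K \<sigma>) (s \<cdot> top_of (FA v \<sigma>)) (y \<cdot> bot_of (FA v \<sigma>))"
  proof (rule pb_eqI[of "fst X" t])
    have "pb1 (fst X) t \<cdot> base_change_fill X t (Cod K \<sigma>) s y \<cdot> bot_of (FA v \<sigma>) =
        snd X (Cod K \<sigma>) (pb1 (fst X) t \<cdot> s) (t \<cdot> y) \<cdot> bot_of (FA v \<sigma>)"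
      using D by (simp add: comp_eq_ext[OF f(2)])
    also have "\<dots> = snd X (Dom K \<sigma>) ((pb1 (fst X) t \<cdot> s) \<cdot> top_of (FA v \<sigma>)) ((t \<cdot> y) \<cdot> bot_of (FA v \<sigma>))"
      using right_map_natural[OF X s square_comp[OF q base_change_square]] .
    also have "\<dots> = snd X (Dom K \<sigma>) (pb1 (fst X) t \<cdot> (s \<cdot> top_of (FA v \<sigma>))) (t \<cdot> (y \<cdot> bot_of (FA v \<sigma>)))"
      using D by simp
    finally show "pb1 (fst X) t \<cdot> base_change_fill X t (Cod K \<sigma>) s y \<cdot> bot_of (FA v \<sigma>) =
        pb1 (fst X) t \<cdot> base_change_fill X t (Dom K \<sigma>) (s \<cdot> top_of (FA v \<sigma>)) (y \<cdot> bot_of (FA v \<sigma>))"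
      using f(4) by simp
  qed (use D comp_eq_ext[OF D(23)] in simp_all)
qed

lemma base_change_map_proj: "rmor (base_change_map X t) (pb1 (fst X) t) t X"
  unfolding right_mor_def
  using X base_change_map_RM base_change_square base_change_fill(2)
  by (auto simp: base_change_map_def right_restr_def)

end

text \<open>Both sides of the required equation are maps into a pullback. Their components over the base agree
  because both sides involve fillers, and their components in \<open>X\<close> agree because the composite is a
  morphism.\<close>

lemma right_mor_cartesian:
  assumes m: "rmor X' a c X" and pb: "is_pullback E (fst X) c a (fst X')"
    and X0: "X0 \<in> RM" and q: "is_square E (fst X0) s y (fst X')"
    and n: "rmor X0 (a \<cdot> s) (c \<cdot> y) X"
  shows "rmor X0 s y X'"
  unfolding right_mor_def
proof (intro conjI ballI allI impI)
  show "X0 \<in> RM" "X' \<in> RM" "is_square E (fst X0) s y (fst X')" using X0 right_mor_D(1)[OF m] q by auto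
  fix i s' t' assume i: "i \<in> Ob K" and q': "is_square E (FO v i) s' t' (fst X0)"
  note sq = right_mor_D(3)[OF m] right_mor_D(3)[OF n]
  note f = right_map_fills[OF X0 i q'] right_map_fills[OF right_mor_D(1)[OF m] i square_comp[OF q' q]]
  note D = is_square_D[OF q] is_square_D[OF q'] is_square_D[OF sq(1)] fills_D[OF f(1)] fills_D[OF f(2)]
  show "s \<cdot> snd X0 i s' t' = snd X' i (s \<cdot> s') (y \<cdot> t')"
  proof (rule pullback_eqI[OF pb])
    have "a \<cdot> s \<cdot> snd X0 i s' t' = (a \<cdot> s) \<cdot> snd X0 i s' t'" using D by simp
    also have "\<dots> = snd X i ((a \<cdot> s) \<cdot> s') ((c \<cdot> y) \<cdot> t')" using right_mor_fill[OF n i q'] .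
    also have "\<dots> = snd X i (a \<cdot> (s \<cdot> s')) (c \<cdot> (y \<cdot> t'))" using D by simp
    also have "\<dots> = a \<cdot> snd X' i (s \<cdot> s') (y \<cdot> t')" using right_mor_fill[OF m i square_comp[OF q' q]] by simp
    finally show "a \<cdot> s \<cdot> snd X0 i s' t' = a \<cdot> snd X' i (s \<cdot> s') (y \<cdot> t')" .
    show "fst X' \<cdot> s \<cdot> snd X0 i s' t' = fst X' \<cdot> snd X' i (s \<cdot> s') (y \<cdot> t')"
      using D by (simp add: comp_sq[OF D(9)])
  qed (use D in \<open>auto simp: hom_def\<close>)
qed

end

section \<open>Pushforward along a map\<close>

context pb_category begin

text \<open>Evaluation of a function: \<open>\<pi> : Q \<rightarrow> B\<close> is thought of as an object of sections along \<open>p : Y \<rightarrow> B\<close>, and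
  \<open>e : Q \<times>\<^sub>B Y \<rightarrow> Z\<close> as its evaluation. For generalized elements \<open>m\<close> of \<open>Q\<close> and \<open>y\<close> of \<open>Y\<close> over the same
  element of \<open>B\<close>, this is the value of \<open>m\<close> at \<open>y\<close>.\<close>

definition app :: "'a \<Rightarrow> 'a \<Rightarrow> 'a \<Rightarrow> 'a \<Rightarrow> 'a \<Rightarrow> 'a" where
  "app p \<pi> e m y = e \<cdot> pair \<pi> p m y"

text \<open>The dependent product along \<open>p\<close> of the base change of \<open>r\<close> along \<open>t\<close>. The universal property is
  stated for every pullback \<open>(x1, x2)\<close> of \<open>b\<close> and \<open>p\<close>, not just for the chosen one, so that it
  applies to pullbacks obtained by pasting.\<close>

definition pushforward :: "'a \<Rightarrow> 'a \<Rightarrow> 'a \<Rightarrow> 'a \<Rightarrow> 'a \<Rightarrow> bool" where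
  "pushforward p t r \<pi> e \<longleftrightarrow>
     p \<in> Ar E \<and> t \<in> Ar E \<and> r \<in> Ar E \<and> \<pi> \<in> Ar E \<and> Dom E t = Dom E p \<and> Cod E t = Cod E r \<and> Cod E \<pi> = Cod E p \<and>
     e \<in> Ar E \<and> Dom E e = Dom E (pb1 \<pi> p) \<and> Cod E e = Dom E r \<and> r \<cdot> e = t \<cdot> pb2 \<pi> p \<and>
     (\<forall>b\<in>Ar E. \<forall>x1 x2 z. Cod E b = Cod E p \<longrightarrow> is_pullback E b p x1 x2 \<longrightarrow> z \<in> hom E (Dom E x1) (Dom E r) \<longrightarrow>
        r \<cdot> z = t \<cdot> x2 \<longrightarrow> (\<exists>!m. m \<in> hom E (Dom E b) (Dom E \<pi>) \<and> \<pi> \<cdot> m = b \<and> app p \<pi> e (m \<cdot> x1) x2 = z))"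

definition transpose :: "'a \<Rightarrow> 'a \<Rightarrow> 'a \<Rightarrow> 'a \<Rightarrow> 'a \<Rightarrow> 'a \<Rightarrow> 'a \<Rightarrow> 'a" where
  "transpose p \<pi> e b x1 x2 z =
     (THE m. m \<in> hom E (Dom E b) (Dom E \<pi>) \<and> \<pi> \<cdot> m = b \<and> app p \<pi> e (m \<cdot> x1) x2 = z)"

context
  fixes p t r \<pi> e assumes pf: "pushforward p t r \<pi> e"
begin

lemma pushforward_typing:
  "p \<in> Ar E" "t \<in> Ar E" "r \<in> Ar E" "\<pi> \<in> Ar E" "Dom E t = Dom E p" "Cod E t = Cod E r" "Cod E \<pi> = Cod E p"
  "e \<in> Ar E" "Dom E e = Dom E (pb1 \<pi> p)" "Cod E e = Dom E r" "r \<cdot> e = t \<cdot> pb2 \<pi> p"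
  using pf by (auto simp: pushforward_def)

lemma app:
  assumes "m \<in> Ar E" "y \<in> Ar E" "Dom E m = Dom E y" "Cod E m = Dom E \<pi>" "Cod E y = Dom E p" "\<pi> \<cdot> m = p \<cdot> y"
  shows "app p \<pi> e m y \<in> Ar E" "Dom E (app p \<pi> e m y) = Dom E y" "Cod E (app p \<pi> e m y) = Dom E r"
    "r \<cdot> app p \<pi> e m y = t \<cdot> y"
  using assms pushforward_typing pair[of \<pi> p m y] comp_sq[OF pushforward_typing(11), of "pair \<pi> p m y"]
  by (simp_all add: app_def)

lemma app_comp:
  assumes "m \<in> Ar E" "y \<in> Ar E" "Dom E m = Dom E y" "Cod E m = Dom E \<pi>" "Cod E y = Dom E p" "\<pi> \<cdot> m = p \<cdot> y"
    "w \<in> Ar E" "Cod E w = Dom E y"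
  shows "app p \<pi> e m y \<cdot> w = app p \<pi> e (m \<cdot> w) (y \<cdot> w)"
  using assms pushforward_typing pair[of \<pi> p m y] pair_comp[of \<pi> p m y w] by (simp add: app_def)

lemma transpose:
  assumes "b \<in> Ar E" "Cod E b = Cod E p" "is_pullback E b p x1 x2" "z \<in> Ar E" "Dom E z = Dom E x1" "Cod E z = Dom E r"
    "r \<cdot> z = t \<cdot> x2"
  shows "transpose p \<pi> e b x1 x2 z \<in> Ar E" "Dom E (transpose p \<pi> e b x1 x2 z) = Dom E b"
    "Cod E (transpose p \<pi> e b x1 x2 z) = Dom E \<pi>" "\<pi> \<cdot> transpose p \<pi> e b x1 x2 z = b"
    "app p \<pi> e (transpose p \<pi> e b x1 x2 z \<cdot> x1) x2 = z"
proof -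
  have "z \<in> hom E (Dom E x1) (Dom E r)" using assms by (auto simp: hom_def)
  then have "\<exists>!m. m \<in> hom E (Dom E b) (Dom E \<pi>) \<and> \<pi> \<cdot> m = b \<and> app p \<pi> e (m \<cdot> x1) x2 = z"
    using pf assms unfolding pushforward_def by blast
  from theI'[OF this, folded transpose_def]
  show "transpose p \<pi> e b x1 x2 z \<in> Ar E" "Dom E (transpose p \<pi> e b x1 x2 z) = Dom E b"
    "Cod E (transpose p \<pi> e b x1 x2 z) = Dom E \<pi>" "\<pi> \<cdot> transpose p \<pi> e b x1 x2 z = b"
    "app p \<pi> e (transpose p \<pi> e b x1 x2 z \<cdot> x1) x2 = z"
    by (auto simp: hom_def)
qed

lemma pushforward_eqI:
  assumes m: "m \<in> Ar E" "m' \<in> Ar E" "Cod E m = Dom E \<pi>" "Cod E m' = Dom E \<pi>" "\<pi> \<cdot> m = \<pi> \<cdot> m'"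
    and pb: "is_pullback E (\<pi> \<cdot> m) p x1 x2" and e: "app p \<pi> e (m \<cdot> x1) x2 = app p \<pi> e (m' \<cdot> x1) x2"
  shows "m = m'"
proof -
  have D: "x1 \<in> Ar E" "x2 \<in> Ar E" "Cod E x1 = Dom E m" "Cod E x2 = Dom E p" "Dom E x2 = Dom E x1"
    and c: "\<pi> \<cdot> m \<cdot> x1 = p \<cdot> x2"
    using pullback_D[OF pb] pushforward_typing m(1-4) by (auto simp: hom_def)
  have d: "Dom E m' = Dom E m" using pushforward_typing m comp_Dom[of m \<pi>] comp_Dom[of m' \<pi>] by simp
  let ?z = "app p \<pi> e (m \<cdot> x1) x2"
  have z: "?z \<in> hom E (Dom E x1) (Dom E r)" "r \<cdot> ?z = t \<cdot> x2"
    using app[of "m \<cdot> x1" x2] c D pushforward_typing m(1-4) by (auto simp: hom_def)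
  have b: "\<pi> \<cdot> m \<in> Ar E" "Cod E (\<pi> \<cdot> m) = Cod E p" "Dom E (\<pi> \<cdot> m) = Dom E m"
    using pushforward_typing m(1-4) by auto
  have "\<exists>!k. k \<in> hom E (Dom E (\<pi> \<cdot> m)) (Dom E \<pi>) \<and> \<pi> \<cdot> k = \<pi> \<cdot> m \<and> app p \<pi> e (k \<cdot> x1) x2 = ?z"
    using pf pb z b unfolding pushforward_def by blast
  then show ?thesis using e d m b by (auto simp: hom_def)
qed

end

end

section \<open>From generators to all left maps\<close>

text \<open>The functorial Frobenius condition for the generators \<open>v\<close> only: \<open>gf i P X s t\<close> is a filler for the
  pullback of \<open>v\<^sub>i\<close> along \<open>P\<close> against the right map \<open>X\<close>, natural in all three.\<close>

locale gen_frobenius = pb_right E pb1 pb2 K v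
  for E :: "('o, 'a) cat" (structure) and pb1 pb2 and K :: "('i, 'j) cat" and v :: "('i, 'j, 'a, 'a square) fctr" +
  fixes gf :: "'i \<Rightarrow> ('a, 'i) lifting_map \<Rightarrow> ('a, 'i) lifting_map \<Rightarrow> 'a \<Rightarrow> 'a \<Rightarrow> 'a"
  assumes gf_fills: "\<lbrakk>i \<in> Ob K; P \<in> RM; X \<in> RM; Cod E (FO v i) = Cod E (fst P); is_square E (pb2 (FO v i) (fst P)) s t (fst X)\<rbrakk>
      \<Longrightarrow> fills E (pb2 (FO v i) (fst P)) s t (fst X) (gf i P X s t)"
    and gf_natural: "\<lbrakk>\<sigma> \<in> Ar K; rmor P y (bot_of (FA v \<sigma>)) P'; rmor X' m n X; Cod E (FO v (Dom K \<sigma>)) = Cod E (fst P);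
        is_square E (pb2 (FO v (Cod K \<sigma>)) (fst P')) s t (fst X')\<rbrakk>
      \<Longrightarrow> m \<cdot> gf (Cod K \<sigma>) P' X' s t \<cdot> y =
          gf (Dom K \<sigma>) P X (m \<cdot> s \<cdot> pb_arr (FO v (Dom K \<sigma>)) (fst P) (top_of (FA v \<sigma>)) y (FO v (Cod K \<sigma>)) (fst P')) (n \<cdot> t \<cdot> y)"

abbreviation (in gen_frobenius) "LM \<equiv> Ob (left_maps E (right_maps E K v) forget)"

locale right_pushforward = gen_frobenius E pb1 pb2 K v gf
  for E :: "('o, 'a) cat" (structure) and pb1 pb2 and K :: "('i, 'j) cat" and v :: "('i, 'j, 'a, 'a square) fctr" and gf +
  fixes P t X \<pi> e
  assumes P: "P \<in> RM" and X: "X \<in> RM" and pf: "pushforward (fst P) t (fst X) \<pi> e"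
begin

abbreviation "ap \<equiv> app (fst P) \<pi> e"

lemmas typing = pushforward_typing[OF pf]
lemmas ap = app[OF pf]
lemmas ap_comp = app_comp[OF pf]

text \<open>A square \<open>(x, y)\<close> from \<open>v\<^sub>i\<close> to \<open>\<pi>\<close> transposes to a square with right side \<open>X\<close>. Its left side is the
  pullback of \<open>v\<^sub>i\<close> along the base change of \<open>P\<close> along \<open>y\<close>, which is again a right map, so it has a
  filler; the transpose of that filler solves the original problem.\<close>

definition problem :: "'i \<Rightarrow> 'a \<Rightarrow> 'a \<Rightarrow> 'a" where
  "problem i x y = ap (x \<cdot> pb1 (FO v i) (pb2 (fst P) y)) (pb1 (fst P) y \<cdot> pb2 (FO v i) (pb2 (fst P) y))"

definition solution :: "'i \<Rightarrow> 'a \<Rightarrow> 'a \<Rightarrow> 'a" where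
  "solution i x y = gf i (base_change_map P y) X (problem i x y) (t \<cdot> pb1 (fst P) y)"

definition push_fill :: "'i \<Rightarrow> 'a \<Rightarrow> 'a \<Rightarrow> 'a" where
  "push_fill i x y = transpose (fst P) \<pi> e y (pb2 (fst P) y) (pb1 (fst P) y) (solution i x y)"

context
  fixes i x y assumes i: "i \<in> Ob K" and q: "is_square E (FO v i) x y \<pi>"
begin

lemma y_typing: "y \<in> Ar E" "Cod E y = Cod E (fst P)" "Dom E y = Cod E (FO v i)" "x \<in> Ar E" "Cod E x = Dom E \<pi>" "Dom E x = Dom E (FO v i)"
  "\<pi> \<cdot> x = y \<cdot> FO v i" "FO v i \<in> Ar E"
  using is_square_D[OF q] typing i by auto

lemma problem_comm:
  "\<pi> \<cdot> x \<cdot> pb1 (FO v i) (pb2 (fst P) y) = fst P \<cdot> pb1 (fst P) y \<cdot> pb2 (FO v i) (pb2 (fst P) y)"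
proof -
  have "\<pi> \<cdot> x \<cdot> pb1 (FO v i) (pb2 (fst P) y) = y \<cdot> FO v i \<cdot> pb1 (FO v i) (pb2 (fst P) y)"
    using y_typing typing by (simp add: comp_sq[OF y_typing(7)])
  also have "\<dots> = y \<cdot> pb2 (fst P) y \<cdot> pb2 (FO v i) (pb2 (fst P) y)"
    using y_typing typing by (simp add: pb_comm)
  finally show ?thesis using y_typing typing by (simp add: pb_comm_ext)
qed

lemma problem: 
  "problem i x y \<in> Ar E" "Dom E (problem i x y) = Dom E (pb1 (FO v i) (pb2 (fst P) y))" "Cod E (problem i x y) = Dom E (fst X)"
  "fst X \<cdot> problem i x y = t \<cdot> pb1 (fst P) y \<cdot> pb2 (FO v i) (pb2 (fst P) y)"
  using ap[OF _ _ _ _ _ problem_comm] y_typing typing unfolding problem_def by simp_all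

lemma problem_square: "is_square E (pb2 (FO v i) (pb2 (fst P) y)) (problem i x y) (t \<cdot> pb1 (fst P) y) (fst X)"
  using problem y_typing typing by (intro is_squareI) simp_all

lemma solution: "fills E (pb2 (FO v i) (pb2 (fst P) y)) (problem i x y) (t \<cdot> pb1 (fst P) y) (fst X) (solution i x y)"
  unfolding solution_def
  using gf_fills[OF i base_change_map_RM[OF P, of y] X, of "problem i x y" "t \<cdot> pb1 (fst P) y"] problem_square y_typing typing
  by simp

lemma y_pullback: "is_pullback E y (fst P) (pb2 (fst P) y) (pb1 (fst P) y)"
  using is_pullback_sym[OF pb] y_typing typing by simp

lemma push_fill: "push_fill i x y \<in> Ar E" "Dom E (push_fill i x y) = Cod E (FO v i)" "Cod E (push_fill i x y) = Dom E \<pi>"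
  "\<pi> \<cdot> push_fill i x y = y" "ap (push_fill i x y \<cdot> pb2 (fst P) y) (pb1 (fst P) y) = solution i x y"
  using transpose[OF pf y_typing(1,2) y_pullback, of "solution i x y"] fills_D[OF solution] y_typing typing
  by (simp_all add: push_fill_def)

lemma push_fill_fills: "fills E (FO v i) x y \<pi> (push_fill i x y)"
proof (rule fillsI)
  note F = push_fill y_typing typing
  have pc: "\<pi> \<cdot> push_fill i x y \<cdot> pb2 (fst P) y = fst P \<cdot> pb1 (fst P) y"
    using F by (simp add: comp_eq_ext[OF F(4)] pb_comm)
  have e: "\<pi> \<cdot> push_fill i x y \<cdot> FO v i = y \<cdot> FO v i" using F by (simp add: comp_eq_ext[OF F(4)])
  show "push_fill i x y \<cdot> FO v i = x"
  proof (rule pushforward_eqI[OF pf, of _ _ "pb1 (FO v i) (pb2 (fst P) y)" "pb1 (fst P) y \<cdot> pb2 (FO v i) (pb2 (fst P) y)"])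
    show "\<pi> \<cdot> push_fill i x y \<cdot> FO v i = \<pi> \<cdot> x" using e F by simp
    show "is_pullback E (\<pi> \<cdot> push_fill i x y \<cdot> FO v i) (fst P) (pb1 (FO v i) (pb2 (fst P) y))
       (pb1 (fst P) y \<cdot> pb2 (FO v i) (pb2 (fst P) y))"
      unfolding e by (rule pullback_paste[OF y_pullback pb]) (use F in simp_all)
    have "ap ((push_fill i x y \<cdot> FO v i) \<cdot> pb1 (FO v i) (pb2 (fst P) y)) (pb1 (fst P) y \<cdot> pb2 (FO v i) (pb2 (fst P) y))
       = ap ((push_fill i x y \<cdot> pb2 (fst P) y) \<cdot> pb2 (FO v i) (pb2 (fst P) y)) (pb1 (fst P) y \<cdot> pb2 (FO v i) (pb2 (fst P) y))"
      using F by (simp add: pb_comm)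
    also have "\<dots> = solution i x y \<cdot> pb2 (FO v i) (pb2 (fst P) y)"
      using F pc by (subst ap_comp[symmetric]) simp_all
    also have "\<dots> = problem i x y" using fills_D[OF solution] by simp
    finally show "ap ((push_fill i x y \<cdot> FO v i) \<cdot> pb1 (FO v i) (pb2 (fst P) y)) (pb1 (fst P) y \<cdot> pb2 (FO v i) (pb2 (fst P) y))
      = ap (x \<cdot> pb1 (FO v i) (pb2 (fst P) y)) (pb1 (fst P) y \<cdot> pb2 (FO v i) (pb2 (fst P) y))"
      by (simp add: problem_def)
  qed (use F in simp_all)
qed (use push_fill in simp_all)

end

end

text \<open>The pushforward is contravariant in \<open>P\<close> and covariant in \<open>X\<close>: a section over \<open>P'\<close> is restricted along
  \<open>y\<close> and composed with \<open>m\<close>. The two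
  pushforwards have different codomains, so this operation is an arrow to the first one from the
  base change of the second one along \<open>b\<close>.\<close>

locale pushforward_comparison =
  A: right_pushforward E pb1 pb2 K v gf P t X \<pi> e + B: right_pushforward E pb1 pb2 K v gf P' t' X' \<pi>' e'
  for E :: "('o, 'a) cat" (structure) and pb1 pb2 and K :: "('i, 'j) cat" and v :: "('i, 'j, 'a, 'a square) fctr" and gf
    and P t X \<pi> e P' t' X' \<pi>' e' +
  fixes y b m n
  assumes rP: "right_mor E K v P y b P'" and rX: "right_mor E K v X' m n X" and tt: "t = n \<cdot> t' \<cdot> y"
begin

lemmas ty = A.typing(1-10) B.typing(1-10)
  is_square_D(1-8)[OF right_mor_D(3)[OF rP]] is_square_D(1-8)[OF right_mor_D(3)[OF rX]]
lemmas P_square = is_square_D(9)[OF right_mor_D(3)[OF rP]]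
lemmas X_square = is_square_D(9)[OF right_mor_D(3)[OF rX]]

text \<open>The graph of that operation on generalized elements: \<open>x\<close> results from \<open>x'\<close>.\<close>

definition related :: "'a \<Rightarrow> 'a \<Rightarrow> bool" where
  "related x x' \<longleftrightarrow> x \<in> Ar E \<and> x' \<in> Ar E \<and> Dom E x = Dom E x' \<and> Cod E x = Dom E \<pi> \<and> Cod E x' = Dom E \<pi>' \<and>
     \<pi>' \<cdot> x' = b \<cdot> \<pi> \<cdot> x \<and>
     (\<forall>c1\<in>Ar E. \<forall>c2\<in>Ar E. Cod E c1 = Dom E x \<and> Cod E c2 = Dom E (fst P) \<and> Dom E c1 = Dom E c2 \<and>
        \<pi> \<cdot> x \<cdot> c1 = fst P \<cdot> c2 \<longrightarrow> A.ap (x \<cdot> c1) c2 = m \<cdot> B.ap (x' \<cdot> c1) (y \<cdot> c2))"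

lemma relatedD:
  assumes "related x x'"
  shows "x \<in> Ar E" "x' \<in> Ar E" "Dom E x = Dom E x'" "Cod E x = Dom E \<pi>" "Cod E x' = Dom E \<pi>'" "\<pi>' \<cdot> x' = b \<cdot> \<pi> \<cdot> x"
    "\<lbrakk>c1 \<in> Ar E; c2 \<in> Ar E; Cod E c1 = Dom E x; Cod E c2 = Dom E (fst P); Dom E c1 = Dom E c2;
        \<pi> \<cdot> x \<cdot> c1 = fst P \<cdot> c2\<rbrakk> \<Longrightarrow> A.ap (x \<cdot> c1) c2 = m \<cdot> B.ap (x' \<cdot> c1) (y \<cdot> c2)"
  using assms by (auto simp: related_def)

text \<open>All pairs \<open>(c1, c2)\<close> in the definition factor through one pullback \<open>(x1, x2)\<close>, the universal pair.\<close>

lemma relatedI: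
  assumes x: "x \<in> Ar E" "x' \<in> Ar E" "Dom E x = Dom E x'" "Cod E x = Dom E \<pi>" "Cod E x' = Dom E \<pi>'" "\<pi>' \<cdot> x' = b \<cdot> \<pi> \<cdot> x"
    and pb: "is_pullback E (\<pi> \<cdot> x) (fst P) x1 x2"
    and e: "A.ap (x \<cdot> x1) x2 = m \<cdot> B.ap (x' \<cdot> x1) (y \<cdot> x2)"
  shows "related x x'"
  unfolding related_def
proof (intro conjI ballI impI)
  fix c1 c2 assume c: "c1 \<in> Ar E" "c2 \<in> Ar E" "Cod E c1 = Dom E x \<and> Cod E c2 = Dom E (fst P) \<and> Dom E c1 = Dom E c2 \<and>
        \<pi> \<cdot> x \<cdot> c1 = fst P \<cdot> c2"
  note D = A.pullback_D[OF pb]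
  have D': "x1 \<in> Ar E" "x2 \<in> Ar E" "Cod E x1 = Dom E x" "Cod E x2 = Dom E (fst P)" "Dom E x1 = Dom E x2"
    "\<pi> \<cdot> x \<cdot> x1 = fst P \<cdot> x2" using D x ty by (auto simp: hom_def)
  have pc: "\<pi>' \<cdot> x' \<cdot> x1 = fst P' \<cdot> y \<cdot> x2"
  proof -
    have "\<pi>' \<cdot> x' \<cdot> x1 = b \<cdot> \<pi> \<cdot> x \<cdot> x1" using D' x ty by (simp add: A.comp_eq_ext[OF x(6)])
    also have "\<dots> = b \<cdot> fst P \<cdot> x2" using D' by simp
    also have "\<dots> = fst P' \<cdot> y \<cdot> x2" using D' x ty A.comp_sq[OF P_square, of x2] by simp
    finally show ?thesis .
  qed
  define w where "w = pb_map E x1 x2 (Dom E c1) c1 c2"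
  have w: "w \<in> Ar E" "Dom E w = Dom E c1" "Cod E w = Dom E x1" "x1 \<cdot> w = c1" "x2 \<cdot> w = c2"
    using A.pb_map[OF pb, of c1 "Dom E c1" c2] c x ty unfolding w_def by (auto simp: hom_def)
  have "A.ap (x \<cdot> c1) c2 = A.ap (x \<cdot> x1) x2 \<cdot> w"
    using w x ty D' by (subst A.ap_comp) simp_all
  also have "\<dots> = m \<cdot> B.ap (x' \<cdot> x1) (y \<cdot> x2) \<cdot> w"
    unfolding e using w x ty D' pc by (simp add: B.ap)
  also have "\<dots> = m \<cdot> B.ap (x' \<cdot> c1) (y \<cdot> c2)"
    using w x ty D' pc by (subst B.ap_comp) simp_all
  finally show "A.ap (x \<cdot> c1) c2 = m \<cdot> B.ap (x' \<cdot> c1) (y \<cdot> c2)" .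
qed (use x in simp_all)

end

context pushforward_comparison begin

lemma A_pb_self: "x \<in> Ar E \<Longrightarrow> Cod E x = Dom E \<pi> \<Longrightarrow> is_pullback E (\<pi> \<cdot> x) (fst P) (pb1 (\<pi> \<cdot> x) (fst P)) (pb2 (\<pi> \<cdot> x) (fst P))"
  using ty by (intro A.pb) simp_all

lemma related_unique:
  assumes x: "related x z" and x': "related x' z" and e: "\<pi> \<cdot> x = \<pi> \<cdot> x'"
  shows "x = x'"
proof (rule A.pushforward_eqI[OF A.pf _ _ _ _ e])
  note D = relatedD(1-5)[OF x] relatedD(1-5)[OF x'] ty
  show "is_pullback E (\<pi> \<cdot> x) (fst P) (pb1 (\<pi> \<cdot> x) (fst P)) (pb2 (\<pi> \<cdot> x) (fst P))"
    using A_pb_self D by blast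
  have t: "\<pi> \<cdot> x \<in> Ar E" "Cod E (\<pi> \<cdot> x) = Cod E (fst P)" using D by auto
  have c: "(\<pi> \<cdot> x) \<cdot> pb1 (\<pi> \<cdot> x) (fst P) = fst P \<cdot> pb2 (\<pi> \<cdot> x) (fst P)"
    using A.pb_comm[OF t(1) A.typing(1) t(2)] .
  have pt: "pb1 (\<pi> \<cdot> x) (fst P) \<in> Ar E" "pb2 (\<pi> \<cdot> x) (fst P) \<in> Ar E" "Dom E (pb2 (\<pi> \<cdot> x) (fst P)) = Dom E (pb1 (\<pi> \<cdot> x) (fst P))"
    "Cod E (pb1 (\<pi> \<cdot> x) (fst P)) = Dom E z" "Cod E (pb2 (\<pi> \<cdot> x) (fst P)) = Dom E (fst P)"
    using A.pb_typing[OF t(1) A.typing(1) t(2)] D by simp_all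
  have c1: "\<pi> \<cdot> x \<cdot> pb1 (\<pi> \<cdot> x) (fst P) = fst P \<cdot> pb2 (\<pi> \<cdot> x) (fst P)" using c pt D(1-5) ty by simp
  have c2: "\<pi> \<cdot> x' \<cdot> pb1 (\<pi> \<cdot> x) (fst P) = fst P \<cdot> pb2 (\<pi> \<cdot> x) (fst P)" using c[unfolded e] pt[unfolded e] D ty
    unfolding e by (simp only: A.comp_assoc)
  show "A.ap (x \<cdot> pb1 (\<pi> \<cdot> x) (fst P)) (pb2 (\<pi> \<cdot> x) (fst P)) = A.ap (x' \<cdot> pb1 (\<pi> \<cdot> x) (fst P)) (pb2 (\<pi> \<cdot> x) (fst P))"
    using relatedD(7)[OF x pt(1,2) _ _ _ c1] relatedD(7)[OF x' pt(1,2) _ _ _ c2] pt D by simp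
qed (use relatedD(1-5)[OF x] relatedD(1-5)[OF x'] in simp_all)

lemma related_comp:
  assumes x: "related x x'" and w: "w \<in> Ar E" "Cod E w = Dom E x"
  shows "related (x \<cdot> w) (x' \<cdot> w)"
proof -
  note D = relatedD(1-5)[OF x] ty w
  have "\<pi>' \<cdot> x' \<cdot> w = b \<cdot> \<pi> \<cdot> x \<cdot> w" using D by (simp add: A.comp_eq_ext[OF relatedD(6)[OF x]])
  moreover have "A.ap ((x \<cdot> w) \<cdot> c1) c2 = m \<cdot> B.ap ((x' \<cdot> w) \<cdot> c1) (y \<cdot> c2)"
    if "c1 \<in> Ar E" "c2 \<in> Ar E" "Cod E c1 = Dom E w" "Cod E c2 = Dom E (fst P)" "Dom E c1 = Dom E c2" "\<pi> \<cdot> (x \<cdot> w) \<cdot> c1 = fst P \<cdot> c2" for c1 c2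
    using relatedD(7)[OF x, of "w \<cdot> c1" c2] that D by simp
  ultimately show ?thesis using D by (auto simp: related_def)
qed

text \<open>The fillers against the two pushforwards are transposes of fillers for pulled back generators, and
  the latter are natural with respect to the map \<open>w\<close> that is induced between the two base changes of
  \<open>P\<close> and \<open>P'\<close>. With \<open>\<sigma>\<close> arbitrary and the comparison trivial, this will say that the pushforward is a
  right map; with \<open>\<sigma>\<close> an identity, that the comparison is a morphism of right maps.\<close>

lemma push_fill_related:
  assumes s: "\<sigma> \<in> Ar K" and q': "is_square E (FO v (Cod K \<sigma>)) x' y' \<pi>'" and q: "is_square E (FO v (Dom K \<sigma>)) x0 y0 \<pi>"
    and yy: "b \<cdot> y0 = y' \<cdot> bot_of (FA v \<sigma>)" and r: "related x0 (x' \<cdot> top_of (FA v \<sigma>))"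
  shows "related (A.push_fill (Dom K \<sigma>) x0 y0) (B.push_fill (Cod K \<sigma>) x' y' \<cdot> bot_of (FA v \<sigma>))"
proof -
  interpret K: category K by (fact A.K)
  let ?s = "top_of (FA v \<sigma>)" and ?t = "bot_of (FA v \<sigma>)"
  have o: "Dom K \<sigma> \<in> Ob K" "Cod K \<sigma> \<in> Ob K" using s by auto
  note V = functor_square(1)[OF A.v s]
  note F = A.push_fill[OF o(1) q] and F' = B.push_fill[OF o(2) q']
  note D = A.y_typing(1-6,8)[OF o(1) q] B.y_typing(1-6,8)[OF o(2) q'] ty is_square_D(1-8)[OF V]
  have sq0: "is_square E y0 ?t b y'" using D yy by (intro is_squareI) simp_all
  have cc: "Cod E (fst P) = Cod E y0" using D by simp
  \<comment> \<open>the induced map between the base changes of \<open>P\<close> and \<open>P'\<close>, a morphism of right maps\<close>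
  define w where "w = A.pb_arr (fst P) y0 y ?t (fst P') y'"
  note W = A.pb_arr[OF right_mor_D(3)[OF rP] sq0 cc, folded w_def]
  have rw: "right_mor E K v (A.base_change_map P y0) w ?t (A.base_change_map P' y')"
  proof (rule A.right_mor_cartesian)
    show "right_mor E K v (A.base_change_map P' y') (pb1 (fst P') y') y' P'"
      by (rule A.base_change_map_proj) (use D B.P in simp_all)
    show "is_pullback E (fst P') y' (pb1 (fst P') y') (fst (A.base_change_map P' y'))"
      using A.pb D by simp
    show "A.base_change_map P y0 \<in> A.RM" by (rule A.base_change_map_RM) (use D A.P in simp_all)
    show "is_square E (fst (A.base_change_map P y0)) w ?t (fst (A.base_change_map P' y'))" using W(6) by simp
    have "right_mor E K v (A.base_change_map P y0) (y \<cdot> pb1 (fst P) y0) (b \<cdot> y0) P'"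
      by (rule A.right_mor_comp[OF A.v A.base_change_map_proj rP]) (use D A.P in simp_all)
    then show "right_mor E K v (A.base_change_map P y0) (pb1 (fst P') y' \<cdot> w) (y' \<cdot> ?t) P'"
      using W(4) yy by simp
  qed
  let ?c1 = "pb1 (FO v (Dom K \<sigma>)) (pb2 (fst P) y0)" and ?d = "pb2 (FO v (Dom K \<sigma>)) (pb2 (fst P) y0)"
  let ?h = "A.pb_arr (FO v (Dom K \<sigma>)) (pb2 (fst P) y0) ?s w (FO v (Cod K \<sigma>)) (pb2 (fst P') y')"
  have ch: "Cod E (FO v (Dom K \<sigma>)) = Cod E (pb2 (fst P) y0)" using D by simp
  note H = A.pb_arr[OF V W(6) ch]
  note prob = B.problem_square[OF o(2) q'] B.problem[OF o(2) q']
  have pr: "m \<cdot> B.problem (Cod K \<sigma>) x' y' \<cdot> ?h = A.problem (Dom K \<sigma>) x0 y0"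
  proof -
    have "B.problem (Cod K \<sigma>) x' y' \<cdot> ?h =
       B.ap ((x' \<cdot> pb1 (FO v (Cod K \<sigma>)) (pb2 (fst P') y')) \<cdot> ?h) ((pb1 (fst P') y' \<cdot> pb2 (FO v (Cod K \<sigma>)) (pb2 (fst P') y')) \<cdot> ?h)"
      unfolding B.problem_def
      by (rule B.ap_comp[OF _ _ _ _ _ B.problem_comm[OF o(2) q']]) (use D H in simp_all)
    also have "(x' \<cdot> pb1 (FO v (Cod K \<sigma>)) (pb2 (fst P') y')) \<cdot> ?h = (x' \<cdot> ?s) \<cdot> ?c1"
      using D H by simp
    also have "(pb1 (fst P') y' \<cdot> pb2 (FO v (Cod K \<sigma>)) (pb2 (fst P') y')) \<cdot> ?h = pb1 (fst P') y' \<cdot> w \<cdot> ?d"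
      using D H by simp
    also have "\<dots> = y \<cdot> pb1 (fst P) y0 \<cdot> ?d" using D W(1-5) by (simp add: A.comp_sq[OF W(4)])
    finally have "B.problem (Cod K \<sigma>) x' y' \<cdot> ?h = B.ap ((x' \<cdot> ?s) \<cdot> ?c1) (y \<cdot> pb1 (fst P) y0 \<cdot> ?d)" .
    then show ?thesis using relatedD(7)[OF r _ _ _ _ _ A.problem_comm[OF o(1) q]] D
      by (simp add: A.problem_def)
  qed
  have tt': "n \<cdot> (t' \<cdot> pb1 (fst P') y') \<cdot> w = t \<cdot> pb1 (fst P) y0"
    unfolding tt using D W by simp
  have sol: "m \<cdot> B.solution (Cod K \<sigma>) x' y' \<cdot> w = A.solution (Dom K \<sigma>) x0 y0"
    using A.gf_natural[OF s rw rX, of "B.problem (Cod K \<sigma>) x' y'" "t' \<cdot> pb1 (fst P') y'"] D prob(1) pr tt'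
    by (simp add: A.solution_def B.solution_def)
  have pc: "\<pi>' \<cdot> B.push_fill (Cod K \<sigma>) x' y' \<cdot> pb2 (fst P') y' = fst P' \<cdot> pb1 (fst P') y'"
    using F' D by (simp add: A.comp_eq_ext[OF F'(4)] A.pb_comm)
  show ?thesis
  proof (rule relatedI[of _ _ "pb2 (fst P) y0" "pb1 (fst P) y0"])
    show "\<pi>' \<cdot> B.push_fill (Cod K \<sigma>) x' y' \<cdot> ?t = b \<cdot> \<pi> \<cdot> A.push_fill (Dom K \<sigma>) x0 y0"
      using F F' D yy by (simp add: A.comp_eq_ext[OF F'(4)])
    show "is_pullback E (\<pi> \<cdot> A.push_fill (Dom K \<sigma>) x0 y0) (fst P) (pb2 (fst P) y0) (pb1 (fst P) y0)"
      using F A.y_pullback[OF o(1) q] by simp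
    have "(B.push_fill (Cod K \<sigma>) x' y' \<cdot> ?t) \<cdot> pb2 (fst P) y0 = (B.push_fill (Cod K \<sigma>) x' y' \<cdot> pb2 (fst P') y') \<cdot> w"
      using D F'(1-3) W by simp
    moreover have "B.ap ((B.push_fill (Cod K \<sigma>) x' y' \<cdot> pb2 (fst P') y') \<cdot> w) (pb1 (fst P') y' \<cdot> w)
        = B.solution (Cod K \<sigma>) x' y' \<cdot> w"
      using F' D W pc by (subst B.ap_comp[symmetric]) simp_all
    ultimately show "A.ap (A.push_fill (Dom K \<sigma>) x0 y0 \<cdot> pb2 (fst P) y0) (pb1 (fst P) y0) =
      m \<cdot> B.ap ((B.push_fill (Cod K \<sigma>) x' y' \<cdot> ?t) \<cdot> pb2 (fst P) y0) (y \<cdot> pb1 (fst P) y0)"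
      using F(5) sol W(4) by simp
  qed (use F F' D in simp_all)
qed

end

context right_pushforward begin

definition push_map :: "('a, 'i) lifting_map" where
  "push_map = (\<pi>, right_restr E K v \<pi> push_fill)"

lemma fst_push_map [simp]: "fst push_map = \<pi>"
  by (simp add: push_map_def)

lemma snd_push_map: "\<lbrakk>i \<in> Ob K; is_square E (FO v i) x y \<pi>\<rbrakk> \<Longrightarrow> snd push_map i x y = push_fill i x y"
  by (simp add: push_map_def right_restr_def)

lemma push_map_RM: "push_map \<in> RM"
  unfolding push_map_def
proof (rule right_map_restrI[OF K v])
  interpret C: pushforward_comparison E pb1 pb2 K v gf P t X \<pi> e P t X \<pi> e
    "Id E (Dom E (fst P))" "Id E (Cod E (fst P))" "Id E (Dom E (fst X))" "Id E (Cod E (fst X))"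
    by unfold_locales (use right_mor_id[OF P v] right_mor_id[OF X v] typing in auto)
  interpret K: category K by (fact K)
  show "\<pi> \<in> Ar E" using typing by simp
  show "fills E (FO v i) x y \<pi> (push_fill i x y)" if "i \<in> Ob K" "is_square E (FO v i) x y \<pi>" for i x y
    using push_fill_fills[OF that] .
  have self: "C.related x x" if "x \<in> Ar E" "Cod E x = Dom E \<pi>" for x
    using that typing ap by (auto simp: C.related_def)
  fix \<sigma> x y assume s: "\<sigma> \<in> Ar K" and q: "is_square E (FO v (Cod K \<sigma>)) x y \<pi>"
  note V = functor_square(1)[OF v s]
  note q0 = square_comp[OF V q]
  note D = is_square_D[OF V] is_square_D[OF q] typing
  have o: "Dom K \<sigma> \<in> Ob K" "Cod K \<sigma> \<in> Ob K" using s by auto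
  note F = push_fill[OF o(1) q0] and F' = push_fill[OF o(2) q]
  have "C.related (push_fill (Dom K \<sigma>) (x \<cdot> top_of (FA v \<sigma>)) (y \<cdot> bot_of (FA v \<sigma>))) (push_fill (Cod K \<sigma>) x y \<cdot> bot_of (FA v \<sigma>))"
    by (rule C.push_fill_related[OF s q q0]) (use D self in simp_all)
  moreover have "C.related (push_fill (Cod K \<sigma>) x y \<cdot> bot_of (FA v \<sigma>)) (push_fill (Cod K \<sigma>) x y \<cdot> bot_of (FA v \<sigma>))"
    using F' D by (intro self) simp_all
  moreover have "\<pi> \<cdot> push_fill (Dom K \<sigma>) (x \<cdot> top_of (FA v \<sigma>)) (y \<cdot> bot_of (FA v \<sigma>)) = \<pi> \<cdot> push_fill (Cod K \<sigma>) x y \<cdot> bot_of (FA v \<sigma>)"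
    using F(4) F' D by (simp add: comp_eq_ext[OF F'(4)])
  ultimately show "push_fill (Cod K \<sigma>) x y \<cdot> bot_of (FA v \<sigma>) = push_fill (Dom K \<sigma>) (x \<cdot> top_of (FA v \<sigma>)) (y \<cdot> bot_of (FA v \<sigma>))"
    using C.related_unique by metis
qed

end

context pushforward_comparison begin

text \<open>The universal element of the base change of the second pushforward along \<open>b\<close> has a result under the
  operation above; it is the arrow \<open>comparison\<close>.\<close>

definition pulled :: "('a, 'i) lifting_map" where
  "pulled = A.base_change_map B.push_map b"

definition comparison :: 'a where
  "comparison = A.transpose (fst P) \<pi> e (pb2 \<pi>' b) (pb1 (pb2 \<pi>' b) (fst P)) (pb2 (pb2 \<pi>' b) (fst P))
     (m \<cdot> B.ap (pb1 \<pi>' b \<cdot> pb1 (pb2 \<pi>' b) (fst P)) (y \<cdot> pb2 (pb2 \<pi>' b) (fst P)))"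

lemma fst_pulled [simp]: "fst pulled = pb2 \<pi>' b"
  by (simp add: pulled_def)

lemma b_typing: "b \<in> Ar E" "Cod E b = Cod E \<pi>'" "Dom E b = Cod E (fst P)" "Cod E \<pi>' = Cod E (fst P')" "Cod E \<pi> = Cod E (fst P)"
  using ty by auto

lemma pulled_RM: "pulled \<in> A.RM"
  unfolding pulled_def using A.base_change_map_RM[OF B.push_map_RM] b_typing by simp

lemma pulled_proj: "right_mor E K v pulled (pb1 \<pi>' b) b B.push_map"
  unfolding pulled_def using A.base_change_map_proj[OF B.push_map_RM, of b] b_typing by simp

lemma comparison_typing: "comparison \<in> Ar E" "Dom E comparison = Dom E (pb1 \<pi>' b)" "Cod E comparison = Dom E \<pi>"
    "\<pi> \<cdot> comparison = pb2 \<pi>' b"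
  and comparison_related: "related comparison (pb1 \<pi>' b)"
proof -
  let ?b = "pb2 \<pi>' b"
  let ?x1 = "pb1 ?b (fst P)" and ?x2 = "pb2 ?b (fst P)"
  note ty' = ty b_typing
  have q: "\<pi>' \<cdot> pb1 \<pi>' b = b \<cdot> ?b" using ty' by (simp add: A.pb_comm)
  have pc: "\<pi>' \<cdot> pb1 \<pi>' b \<cdot> ?x1 = fst P' \<cdot> y \<cdot> ?x2"
  proof -
    have "\<pi>' \<cdot> pb1 \<pi>' b \<cdot> ?x1 = b \<cdot> ?b \<cdot> ?x1" using ty' by (simp add: A.comp_sq[OF q])
    also have "\<dots> = b \<cdot> fst P \<cdot> ?x2" using ty' by (simp add: A.pb_comm)
    also have "\<dots> = fst P' \<cdot> y \<cdot> ?x2" using ty' by (simp add: A.comp_sq[OF P_square])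
    finally show ?thesis .
  qed
  let ?z = "m \<cdot> B.ap (pb1 \<pi>' b \<cdot> ?x1) (y \<cdot> ?x2)"
  have B: "B.ap (pb1 \<pi>' b \<cdot> ?x1) (y \<cdot> ?x2) \<in> Ar E" "Dom E (B.ap (pb1 \<pi>' b \<cdot> ?x1) (y \<cdot> ?x2)) = Dom E ?x1"
    "Cod E (B.ap (pb1 \<pi>' b \<cdot> ?x1) (y \<cdot> ?x2)) = Dom E (fst X')"
    "fst X' \<cdot> B.ap (pb1 \<pi>' b \<cdot> ?x1) (y \<cdot> ?x2) = t' \<cdot> y \<cdot> ?x2"
    using ty' pc by (simp_all add: B.ap)
  have z: "fst X \<cdot> ?z = t \<cdot> ?x2" 
    using ty' B tt by (simp add: A.comp_sq[OF X_square])
  have pb: "is_pullback E ?b (fst P) ?x1 ?x2" using A.pb ty' by simp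
  note T = A.transpose[OF A.pf _ _ pb, of ?z, folded comparison_def]
  show T': "comparison \<in> Ar E" "Dom E comparison = Dom E (pb1 \<pi>' b)" "Cod E comparison = Dom E \<pi>" "\<pi> \<cdot> comparison = ?b"
    using T z B ty' by simp_all
  have ap: "A.ap (comparison \<cdot> ?x1) ?x2 = ?z" using T(5) z B ty' by simp
  show "related comparison (pb1 \<pi>' b)"
    by (rule relatedI[of _ _ ?x1 ?x2]) (use T' ty' q pb ap in simp_all)
qed

lemma comparison_right_mor: "right_mor E K v pulled comparison (Id E (Cod E \<pi>)) A.push_map"
  unfolding right_mor_def
proof (intro conjI ballI allI impI)
  interpret K: category K by (fact A.K)
  note C = comparison_typing ty b_typing
  show "pulled \<in> A.RM" "A.push_map \<in> A.RM" by (fact pulled_RM A.push_map_RM)+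
  show sq: "is_square E (fst pulled) comparison (Id E (Cod E \<pi>)) (fst A.push_map)"
    using C by (intro is_squareI) simp_all
  fix i x0 y0 assume i: "i \<in> Ob K" and q: "is_square E (FO v i) x0 y0 (fst pulled)"
  note f = right_map_fills[OF pulled_RM i q]
  note D = is_square_D(1-8)[OF q] is_square_D(9)[OF q, unfolded fst_pulled] fills_D[OF f]
  \<comment> \<open>the fillers of both right maps are compared, using the case of an identity arrow of \<open>K\<close>\<close>
  have Idv: "FA v (Id K i) = (FO v i, (Id E (Dom E (FO v i)), Id E (Cod E (FO v i))), FO v i)"
    using A.v i by (simp add: is_functor_def)
  have q': "is_square E (FO v i) (pb1 \<pi>' b \<cdot> x0) (b \<cdot> y0) \<pi>'"
    using A.square_comp[OF q right_mor_D(3)[OF pulled_proj]] by simp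
  have qA: "is_square E (FO v i) (comparison \<cdot> x0) y0 \<pi>"
    using D C by (intro is_squareI) (simp_all add: A.comp_eq_ext[OF C(4)])
  have r1: "related (A.push_fill i (comparison \<cdot> x0) y0) (B.push_fill i (pb1 \<pi>' b \<cdot> x0) (b \<cdot> y0))"
    using push_fill_related[of "Id K i" "pb1 \<pi>' b \<cdot> x0" "b \<cdot> y0" "comparison \<cdot> x0" y0] i q' qA Idv D C
      B.push_fill[OF i q'] related_comp[OF comparison_related, of x0] by simp
  have "B.push_fill i (pb1 \<pi>' b \<cdot> x0) (b \<cdot> y0) = pb1 \<pi>' b \<cdot> snd pulled i x0 y0"
    using right_mor_fill[OF pulled_proj i q] B.snd_push_map[OF i q'] by simp
  then have r2: "related (comparison \<cdot> snd pulled i x0 y0) (B.push_fill i (pb1 \<pi>' b \<cdot> x0) (b \<cdot> y0))"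
    using related_comp[OF comparison_related, of "snd pulled i x0 y0"] D C by simp
  have "\<pi> \<cdot> comparison \<cdot> snd pulled i x0 y0 = \<pi> \<cdot> A.push_fill i (comparison \<cdot> x0) y0"
    using D C A.push_fill(4)[OF i qA] by (simp add: A.comp_eq_ext[OF C(4)])
  from related_unique[OF r2 r1 this]
  show "comparison \<cdot> snd pulled i x0 y0 = snd A.push_map i (comparison \<cdot> x0) (Id E (Cod E \<pi>) \<cdot> y0)"
    using A.snd_push_map[OF i qA] D C by simp
qed

end

context right_pushforward begin

text \<open>For a left map \<open>g\<close> with the same codomain as \<open>P\<close>, a square \<open>s, t\<close> from its pullback to \<open>X\<close> transposes
  to a map \<open>left_top\<close> over that codomain. The filler of the square with top \<open>left_top\<close> and bottom the
  identity is a section of \<open>\<pi>\<close>, and a section of \<open>\<pi>\<close> is a map from the domain of \<open>P\<close> to that of \<open>X\<close>.\<close>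

definition left_top :: "'a \<Rightarrow> 'a \<Rightarrow> 'a" where
  "left_top g s = transpose (fst P) \<pi> e g (pb1 g (fst P)) (pb2 g (fst P)) s"

definition left_section :: "'a \<times> (('a, 'i) lifting_map \<Rightarrow> 'a \<Rightarrow> 'a \<Rightarrow> 'a) \<Rightarrow> 'a \<Rightarrow> 'a" where
  "left_section G s = snd G push_map (left_top (fst G) s) (Id E (Cod E (fst G)))"

definition left_fill :: "'a \<times> (('a, 'i) lifting_map \<Rightarrow> 'a \<Rightarrow> 'a \<Rightarrow> 'a) \<Rightarrow> 'a \<Rightarrow> 'a" where
  "left_fill G s = ap (left_section G s \<cdot> fst P) (Id E (Dom E (fst P)))"

context
  fixes G s assumes G: "G \<in> LM" "Cod E (fst G) = Cod E (fst P)" and s: "is_square E (pb2 (fst G) (fst P)) s t (fst X)"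
begin

lemma left_top: 
  "left_top (fst G) s \<in> Ar E" "Dom E (left_top (fst G) s) = Dom E (fst G)" "Cod E (left_top (fst G) s) = Dom E \<pi>"
  "\<pi> \<cdot> left_top (fst G) s = fst G" "ap (left_top (fst G) s \<cdot> pb1 (fst G) (fst P)) (pb2 (fst G) (fst P)) = s"
proof -
  have g: "fst G \<in> Ar E" using left_map_Ar[OF G(1)] .
  show "left_top (fst G) s \<in> Ar E" "Dom E (left_top (fst G) s) = Dom E (fst G)" "Cod E (left_top (fst G) s) = Dom E \<pi>"
    "\<pi> \<cdot> left_top (fst G) s = fst G" "ap (left_top (fst G) s \<cdot> pb1 (fst G) (fst P)) (pb2 (fst G) (fst P)) = s"
    using transpose[OF pf g G(2) pb[OF g typing(1) G(2)], of s] is_square_D[OF s] g G(2) typing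
    by (simp_all add: left_top_def)
qed

lemma left_top_square: "is_square E (fst G) (left_top (fst G) s) (Id E (Cod E (fst G))) \<pi>"
  using left_top typing left_map_Ar[OF G(1)] G(2) by (intro is_squareI) simp_all

lemma left_section: "fills E (fst G) (left_top (fst G) s) (Id E (Cod E (fst G))) \<pi> (left_section G s)"
  using left_map_fills[OF G(1) push_map_RM, of "left_top (fst G) s"] left_top_square by (simp add: left_section_def)

lemma left_section_comm: "\<pi> \<cdot> left_section G s \<cdot> fst P = fst P \<cdot> Id E (Dom E (fst P))"
  using fills_D[OF left_section] typing G(2) left_map_Ar[OF G(1)] by (simp add: comp_eq_ext[OF fills_D(5)[OF left_section]])

lemma left_fill: "fills E (pb2 (fst G) (fst P)) s t (fst X) (left_fill G s)"
proof -
  have g: "fst G \<in> Ar E" using left_map_Ar[OF G(1)] .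
  note L = fills_D[OF left_section] typing G(2) g left_top
  have a: "left_fill G s \<in> Ar E" "Dom E (left_fill G s) = Dom E (fst P)" "Cod E (left_fill G s) = Dom E (fst X)" 
    "fst X \<cdot> left_fill G s = t"
    using ap[OF _ _ _ _ _ left_section_comm] L unfolding left_fill_def by simp_all
  have "left_fill G s \<cdot> pb2 (fst G) (fst P) = ap ((left_section G s \<cdot> fst P) \<cdot> pb2 (fst G) (fst P)) (Id E (Dom E (fst P)) \<cdot> pb2 (fst G) (fst P))"
    unfolding left_fill_def by (rule ap_comp[OF _ _ _ _ _ left_section_comm]) (use L in simp_all)
  also have "(left_section G s \<cdot> fst P) \<cdot> pb2 (fst G) (fst P) = left_section G s \<cdot> fst G \<cdot> pb1 (fst G) (fst P)"
    using L by (simp add: pb_comm)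
  also have "\<dots> = left_top (fst G) s \<cdot> pb1 (fst G) (fst P)" using L by (simp add: comp_eq_ext[OF L(4)])
  finally have "left_fill G s \<cdot> pb2 (fst G) (fst P) = s" using L by simp
  with a show ?thesis using L by (intro fillsI) simp_all
qed

end

end

text \<open>The sections for \<open>G\<close> and \<open>G'\<close> are compared through the filler \<open>d\<close> against the base change \<open>pulled\<close>
  in the middle of the span between the two pushforwards: \<open>d\<close> is carried to the section for \<open>G\<close> by
  \<open>comparison\<close> and, restricted along \<open>b\<close>, to the section for \<open>G'\<close> by the projection.\<close>

lemma (in pushforward_comparison) left_fill_natural:
  assumes G: "left_mor E (right_maps E K v) forget G a b G'" and c: "Cod E (fst G) = Cod E (fst P)"
    and s: "is_square E (pb2 (fst G') (fst P')) s t' (fst X')"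
  shows "m \<cdot> B.left_fill G' s \<cdot> y = A.left_fill G (m \<cdot> s \<cdot> A.pb_arr (fst G) (fst P) a y (fst G') (fst P'))"
proof -
  note ty' = ty b_typing
  let ?h = "A.pb_arr (fst G) (fst P) a y (fst G') (fst P')"
  note GD = left_mor_D[OF G] 
  note sG = is_square_D[OF GD(3)]
  have c': "Cod E (fst G') = Cod E (fst P')" using sG ty' by simp
  note H = A.pb_arr[OF GD(3) right_mor_D(3)[OF rP] c]
  have s': "is_square E (pb2 (fst G) (fst P)) (m \<cdot> s \<cdot> ?h) t (fst X)"
    using A.square_comp[OF A.square_comp[OF H(6) s] right_mor_D(3)[OF rX]] tt is_square_D[OF s] H ty' by simp
  note LA = A.left_top[OF GD(1) c s'] and LB = B.left_top[OF GD(2) c' s]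
  note SA = fills_D[OF A.left_section[OF GD(1) c s']] and SB = fills_D[OF B.left_section[OF GD(2) c' s]]
  let ?ta = "A.left_top (fst G) (m \<cdot> s \<cdot> ?h)" and ?tb = "B.left_top (fst G') s"
  let ?sa = "A.left_section G (m \<cdot> s \<cdot> ?h)" and ?sb = "B.left_section G' s"
  \<comment> \<open>the top side of a square from \<open>G\<close> to the middle of the span\<close>
  define x where "x = A.pair \<pi>' b (?tb \<cdot> a) (fst G)"
  have e: "\<pi>' \<cdot> ?tb \<cdot> a = b \<cdot> fst G" using LB sG ty' by (simp add: A.comp_eq_ext[OF LB(4)])
  have X: "x \<in> Ar E" "Dom E x = Dom E (fst G)" "Cod E x = Dom E (pb1 \<pi>' b)" "pb1 \<pi>' b \<cdot> x = ?tb \<cdot> a" "pb2 \<pi>' b \<cdot> x = fst G"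
    using A.pair[of \<pi>' b "?tb \<cdot> a" "fst G"] e LB sG(1-8) ty' c unfolding x_def by simp_all
  note C = comparison_typing
  have px: "\<pi> \<cdot> comparison \<cdot> x = fst G" using C X ty' by (simp add: A.comp_eq_ext[OF C(4)])
  have kx: "comparison \<cdot> x = ?ta"
  proof (rule A.pushforward_eqI[OF A.pf, of _ _ "pb1 (fst G) (fst P)" "pb2 (fst G) (fst P)"])
    show "is_pullback E (\<pi> \<cdot> comparison \<cdot> x) (fst P) (pb1 (fst G) (fst P)) (pb2 (fst G) (fst P))"
      unfolding px using A.pb sG c ty' by simp
    have r: "related (comparison \<cdot> x) (?tb \<cdot> a)"
      using related_comp[OF comparison_related X(1)] X C by simp
    have "\<pi> \<cdot> (comparison \<cdot> x) \<cdot> pb1 (fst G) (fst P) = fst P \<cdot> pb2 (fst G) (fst P)"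
      using X C c sG(1-8) ty' by (simp add: A.comp_eq_ext[OF C(4)] A.comp_eq_ext[OF X(5)] A.pb_comm)
    from relatedD(7)[OF r _ _ _ _ _ this]
    have "A.ap ((comparison \<cdot> x) \<cdot> pb1 (fst G) (fst P)) (pb2 (fst G) (fst P)) =
        m \<cdot> B.ap ((?tb \<cdot> a) \<cdot> pb1 (fst G) (fst P)) (y \<cdot> pb2 (fst G) (fst P))"
      using X C c sG(1-8) ty' by simp
    also have "(?tb \<cdot> a) \<cdot> pb1 (fst G) (fst P) = (?tb \<cdot> pb1 (fst G') (fst P')) \<cdot> ?h"
      using LB(1-3) c c' sG(1-8) ty' H by simp
    also have "B.ap ((?tb \<cdot> pb1 (fst G') (fst P')) \<cdot> ?h) (y \<cdot> pb2 (fst G) (fst P)) = s \<cdot> ?h"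
    proof -
      have "\<pi>' \<cdot> ?tb \<cdot> pb1 (fst G') (fst P') = fst P' \<cdot> pb2 (fst G') (fst P')"
        using LB c' sG(1-8) ty' by (simp add: A.comp_eq_ext[OF LB(4)] A.pb_comm)
      then have "B.ap (?tb \<cdot> pb1 (fst G') (fst P')) (pb2 (fst G') (fst P')) \<cdot> ?h =
          B.ap ((?tb \<cdot> pb1 (fst G') (fst P')) \<cdot> ?h) (pb2 (fst G') (fst P') \<cdot> ?h)"
        using LB c' sG(1-8) ty' H by (intro B.ap_comp) simp_all
      then show ?thesis using LB(5) H by simp
    qed
    finally show "A.ap ((comparison \<cdot> x) \<cdot> pb1 (fst G) (fst P)) (pb2 (fst G) (fst P)) =
      A.ap (?ta \<cdot> pb1 (fst G) (fst P)) (pb2 (fst G) (fst P))" using LA(5) by simp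
  qed (use C X LA px ty' in simp_all)
  let ?I = "Id E (Cod E (fst G))"
  define d where "d = snd G pulled x ?I"
  have qx: "is_square E (fst G) x ?I (fst pulled)" using X sG(1-8) ty' c by (intro is_squareI) simp_all
  note d = fills_D[OF left_map_fills[OF GD(1) pulled_RM, of x ?I, unfolded forget_simps, OF qx], folded d_def]
  have "(pulled, (fst pulled, (comparison, Id E (Cod E \<pi>)), fst A.push_map), A.push_map) \<in> Ar (right_maps E K v)"
    using comparison_right_mor by (auto simp: right_maps_Ar)
  from left_map_natural[OF GD(1) this, of x ?I]
  have kd: "comparison \<cdot> d = ?sa"
    using qx sG(1-8) ty(1) b_typing c kx by (simp add: d_def A.left_section_def)
  have "(pulled, (fst pulled, (pb1 \<pi>' b, b), fst B.push_map), B.push_map) \<in> Ar (right_maps E K v)"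
    using pulled_proj by (auto simp: right_maps_Ar)
  from left_map_natural[OF GD(1) this, of x ?I]
  have "pb1 \<pi>' b \<cdot> d = snd G B.push_map (?tb \<cdot> a) b"
    using qx sG(1-8) c X ty' by (simp add: d_def)
  also have "\<dots> = ?sb \<cdot> b"
    using left_mor_fill[OF G B.push_map_RM, of ?tb "Id E (Cod E (fst G'))"] B.left_top_square[OF GD(2) c' s] sG(1-8) b_typing
    by (simp add: B.left_section_def)
  finally have pd: "pb1 \<pi>' b \<cdot> d = ?sb \<cdot> b" .
  let ?J = "Id E (Dom E (fst P))"
  have pk: "\<pi> \<cdot> (comparison \<cdot> d) \<cdot> fst P = fst P \<cdot> ?J"
    using A.left_section_comm[OF GD(1) c s'] kd by simp
  have r: "related (comparison \<cdot> d) (?sb \<cdot> b)"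
    using related_comp[OF comparison_related d(1)] d pd C b_typing A.typing(4) B.typing(4) by simp
  have "A.left_fill G (m \<cdot> s \<cdot> ?h) = A.ap ((comparison \<cdot> d) \<cdot> fst P) ?J"
    by (simp add: A.left_fill_def kd)
  also have "\<dots> = m \<cdot> B.ap ((?sb \<cdot> b) \<cdot> fst P) (y \<cdot> ?J)"
    by (rule relatedD(7)[OF r _ _ _ _ _ pk]) (use d C c ty' in simp_all)
  also have "(?sb \<cdot> b) \<cdot> fst P = (?sb \<cdot> fst P') \<cdot> y"
    using SB ty' c' P_square by simp
  also have "B.ap ((?sb \<cdot> fst P') \<cdot> y) (y \<cdot> ?J) = B.ap ((?sb \<cdot> fst P') \<cdot> y) (Id E (Dom E (fst P')) \<cdot> y)"
    using ty' by simp
  also have "\<dots> = B.left_fill G' s \<cdot> y"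
    unfolding B.left_fill_def
    by (rule B.ap_comp[OF _ _ _ _ _ B.left_section_comm[OF GD(2) c' s], symmetric]) (use SB ty' c' in simp_all)
  finally show ?thesis by simp
qed

section \<open>Pushforwards in a locally cartesian closed category\<close>

lemma right_adjoint_universal:
  assumes C: "category C" and D: "category D" and F: "is_functor C D F" and "has_right_adjoint C D F" and Y: "Y \<in> Ob D"
  obtains Q e where "Q \<in> Ob C" "e \<in> hom D (FO F Q) Y"
    "\<And>X z. \<lbrakk>X \<in> Ob C; z \<in> hom D (FO F X) Y\<rbrakk> \<Longrightarrow> \<exists>!m. m \<in> hom C X Q \<and> e \<cdot>\<^bsub>D\<^esub> FA F m = z"
proof -
  interpret C: category C by fact
  interpret D: category D by fact
  from assms(4) obtain G \<eta> \<epsilon> where G: "is_functor D C G" and \<eta>: "nat_trans C C fid (fcomp G F) \<eta>"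
    and \<epsilon>: "nat_trans D D (fcomp F G) fid \<epsilon>"
    and 1: "\<And>X. X \<in> Ob C \<Longrightarrow> \<epsilon> (FO F X) \<cdot>\<^bsub>D\<^esub> FA F (\<eta> X) = Id D (FO F X)"
    and 2: "\<And>Y. Y \<in> Ob D \<Longrightarrow> FA G (\<epsilon> Y) \<cdot>\<^bsub>C\<^esub> \<eta> (FO G Y) = Id C (FO G Y)"
    unfolding has_right_adjoint_def by blast
  have Go: "FO G Y \<in> Ob C" if "Y \<in> Ob D" for Y using G that by (auto simp: is_functor_def)
  have Fo: "FO F X \<in> Ob D" if "X \<in> Ob C" for X using F that by (auto simp: is_functor_def)
  have Fa: "FA F f \<in> hom D (FO F X) (FO F X')" if "f \<in> hom C X X'" for f X X' 
    using F that by (auto simp: is_functor_def hom_def)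
  have Ga: "FA G f \<in> hom C (FO G X) (FO G X')" if "f \<in> hom D X X'" for f X X' 
    using G that by (auto simp: is_functor_def hom_def)
  have Fc: "FA F (g \<cdot>\<^bsub>C\<^esub> f) = FA F g \<cdot>\<^bsub>D\<^esub> FA F f" if "f \<in> hom C X X'" "g \<in> hom C X' X''" for f g X X' X''
    using F that by (auto simp: is_functor_def hom_def)
  have Gc: "FA G (g \<cdot>\<^bsub>D\<^esub> f) = FA G g \<cdot>\<^bsub>C\<^esub> FA G f" if "f \<in> hom D X X'" "g \<in> hom D X' X''" for f g X X' X''
    using G that by (auto simp: is_functor_def hom_def)
  have eta: "\<eta> X \<in> hom C X (FO G (FO F X))" if "X \<in> Ob C" for X using \<eta> that by (auto simp: nat_trans_def)
  have eps: "\<epsilon> Y \<in> hom D (FO F (FO G Y)) Y" if "Y \<in> Ob D" for Y using \<epsilon> that by (auto simp: nat_trans_def)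
  have etan: "\<eta> X' \<cdot>\<^bsub>C\<^esub> f = FA G (FA F f) \<cdot>\<^bsub>C\<^esub> \<eta> X" if "f \<in> hom C X X'" for f X X'
    using \<eta> that by (auto simp: nat_trans_def hom_def)
  have epsn: "\<epsilon> X' \<cdot>\<^bsub>D\<^esub> FA F (FA G f) = f \<cdot>\<^bsub>D\<^esub> \<epsilon> X" if "f \<in> hom D X X'" for f X X'
    using \<epsilon> that by (auto simp: nat_trans_def hom_def)
  show thesis
  proof (rule that[OF Go[OF Y] eps[OF Y]])
    fix X z assume X: "X \<in> Ob C" and z: "z \<in> hom D (FO F X) Y"
    show "\<exists>!m. m \<in> hom C X (FO G Y) \<and> \<epsilon> Y \<cdot>\<^bsub>D\<^esub> FA F m = z"
    proof (rule ex1I[of _ "FA G z \<cdot>\<^bsub>C\<^esub> \<eta> X"], intro conjI)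
      show "FA G z \<cdot>\<^bsub>C\<^esub> \<eta> X \<in> hom C X (FO G Y)" using C.Comp_hom[OF eta[OF X] Ga[OF z]] .
      have "\<epsilon> Y \<cdot>\<^bsub>D\<^esub> FA F (FA G z \<cdot>\<^bsub>C\<^esub> \<eta> X) = (\<epsilon> Y \<cdot>\<^bsub>D\<^esub> FA F (FA G z)) \<cdot>\<^bsub>D\<^esub> FA F (\<eta> X)"
        using Fc[OF eta[OF X] Ga[OF z]] D.Comp_assoc[OF Fa[OF eta[OF X]] Fa[OF Ga[OF z]] eps[OF Y]] by simp
      also have "\<dots> = z \<cdot>\<^bsub>D\<^esub> \<epsilon> (FO F X) \<cdot>\<^bsub>D\<^esub> FA F (\<eta> X)"
        using epsn[OF z] D.Comp_assoc[OF Fa[OF eta[OF X]] eps[OF Fo[OF X]] z] by simp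
      finally show "\<epsilon> Y \<cdot>\<^bsub>D\<^esub> FA F (FA G z \<cdot>\<^bsub>C\<^esub> \<eta> X) = z" using 1[OF X] D.Id_right[OF z] by simp
    next
      fix m assume m: "m \<in> hom C X (FO G Y) \<and> \<epsilon> Y \<cdot>\<^bsub>D\<^esub> FA F m = z"
      then have m: "m \<in> hom C X (FO G Y)" and z: "\<epsilon> Y \<cdot>\<^bsub>D\<^esub> FA F m = z" by auto
      have "FA G z \<cdot>\<^bsub>C\<^esub> \<eta> X = FA G (\<epsilon> Y) \<cdot>\<^bsub>C\<^esub> FA G (FA F m) \<cdot>\<^bsub>C\<^esub> \<eta> X"
        using Gc[OF Fa[OF m] eps[OF Y]] C.Comp_assoc[OF eta[OF X] Ga[OF Fa[OF m]] Ga[OF eps[OF Y]]] z by simp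
      also have "\<dots> = (FA G (\<epsilon> Y) \<cdot>\<^bsub>C\<^esub> \<eta> (FO G Y)) \<cdot>\<^bsub>C\<^esub> m"
        using etan[OF m] C.Comp_assoc[OF m eta[OF Go[OF Y]] Ga[OF eps[OF Y]]] by simp
      finally show "m = FA G z \<cdot>\<^bsub>C\<^esub> \<eta> X" using 2[OF Y] C.Id_left[OF m] by simp
    qed
  qed
qed

lemma slice_simps [simp]:
  "g \<in> Ob (slice E X) \<longleftrightarrow> g \<in> Ar E \<and> Cod E g = X"
  "(g, m, h) \<in> Ar (slice E X) \<longleftrightarrow> g \<in> Ar E \<and> Cod E g = X \<and> h \<in> Ar E \<and> Cod E h = X \<and>
     m \<in> hom E (Dom E g) (Dom E h) \<and> h \<cdot>\<^bsub>E\<^esub> m = g"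
  "Dom (slice E X) (g, m, h) = g" "Cod (slice E X) (g, m, h) = h"
  "Id (slice E X) g = (g, Id E (Dom E g), g)"
  "Comp (slice E X) (g', n, k) (g, m, h) = (g, n \<cdot>\<^bsub>E\<^esub> m, k)"
  by (auto simp: slice_def)

lemma slice_hom:
  "(g', m, h') \<in> hom (slice E X) g h \<longleftrightarrow> g' = g \<and> h' = h \<and> g \<in> Ar E \<and> Cod E g = X \<and> h \<in> Ar E \<and> Cod E h = X \<and>
     m \<in> hom E (Dom E g) (Dom E h) \<and> h \<cdot>\<^bsub>E\<^esub> m = g"
  by (auto simp: hom_def[of "slice E X"])

lemma slice_homE:
  assumes "w \<in> hom (slice E X) g h"
  obtains m where "w = (g, m, h)" "g \<in> Ar E" "Cod E g = X" "h \<in> Ar E" "Cod E h = X"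
    "m \<in> hom E (Dom E g) (Dom E h)" "h \<cdot>\<^bsub>E\<^esub> m = g"
  using assms by (cases w) (auto simp: slice_hom)

lemma (in category) category_slice: "category (slice C X)"
proof
  fix f Y Z g W assume "f \<in> hom (slice C X) Y Z" "g \<in> hom (slice C X) Z W"
  then show "g \<cdot>\<^bsub>slice C X\<^esub> f \<in> hom (slice C X) Y W"
    by (elim slice_homE) (auto simp: slice_hom hom_def comp_eq_ext)
qed (auto elim!: slice_homE simp: hom_def)

context pb_category begin

text \<open>The base change functor on a slice is the pullback functor on squares with identities on one side.\<close>

lemma base_change_FA:
  assumes "(g, m, h) \<in> Ar (slice E (Cod E f))" "f \<in> Ar E"
  shows "FA (base_change E pb1 pb2 f) (g, m, h) = (pb2 g f, pb_arr g f m (Id E (Dom E f)) h f, pb2 h f)"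
  using assms by (auto simp: base_change_def pb_arr_def pair_def pb_map_def hom_def)

lemma slice_square:
  assumes "(g, m, h) \<in> Ar (slice E X)"
  shows "is_square E g m (Id E X) h"
proof -
  have "g \<in> Ar E" "h \<in> Ar E" "Cod E g = X" "Cod E h = X" "m \<in> Ar E" "Dom E m = Dom E g" "Cod E m = Dom E h" "h \<cdot> m = g"
    using assms unfolding slice_simps hom_def by blast+
  moreover have "X \<in> Ob E" using Cod_Ob[of g] calculation by simp
  ultimately show ?thesis by (intro is_squareI) simp_all
qed

lemma base_change_functor:
  assumes f: "f \<in> Ar E"
  shows "is_functor (slice E (Cod E f)) (slice E (Dom E f)) (base_change E pb1 pb2 f)"
  unfolding is_functor_def
proof (intro conjI ballI impI)
  let ?F = "base_change E pb1 pb2 f"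
  note sf = square_id[OF f]
  show "FO ?F g \<in> Ob (slice E (Dom E f))" if "g \<in> Ob (slice E (Cod E f))" for g
    using that f by (simp add: base_change_def)
  show "FA ?F w \<in> hom (slice E (Dom E f)) (FO ?F (Dom (slice E (Cod E f)) w)) (FO ?F (Cod (slice E (Cod E f)) w))"
    if "w \<in> Ar (slice E (Cod E f))" for w
  proof -
    obtain g m h where w: "w = (g, m, h)" by (cases w)
    note P = pb_arr[OF slice_square[OF that[unfolded w]] sf]
    have g: "g \<in> Ar E" "Cod E g = Cod E f" "h \<in> Ar E" "Cod E h = Cod E f" using that unfolding w by auto
    have "FA ?F w = (pb2 g f, pb_arr g f m (Id E (Dom E f)) h f, pb2 h f)"
      using base_change_FA[OF that[unfolded w] f] w by simp
    moreover have "pb_arr g f m (Id E (Dom E f)) h f \<in> hom E (Dom E (pb2 g f)) (Dom E (pb2 h f))"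
      "pb2 h f \<cdot> pb_arr g f m (Id E (Dom E f)) h f = pb2 g f"
      using P(1-3,5) g f by (simp_all add: hom_def)
    ultimately show ?thesis using g f unfolding w by (simp add: slice_hom) (simp add: base_change_def)
  qed
  show "FA ?F (Id (slice E (Cod E f)) g) = Id (slice E (Dom E f)) (FO ?F g)" if "g \<in> Ob (slice E (Cod E f))" for g
    using that f pb_arr_id[of g f] by (simp add: base_change_FA hom_def) (simp add: base_change_def)
  show "FA ?F (w' \<cdot>\<^bsub>slice E (Cod E f)\<^esub> w) = FA ?F w' \<cdot>\<^bsub>slice E (Dom E f)\<^esub> FA ?F w"
    if w: "w \<in> Ar (slice E (Cod E f))" "w' \<in> Ar (slice E (Cod E f))" "Cod (slice E (Cod E f)) w = Dom (slice E (Cod E f)) w'" for w w'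
  proof -
    obtain g m h where e: "w = (g, m, h)" by (cases w)
    obtain n k where e': "w' = (h, n, k)" using w(3) e by (cases w') auto
    have c: "(g, n \<cdot> m, k) \<in> Ar (slice E (Cod E f))"
      using w(1,2) unfolding e e' by (auto simp: hom_def comp_eq_ext)
    show ?thesis
      using w c f pb_arr_comp[OF slice_square[OF w(1)[unfolded e]] sf _ slice_square[OF w(2)[unfolded e']] sf]
      unfolding e e' by (simp add: base_change_FA)
  qed
qed

text \<open>The right adjoint of base change along \<open>p\<close>, applied to the base change of \<open>r\<close> along \<open>t\<close>, is \<open>\<pi>\<close>, and \<open>e\<close> is
  the counit followed by the projection to the domain of \<open>r\<close>. The adjoint is given for another
  choice of pullbacks \<open>p'\<close> and \<open>q'\<close>, and the universal property is wanted for arbitrary ones, whence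
  the comparison maps \<open>c\<close>, \<open>i\<close> and \<open>j\<close>.\<close>

lemma pushforward_exists:
  assumes lcc: "locally_cartesian_closed E"
    and p: "p \<in> Ar E" and t: "t \<in> Ar E" "Dom E t = Dom E p" and r: "r \<in> Ar E" "Cod E t = Cod E r"
  shows "\<exists>\<pi> e. pushforward p t r \<pi> e"
proof -
  from lcc obtain p' q' where ch: "chosen_pullbacks E p' q'"
    and adj: "\<And>f. f \<in> Ar E \<Longrightarrow> has_right_adjoint (slice E (Cod E f)) (slice E (Dom E f)) (base_change E p' q' f)"
    unfolding locally_cartesian_closed_def by blast
  interpret L: pb_category E p' q' by unfold_locales (fact ch)
  have "q' r t \<in> Ob (slice E (Dom E p))" using r t by simp
  from right_adjoint_universal[OF category_slice category_slice L.base_change_functor[OF p] adj[OF p] this]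
  obtain \<pi> w where \<pi>0: "\<pi> \<in> Ob (slice E (Cod E p))"
    and w0: "w \<in> hom (slice E (Dom E p)) (FO (base_change E p' q' p) \<pi>) (q' r t)"
    and univ0: "\<And>b z. \<lbrakk>b \<in> Ob (slice E (Cod E p)); z \<in> hom (slice E (Dom E p)) (FO (base_change E p' q' p) b) (q' r t)\<rbrakk> \<Longrightarrow>
      \<exists>!m. m \<in> hom (slice E (Cod E p)) b \<pi> \<and> w \<cdot>\<^bsub>slice E (Dom E p)\<^esub> FA (base_change E p' q' p) m = z"
    by metis
  have FO: "FO (base_change E p' q' p) b = q' b p" for b by (simp add: base_change_def)
  have \<pi>: "\<pi> \<in> Ar E" "Cod E \<pi> = Cod E p" using \<pi>0 by auto
  have w: "w \<in> hom (slice E (Dom E p)) (q' \<pi> p) (q' r t)" using w0 FO by simp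
  have univ: "\<exists>!m. m \<in> hom (slice E (Cod E p)) b \<pi> \<and> w \<cdot>\<^bsub>slice E (Dom E p)\<^esub> FA (base_change E p' q' p) m = z"
    if "b \<in> Ar E" "Cod E b = Cod E p" "z \<in> hom (slice E (Dom E p)) (q' b p) (q' r t)" for b z
    using univ0[of b z] that FO by simp
  from w obtain k where w': "w = (q' \<pi> p, k, q' r t)" and k: "k \<in> hom E (Dom E (q' \<pi> p)) (Dom E (q' r t))" "q' r t \<cdot> k = q' \<pi> p"
    by (elim slice_homE) auto
  have kt: "k \<in> Ar E" "Dom E k = Dom E (p' \<pi> p)" "Cod E k = Dom E (p' r t)" using k(1) p r t \<pi> by (auto simp: hom_def)
  note T = p t r \<pi> kt
  define c where "c = L.pair \<pi> p (pb1 \<pi> p) (pb2 \<pi> p)"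
  have c: "c \<in> Ar E" "Dom E c = Dom E (pb1 \<pi> p)" "Cod E c = Dom E (p' \<pi> p)" "p' \<pi> p \<cdot> c = pb1 \<pi> p" "q' \<pi> p \<cdot> c = pb2 \<pi> p"
    using L.pair[of \<pi> p "pb1 \<pi> p" "pb2 \<pi> p"] T pb_comm[of \<pi> p] by (simp_all add: c_def)
  define e where "e = p' r t \<cdot> k \<cdot> c"
  have e: "e \<in> Ar E" "Dom E e = Dom E (pb1 \<pi> p)" "Cod E e = Dom E r" using c T by (simp_all add: e_def)
  have "r \<cdot> e = t \<cdot> q' r t \<cdot> k \<cdot> c" unfolding e_def using T c by (simp add: L.pb_comm_ext)
  also have "\<dots> = t \<cdot> pb2 \<pi> p" using T c by (simp add: comp_eq_ext[OF k(2)])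
  finally have re: "r \<cdot> e = t \<cdot> pb2 \<pi> p" .
  have app: "app p \<pi> e m y = p' r t \<cdot> k \<cdot> L.pair \<pi> p m y"
    if "m \<in> Ar E" "y \<in> Ar E" "Dom E m = Dom E y" "Cod E m = Dom E \<pi>" "Cod E y = Dom E p" "\<pi> \<cdot> m = p \<cdot> y" for m y
  proof -
    note P = pair[of \<pi> p m y, OF _ _ _ that(1,2,4,5,3,6)]
    have "L.pair \<pi> p m y = c \<cdot> pair \<pi> p m y"
      by (rule L.pair_unique) (use P T c that in \<open>simp_all add: comp_eq_ext[OF c(4)] comp_eq_ext[OF c(5)]\<close>)
    then show ?thesis using P T c that by (simp add: app_def e_def)
  qed
  have uq: "\<exists>!m. m \<in> hom E (Dom E b) (Dom E \<pi>) \<and> \<pi> \<cdot> m = b \<and> app p \<pi> e (m \<cdot> x1) x2 = z"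
    if b: "b \<in> Ar E" "Cod E b = Cod E p" and pb: "is_pullback E b p x1 x2" and z: "z \<in> hom E (Dom E x1) (Dom E r)"
      and rz: "r \<cdot> z = t \<cdot> x2" for b x1 x2 z
  proof -
    have X: "x1 \<in> Ar E" "x2 \<in> Ar E" "Cod E x1 = Dom E b" "Cod E x2 = Dom E p" "Dom E x2 = Dom E x1" "b \<cdot> x1 = p \<cdot> x2"
      using pullback_D[OF pb] by (auto simp: hom_def)
    \<comment> \<open>\<open>j\<close> and \<open>i\<close> are the mutually inverse comparisons of the pullbacks \<open>(x1, x2)\<close> and \<open>(p' b p, q' b p)\<close>\<close>
    define j where "j = L.pair b p x1 x2"
    have j: "j \<in> Ar E" "Dom E j = Dom E x1" "Cod E j = Dom E (p' b p)" "p' b p \<cdot> j = x1" "q' b p \<cdot> j = x2"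
      using L.pair[of b p x1 x2] b p X by (simp_all add: j_def)
    define i where "i = pb_map E x1 x2 (Dom E (p' b p)) (p' b p) (q' b p)"
    have i: "i \<in> Ar E" "Dom E i = Dom E (p' b p)" "Cod E i = Dom E x1" "x1 \<cdot> i = p' b p" "x2 \<cdot> i = q' b p"
      using pb_map[OF pb, of "p' b p" "Dom E (p' b p)" "q' b p"] b p L.pb_comm[of b p] by (simp_all add: i_def hom_def)
    have ij: "i \<cdot> j = Id E (Dom E x1)"
      by (rule pullback_eqI[OF pb b(1) p b(2), of _ "Dom E x1"])
        (use i j X in \<open>simp_all add: hom_def comp_eq_ext[OF i(4)] comp_eq_ext[OF i(5)]\<close>)
    have ji: "j \<cdot> i = Id E (Dom E (p' b p))"
      by (rule L.pb_eqI[OF b(1) p b(2)])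
        (use i j X b p in \<open>simp_all add: comp_eq_ext[OF j(4)] comp_eq_ext[OF j(5)]\<close>)
    have zt: "z \<in> Ar E" "Dom E z = Dom E x1" "Cod E z = Dom E r" using z by (auto simp: hom_def)
    define z' where "z' = L.pair r t (z \<cdot> i) (q' b p)"
    have "r \<cdot> z \<cdot> i = t \<cdot> q' b p" using zt i X T b by (simp add: comp_sq[OF rz])
    then have z': "z' \<in> Ar E" "Dom E z' = Dom E (p' b p)" "Cod E z' = Dom E (p' r t)" "p' r t \<cdot> z' = z \<cdot> i" "q' r t \<cdot> z' = q' b p"
      using L.pair[of r t "z \<cdot> i" "q' b p"] zt i T b by (simp_all add: z'_def)
    have "(q' b p, z', q' r t) \<in> hom (slice E (Dom E p)) (q' b p) (q' r t)"
      using z' b p t r by (simp add: slice_hom) (simp add: hom_def)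
    from univ[OF b this]
    have ex: "\<exists>!m. m \<in> hom (slice E (Cod E p)) b \<pi> \<and>
      w \<cdot>\<^bsub>slice E (Dom E p)\<^esub> FA (base_change E p' q' p) m = (q' b p, z', q' r t)" .
    \<comment> \<open>transposition along the adjunction, with the two pullbacks identified\<close>
    have iff: "m \<in> hom E (Dom E b) (Dom E \<pi>) \<and> \<pi> \<cdot> m = b \<and> app p \<pi> e (m \<cdot> x1) x2 = z \<longleftrightarrow>
      (b, m, \<pi>) \<in> hom (slice E (Cod E p)) b \<pi> \<and>
      w \<cdot>\<^bsub>slice E (Dom E p)\<^esub> FA (base_change E p' q' p) (b, m, \<pi>) = (q' b p, z', q' r t)" for m
    proof (cases "m \<in> hom E (Dom E b) (Dom E \<pi>) \<and> \<pi> \<cdot> m = b")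
      case True
      then have m: "m \<in> Ar E" "Dom E m = Dom E b" "Cod E m = Dom E \<pi>" "\<pi> \<cdot> m = b" by (auto simp: hom_def)
      have sm: "(b, m, \<pi>) \<in> Ar (slice E (Cod E p))" using True b \<pi> by simp
      define h where "h = L.pb_arr b p m (Id E (Dom E p)) \<pi> p"
      note H = L.pb_arr[OF slice_square[OF sm] square_id[OF p] b(2), folded h_def]
      have FAm: "w \<cdot>\<^bsub>slice E (Dom E p)\<^esub> FA (base_change E p' q' p) (b, m, \<pi>) = (q' b p, k \<cdot> h, q' r t)"
        using L.base_change_FA[OF sm p] by (simp add: w' h_def)
      have pm: "\<pi> \<cdot> m \<cdot> x1 = p \<cdot> x2" using X m T b by (simp add: comp_eq_ext[OF m(4)])
      have "L.pair \<pi> p (m \<cdot> x1) x2 = h \<cdot> j"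
        by (rule L.pair_unique)
          (use H(1-5) j T b m X in \<open>simp_all add: comp_eq_ext[OF H(4)] comp_eq_ext[OF H(5)]\<close>)
      then have a: "app p \<pi> e (m \<cdot> x1) x2 = p' r t \<cdot> k \<cdot> h \<cdot> j" 
        using app[of "m \<cdot> x1" x2] pm m X by simp
      have "app p \<pi> e (m \<cdot> x1) x2 = z \<longleftrightarrow> k \<cdot> h = z'"
      proof
        assume "k \<cdot> h = z'"
        then have "app p \<pi> e (m \<cdot> x1) x2 = p' r t \<cdot> z' \<cdot> j" using a H(1-3) j T b by (simp add: comp_eq_ext)
        also have "\<dots> = z \<cdot> i \<cdot> j" using z' j zt i T b by (simp add: comp_eq_ext[OF z'(4)])
        finally show "app p \<pi> e (m \<cdot> x1) x2 = z" using ij zt by simp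
      next
        assume z0: "app p \<pi> e (m \<cdot> x1) x2 = z"
        show "k \<cdot> h = z'"
        proof (rule L.pb_eqI[OF r(1) t(1) r(2)[symmetric]])
          have "z \<cdot> i = (p' r t \<cdot> k \<cdot> h \<cdot> j) \<cdot> i" using z0 a by simp
          also have "\<dots> = p' r t \<cdot> k \<cdot> h \<cdot> (j \<cdot> i)" using i j H(1-3) T b by simp
          also have "\<dots> = p' r t \<cdot> k \<cdot> h" using ji H(1-3) T b by simp
          finally show "p' r t \<cdot> k \<cdot> h = p' r t \<cdot> z'" using z' by simp
          show "q' r t \<cdot> k \<cdot> h = q' r t \<cdot> z'"
            using z' H(1-5) T b p by (simp add: comp_eq_ext[OF k(2)])
        qed (use H(1-3) T b z' in simp_all)
      qed
      then show ?thesis using True FAm sm b \<pi> by (simp add: slice_hom)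
    next
      case False
      then show ?thesis by (auto simp: slice_hom)
    qed
    from ex obtain m0 where m0: "m0 \<in> hom (slice E (Cod E p)) b \<pi>"
      "w \<cdot>\<^bsub>slice E (Dom E p)\<^esub> FA (base_change E p' q' p) m0 = (q' b p, z', q' r t)" by blast
    obtain m where "m0 = (b, m, \<pi>)" using m0(1) by (elim slice_homE)
    with m0 have m: "(b, m, \<pi>) \<in> hom (slice E (Cod E p)) b \<pi> \<and>
      w \<cdot>\<^bsub>slice E (Dom E p)\<^esub> FA (base_change E p' q' p) (b, m, \<pi>) = (q' b p, z', q' r t)" by simp
    show ?thesis
      unfolding iff using m ex by (intro ex1I[of _ m]) blast+
  qed
  have "pushforward p t r \<pi> e"
    unfolding pushforward_def using T e re uq by simp
  then show ?thesis by blast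
qed

end

section \<open>Functors over the pullback functor\<close>

lemma functor_comp:
  assumes F: "is_functor C D F" and G: "is_functor D B G"
  shows "is_functor C B (fcomp G F)"
proof -
  have "FA F f \<in> Ar D \<and> Dom D (FA F f) = FO F (Dom C f) \<and> Cod D (FA F f) = FO F (Cod C f)" if "f \<in> Ar C" for f
    using F that by (auto simp: is_functor_def hom_def)
  moreover from this have "FA G (FA F f) \<in> hom B (FO G (FO F (Dom C f))) (FO G (FO F (Cod C f)))" if "f \<in> Ar C" for f
    using G that unfolding is_functor_def by metis
  ultimately show ?thesis using assms unfolding is_functor_def by simp
qed

lemma functor_comp_eq:
  "\<lbrakk>is_functor C D F; f \<in> Ar C; g \<in> Ar C; Cod C f = Dom C g\<rbrakk> \<Longrightarrow> FA F (g \<cdot>\<^bsub>C\<^esub> f) = FA F g \<cdot>\<^bsub>D\<^esub> FA F f"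
  by (simp add: is_functor_def)

lemma nat_trans_eq:
  "\<lbrakk>nat_trans C D F G \<alpha>; f \<in> Ar C\<rbrakk> \<Longrightarrow> \<alpha> (Cod C f) \<cdot>\<^bsub>D\<^esub> FA F f = FA G f \<cdot>\<^bsub>D\<^esub> \<alpha> (Dom C f)"
  by (simp add: nat_trans_def)

lemma functor_Ob: "is_functor C D F \<Longrightarrow> X \<in> Ob C \<Longrightarrow> FO F X \<in> Ob D"
  and functor_Ar: "is_functor C D F \<Longrightarrow> f \<in> Ar C \<Longrightarrow> FA F f \<in> Ar D"
  by (auto simp: is_functor_def hom_def)

lemma fib_prod_simps [simp]:
  "(X, Y) \<in> Ob (fib_prod C D F G) \<longleftrightarrow> X \<in> Ob C \<and> Y \<in> Ob D \<and> FO F X = FO G Y"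
  "(f, g) \<in> Ar (fib_prod C D F G) \<longleftrightarrow> f \<in> Ar C \<and> g \<in> Ar D \<and> FA F f = FA G g"
  "Dom (fib_prod C D F G) (f, g) = (Dom C f, Dom D g)" "Cod (fib_prod C D F G) (f, g) = (Cod C f, Cod D g)"
  "Id (fib_prod C D F G) (X, Y) = (Id C X, Id D Y)"
  "Comp (fib_prod C D F G) (f', g') (f, g) = (f' \<cdot>\<^bsub>C\<^esub> f, g' \<cdot>\<^bsub>D\<^esub> g)"
  by (auto simp: fib_prod_def)

lemma fib_prod_functor:
  assumes A: "is_functor C' C A" "feq C' (fcomp F A) F'" and B: "is_functor D' D B" "feq D' (fcomp G B) G'"
  shows "is_functor (fib_prod C' D' F' G') (fib_prod C D F G) (fprod A B)"
proof -
  have a: "FA A f \<in> Ar C" "Dom C (FA A f) = FO A (Dom C' f)" "Cod C (FA A f) = FO A (Cod C' f)" if "f \<in> Ar C'" for f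
    using A that by (auto simp: is_functor_def hom_def)
  have b: "FA B f \<in> Ar D" "Dom D (FA B f) = FO B (Dom D' f)" "Cod D (FA B f) = FO B (Cod D' f)" if "f \<in> Ar D'" for f
    using B that by (auto simp: is_functor_def hom_def)
  show ?thesis
    unfolding is_functor_def
  proof (intro conjI ballI impI; clarsimp)
    show "FO A X \<in> Ob C \<and> FO B Y \<in> Ob D \<and> FO F (FO A X) = FO G (FO B Y)"
      if "X \<in> Ob C'" "Y \<in> Ob D'" "FO F' X = FO G' Y" for X Y
      using that A B by (auto simp: is_functor_def feq_def)
    show "(FA A f, FA B g) \<in> hom (fib_prod C D F G) (FO A (Dom C' f), FO B (Dom D' g)) (FO A (Cod C' f), FO B (Cod D' g))"
      if "f \<in> Ar C'" "g \<in> Ar D'" "FA F' f = FA G' g" for f g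
      using that a b A(2) B(2) by (auto simp: hom_def feq_def)
  qed (use A B in \<open>auto simp: is_functor_def\<close>)
qed

abbreviation cod_of :: "('o, 'a) cat \<Rightarrow> ('p, 'b, 'a, 'a square) fctr \<Rightarrow> ('p, 'b, 'o, 'a) fctr" where
  "cod_of E U \<equiv> fcomp (cod_fun E) U"

text \<open>Compose with the given functors on both factors and on the target.\<close>

lemma lifts_fib_prod_transfer:
  assumes P: "lifts (fib_prod C D (cod_of E U) (cod_of E V)) L (fprod U V) W F"
    and A: "lifts C' C U' U fid" and B: "lifts D' D V' V fid" and N: "lifts L L' W W' fid"
  shows "lifts (fib_prod C' D' (cod_of E U') (cod_of E V')) L' (fprod U' V') W' F"
proof -
  from A obtain A where A: "is_functor C' C A" "feq C' (fcomp U A) U'" by (auto simp: lifts_def feq_def)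
  from B obtain B where B: "is_functor D' D B" "feq D' (fcomp V B) V'" by (auto simp: lifts_def feq_def)
  from N obtain N where N: "is_functor L L' N" "feq L (fcomp W' N) W" by (auto simp: lifts_def feq_def)
  from P obtain P where P: "is_functor (fib_prod C D (cod_of E U) (cod_of E V)) L P"
    "feq (fib_prod C D (cod_of E U) (cod_of E V)) (fcomp W P) (fcomp F (fprod U V))" by (auto simp: lifts_def)
  have AB: "is_functor (fib_prod C' D' (cod_of E U') (cod_of E V')) (fib_prod C D (cod_of E U) (cod_of E V)) (fprod A B)"
    using A B by (intro fib_prod_functor) (auto simp: feq_def)
  let ?Q = "fcomp N (fcomp P (fprod A B))"
  have "is_functor (fib_prod C' D' (cod_of E U') (cod_of E V')) L' ?Q"
    using functor_comp functor_comp[OF AB P(1)] N(1) by blast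
  moreover have "feq (fib_prod C' D' (cod_of E U') (cod_of E V')) (fcomp W' ?Q) (fcomp F (fprod U' V'))"
    unfolding feq_def
  proof (intro conjI ballI; clarify)
    fix X Y assume XY: "(X, Y) \<in> Ob (fib_prod C' D' (cod_of E U') (cod_of E V'))"
    have 1: "(FO A X, FO B Y) \<in> Ob (fib_prod C D (cod_of E U) (cod_of E V))"
      using functor_Ob[OF AB XY] by (simp del: fib_prod_simps)
    note 2 = functor_Ob[OF P(1) this]
    show "FO (fcomp W' ?Q) (X, Y) = FO (fcomp F (fprod U' V')) (X, Y)"
      using XY 1 2 N(2) P(2) A(2) B(2) by (auto simp: feq_def)
  next
    fix f g assume fg: "(f, g) \<in> Ar (fib_prod C' D' (cod_of E U') (cod_of E V'))"
    have 1: "(FA A f, FA B g) \<in> Ar (fib_prod C D (cod_of E U) (cod_of E V))"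
      using functor_Ar[OF AB fg] by (simp del: fib_prod_simps)
    note 2 = functor_Ar[OF P(1) this]
    show "FA (fcomp W' ?Q) (f, g) = FA (fcomp F (fprod U' V')) (f, g)"
      using fg 1 2 N(2) P(2) A(2) B(2) by (auto simp: feq_def)
  qed
  ultimately show ?thesis unfolding lifts_def by blast
qed

lemma functor_forget:
  assumes "\<And>X. X \<in> S \<Longrightarrow> fst X \<in> Ob C"
  shows "is_functor (str_cat C S H) C forget"
  using assms by (auto simp: is_functor_def)

lemma cod_fun_simps [simp]: "FO (cod_fun E) f = Cod E f" "FA (cod_fun E) m = bot_of m"
  by (auto simp: cod_fun_def)

lemma functor_bot:
  assumes "is_functor C (arrow_cat E) U" "f \<in> Ar C"
  shows "FA (cod_of E U) f \<in> hom E (FO (cod_of E U) (Dom C f)) (FO (cod_of E U) (Cod C f))"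
  using is_square_D(4,7,8)[OF functor_square(1)[OF assms]] by (simp add: hom_def)

lemma typed_fib_prod_cod:
  assumes "typed_cat C" "typed_cat D" "is_functor C (arrow_cat E) U" "is_functor D (arrow_cat E) V"
  shows "typed_cat (fib_prod C D (cod_of E U) (cod_of E V))"
  by (rule typed_cat_fib_prod[OF assms(1,2) functor_bot[OF assms(3)] functor_bot[OF assms(4)]])

lemma (in pb_category) pullback_functor:
  assumes U: "is_functor C (arrow_cat E) U" and V: "is_functor D (arrow_cat E) V" and "typed_cat C" "typed_cat D"
  shows "is_functor (fib_prod C D (cod_of E U) (cod_of E V)) (arrow_cat E) (fcomp (pullback_fun E pb1 pb2) (fprod U V))"
  unfolding is_functor_def
proof (intro conjI ballI impI; clarify)
  let ?B = "fib_prod C D (cod_of E U) (cod_of E V)"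
  let ?P = "fcomp (pullback_fun E pb1 pb2) (fprod U V)"
  have UO: "FO U X \<in> Ar E" if "X \<in> Ob C" for X using U that by (auto simp: is_functor_def)
  have VO: "FO V X \<in> Ar E" if "X \<in> Ob D" for X using V that by (auto simp: is_functor_def)
  have FA: "FA ?P (f, g) = (pb2 (FO U (Dom C f)) (FO V (Dom D g)),
      (pb_arr (FO U (Dom C f)) (FO V (Dom D g)) (top_of (FA U f)) (top_of (FA V g)) (FO U (Cod C f)) (FO V (Cod D g)), top_of (FA V g)),
      pb2 (FO U (Cod C f)) (FO V (Cod D g)))"
    and SU: "is_square E (FO U (Dom C f)) (top_of (FA U f)) (bot_of (FA U f)) (FO U (Cod C f))"
    and SV: "is_square E (FO V (Dom D g)) (top_of (FA V g)) (bot_of (FA U f)) (FO V (Cod D g))"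
    and SD: "Cod E (FO U (Dom C f)) = Cod E (FO V (Dom D g))"
    if fg: "(f, g) \<in> Ar ?B" for f g
  proof -
    from fg have f: "f \<in> Ar C" and g: "g \<in> Ar D" and e: "bot_of (FA U f) = bot_of (FA V g)" by auto
    show su: "is_square E (FO U (Dom C f)) (top_of (FA U f)) (bot_of (FA U f)) (FO U (Cod C f))"
      using functor_square(1)[OF U f] .
    show sv: "is_square E (FO V (Dom D g)) (top_of (FA V g)) (bot_of (FA U f)) (FO V (Cod D g))"
      using functor_square(1)[OF V g] e by simp
    show c: "Cod E (FO U (Dom C f)) = Cod E (FO V (Dom D g))"
      using is_square_D(7)[OF su] is_square_D(7)[OF sv] by simp
    have 1: "FA U f = (FO U (Dom C f), (top_of (FA U f), bot_of (FA U f)), FO U (Cod C f))"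
      "FA V g = (FO V (Dom D g), (top_of (FA V g), bot_of (FA U f)), FO V (Cod D g))"
      using functor_square(2)[OF U f] functor_square(2)[OF V g] e by simp_all
    show "FA ?P (f, g) = (pb2 (FO U (Dom C f)) (FO V (Dom D g)),
      (pb_arr (FO U (Dom C f)) (FO V (Dom D g)) (top_of (FA U f)) (top_of (FA V g)) (FO U (Cod C f)) (FO V (Cod D g)), top_of (FA V g)),
      pb2 (FO U (Cod C f)) (FO V (Cod D g)))"
      using pullback_fun_FA[OF su sv c] 1 by simp
  qed
  show "FO ?P (X, Y) \<in> Ob (arrow_cat E)" if "(X, Y) \<in> Ob ?B" for X Y
    using that UO VO by simp
  show "FA ?P (f, g) \<in> hom (arrow_cat E) (FO ?P (Dom ?B (f, g))) (FO ?P (Cod ?B (f, g)))" if "(f, g) \<in> Ar ?B" for f g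
    using FA[OF that] pb_arr(6)[OF SU[OF that] SV[OF that] SD[OF that]] by (simp add: arrow_cat_hom)
  show "FA ?P (Id ?B (X, Y)) = Id (arrow_cat E) (FO ?P (X, Y))" if XY: "(X, Y) \<in> Ob ?B" for X Y
  proof -
    have 1: "FO U X \<in> Ar E" "FO V Y \<in> Ar E" "Cod E (FO U X) = Cod E (FO V Y)" using XY UO VO by auto
    have 2: "FA U (Id C X) = (FO U X, (Id E (Dom E (FO U X)), Id E (Cod E (FO U X))), FO U X)"
      "FA V (Id D Y) = (FO V Y, (Id E (Dom E (FO V Y)), Id E (Cod E (FO U X))), FO V Y)"
      using U V XY 1 by (auto simp: is_functor_def)
    show ?thesis 
      using pullback_fun_FA[OF square_id[OF 1(1)], of "FO V Y" "Id E (Dom E (FO V Y))" "FO V Y"] square_id[OF 1(2)] 1 2 pb_arr_id[OF 1] by simp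
  qed
  show "FA ?P ((f', g') \<cdot>\<^bsub>?B\<^esub> (f, g)) = FA ?P (f', g') \<cdot>\<^bsub>arrow_cat E\<^esub> FA ?P (f, g)"
    if 1: "(f, g) \<in> Ar ?B" and 2: "(f', g') \<in> Ar ?B" and 3: "Cod ?B (f, g) = Dom ?B (f', g')" for f g f' g'
  proof -
    from 1 2 3 have f: "f \<in> Ar C" "f' \<in> Ar C" "Cod C f = Dom C f'" and g: "g \<in> Ar D" "g' \<in> Ar D" "Cod D g = Dom D g'" by auto
    have d: "Dom C (f' \<cdot>\<^bsub>C\<^esub> f) = Dom C f" "Cod C (f' \<cdot>\<^bsub>C\<^esub> f) = Cod C f'" "Dom D (g' \<cdot>\<^bsub>D\<^esub> g) = Dom D g" "Cod D (g' \<cdot>\<^bsub>D\<^esub> g) = Cod D g'"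
      using assms(3,4) f g by (auto simp: typed_cat_def)
    note su = functor_square[OF U f(1)] functor_square[OF U f(2)] and sv = functor_square[OF V g(1)] functor_square[OF V g(2)]
    have e: "bot_of (FA U f) = bot_of (FA V g)" "bot_of (FA U f') = bot_of (FA V g')" using 1 2 by auto
    have "FA U (f' \<cdot>\<^bsub>C\<^esub> f) = FA U f' \<cdot>\<^bsub>arrow_cat E\<^esub> FA U f" using U f by (simp add: is_functor_def)
    then have u: "FA U (f' \<cdot>\<^bsub>C\<^esub> f) = (FO U (Dom C f), (top_of (FA U f') \<cdot> top_of (FA U f), bot_of (FA U f') \<cdot> bot_of (FA U f)), FO U (Cod C f'))"
      using su by (metis arrow_cat_simps(6))
    have "FA V (g' \<cdot>\<^bsub>D\<^esub> g) = FA V g' \<cdot>\<^bsub>arrow_cat E\<^esub> FA V g" using V g by (simp add: is_functor_def)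
    then have v: "FA V (g' \<cdot>\<^bsub>D\<^esub> g) = (FO V (Dom D g), (top_of (FA V g') \<cdot> top_of (FA V g), bot_of (FA U f') \<cdot> bot_of (FA U f)), FO V (Cod D g'))"
      using sv e by (metis arrow_cat_simps(6))
    note S = SU[OF 1] SV[OF 1] SD[OF 1] SU[OF 2] SV[OF 2]
    have S2: "is_square E (FO U (Dom C f)) (top_of (FA U f') \<cdot> top_of (FA U f)) (bot_of (FA U f') \<cdot> bot_of (FA U f)) (FO U (Cod C f'))"
      "is_square E (FO V (Dom D g)) (top_of (FA V g') \<cdot> top_of (FA V g)) (bot_of (FA U f') \<cdot> bot_of (FA U f)) (FO V (Cod D g'))"
      using square_comp[OF S(1)] S(4) square_comp[OF S(2)] S(5) f(3) g(3) by simp_all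
    show ?thesis
      using FA[OF 1] FA[OF 2] pullback_fun_FA[OF S2 S(3)] u v f(3) g(3) pb_arr_comp[OF S(1-3) S(4)[folded f(3)] S(5)[folded g(3)]]
      by simp
  qed
qed

lemma lifts_right_mapsI:
  assumes "is_functor C (arrow_cat E) (fcomp F U)" "typed_cat C"
    and S: "\<And>X. X \<in> Ob C \<Longrightarrow> (FO F (FO U X), \<Phi> X) \<in> Ob (right_maps E J v)"
    and H: "\<And>f. f \<in> Ar C \<Longrightarrow> right_mor E J v (FO F (FO U (Dom C f)), \<Phi> (Dom C f)) (top_of (FA F (FA U f)))
        (bot_of (FA F (FA U f))) (FO F (FO U (Cod C f)), \<Phi> (Cod C f))"
  shows "lifts C (right_maps E J v) U forget F"
  unfolding right_maps_def
  using assms(2) S H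
  by (intro lifts_str_catI[where \<Phi> = \<Phi>, OF assms(1)]) (simp_all add: right_mor_def right_maps_def)

lemma lifts_left_mapsI:
  assumes "is_functor C (arrow_cat E) (fcomp F U)" "typed_cat C"
    and S: "\<And>X. X \<in> Ob C \<Longrightarrow> (FO F (FO U X), \<Phi> X) \<in> Ob (left_maps E J v)"
    and H: "\<And>f. f \<in> Ar C \<Longrightarrow> left_mor E J v (FO F (FO U (Dom C f)), \<Phi> (Dom C f)) (top_of (FA F (FA U f)))
        (bot_of (FA F (FA U f))) (FO F (FO U (Cod C f)), \<Phi> (Cod C f))"
  shows "lifts C (left_maps E J v) U forget F"
  unfolding left_maps_def
  using assms(2) S H
  by (intro lifts_str_catI[where \<Phi> = \<Phi>, OF assms(1)]) (simp_all add: left_mor_def left_maps_def)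

context category begin

lemma left_mor_id:
  assumes "X \<in> Ob (left_maps C J u)"
  shows "left_mor C J u X (Id C (Dom C (fst X))) (Id C (Cod C (fst X))) X"
proof -
  have X: "fst X \<in> Ar C" using left_map_Ar[OF assms(1)] .
  have "snd X i s t \<cdot> Id C (Cod C (fst X)) = snd X i (s \<cdot> Id C (Dom C (fst X))) (t \<cdot> Id C (Cod C (fst X)))"
    if "i \<in> Ob J" "is_square C (fst X) s t (FO u i)" for i s t
    using fills_D(1-3)[OF left_map_fills[OF assms that]] is_square_D[OF that(2)] by simp
  then show ?thesis using assms X square_id[OF X] by (auto simp: left_mor_def)
qed

end

text \<open>The filler for given data uses a pushforward that is chosen for these data. The fillers are natural
  all the same, because \<open>left_fill_natural\<close> compares any two pushforwards.\<close>

locale lcc_gen_frobenius = gen_frobenius E pb1 pb2 K v gf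
  for E :: "('o, 'a) cat" (structure) and pb1 pb2 and K :: "('i, 'j) cat" and v :: "('i, 'j, 'a, 'a square) fctr" and gf +
  assumes lcc: "locally_cartesian_closed E"
begin

definition chosen_pf :: "'a \<Rightarrow> 'a \<Rightarrow> 'a \<Rightarrow> 'a \<times> 'a" where
  "chosen_pf p t r = (SOME x. pushforward p t r (fst x) (snd x))"

lemma chosen_pf:
  assumes "p \<in> Ar E" "t \<in> Ar E" "Dom E t = Dom E p" "r \<in> Ar E" "Cod E t = Cod E r"
  shows "pushforward p t r (fst (chosen_pf p t r)) (snd (chosen_pf p t r))"
proof -
  have "\<exists>x. pushforward p t r (fst x) (snd x)"
    using pushforward_exists[OF lcc assms] by simp
  then show ?thesis unfolding chosen_pf_def by (rule someI_ex)
qed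

definition frob_fill where
  "frob_fill G P X s t = right_pushforward.left_fill E pb1 pb2 K v gf P t X
     (fst (chosen_pf (fst P) t (fst X))) (snd (chosen_pf (fst P) t (fst X))) G s"

lemma right_pushforward_chosen:
  assumes "P \<in> RM" "X \<in> RM" "G \<in> LM" "Cod E (fst G) = Cod E (fst P)" "is_square E (pb2 (fst G) (fst P)) s t (fst X)"
  shows "right_pushforward E pb1 pb2 K v gf P t X (fst (chosen_pf (fst P) t (fst X))) (snd (chosen_pf (fst P) t (fst X)))"
proof unfold_locales
  show "P \<in> RM" "X \<in> RM" by fact+
  show "pushforward (fst P) t (fst X) (fst (chosen_pf (fst P) t (fst X))) (snd (chosen_pf (fst P) t (fst X)))"
    using right_map_Ar[OF assms(1)] right_map_Ar[OF assms(2)] left_map_Ar[OF assms(3)] is_square_D[OF assms(5)] assms(4)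
    by (intro chosen_pf) simp_all
qed

lemma frob_fill:
  assumes "G \<in> LM" "P \<in> RM" "X \<in> RM" "Cod E (fst G) = Cod E (fst P)" "is_square E (pb2 (fst G) (fst P)) s t (fst X)"
  shows "fills E (pb2 (fst G) (fst P)) s t (fst X) (frob_fill G P X s t)"
proof -
  interpret right_pushforward E pb1 pb2 K v gf P t X "fst (chosen_pf (fst P) t (fst X))" "snd (chosen_pf (fst P) t (fst X))"
    using right_pushforward_chosen assms by blast
  show ?thesis using left_fill[OF assms(1,4,5)] by (simp add: frob_fill_def)
qed

lemma frob_fill_natural:
  assumes G: "left_mor E (right_maps E K v) forget G a b G'" and P: "rmor P y b P'" and X: "rmor X' m n X"
    and c: "Cod E (fst G) = Cod E (fst P)" and s: "is_square E (pb2 (fst G') (fst P')) s t (fst X')"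
  shows "m \<cdot> frob_fill G' P' X' s t \<cdot> y =
    frob_fill G P X (m \<cdot> s \<cdot> pb_arr (fst G) (fst P) a y (fst G') (fst P')) (n \<cdot> t \<cdot> y)"
proof -
  note H = pb_arr(6)[OF left_mor_D(3)[OF G] right_mor_D(3)[OF P] c]
  note s' = square_comp[OF square_comp[OF H s] right_mor_D(3)[OF X]]
  have c': "Cod E (fst G') = Cod E (fst P')"
    using is_square_D(8)[OF left_mor_D(3)[OF G]] is_square_D(8)[OF right_mor_D(3)[OF P]] by simp
  interpret pushforward_comparison E pb1 pb2 K v gf
    P "n \<cdot> t \<cdot> y" X "fst (chosen_pf (fst P) (n \<cdot> t \<cdot> y) (fst X))" "snd (chosen_pf (fst P) (n \<cdot> t \<cdot> y) (fst X))"
    P' t X' "fst (chosen_pf (fst P') t (fst X'))" "snd (chosen_pf (fst P') t (fst X'))" y b m n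
    by (intro pushforward_comparison.intro pushforward_comparison_axioms.intro P X refl
        right_pushforward_chosen[OF right_mor_D(1)[OF P] right_mor_D(2)[OF X] left_mor_D(1)[OF G] c s']
        right_pushforward_chosen[OF right_mor_D(2)[OF P] right_mor_D(1)[OF X] left_mor_D(2)[OF G] c' s])
  show ?thesis
    using left_fill_natural[OF G c s] by (simp add: frob_fill_def)
qed

definition frob_str where
  "frob_str G P = left_restr E (right_maps E K v) forget (pb2 (fst G) (fst P)) (\<lambda>X. frob_fill G P X)"

lemma right_maps_typing: "typed_cat (right_maps E K v)"
  by (simp add: right_maps_def)

lemma left_maps_typing: "typed_cat (left_maps E J' v')"
  by (simp add: left_maps_def)

lemma right_forget: "is_functor (right_maps E K v) (arrow_cat E) forget"
  unfolding right_maps_def by (rule functor_forget) auto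

lemma left_forget: "is_functor (left_maps E J' v') (arrow_cat E) forget"
  unfolding left_maps_def by (rule functor_forget) auto

lemma frob_left_map:
  assumes G: "G \<in> LM" and P: "P \<in> RM" and c: "Cod E (fst G) = Cod E (fst P)"
  shows "(pb2 (fst G) (fst P), frob_str G P) \<in> LM"
proof -
  have t: "fst G \<in> Ar E" "fst P \<in> Ar E" using left_map_Ar[OF G] right_map_Ar[OF P] .
  show ?thesis
    unfolding frob_str_def
  proof (rule left_map_restrI[OF right_maps_typing right_forget])
    show "pb2 (fst G) (fst P) \<in> Ar E" using t c by simp
    show "fills E (pb2 (fst G) (fst P)) s u (FO forget X) (frob_fill G P X s u)"
      if "X \<in> RM" "is_square E (pb2 (fst G) (fst P)) s u (FO forget X)" for X s u
      using frob_fill[OF G P that(1) c, of s u] that(2) by simp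
    fix w s u assume w: "w \<in> Ar (right_maps E K v)"
      and q: "is_square E (pb2 (fst G) (fst P)) s u (FO forget (Dom (right_maps E K v) w))"
    obtain X' mm X where e: "w = (X', mm, X)" by (cases w)
    from w e obtain m n where mm: "mm = (fst X', (m, n), fst X)" and r: "rmor X' m n X" by (auto simp: right_maps_Ar)
    note q' = q[unfolded e right_maps_Dom_Cod forget_simps]
    note f = frob_fill[OF G P right_mor_D(1)[OF r] c q']
    show "top_of (FA forget w) \<cdot> frob_fill G P (Dom (right_maps E K v) w) s u =
       frob_fill G P (Cod (right_maps E K v) w) (top_of (FA forget w) \<cdot> s) (bot_of (FA forget w) \<cdot> u)"
      using frob_fill_natural[OF left_mor_id[OF G] right_mor_id[OF P v, folded c] r c q']
        fills_D[OF f] is_square_D[OF q'] is_square_D[OF right_mor_D(3)[OF r]] pb_arr_id[OF t c] t c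
      by (simp add: e mm)
  qed
qed

lemma frob_left_mor:
  assumes G: "left_mor E (right_maps E K v) forget G a b G'" and P: "rmor P y b P'" and c: "Cod E (fst G) = Cod E (fst P)"
  shows "left_mor E (right_maps E K v) forget (pb2 (fst G) (fst P), frob_str G P)
    (pb_arr (fst G) (fst P) a y (fst G') (fst P')) y (pb2 (fst G') (fst P'), frob_str G' P')"
proof -
  have c': "Cod E (fst G') = Cod E (fst P')"
    using is_square_D(8)[OF left_mor_D(3)[OF G]] is_square_D(8)[OF right_mor_D(3)[OF P]] by simp
  note H = pb_arr(6)[OF left_mor_D(3)[OF G] right_mor_D(3)[OF P] c]
  have "frob_str G' P' X s t \<cdot> y = frob_str G P X (s \<cdot> pb_arr (fst G) (fst P) a y (fst G') (fst P')) (t \<cdot> y)"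
    if X: "X \<in> RM" and q: "is_square E (pb2 (fst G') (fst P')) s t (fst X)" for X s t
  proof -
    note f = fills_D[OF frob_fill[OF left_mor_D(2)[OF G] right_mor_D(2)[OF P] X c' q]]
    note q' = square_comp[OF H q]
    have "frob_fill G' P' X s t \<cdot> y = frob_fill G P X (s \<cdot> pb_arr (fst G) (fst P) a y (fst G') (fst P')) (t \<cdot> y)"
      using frob_fill_natural[OF G P right_mor_id[OF X v] c q] f is_square_D[OF q] is_square_D[OF H] by simp
    then show ?thesis using X q q' by (simp add: frob_str_def left_restr_def)
  qed
  then show ?thesis
    unfolding left_mor_def
    using frob_left_map[OF left_mor_D(1)[OF G] right_mor_D(1)[OF P] c]
      frob_left_map[OF left_mor_D(2)[OF G] right_mor_D(2)[OF P] c'] H by simp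
qed

theorem frobenius_lifts:
  "lifts (fib_prod (left_maps E (right_maps E K v) forget) (right_maps E K v) (cod_of E forget) (cod_of E forget))
     (left_maps E (right_maps E K v) forget) (fprod forget forget) forget (pullback_fun E pb1 pb2)"
proof (rule lifts_left_mapsI[where \<Phi> = "\<lambda>(G, P). frob_str G P"])
  let ?B = "fib_prod (left_maps E (right_maps E K v) forget) (right_maps E K v) (cod_of E forget) (cod_of E forget)"
  show "is_functor ?B (arrow_cat E) (fcomp (pullback_fun E pb1 pb2) (fprod forget forget))"
    by (intro pullback_functor left_forget right_forget left_maps_typing right_maps_typing)
  show "typed_cat ?B"
    by (intro typed_fib_prod_cod left_forget right_forget left_maps_typing right_maps_typing)
  show "(FO (pullback_fun E pb1 pb2) (FO (fprod forget forget) X), case X of (G, P) \<Rightarrow> frob_str G P) \<in> LM" if "X \<in> Ob ?B" for X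
    using that frob_left_map by (cases X) auto
  fix w assume w: "w \<in> Ar ?B"
  obtain G mg G' P mp P' where e: "w = ((G, mg, G'), (P, mp, P'))" by (cases w; cases "fst w"; cases "snd w") auto
  from w e obtain a b where G: "mg = (fst G, (a, b), fst G')" "left_mor E (right_maps E K v) forget G a b G'"
    by (auto simp: left_maps_Ar)
  from w e obtain y b' where P: "mp = (fst P, (y, b'), fst P')" "rmor P y b' P'"
    by (auto simp: right_maps_Ar)
  have b: "b' = b" using w e G P by simp
  have c: "Cod E (fst G) = Cod E (fst P)"
    using is_square_D(7)[OF left_mor_D(3)[OF G(2)]] is_square_D(7)[OF right_mor_D(3)[OF P(2)]] b by simp
  show "left_mor E (right_maps E K v) forget
      (FO (pullback_fun E pb1 pb2) (FO (fprod forget forget) (Dom ?B w)), case Dom ?B w of (G, P) \<Rightarrow> frob_str G P)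
      (top_of (FA (pullback_fun E pb1 pb2) (FA (fprod forget forget) w)))
      (bot_of (FA (pullback_fun E pb1 pb2) (FA (fprod forget forget) w)))
      (FO (pullback_fun E pb1 pb2) (FO (fprod forget forget) (Cod ?B w)), case Cod ?B w of (G, P) \<Rightarrow> frob_str G P)"
    using frob_left_mor[OF G(2) P(2)[unfolded b] c]
      pullback_fun_FA[OF left_mor_D(3)[OF G(2)] right_mor_D(3)[OF P(2)[unfolded b]] c]
    unfolding e G(1) P(1) b by simp
qed

end

section \<open>Cylinders\<close>

locale cylinder = pb_category E "pb1 ch" "pb2 ch"
  for E :: "('o, 'a) cat" (structure) and ch :: "('o, 'a) chosen" +
  fixes I :: "('o, 'a, 'o, 'a) fctr" and \<delta> :: "nat \<Rightarrow> 'o \<Rightarrow> 'a"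
  assumes ch: "is_chosen E ch" and cyl: "functorial_cylinder E I \<delta>" and adj: "has_right_adjoint E E I"
begin

lemma I_simps [simp]:
  "X \<in> Ob E \<Longrightarrow> FO I X \<in> Ob E"
  "f \<in> Ar E \<Longrightarrow> FA I f \<in> Ar E" "f \<in> Ar E \<Longrightarrow> Dom E (FA I f) = FO I (Dom E f)" "f \<in> Ar E \<Longrightarrow> Cod E (FA I f) = FO I (Cod E f)"
  "\<lbrakk>f \<in> Ar E; g \<in> Ar E; Cod E f = Dom E g\<rbrakk> \<Longrightarrow> FA I (g \<cdot> f) = FA I g \<cdot> FA I f"
  "X \<in> Ob E \<Longrightarrow> FA I (Id E X) = Id E (FO I X)"
  using cyl by (auto simp: functorial_cylinder_def is_functor_def hom_def)

lemma \<delta>_simps [simp]: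
  assumes "k < 2" "X \<in> Ob E"
  shows "\<delta> k X \<in> Ar E" "Dom E (\<delta> k X) = X" "Cod E (\<delta> k X) = FO I X"
proof -
  have "k = 0 \<or> k = 1" using assms by auto
  then show "\<delta> k X \<in> Ar E" "Dom E (\<delta> k X) = X" "Cod E (\<delta> k X) = FO I X"
    using cyl assms by (auto simp: functorial_cylinder_def nat_trans_def hom_def)
qed

lemma \<delta>_natural:
  assumes "k < 2" "f \<in> Ar E"
  shows "\<delta> k (Cod E f) \<cdot> f = FA I f \<cdot> \<delta> k (Dom E f)"
proof -
  have "k = 0 \<or> k = 1" using assms by auto
  then show ?thesis using cyl assms by (auto simp: functorial_cylinder_def nat_trans_def)
qed

subsection \<open>Path objects\<close>

text \<open>The right adjoint of the cylinder enters only through its universal arrows: \<open>path Y\<close> represents the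
  maps \<open>I \<otimes> X \<rightarrow> Y\<close>, with universal such map \<open>ev Y\<close>, and \<open>tr X x\<close> is the transpose of \<open>x\<close>. The object \<open>X\<close>
  is an argument because it cannot be recovered from \<open>I \<otimes> X\<close>.\<close>

definition path_data :: "'o \<Rightarrow> 'o \<times> 'a" where
  "path_data Y = (SOME x. fst x \<in> Ob E \<and> snd x \<in> hom E (FO I (fst x)) Y \<and>
     (\<forall>X z. X \<in> Ob E \<longrightarrow> z \<in> hom E (FO I X) Y \<longrightarrow> (\<exists>!m. m \<in> hom E X (fst x) \<and> snd x \<cdot> FA I m = z)))"

definition path :: "'o \<Rightarrow> 'o" where "path Y = fst (path_data Y)"

definition ev :: "'o \<Rightarrow> 'a" where "ev Y = snd (path_data Y)"

definition tr :: "'o \<Rightarrow> 'a \<Rightarrow> 'a" where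
  "tr X x = (THE m. m \<in> hom E X (path (Cod E x)) \<and> ev (Cod E x) \<cdot> FA I m = x)"

lemma path_universal:
  assumes Y: "Y \<in> Ob E"
  shows "path Y \<in> Ob E" "ev Y \<in> hom E (FO I (path Y)) Y"
    "\<lbrakk>X \<in> Ob E; z \<in> hom E (FO I X) Y\<rbrakk> \<Longrightarrow> \<exists>!m. m \<in> hom E X (path Y) \<and> ev Y \<cdot> FA I m = z"
proof -
  have F: "is_functor E E I" using cyl by (simp add: functorial_cylinder_def)
  obtain Q e where "Q \<in> Ob E" "e \<in> hom E (FO I Q) Y"
    "\<And>X z. \<lbrakk>X \<in> Ob E; z \<in> hom E (FO I X) Y\<rbrakk> \<Longrightarrow> \<exists>!m. m \<in> hom E X Q \<and> e \<cdot> FA I m = z"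
    using right_adjoint_universal[OF category_axioms category_axioms F adj Y] by blast
  then have "\<exists>x. fst x \<in> Ob E \<and> snd x \<in> hom E (FO I (fst x)) Y \<and>
     (\<forall>X z. X \<in> Ob E \<longrightarrow> z \<in> hom E (FO I X) Y \<longrightarrow> (\<exists>!m. m \<in> hom E X (fst x) \<and> snd x \<cdot> FA I m = z))"
    by (intro exI[of _ "(Q, e)"]) simp
  from someI_ex[OF this, folded path_data_def, folded path_def ev_def]
  show "path Y \<in> Ob E" "ev Y \<in> hom E (FO I (path Y)) Y"
    "\<lbrakk>X \<in> Ob E; z \<in> hom E (FO I X) Y\<rbrakk> \<Longrightarrow> \<exists>!m. m \<in> hom E X (path Y) \<and> ev Y \<cdot> FA I m = z"
    by simp_all
qed

lemma path_simps [simp]: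
  assumes "Y \<in> Ob E"
  shows "path Y \<in> Ob E" "ev Y \<in> Ar E" "Dom E (ev Y) = FO I (path Y)" "Cod E (ev Y) = Y"
  using path_universal(1,2)[OF assms] by (auto simp: hom_def)

lemma tr [simp]:
  assumes "X \<in> Ob E" "x \<in> Ar E" "Dom E x = FO I X"
  shows "tr X x \<in> Ar E" "Dom E (tr X x) = X" "Cod E (tr X x) = path (Cod E x)"
    and ev_tr: "ev (Cod E x) \<cdot> FA I (tr X x) = x"
proof -
  have "\<exists>!m. m \<in> hom E X (path (Cod E x)) \<and> ev (Cod E x) \<cdot> FA I m = x"
    using path_universal(3)[of "Cod E x" X x] assms by (simp add: hom_def)
  from theI'[OF this, folded tr_def] show "tr X x \<in> Ar E" "Dom E (tr X x) = X" "Cod E (tr X x) = path (Cod E x)"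
    "ev (Cod E x) \<cdot> FA I (tr X x) = x" by (auto simp: hom_def)
qed

lemma ev_eqI:
  assumes "Y \<in> Ob E" "m \<in> Ar E" "m' \<in> Ar E" "Dom E m = Dom E m'" "Cod E m = path Y" "Cod E m' = path Y"
    "ev Y \<cdot> FA I m = ev Y \<cdot> FA I m'"
  shows "m = m'"
proof -
  have "\<exists>!l. l \<in> hom E (Dom E m) (path Y) \<and> ev Y \<cdot> FA I l = ev Y \<cdot> FA I m"
    using path_universal(3)[OF assms(1), of "Dom E m" "ev Y \<cdot> FA I m"] assms by (simp add: hom_def)
  then show ?thesis using assms by (auto simp: hom_def)
qed

lemma tr_unique:
  assumes "m \<in> Ar E" "Cod E m = path (Cod E x)" "ev (Cod E x) \<cdot> FA I m = x" "x \<in> Ar E" "Dom E m = X"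
  shows "tr X x = m"
proof -
  have X: "X \<in> Ob E" using assms by auto
  have "Dom E (ev (Cod E x) \<cdot> FA I m) = FO I X" using assms by (subst comp_Dom) simp_all
  then have d: "Dom E x = FO I X" using assms by simp
  show ?thesis
    by (rule ev_eqI[of "Cod E x"]) (use assms X d ev_tr[OF X assms(4) d] in simp_all)
qed

definition path_map :: "'a \<Rightarrow> 'a" where
  "path_map f = tr (path (Dom E f)) (f \<cdot> ev (Dom E f))"

lemma path_map [simp]:
  assumes "f \<in> Ar E"
  shows "path_map f \<in> Ar E" "Dom E (path_map f) = path (Dom E f)" "Cod E (path_map f) = path (Cod E f)"
    and ev_path_map: "ev (Cod E f) \<cdot> FA I (path_map f) = f \<cdot> ev (Dom E f)"
  using tr[of "path (Dom E f)" "f \<cdot> ev (Dom E f)"] ev_tr[of "path (Dom E f)" "f \<cdot> ev (Dom E f)"] assms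
  by (simp_all add: path_map_def)

lemma ev_path_map_ext:
  assumes "f \<in> Ar E" "x \<in> Ar E" "Cod E x = FO I (path (Dom E f))"
  shows "ev (Cod E f) \<cdot> FA I (path_map f) \<cdot> x = f \<cdot> ev (Dom E f) \<cdot> x"
  using comp_sq[OF ev_path_map[OF assms(1)], of x] assms by simp

text \<open>Evaluation of a path at the endpoint \<open>k\<close>.\<close>

definition endpoint :: "nat \<Rightarrow> 'o \<Rightarrow> 'a" where
  "endpoint k Y = ev Y \<cdot> \<delta> k (path Y)"

lemma endpoint [simp]:
  assumes "k < 2" "Y \<in> Ob E"
  shows "endpoint k Y \<in> Ar E" "Dom E (endpoint k Y) = path Y" "Cod E (endpoint k Y) = Y"
  using assms by (simp_all add: endpoint_def)

lemma endpoint_comp: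
  assumes "k < 2" "Y \<in> Ob E" "x \<in> Ar E" "Cod E x = path Y"
  shows "endpoint k Y \<cdot> x = ev Y \<cdot> FA I x \<cdot> \<delta> k (Dom E x)"
  using assms \<delta>_natural[OF assms(1,3)] by (simp add: endpoint_def)

lemma endpoint_natural:
  assumes "k < 2" "f \<in> Ar E"
  shows "endpoint k (Cod E f) \<cdot> path_map f = f \<cdot> endpoint k (Dom E f)"
  using assms endpoint_comp[of k "Cod E f" "path_map f"] by (simp add: ev_path_map_ext endpoint_def)

subsection \<open>The cylinder preserves the initial object and pushouts\<close>

lemma initial_map:
  assumes "X \<in> Ob E" "f \<in> Ar E" "g \<in> Ar E" "Dom E f = zero ch" "Dom E g = zero ch" "Cod E f = X" "Cod E g = X"
  shows "f = g"
  using ch assms by (auto simp: is_chosen_def is_initial_def hom_def)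

lemma cyl_initial_map:
  assumes "f \<in> Ar E" "g \<in> Ar E" "Dom E f = FO I (zero ch)" "Dom E g = FO I (zero ch)" "Cod E f = Cod E g"
  shows "f = g"
proof -
  have z: "zero ch \<in> Ob E" using ch by (auto simp: is_chosen_def is_initial_def)
  have "tr (zero ch) f = tr (zero ch) g"
    by (rule initial_map[of "path (Cod E f)"]) (use assms z in simp_all)
  then show ?thesis using ev_tr[OF z assms(1,3)] ev_tr[OF z assms(2,4)] assms(5) by metis
qed

definition copair :: "'a \<Rightarrow> 'a \<Rightarrow> 'a \<Rightarrow> 'a \<Rightarrow> 'a" where
  "copair g h x y = (THE w. w \<in> hom E (Cod E (po1 ch g h)) (Cod E x) \<and> w \<cdot> po1 ch g h = x \<and> w \<cdot> po2 ch g h = y)"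

lemma po:
  assumes "g \<in> Ar E" "h \<in> Ar E" "Dom E g = Dom E h"
  shows "is_pushout E g h (po1 ch g h) (po2 ch g h)"
  using ch assms by (auto simp: is_chosen_def chosen_pushouts_def)

lemma po_typing [simp]:
  assumes "g \<in> Ar E" "h \<in> Ar E" "Dom E g = Dom E h"
  shows "po1 ch g h \<in> Ar E" "po2 ch g h \<in> Ar E" "Cod E (po2 ch g h) = Cod E (po1 ch g h)"
    "Dom E (po1 ch g h) = Cod E g" "Dom E (po2 ch g h) = Cod E h"
  using po[OF assms] by (auto simp: is_pushout_def)

lemma po_comm:
  assumes "g \<in> Ar E" "h \<in> Ar E" "Dom E g = Dom E h"
  shows "po1 ch g h \<cdot> g = po2 ch g h \<cdot> h"
  using po[OF assms] by (auto simp: is_pushout_def)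

lemma copair:
  assumes "g \<in> Ar E" "h \<in> Ar E" "Dom E g = Dom E h" "x \<in> Ar E" "y \<in> Ar E" "Dom E x = Cod E g" "Dom E y = Cod E h" "Cod E x = Cod E y"
    "x \<cdot> g = y \<cdot> h"
  shows "copair g h x y \<in> Ar E" "Dom E (copair g h x y) = Cod E (po1 ch g h)" "Cod E (copair g h x y) = Cod E x"
    "copair g h x y \<cdot> po1 ch g h = x" "copair g h x y \<cdot> po2 ch g h = y"
proof -
  have hom: "x \<in> hom E (Cod E g) (Cod E x)" "y \<in> hom E (Cod E h) (Cod E x)"
    using assms(4-8) by (simp_all add: hom_def)
  have "\<exists>!w. w \<in> hom E (Cod E (po1 ch g h)) (Cod E x) \<and> w \<cdot> po1 ch g h = x \<and> w \<cdot> po2 ch g h = y"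
    using po[OF assms(1-3)] Cod_Ob[OF assms(4)] hom assms(9) unfolding is_pushout_def by blast
  from theI'[OF this, folded copair_def] show "copair g h x y \<in> Ar E" "Dom E (copair g h x y) = Cod E (po1 ch g h)" "Cod E (copair g h x y) = Cod E x"
    "copair g h x y \<cdot> po1 ch g h = x" "copair g h x y \<cdot> po2 ch g h = y" by (auto simp: hom_def)
qed

lemma po_eqI:
  assumes "g \<in> Ar E" "h \<in> Ar E" "Dom E g = Dom E h" "w \<in> Ar E" "w' \<in> Ar E" "Dom E w = Cod E (po1 ch g h)" "Dom E w' = Cod E (po1 ch g h)"
    "Cod E w = Cod E w'" "w \<cdot> po1 ch g h = w' \<cdot> po1 ch g h" "w \<cdot> po2 ch g h = w' \<cdot> po2 ch g h"
  shows "w = w'"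
proof -
  have e: "(w \<cdot> po1 ch g h) \<cdot> g = (w \<cdot> po2 ch g h) \<cdot> h" using assms(1-8) po_comm[OF assms(1-3)] by simp
  have h: "w \<cdot> po1 ch g h \<in> hom E (Cod E g) (Cod E w)" "w \<cdot> po2 ch g h \<in> hom E (Cod E h) (Cod E w)"
    using assms(1-8) by (simp_all add: hom_def)
  have "\<exists>!v. v \<in> hom E (Cod E (po1 ch g h)) (Cod E w) \<and> v \<cdot> po1 ch g h = w \<cdot> po1 ch g h \<and> v \<cdot> po2 ch g h = w \<cdot> po2 ch g h"
    using po[OF assms(1-3)] Cod_Ob[OF assms(4)] h e unfolding is_pushout_def by blast
  then show ?thesis using assms by (auto simp: hom_def)
qed

lemma copair_unique:
  assumes "g \<in> Ar E" "h \<in> Ar E" "Dom E g = Dom E h" "w \<in> Ar E" "Dom E w = Cod E (po1 ch g h)" 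
    "w \<cdot> po1 ch g h = x" "w \<cdot> po2 ch g h = y"
  shows "copair g h x y = w"
proof -
  have xy: "x \<in> Ar E" "y \<in> Ar E" "Dom E x = Cod E g" "Dom E y = Cod E h" "Cod E x = Cod E w" "Cod E y = Cod E w"
    using assms by auto
  have "x \<cdot> g = y \<cdot> h" using po_comm[OF assms(1-3)] assms by (auto simp flip: assms(6,7))
  note C = copair[OF assms(1-3) xy(1-4) _ this]
  show ?thesis by (rule po_eqI[OF assms(1-3)]) (use C assms xy in simp_all)
qed

lemma comp_copair:
  assumes "g \<in> Ar E" "h \<in> Ar E" "Dom E g = Dom E h" "x \<in> Ar E" "y \<in> Ar E" "Dom E x = Cod E g" "Dom E y = Cod E h" "Cod E x = Cod E y"
    "x \<cdot> g = y \<cdot> h" "m \<in> Ar E" "Dom E m = Cod E x"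
  shows "m \<cdot> copair g h x y = copair g h (m \<cdot> x) (m \<cdot> y)"
  using copair[OF assms(1-9)] assms by (intro copair_unique[symmetric]) simp_all

text \<open>As a left adjoint, the cylinder preserves pushouts: transpose, form the induced map, and transpose
  back.\<close>

definition cyl_copair :: "'a \<Rightarrow> 'a \<Rightarrow> 'a \<Rightarrow> 'a \<Rightarrow> 'a" where
  "cyl_copair g h x y = ev (Cod E x) \<cdot> FA I (copair g h (tr (Cod E g) x) (tr (Cod E h) y))"

lemma cyl_copair:
  assumes gh: "g \<in> Ar E" "h \<in> Ar E" "Dom E g = Dom E h" and xy: "x \<in> Ar E" "y \<in> Ar E" "Dom E x = FO I (Cod E g)" "Dom E y = FO I (Cod E h)" "Cod E x = Cod E y"
    and c: "x \<cdot> FA I g = y \<cdot> FA I h"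
  shows "cyl_copair g h x y \<in> Ar E" "Dom E (cyl_copair g h x y) = FO I (Cod E (po1 ch g h))" "Cod E (cyl_copair g h x y) = Cod E y"
    "cyl_copair g h x y \<cdot> FA I (po1 ch g h) = x" "cyl_copair g h x y \<cdot> FA I (po2 ch g h) = y"
proof -
  have tx: "ev (Cod E y) \<cdot> FA I (tr (Cod E g) x) = x" and ty: "ev (Cod E y) \<cdot> FA I (tr (Cod E h) y) = y"
    using ev_tr[of "Cod E g" x] ev_tr[of "Cod E h" y] gh xy by auto
  have "tr (Cod E g) x \<cdot> g = tr (Cod E h) y \<cdot> h"
    by (rule ev_eqI[of "Cod E y"]) (use gh xy c in \<open>simp_all add: comp_eq_ext[OF tx] comp_eq_ext[OF ty]\<close>)
  then have C: "copair g h (tr (Cod E g) x) (tr (Cod E h) y) \<in> Ar E"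
    "Dom E (copair g h (tr (Cod E g) x) (tr (Cod E h) y)) = Cod E (po1 ch g h)"
    "Cod E (copair g h (tr (Cod E g) x) (tr (Cod E h) y)) = path (Cod E y)"
    "copair g h (tr (Cod E g) x) (tr (Cod E h) y) \<cdot> po1 ch g h = tr (Cod E g) x"
    "copair g h (tr (Cod E g) x) (tr (Cod E h) y) \<cdot> po2 ch g h = tr (Cod E h) y"
    using copair[of g h "tr (Cod E g) x" "tr (Cod E h) y"] gh xy by simp_all
  have i: "FA I (copair g h (tr (Cod E g) x) (tr (Cod E h) y)) \<cdot> FA I (po1 ch g h) = FA I (tr (Cod E g) x)"
    "FA I (copair g h (tr (Cod E g) x) (tr (Cod E h) y)) \<cdot> FA I (po2 ch g h) = FA I (tr (Cod E h) y)"
    using C gh xy by (simp_all flip: I_simps(5))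
  show "cyl_copair g h x y \<in> Ar E" "Dom E (cyl_copair g h x y) = FO I (Cod E (po1 ch g h))" "Cod E (cyl_copair g h x y) = Cod E y"
    "cyl_copair g h x y \<cdot> FA I (po1 ch g h) = x" "cyl_copair g h x y \<cdot> FA I (po2 ch g h) = y"
    using C(1-3) i tx ty gh xy by (simp_all add: cyl_copair_def)
qed

lemma cyl_po_eqI:
  assumes gh: "g \<in> Ar E" "h \<in> Ar E" "Dom E g = Dom E h" and w: "w \<in> Ar E" "w' \<in> Ar E" "Dom E w = FO I (Cod E (po1 ch g h))" "Dom E w' = FO I (Cod E (po1 ch g h))"
    "Cod E w = Cod E w'" and e: "w \<cdot> FA I (po1 ch g h) = w' \<cdot> FA I (po1 ch g h)" "w \<cdot> FA I (po2 ch g h) = w' \<cdot> FA I (po2 ch g h)"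
  shows "w = w'"
proof -
  let ?P = "Cod E (po1 ch g h)"
  have P: "?P \<in> Ob E" using gh by simp
  have t: "ev (Cod E w') \<cdot> FA I (tr ?P w) = w" "ev (Cod E w') \<cdot> FA I (tr ?P w') = w'"
    using ev_tr[of ?P w] ev_tr[of ?P w'] w P by auto
  have "tr ?P w = tr ?P w'"
  proof (rule po_eqI[OF gh])
    show "tr ?P w \<cdot> po1 ch g h = tr ?P w' \<cdot> po1 ch g h"
      by (rule ev_eqI[of "Cod E w'"]) (use gh w P e in \<open>simp_all add: comp_eq_ext[OF t(1)] comp_eq_ext[OF t(2)]\<close>)
    show "tr ?P w \<cdot> po2 ch g h = tr ?P w' \<cdot> po2 ch g h"
      by (rule ev_eqI[of "Cod E w'"]) (use gh w P e in \<open>simp_all add: comp_eq_ext[OF t(1)] comp_eq_ext[OF t(2)]\<close>)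
  qed (use w P in simp_all)
  then show ?thesis using t by metis
qed

subsection \<open>The Leibniz product with an endpoint\<close>

text \<open>\<open>lp\<close> and \<open>lq\<close> are the injections of \<open>I \<otimes> A\<close> and \<open>B\<close> into the domain of the Leibniz product of the
  endpoint \<open>k\<close> with \<open>f : A \<rightarrow> B\<close>.\<close>

abbreviation "lei k \<equiv> leibniz E ch I (\<delta> k)"
abbreviation "lp k f \<equiv> po1 ch (\<delta> k (Dom E f)) f"
abbreviation "lq k f \<equiv> po2 ch (\<delta> k (Dom E f)) f"

lemma leibniz_FO: "FO (lei k) f = copair (\<delta> k (Dom E f)) f (FA I f) (\<delta> k (Cod E f))" if "f \<in> Ar E"
  using that by (simp add: leibniz_def copair_def Let_def)

lemma leibniz:
  assumes "k < 2" "f \<in> Ar E"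
  shows "FO (lei k) f \<in> Ar E" "Dom E (FO (lei k) f) = Cod E (lp k f)" "Cod E (FO (lei k) f) = FO I (Cod E f)"
    "FO (lei k) f \<cdot> lp k f = FA I f" "FO (lei k) f \<cdot> lq k f = \<delta> k (Cod E f)"
  using assms copair[of "\<delta> k (Dom E f)" f "FA I f" "\<delta> k (Cod E f)"] \<delta>_natural[OF assms] by (simp_all add: leibniz_FO)

definition leibniz_top :: "nat \<Rightarrow> 'a \<Rightarrow> 'a \<Rightarrow> 'a \<Rightarrow> 'a \<Rightarrow> 'a" where
  "leibniz_top k f s t g = copair (\<delta> k (Dom E f)) f (lp k g \<cdot> FA I s) (lq k g \<cdot> t)"

lemma leibniz_top:
  assumes k: "k < 2" and q: "is_square E f s t g"
  shows "leibniz_top k f s t g \<in> Ar E" "Dom E (leibniz_top k f s t g) = Cod E (lp k f)" "Cod E (leibniz_top k f s t g) = Cod E (lp k g)"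
    "leibniz_top k f s t g \<cdot> lp k f = lp k g \<cdot> FA I s" "leibniz_top k f s t g \<cdot> lq k f = lq k g \<cdot> t"
    and leibniz_FA: "FA (lei k) (f, (s, t), g) = (FO (lei k) f, (leibniz_top k f s t g, FA I t), FO (lei k) g)"
    and leibniz_square: "is_square E (FO (lei k) f) (leibniz_top k f s t g) (FA I t) (FO (lei k) g)"
proof -
  note D = is_square_D[OF q]
  have "(lp k g \<cdot> FA I s) \<cdot> \<delta> k (Dom E f) = lp k g \<cdot> \<delta> k (Dom E g) \<cdot> s"
    using D k \<delta>_natural[OF k D(3)] by simp
  also have "\<dots> = lq k g \<cdot> g \<cdot> s" using D(1-8) k po_comm[of "\<delta> k (Dom E g)" g] by (simp add: comp_sq[OF po_comm])
  also have "\<dots> = (lq k g \<cdot> t) \<cdot> f" using D k by simp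
  finally have e: "(lp k g \<cdot> FA I s) \<cdot> \<delta> k (Dom E f) = (lq k g \<cdot> t) \<cdot> f" .
  note C = copair[OF _ _ _ _ _ _ _ _ e, folded leibniz_top_def]
  show T: "leibniz_top k f s t g \<in> Ar E" "Dom E (leibniz_top k f s t g) = Cod E (lp k f)" "Cod E (leibniz_top k f s t g) = Cod E (lp k g)"
    "leibniz_top k f s t g \<cdot> lp k f = lp k g \<cdot> FA I s" "leibniz_top k f s t g \<cdot> lq k f = lq k g \<cdot> t"
    using C D k by simp_all
  have "Cod E (lp k g \<cdot> FA I s) = Cod E (lp k g)" using D k by simp
  then show "FA (lei k) (f, (s, t), g) = (FO (lei k) f, (leibniz_top k f s t g, FA I t), FO (lei k) g)"
    using leibniz_FO[OF D(1)] leibniz_FO[OF D(2)] by (simp add: leibniz_def Let_def leibniz_top_def copair_def)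
  note L = leibniz[OF k D(1)] leibniz[OF k D(2)]
  show "is_square E (FO (lei k) f) (leibniz_top k f s t g) (FA I t) (FO (lei k) g)"
  proof (rule is_squareI)
    show "FO (lei k) g \<cdot> leibniz_top k f s t g = FA I t \<cdot> FO (lei k) f"
    proof (rule po_eqI[of "\<delta> k (Dom E f)" f])
      have "FA I g \<cdot> FA I s = FA I t \<cdot> FA I f" using D by (simp flip: I_simps(5))
      then show "(FO (lei k) g \<cdot> leibniz_top k f s t g) \<cdot> lp k f = (FA I t \<cdot> FO (lei k) f) \<cdot> lp k f"
        using T L D(1-8) k by (simp add: comp_eq_ext[OF L(9)])
      show "(FO (lei k) g \<cdot> leibniz_top k f s t g) \<cdot> lq k f = (FA I t \<cdot> FO (lei k) f) \<cdot> lq k f"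
        using T L D(1-8) k \<delta>_natural[OF k D(4)] by (simp add: comp_eq_ext[OF L(10)])
    qed (use T L D(1-8) k in simp_all)
  qed (use T L D(1-8) k in simp_all)
qed

end

section \<open>Filling against Leibniz products of cofibrations\<close>

lemma sum_cat_simps [simp]:
  "Inl i \<in> Ob (sum_cat C D) \<longleftrightarrow> i \<in> Ob C" "Inr j \<in> Ob (sum_cat C D) \<longleftrightarrow> j \<in> Ob D"
  "Inl f \<in> Ar (sum_cat C D) \<longleftrightarrow> f \<in> Ar C" "Inr g \<in> Ar (sum_cat C D) \<longleftrightarrow> g \<in> Ar D"
  "Dom (sum_cat C D) (Inl f) = Inl (Dom C f)" "Dom (sum_cat C D) (Inr g) = Inr (Dom D g)"
  "Cod (sum_cat C D) (Inl f) = Inl (Cod C f)" "Cod (sum_cat C D) (Inr g) = Inr (Cod D g)"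
  "Id (sum_cat C D) (Inl i) = Inl (Id C i)" "Id (sum_cat C D) (Inr j) = Inr (Id D j)"
  "Comp (sum_cat C D) (Inl f') (Inl f) = Inl (f' \<cdot>\<^bsub>C\<^esub> f)" "Comp (sum_cat C D) (Inr g') (Inr g) = Inr (g' \<cdot>\<^bsub>D\<^esub> g)"
  by (auto simp: sum_cat_def)

lemma sum_cat_hom:
  "w \<in> hom (sum_cat C D) x y \<longleftrightarrow>
    (\<exists>f X Y. w = Inl f \<and> x = Inl X \<and> y = Inl Y \<and> f \<in> hom C X Y) \<or>
    (\<exists>g X Y. w = Inr g \<and> x = Inr X \<and> y = Inr Y \<and> g \<in> hom D X Y)"
  by (cases w) (auto simp: hom_def)

lemma category_sum_cat:
  assumes "category C" "category D"
  shows "category (sum_cat C D)"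
proof -
  interpret C: category C by fact
  interpret D: category D by fact
  show ?thesis
  proof
    fix X assume "X \<in> Ob (sum_cat C D)"
    then show "Id (sum_cat C D) X \<in> hom (sum_cat C D) X X"
      by (cases X) (auto simp: sum_cat_hom C.Id_hom D.Id_hom)
  next
    fix f assume "f \<in> Ar (sum_cat C D)"
    then show "Dom (sum_cat C D) f \<in> Ob (sum_cat C D)" "Cod (sum_cat C D) f \<in> Ob (sum_cat C D)"
      by (cases f; simp)+
  qed (auto simp: sum_cat_hom intro: C.Comp_hom D.Comp_hom C.Comp_assoc D.Comp_assoc C.Id_left D.Id_left C.Id_right D.Id_right)
qed

lemma fcopair_simps [simp]:
  "FO (fcopair F G) (Inl i) = FO F i" "FO (fcopair F G) (Inr j) = FO G j"
  "FA (fcopair F G) (Inl f) = FA F f" "FA (fcopair F G) (Inr g) = FA G g"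
  by (auto simp: fcopair_def)

lemma functor_copair:
  assumes F: "is_functor C Z F" and G: "is_functor D Z G"
  shows "is_functor (sum_cat C D) Z (fcopair F G)"
  unfolding is_functor_def
proof (intro conjI ballI impI)
  show "FO (fcopair F G) X \<in> Ob Z" if "X \<in> Ob (sum_cat C D)" for X
    using that F G by (cases X) (auto simp: is_functor_def)
  show "FA (fcopair F G) f \<in> hom Z (FO (fcopair F G) (Dom (sum_cat C D) f)) (FO (fcopair F G) (Cod (sum_cat C D) f))"
    if "f \<in> Ar (sum_cat C D)" for f
    using that F G by (cases f) (auto simp: is_functor_def)
  show "FA (fcopair F G) (Id (sum_cat C D) X) = Id Z (FO (fcopair F G) X)" if "X \<in> Ob (sum_cat C D)" for X
    using that F G by (cases X) (auto simp: is_functor_def)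
  show "FA (fcopair F G) (g \<cdot>\<^bsub>sum_cat C D\<^esub> f) = FA (fcopair F G) g \<cdot>\<^bsub>Z\<^esub> FA (fcopair F G) f"
    if "f \<in> Ar (sum_cat C D)" "g \<in> Ar (sum_cat C D)" "Cod (sum_cat C D) f = Dom (sum_cat C D) g" for f g
    using that F G by (cases f; cases g) (auto simp: is_functor_def)
qed

lemma (in cylinder) leibniz_functor:
  assumes k: "k < 2"
  shows "is_functor (arrow_cat E) (arrow_cat E) (lei k)"
  unfolding is_functor_def
proof (intro conjI ballI impI)
  show "FO (lei k) f \<in> Ob (arrow_cat E)" if "f \<in> Ob (arrow_cat E)" for f
    using that leibniz(1)[OF k] by simp
  show "FA (lei k) w \<in> hom (arrow_cat E) (FO (lei k) (Dom (arrow_cat E) w)) (FO (lei k) (Cod (arrow_cat E) w))"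
    if "w \<in> Ar (arrow_cat E)" for w
  proof -
    obtain f s t g where w: "w = (f, (s, t), g)" by (cases w) auto
    with that have q: "is_square E f s t g" by simp
    show ?thesis using leibniz_square[OF k q] leibniz_FA[OF k q] unfolding w by (simp add: arrow_cat_hom)
  qed
  show "FA (lei k) (Id (arrow_cat E) f) = Id (arrow_cat E) (FO (lei k) f)" if "f \<in> Ob (arrow_cat E)" for f
  proof -
    have f: "f \<in> Ar E" using that by simp
    have "leibniz_top k f (Id E (Dom E f)) (Id E (Cod E f)) f = Id E (Cod E (lp k f))"
      unfolding leibniz_top_def by (rule copair_unique) (use f k in simp_all)
    then show ?thesis using leibniz_FA[OF k square_id[OF f]] leibniz[OF k f] f by simp
  qed
  show "FA (lei k) (w' \<cdot>\<^bsub>arrow_cat E\<^esub> w) = FA (lei k) w' \<cdot>\<^bsub>arrow_cat E\<^esub> FA (lei k) w"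
    if w: "w \<in> Ar (arrow_cat E)" "w' \<in> Ar (arrow_cat E)" "Cod (arrow_cat E) w = Dom (arrow_cat E) w'" for w w'
  proof -
    obtain f s t g where e: "w = (f, (s, t), g)" by (cases w) auto
    with w(1) have q: "is_square E f s t g" by simp
    obtain s' t' h where e': "w' = (g, (s', t'), h)" using w(3) e by (cases w') auto
    with w(2) have q': "is_square E g s' t' h" by simp
    note D = is_square_D(1-8)[OF q] is_square_D(1-8)[OF q']
    note T = leibniz_top[OF k q] leibniz_top[OF k q']
    have "leibniz_top k f (s' \<cdot> s) (t' \<cdot> t) h = leibniz_top k g s' t' h \<cdot> leibniz_top k f s t g"
      unfolding leibniz_top_def[of k f "s' \<cdot> s"]
      by (rule copair_unique) (use T D k in \<open>simp_all add: comp_sq[OF T(11)] comp_sq[OF T(12)]\<close>)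
    then show ?thesis
      using leibniz_FA[OF k q] leibniz_FA[OF k q'] leibniz_FA[OF k square_comp[OF q q']] D unfolding e e' by simp
  qed
qed

text \<open>The summand of \<open>\<I>\<^sub>\<otimes>\<close> that belongs to the endpoint \<open>k\<close>.\<close>

definition inj_at :: "nat \<Rightarrow> 'x \<Rightarrow> 'x + 'x" where
  "inj_at k = (if k = 0 then Inl else Inr)"

text \<open>A category of cofibrations, given by its objects \<open>Cof\<close> and its arrows \<open>cmor\<close>, with natural fillers
  against the right \<open>J\<close>-maps.\<close>

locale cof_lifting = cylinder E ch I \<delta>
  for E :: "('o, 'a) cat" (structure) and ch :: "('o, 'a) chosen" and I :: "('o, 'a, 'o, 'a) fctr" and \<delta> :: "nat \<Rightarrow> 'o \<Rightarrow> 'a" +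
  fixes J :: "('i, 'j) cat" and u :: "('i, 'j, 'a, 'a square) fctr"
    and Cof :: "('a \<times> 's) set" and cmor :: "'a \<times> 's \<Rightarrow> 'a \<Rightarrow> 'a \<Rightarrow> 'a \<times> 's \<Rightarrow> bool"
    and cfill :: "'a \<times> 's \<Rightarrow> ('a, 'i) lifting_map \<Rightarrow> 'a \<Rightarrow> 'a \<Rightarrow> 'a"
  assumes J: "category J" and u: "is_functor J (arrow_cat E) u"
    and Cof_Ar: "c \<in> Cof \<Longrightarrow> fst c \<in> Ar E"
    and cmor_D: "cmor c a b c' \<Longrightarrow> c \<in> Cof \<and> c' \<in> Cof \<and> is_square E (fst c) a b (fst c')"
    and cfill: "\<lbrakk>c \<in> Cof; Y \<in> Ob (right_maps E J u); is_square E (fst c) s t (fst Y)\<rbrakk>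
      \<Longrightarrow> fills E (fst c) s t (fst Y) (cfill c Y s t)"
    and cfill_natural: "\<lbrakk>cmor c' a b c; right_mor E J u Y m n Y'; is_square E (fst c) s t (fst Y)\<rbrakk>
      \<Longrightarrow> m \<cdot> cfill c Y s t \<cdot> b = cfill c' Y' (m \<cdot> s \<cdot> a) (n \<cdot> t \<cdot> b)"
begin

abbreviation "JJ \<equiv> sum_cat J J"
abbreviation "gens \<equiv> tensor_gen E ch I \<delta> u"

lemma gens_FO: "k < 2 \<Longrightarrow> FO gens (inj_at k i) = FO (lei k) (FO u i)"
  and gens_FA: "k < 2 \<Longrightarrow> FA gens (inj_at k \<sigma>) = FA (lei k) (FA u \<sigma>)"
  by (auto simp: tensor_gen_def inj_at_def less_2_cases_iff)

lemma JJ_inj [simp]: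
  "inj_at k i \<in> Ob JJ \<longleftrightarrow> i \<in> Ob J" "inj_at k \<sigma> \<in> Ar JJ \<longleftrightarrow> \<sigma> \<in> Ar J"
  "Dom JJ (inj_at k \<sigma>) = inj_at k (Dom J \<sigma>)" "Cod JJ (inj_at k \<sigma>) = inj_at k (Cod J \<sigma>)"
  by (auto simp: inj_at_def)

sublocale pb_right E "pb1 ch" "pb2 ch" JJ gens
proof (intro pb_right.intro pb_right_axioms.intro pb_category_axioms)
  show "category JJ" using category_sum_cat[OF J J] .
  show "is_functor JJ (arrow_cat E) gens"
    unfolding tensor_gen_def
    by (intro functor_copair functor_comp[OF u] leibniz_functor) auto
qed

lemma u_Ar: "i \<in> Ob J \<Longrightarrow> FO u i \<in> Ar E"
  using u by (auto simp: is_functor_def)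

text \<open>The domain of \<open>lei k f\<close> is a pushout, so a square from \<open>lei k f\<close> to \<open>r\<close> amounts to three maps: \<open>\<alpha>\<close> on
  \<open>I \<otimes> A\<close> and \<open>\<beta>\<close> on \<open>B\<close> for its top side, and the bottom side \<open>y\<close>. In this form, squares can be handled
  without reference to the pushout.\<close>

definition cyl_square :: "nat \<Rightarrow> 'a \<Rightarrow> 'a \<Rightarrow> 'a \<Rightarrow> 'a \<Rightarrow> 'a \<Rightarrow> bool" where
  "cyl_square k f \<alpha> \<beta> y r \<longleftrightarrow> k < 2 \<and> f \<in> Ar E \<and> r \<in> Ar E \<and>
     \<alpha> \<in> Ar E \<and> Dom E \<alpha> = FO I (Dom E f) \<and> Cod E \<alpha> = Dom E r \<and>
     \<beta> \<in> Ar E \<and> Dom E \<beta> = Cod E f \<and> Cod E \<beta> = Dom E r \<and>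
     y \<in> Ar E \<and> Dom E y = FO I (Cod E f) \<and> Cod E y = Cod E r \<and>
     \<alpha> \<cdot> \<delta> k (Dom E f) = \<beta> \<cdot> f \<and> r \<cdot> \<alpha> = y \<cdot> FA I f \<and> r \<cdot> \<beta> = y \<cdot> \<delta> k (Cod E f)"

definition cyl_fills :: "nat \<Rightarrow> 'a \<Rightarrow> 'a \<Rightarrow> 'a \<Rightarrow> 'a \<Rightarrow> 'a \<Rightarrow> 'a \<Rightarrow> bool" where
  "cyl_fills k f \<alpha> \<beta> y r \<theta> \<longleftrightarrow> \<theta> \<in> Ar E \<and> Dom E \<theta> = FO I (Cod E f) \<and> Cod E \<theta> = Dom E r \<and>
     \<theta> \<cdot> FA I f = \<alpha> \<and> \<theta> \<cdot> \<delta> k (Cod E f) = \<beta> \<and> r \<cdot> \<theta> = y"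

lemma cyl_square_D:
  assumes "cyl_square k f \<alpha> \<beta> y r"
  shows "k < 2" "f \<in> Ar E" "r \<in> Ar E" "\<alpha> \<in> Ar E" "Dom E \<alpha> = FO I (Dom E f)" "Cod E \<alpha> = Dom E r"
    "\<beta> \<in> Ar E" "Dom E \<beta> = Cod E f" "Cod E \<beta> = Dom E r" "y \<in> Ar E" "Dom E y = FO I (Cod E f)" "Cod E y = Cod E r"
    "\<alpha> \<cdot> \<delta> k (Dom E f) = \<beta> \<cdot> f" "r \<cdot> \<alpha> = y \<cdot> FA I f" "r \<cdot> \<beta> = y \<cdot> \<delta> k (Cod E f)"
  using assms by (auto simp: cyl_square_def)

lemma cyl_fills_D:
  assumes "cyl_fills k f \<alpha> \<beta> y r \<theta>"
  shows "\<theta> \<in> Ar E" "Dom E \<theta> = FO I (Cod E f)" "Cod E \<theta> = Dom E r" "\<theta> \<cdot> FA I f = \<alpha>" "\<theta> \<cdot> \<delta> k (Cod E f) = \<beta>" "r \<cdot> \<theta> = y"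
  using assms by (auto simp: cyl_fills_def)

definition gen_fill :: "nat \<Rightarrow> 'i \<Rightarrow> ('a, 'i + 'i) lifting_map \<Rightarrow> 'a \<Rightarrow> 'a \<Rightarrow> 'a \<Rightarrow> 'a" where
  "gen_fill k i X \<alpha> \<beta> y = snd X (inj_at k i) (copair (\<delta> k (Dom E (FO u i))) (FO u i) \<alpha> \<beta>) y"

lemma cyl_square_copair:
  assumes "cyl_square k f \<alpha> \<beta> y r"
  shows "is_square E (FO (lei k) f) (copair (\<delta> k (Dom E f)) f \<alpha> \<beta>) y r"
proof -
  note C = cyl_square_D[OF assms] and L = leibniz[OF cyl_square_D(1,2)[OF assms]]
  note P = copair[of "\<delta> k (Dom E f)" f \<alpha> \<beta>]
  have P': "copair (\<delta> k (Dom E f)) f \<alpha> \<beta> \<in> Ar E" "Dom E (copair (\<delta> k (Dom E f)) f \<alpha> \<beta>) = Cod E (lp k f)"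
    "Cod E (copair (\<delta> k (Dom E f)) f \<alpha> \<beta>) = Dom E r"
    "copair (\<delta> k (Dom E f)) f \<alpha> \<beta> \<cdot> lp k f = \<alpha>" "copair (\<delta> k (Dom E f)) f \<alpha> \<beta> \<cdot> lq k f = \<beta>"
    using P C by simp_all
  show ?thesis
  proof (rule is_squareI)
    show "r \<cdot> copair (\<delta> k (Dom E f)) f \<alpha> \<beta> = y \<cdot> FO (lei k) f"
      by (rule po_eqI[of "\<delta> k (Dom E f)" f]) (use C P' L in simp_all)
  qed (use C P' L in simp_all)
qed

lemma gen_fill:
  assumes X: "X \<in> RM" and i: "i \<in> Ob J" and c: "cyl_square k (FO u i) \<alpha> \<beta> y (fst X)"
  shows "cyl_fills k (FO u i) \<alpha> \<beta> y (fst X) (gen_fill k i X \<alpha> \<beta> y)"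
proof -
  note C = cyl_square_D[OF c] and L = leibniz[OF cyl_square_D(1,2)[OF c]]
  let ?w = "copair (\<delta> k (Dom E (FO u i))) (FO u i) \<alpha> \<beta>"
  have P: "?w \<in> Ar E" "Dom E ?w = Cod E (lp k (FO u i))" "?w \<cdot> lp k (FO u i) = \<alpha>" "?w \<cdot> lq k (FO u i) = \<beta>"
    using copair[of "\<delta> k (Dom E (FO u i))" "FO u i" \<alpha> \<beta>] C by simp_all
  have "fills E (FO (lei k) (FO u i)) ?w y (fst X) (gen_fill k i X \<alpha> \<beta> y)"
    using right_map_fills[OF X, of "inj_at k i" ?w y] i cyl_square_copair[OF c] C(1) by (simp add: gen_fill_def gens_FO)
  note F = fills_D[OF this]
  have "gen_fill k i X \<alpha> \<beta> y \<cdot> FA I (FO u i) = gen_fill k i X \<alpha> \<beta> y \<cdot> FO (lei k) (FO u i) \<cdot> lp k (FO u i)" using L(4) by simp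
  also have "\<dots> = ?w \<cdot> lp k (FO u i)" using F L(1-3) C(1-12) by (simp add: comp_eq_ext[OF F(4)])
  finally have 1: "gen_fill k i X \<alpha> \<beta> y \<cdot> FA I (FO u i) = \<alpha>" using P by simp
  have "gen_fill k i X \<alpha> \<beta> y \<cdot> \<delta> k (Cod E (FO u i)) = gen_fill k i X \<alpha> \<beta> y \<cdot> FO (lei k) (FO u i) \<cdot> lq k (FO u i)" using L(5) by simp
  also have "\<dots> = ?w \<cdot> lq k (FO u i)" using F L(1-3) C(1-12) by (simp add: comp_eq_ext[OF F(4)])
  finally have 2: "gen_fill k i X \<alpha> \<beta> y \<cdot> \<delta> k (Cod E (FO u i)) = \<beta>" using P by simp
  show ?thesis using F L(3) 1 2 by (simp add: cyl_fills_def)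
qed

lemma gen_fill_natural:
  assumes X: "X \<in> RM" and s: "\<sigma> \<in> Ar J" and c: "cyl_square k (FO u (Cod J \<sigma>)) \<alpha> \<beta> y (fst X)"
  shows "gen_fill k (Cod J \<sigma>) X \<alpha> \<beta> y \<cdot> FA I (bot_of (FA u \<sigma>)) =
    gen_fill k (Dom J \<sigma>) X (\<alpha> \<cdot> FA I (top_of (FA u \<sigma>))) (\<beta> \<cdot> bot_of (FA u \<sigma>)) (y \<cdot> FA I (bot_of (FA u \<sigma>)))"
proof -
  note V = functor_square[OF u s]
  note C = cyl_square_D[OF c] and D = is_square_D[OF V(1)]
  let ?w = "copair (\<delta> k (Dom E (FO u (Cod J \<sigma>)))) (FO u (Cod J \<sigma>)) \<alpha> \<beta>"
  let ?h = "leibniz_top k (FO u (Dom J \<sigma>)) (top_of (FA u \<sigma>)) (bot_of (FA u \<sigma>)) (FO u (Cod J \<sigma>))"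
  have P: "?w \<in> Ar E" "Dom E ?w = Cod E (lp k (FO u (Cod J \<sigma>)))" "?w \<cdot> lp k (FO u (Cod J \<sigma>)) = \<alpha>" "?w \<cdot> lq k (FO u (Cod J \<sigma>)) = \<beta>"
    using copair[of "\<delta> k (Dom E (FO u (Cod J \<sigma>)))" "FO u (Cod J \<sigma>)" \<alpha> \<beta>] C by simp_all
  note T = leibniz_top[OF C(1) V(1)]
  have FA: "FA gens (inj_at k \<sigma>) = (FO (lei k) (FO u (Dom J \<sigma>)), (?h, FA I (bot_of (FA u \<sigma>))), FO (lei k) (FO u (Cod J \<sigma>)))"
    using leibniz_FA[OF C(1) V(1)] V(2) gens_FA[OF C(1)] by simp
  have "copair (\<delta> k (Dom E (FO u (Dom J \<sigma>)))) (FO u (Dom J \<sigma>)) (\<alpha> \<cdot> FA I (top_of (FA u \<sigma>))) (\<beta> \<cdot> bot_of (FA u \<sigma>)) = ?w \<cdot> ?h"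
    by (rule copair_unique) (use T P C D in \<open>simp_all add: comp_eq_ext[OF P(3)] comp_eq_ext[OF P(4)]\<close>)
  then show ?thesis
    using right_map_natural[OF X, of "inj_at k \<sigma>" ?w y] s cyl_square_copair[OF c] C(1) FA
    by (simp add: gen_fill_def gens_FO)
qed

lemma gen_fill_mor:
  assumes X: "rmor X m n X'" and i: "i \<in> Ob J" and c: "cyl_square k (FO u i) \<alpha> \<beta> y (fst X)"
  shows "m \<cdot> gen_fill k i X \<alpha> \<beta> y = gen_fill k i X' (m \<cdot> \<alpha>) (m \<cdot> \<beta>) (n \<cdot> y)"
proof -
  note C = cyl_square_D[OF c] and D = is_square_D[OF right_mor_D(3)[OF X]]
  have "m \<cdot> copair (\<delta> k (Dom E (FO u i))) (FO u i) \<alpha> \<beta> = copair (\<delta> k (Dom E (FO u i))) (FO u i) (m \<cdot> \<alpha>) (m \<cdot> \<beta>)"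
    by (rule comp_copair) (use C D in simp_all)
  then show ?thesis
    using right_mor_fill[OF X, of "inj_at k i" "copair (\<delta> k (Dom E (FO u i))) (FO u i) \<alpha> \<beta>" y] i cyl_square_copair[OF c] C(1)
    by (simp add: gen_fill_def gens_FO)
qed

subsection \<open>The pullback exponential of a right map\<close>

text \<open>The pullback exponential of \<open>r : Z \<rightarrow> W\<close> with the endpoint \<open>k\<close>: the map from the paths in \<open>Z\<close> to the pairs
  of a path in \<open>W\<close> and a point of \<open>Z\<close> over its endpoint \<open>k\<close>.\<close>

definition exp_bot :: "nat \<Rightarrow> 'a \<Rightarrow> 'a" where
  "exp_bot k r = pair (endpoint k (Cod E r)) r (path_map r) (endpoint k (Dom E r))"

abbreviation "xb1 k r \<equiv> pb1 ch (endpoint k (Cod E r)) r"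
abbreviation "xb2 k r \<equiv> pb2 ch (endpoint k (Cod E r)) r"

lemma exp_bot:
  assumes "k < 2" "r \<in> Ar E"
  shows "exp_bot k r \<in> Ar E" "Dom E (exp_bot k r) = path (Dom E r)" "Cod E (exp_bot k r) = Dom E (xb1 k r)"
    "xb1 k r \<cdot> exp_bot k r = path_map r" "xb2 k r \<cdot> exp_bot k r = endpoint k (Dom E r)"
  using pair[of "endpoint k (Cod E r)" r "path_map r" "endpoint k (Dom E r)"] endpoint_natural[OF assms] assms
  by (simp_all add: exp_bot_def)

text \<open>The next two lemmas are the two directions of the adjunction between Leibniz product and
  pullback exponential.\<close>

lemma exp_square_cyl:
  assumes k: "k < 2" and r: "r \<in> Ar E" and q: "is_square E f s t (exp_bot k r)"
  shows "cyl_square k f (ev (Dom E r) \<cdot> FA I s) (xb2 k r \<cdot> t) (ev (Cod E r) \<cdot> FA I (xb1 k r \<cdot> t)) r"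
proof -
  note D = is_square_D[OF q] and B = exp_bot[OF k r]
  have "(ev (Dom E r) \<cdot> FA I s) \<cdot> \<delta> k (Dom E f) = endpoint k (Dom E r) \<cdot> s"
    using endpoint_comp[OF k, of "Dom E r" s] D B k r by simp
  also have "\<dots> = xb2 k r \<cdot> t \<cdot> f" using D B k r comp_eq_ext[OF B(5), of s] by simp
  finally have 1: "(ev (Dom E r) \<cdot> FA I s) \<cdot> \<delta> k (Dom E f) = (xb2 k r \<cdot> t) \<cdot> f" using D B k r by simp
  have "path_map r \<cdot> s = xb1 k r \<cdot> t \<cdot> f" using D B k r comp_eq_ext[OF B(4), of s] by simp
  then have "FA I (path_map r) \<cdot> FA I s = FA I (xb1 k r \<cdot> t) \<cdot> FA I f"
    using D B k r by (simp flip: I_simps(5))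
  then have 2: "r \<cdot> ev (Dom E r) \<cdot> FA I s = (ev (Cod E r) \<cdot> FA I (xb1 k r \<cdot> t)) \<cdot> FA I f"
    using D B k r ev_path_map_ext[OF r, of "FA I s"] by simp
  have 3: "r \<cdot> xb2 k r \<cdot> t = (ev (Cod E r) \<cdot> FA I (xb1 k r \<cdot> t)) \<cdot> \<delta> k (Cod E f)"
    using D B k r endpoint_comp[OF k, of "Cod E r" "xb1 k r \<cdot> t"] by (simp add: pb_comm_ext)
  show ?thesis using 1 2 3 D(1-8) B k r by (simp add: cyl_square_def)
qed

lemma cyl_square_exp:
  assumes c: "cyl_square k f \<alpha> \<beta> y r"
  shows "is_square E f (tr (Dom E f) \<alpha>) (pair (endpoint k (Cod E r)) r (tr (Cod E f) y) \<beta>) (exp_bot k r)"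
    and "xb1 k r \<cdot> pair (endpoint k (Cod E r)) r (tr (Cod E f) y) \<beta> = tr (Cod E f) y"
    and "xb2 k r \<cdot> pair (endpoint k (Cod E r)) r (tr (Cod E f) y) \<beta> = \<beta>"
proof -
  note C = cyl_square_D[OF c]
  note B = exp_bot[OF C(1) C(3)]
  have ta: "ev (Dom E r) \<cdot> FA I (tr (Dom E f) \<alpha>) = \<alpha>" and ty: "ev (Cod E r) \<cdot> FA I (tr (Cod E f) y) = y"
    using ev_tr[of "Dom E f" \<alpha>] ev_tr[of "Cod E f" y] C by simp_all
  have e: "endpoint k (Cod E r) \<cdot> tr (Cod E f) y = r \<cdot> \<beta>"
    using endpoint_comp[of k "Cod E r" "tr (Cod E f) y"] C comp_eq_ext[OF ty] by simp
  note P = pair[OF _ C(3) _ _ C(7) _ C(9) _ e]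
  have P': "pair (endpoint k (Cod E r)) r (tr (Cod E f) y) \<beta> \<in> Ar E"
    "Dom E (pair (endpoint k (Cod E r)) r (tr (Cod E f) y) \<beta>) = Cod E f"
    "Cod E (pair (endpoint k (Cod E r)) r (tr (Cod E f) y) \<beta>) = Dom E (xb1 k r)"
    and Pe: "xb1 k r \<cdot> pair (endpoint k (Cod E r)) r (tr (Cod E f) y) \<beta> = tr (Cod E f) y"
    "xb2 k r \<cdot> pair (endpoint k (Cod E r)) r (tr (Cod E f) y) \<beta> = \<beta>"
    using P C(1-12) by simp_all
  show "xb1 k r \<cdot> pair (endpoint k (Cod E r)) r (tr (Cod E f) y) \<beta> = tr (Cod E f) y"
    "xb2 k r \<cdot> pair (endpoint k (Cod E r)) r (tr (Cod E f) y) \<beta> = \<beta>" by fact+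
  show "is_square E f (tr (Dom E f) \<alpha>) (pair (endpoint k (Cod E r)) r (tr (Cod E f) y) \<beta>) (exp_bot k r)"
  proof (rule is_squareI)
    have 1: "path_map r \<cdot> tr (Dom E f) \<alpha> = tr (Cod E f) y \<cdot> f"
      by (rule ev_eqI[of "Cod E r"])
        (use C ta in \<open>simp_all add: ev_path_map_ext comp_eq_ext[OF ty]\<close>)
    have 2: "endpoint k (Dom E r) \<cdot> tr (Dom E f) \<alpha> = \<beta> \<cdot> f"
      using endpoint_comp[of k "Dom E r" "tr (Dom E f) \<alpha>"] C comp_eq_ext[OF ta] by simp
    show "exp_bot k r \<cdot> tr (Dom E f) \<alpha> = pair (endpoint k (Cod E r)) r (tr (Cod E f) y) \<beta> \<cdot> f"
      by (rule pb_eqI[of "endpoint k (Cod E r)" r])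
        (use C(1-12) B P' 1 2 in \<open>simp_all add: comp_eq_ext[OF B(4)] comp_eq_ext[OF B(5)] comp_eq_ext[OF Pe(1)] comp_eq_ext[OF Pe(2)]\<close>)
  qed (use C P' B in simp_all)
qed

text \<open>By the adjunction, a filler for \<open>u\<^sub>i\<close> against the exponential is the transpose of a filler for
  \<open>\<delta>\<^sup>k \<otimes> u\<^sub>i\<close>. So the exponential turns right maps for \<open>tensor_gen\<close> into right \<open>J\<close>-maps.\<close>

definition exp_fill :: "nat \<Rightarrow> ('a, 'i + 'i) lifting_map \<Rightarrow> 'i \<Rightarrow> 'a \<Rightarrow> 'a \<Rightarrow> 'a" where
  "exp_fill k X i s t = tr (Cod E (FO u i)) (gen_fill k i X (ev (Dom E (fst X)) \<cdot> FA I s) (xb2 k (fst X) \<cdot> t)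
     (ev (Cod E (fst X)) \<cdot> FA I (xb1 k (fst X) \<cdot> t)))"

definition exp_map :: "nat \<Rightarrow> ('a, 'i + 'i) lifting_map \<Rightarrow> ('a, 'i) lifting_map" where
  "exp_map k X = (exp_bot k (fst X), right_restr E J u (exp_bot k (fst X)) (exp_fill k X))"

lemma fst_exp_map [simp]: "fst (exp_map k X) = exp_bot k (fst X)"
  by (simp add: exp_map_def)

lemma exp_fill_ev:
  assumes k: "k < 2" and X: "X \<in> RM" and i: "i \<in> Ob J" and q: "is_square E (FO u i) s t (exp_bot k (fst X))"
  shows "exp_fill k X i s t \<in> Ar E" "Dom E (exp_fill k X i s t) = Cod E (FO u i)" "Cod E (exp_fill k X i s t) = path (Dom E (fst X))"
   "ev (Dom E (fst X)) \<cdot> FA I (exp_fill k X i s t) = gen_fill k i X (ev (Dom E (fst X)) \<cdot> FA I s) (xb2 k (fst X) \<cdot> t)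
     (ev (Cod E (fst X)) \<cdot> FA I (xb1 k (fst X) \<cdot> t))"
proof -
  note F = cyl_fills_D[OF gen_fill[OF X i exp_square_cyl[OF k right_map_Ar[OF X] q]]]
  show "exp_fill k X i s t \<in> Ar E" "Dom E (exp_fill k X i s t) = Cod E (FO u i)" "Cod E (exp_fill k X i s t) = path (Dom E (fst X))"
   "ev (Dom E (fst X)) \<cdot> FA I (exp_fill k X i s t) = gen_fill k i X (ev (Dom E (fst X)) \<cdot> FA I s) (xb2 k (fst X) \<cdot> t)
     (ev (Cod E (fst X)) \<cdot> FA I (xb1 k (fst X) \<cdot> t))"
    unfolding exp_fill_def using tr[OF _ F(1,2)] ev_tr[OF _ F(1,2)] F(3) u_Ar[OF i] by simp_all
qed

lemma exp_fill:
  assumes k: "k < 2" and X: "X \<in> RM" and i: "i \<in> Ob J" and q: "is_square E (FO u i) s t (exp_bot k (fst X))"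
  shows "fills E (FO u i) s t (exp_bot k (fst X)) (exp_fill k X i s t)"
proof (rule fillsI)
  let ?r = "fst X" and ?d = "exp_fill k X i s t"
  note r = right_map_Ar[OF X]
  note F = cyl_fills_D[OF gen_fill[OF X i exp_square_cyl[OF k r q]]]
  note D = is_square_D(1-8)[OF q] exp_bot(1-3)[OF k r] k r
  note e = exp_fill_ev[OF assms]
  note B = exp_bot(4,5)[OF k r]
  show "?d \<cdot> FO u i = s"
    by (rule ev_eqI[of "Dom E ?r"]) (use D e(1-3) F in \<open>simp_all add: comp_eq_ext[OF e(4)]\<close>)
  have 1: "path_map ?r \<cdot> ?d = xb1 k ?r \<cdot> t"
    by (rule ev_eqI[of "Cod E ?r"]) (use D e F(6) in \<open>simp_all add: ev_path_map_ext\<close>)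
  have 2: "endpoint k (Dom E ?r) \<cdot> ?d = xb2 k ?r \<cdot> t"
    using endpoint_comp[of k "Dom E ?r" ?d] D e(1-3) comp_eq_ext[OF e(4)] F by simp
  show "exp_bot k ?r \<cdot> ?d = t"
    by (rule pb_eqI[of "endpoint k (Cod E ?r)" ?r]) (use D e(1-3) 1 2 in \<open>simp_all add: comp_eq_ext[OF B(1)] comp_eq_ext[OF B(2)]\<close>)
qed (use exp_fill_ev[OF assms] exp_bot[OF k right_map_Ar[OF X]] in simp_all)

lemma exp_map:
  assumes k: "k < 2" and X: "X \<in> RM"
  shows "exp_map k X \<in> Ob (right_maps E J u)"
  unfolding exp_map_def
proof (rule right_map_restrI[OF J u])
  interpret J: category J by (fact J)
  show "exp_bot k (fst X) \<in> Ar E" using exp_bot(1)[OF k right_map_Ar[OF X]] .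
  show "fills E (FO u i) s t (exp_bot k (fst X)) (exp_fill k X i s t)"
    if "i \<in> Ob J" "is_square E (FO u i) s t (exp_bot k (fst X))" for i s t using exp_fill[OF k X that] .
  fix \<sigma> s t assume s: "\<sigma> \<in> Ar J" and q: "is_square E (FO u (Cod J \<sigma>)) s t (exp_bot k (fst X))"
  note V = functor_square(1)[OF u s]
  have o: "Cod J \<sigma> \<in> Ob J" "Dom J \<sigma> \<in> Ob J" using s by auto
  let ?r = "fst X"
  note r = right_map_Ar[OF X]
  note q' = square_comp[OF V q]
  note D = is_square_D(1-8)[OF q] is_square_D(1-8)[OF V] exp_bot(1-3)[OF k r] k r
  note e = exp_fill_ev[OF k X o(1) q] and e' = exp_fill_ev[OF k X o(2) q']
  show "exp_fill k X (Cod J \<sigma>) s t \<cdot> bot_of (FA u \<sigma>) = exp_fill k X (Dom J \<sigma>) (s \<cdot> top_of (FA u \<sigma>)) (t \<cdot> bot_of (FA u \<sigma>))"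
    by (rule ev_eqI[of "Dom E ?r"])
      (use D e(1-3) e' gen_fill_natural[OF X s exp_square_cyl[OF k r q]] in \<open>simp_all add: comp_eq_ext[OF e(4)]\<close>)
qed

definition exp_arr :: "nat \<Rightarrow> 'a \<Rightarrow> 'a \<Rightarrow> 'a \<Rightarrow> 'a \<Rightarrow> 'a" where
  "exp_arr k r m n r' = pb_arr (endpoint k (Cod E r)) r (path_map n) m (endpoint k (Cod E r')) r'"

lemma exp_arr:
  assumes k: "k < 2" and q: "is_square E r m n r'"
  shows "exp_arr k r m n r' \<in> Ar E" "Dom E (exp_arr k r m n r') = Dom E (xb1 k r)" "Cod E (exp_arr k r m n r') = Dom E (xb1 k r')"
    "xb1 k r' \<cdot> exp_arr k r m n r' = path_map n \<cdot> xb1 k r" "xb2 k r' \<cdot> exp_arr k r m n r' = m \<cdot> xb2 k r"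
    and exp_arr_square: "is_square E (exp_bot k r) (path_map m) (exp_arr k r m n r') (exp_bot k r')"
proof -
  note D = is_square_D[OF q]
  have w: "is_square E (endpoint k (Cod E r)) (path_map n) n (endpoint k (Cod E r'))"
    using D k endpoint_natural[OF k D(4)] by (intro is_squareI) simp_all
  have c: "Cod E (endpoint k (Cod E r)) = Cod E r" using D k by simp
  note P = pb_arr[OF w q c, folded exp_arr_def]
  show A: "exp_arr k r m n r' \<in> Ar E" "Dom E (exp_arr k r m n r') = Dom E (xb1 k r)" "Cod E (exp_arr k r m n r') = Dom E (xb1 k r')"
    "xb1 k r' \<cdot> exp_arr k r m n r' = path_map n \<cdot> xb1 k r" "xb2 k r' \<cdot> exp_arr k r m n r' = m \<cdot> xb2 k r"
    using P by simp_all
  note B = exp_bot[OF k D(1)] and B' = exp_bot[OF k D(2)]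
  show "is_square E (exp_bot k r) (path_map m) (exp_arr k r m n r') (exp_bot k r')"
  proof (rule is_squareI)
    have 1: "path_map r' \<cdot> path_map m = path_map n \<cdot> path_map r"
    proof (rule ev_eqI[of "Cod E r'"])
      have "ev (Cod E r') \<cdot> FA I (path_map r') \<cdot> FA I (path_map m) = r' \<cdot> m \<cdot> ev (Dom E r)"
        using D(1-8) ev_path_map_ext[OF D(2), of "FA I (path_map m)"] ev_path_map[OF D(3)] by simp
      also have "\<dots> = n \<cdot> r \<cdot> ev (Dom E r)" using D(1-8) by (simp add: comp_sq[OF D(9)])
      also have "\<dots> = ev (Cod E r') \<cdot> FA I (path_map n) \<cdot> FA I (path_map r)"
        using D(1-8) ev_path_map_ext[OF D(4), of "FA I (path_map r)"] ev_path_map[OF D(1)] by simp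
      finally show "ev (Cod E r') \<cdot> FA I (path_map r' \<cdot> path_map m) = ev (Cod E r') \<cdot> FA I (path_map n \<cdot> path_map r)"
        using D(1-8) by simp
    qed (use D in simp_all)
    have 2: "endpoint k (Dom E r') \<cdot> path_map m = m \<cdot> endpoint k (Dom E r)"
      using endpoint_natural[OF k D(3)] D by simp
    show "exp_bot k r' \<cdot> path_map m = exp_arr k r m n r' \<cdot> exp_bot k r"
      by (rule pb_eqI[of "endpoint k (Cod E r')" r'])
        (use D(1-8) k A(1-3) B B' 1 2 in \<open>simp_all add: comp_eq_ext[OF B'(4)] comp_eq_ext[OF B'(5)] comp_sq[OF A(4)] comp_sq[OF A(5)]\<close>)
  qed (use D A B B' in simp_all)
qed

lemma exp_mor:
  assumes k: "k < 2" and X: "rmor X m n X'"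
  shows "right_mor E J u (exp_map k X) (path_map m) (exp_arr k (fst X) m n (fst X')) (exp_map k X')"
  unfolding right_mor_def
proof (intro conjI ballI allI impI)
  let ?r = "fst X" and ?r' = "fst X'"
  let ?h = "exp_arr k (fst X) m n (fst X')"
  note Q = right_mor_D[OF X]
  note D = is_square_D(1-8)[OF Q(3)]
  show "exp_map k X \<in> Ob (right_maps E J u)" "exp_map k X' \<in> Ob (right_maps E J u)"
    using exp_map[OF k] Q by auto
  show sq: "is_square E (fst (exp_map k X)) (path_map m) ?h (fst (exp_map k X'))"
    using exp_arr_square[OF k Q(3)] by simp
  fix i s t assume i: "i \<in> Ob J" and q: "is_square E (FO u i) s t (fst (exp_map k X))"
  note q0 = q[unfolded fst_exp_map]
  note q' = square_comp[OF q0 exp_arr_square[OF k Q(3)]]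
  note e = exp_fill_ev[OF k Q(1) i q0] and e' = exp_fill_ev[OF k Q(2) i q']
  note A = exp_arr[OF k Q(3)] and S = is_square_D(1-8)[OF q0] exp_bot(1-3)[OF k D(1)] exp_bot(1-3)[OF k D(2)] k
  have "path_map m \<cdot> exp_fill k X i s t = exp_fill k X' i (path_map m \<cdot> s) (?h \<cdot> t)"
  proof (rule ev_eqI[of "Dom E ?r'"])
    have "ev (Dom E ?r') \<cdot> FA I (path_map m \<cdot> exp_fill k X i s t) = m \<cdot> ev (Dom E ?r) \<cdot> FA I (exp_fill k X i s t)"
      using D S e(1-3) ev_path_map_ext[OF D(3), of "FA I (exp_fill k X i s t)"] by simp
    also have "\<dots> = gen_fill k i X' (m \<cdot> ev (Dom E ?r) \<cdot> FA I s) (m \<cdot> xb2 k ?r \<cdot> t) (n \<cdot> ev (Cod E ?r) \<cdot> FA I (xb1 k ?r \<cdot> t))"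
      using e(4) gen_fill_mor[OF X i exp_square_cyl[OF k D(1) q0]] by simp
    also have "m \<cdot> ev (Dom E ?r) \<cdot> FA I s = ev (Dom E ?r') \<cdot> FA I (path_map m \<cdot> s)"
      using D S ev_path_map_ext[OF D(3), of "FA I s"] by simp
    also have "m \<cdot> xb2 k ?r \<cdot> t = xb2 k ?r' \<cdot> ?h \<cdot> t" using D S A(1-3) by (simp add: comp_sq[OF A(5)])
    also have "n \<cdot> ev (Cod E ?r) \<cdot> FA I (xb1 k ?r \<cdot> t) = ev (Cod E ?r') \<cdot> FA I (path_map n \<cdot> xb1 k ?r \<cdot> t)"
      using D S ev_path_map_ext[OF D(4), of "FA I (xb1 k ?r \<cdot> t)"] by simp
    also have "path_map n \<cdot> xb1 k ?r \<cdot> t = xb1 k ?r' \<cdot> ?h \<cdot> t" using D S A(1-3) by (simp add: comp_sq[OF A(4)])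
    finally show "ev (Dom E ?r') \<cdot> FA I (path_map m \<cdot> exp_fill k X i s t) = ev (Dom E ?r') \<cdot> FA I (exp_fill k X' i (path_map m \<cdot> s) (?h \<cdot> t))"
      using e'(4) by simp
  qed (use D e(1-3) e'(1-3) in simp_all)
  then show "path_map m \<cdot> snd (exp_map k X) i s t = snd (exp_map k X') i (path_map m \<cdot> s) (?h \<cdot> t)"
    using i q0 q' by (simp add: exp_map_def right_restr_def)
qed

subsection \<open>Fillers for cofibrations\<close>

text \<open>The cofibration \<open>c\<close> fills against the exponential of \<open>X\<close>, and the transpose of this filler is a filler for
  \<open>\<delta>\<^sup>k \<otimes> c\<close> against \<open>X\<close>.\<close>

definition cyl_fill :: "nat \<Rightarrow> 'a \<times> 's \<Rightarrow> ('a, 'i + 'i) lifting_map \<Rightarrow> 'a \<Rightarrow> 'a \<Rightarrow> 'a \<Rightarrow> 'a" where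
  "cyl_fill k c X \<alpha> \<beta> y = ev (Dom E (fst X)) \<cdot> FA I (cfill c (exp_map k X) (tr (Dom E (fst c)) \<alpha>)
     (pair (endpoint k (Cod E (fst X))) (fst X) (tr (Cod E (fst c)) y) \<beta>))"

lemma cyl_fill:
  assumes c: "c \<in> Cof" and X: "X \<in> RM" and s: "cyl_square k (fst c) \<alpha> \<beta> y (fst X)"
  shows "cyl_fills k (fst c) \<alpha> \<beta> y (fst X) (cyl_fill k c X \<alpha> \<beta> y)"
proof -
  let ?r = "fst X" and ?f = "fst c"
  note C = cyl_square_D[OF s] and q = cyl_square_exp[OF s]
  note B = exp_bot[OF C(1,3)]
  let ?s = "tr (Dom E ?f) \<alpha>" and ?t = "pair (endpoint k (Cod E ?r)) ?r (tr (Cod E ?f) y) \<beta>"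
  let ?d = "cfill c (exp_map k X) ?s ?t"
  have F0: "fills E ?f ?s ?t (exp_bot k ?r) ?d"
    using cfill[OF c exp_map[OF C(1) X], of ?s ?t] q(1) by simp
  have ta: "ev (Dom E ?r) \<cdot> FA I ?s = \<alpha>" and ty: "ev (Cod E ?r) \<cdot> FA I (tr (Cod E ?f) y) = y"
    using ev_tr[of "Dom E ?f" \<alpha>] ev_tr[of "Cod E ?f" y] C by simp_all
  have d: "?d \<in> Ar E" "Dom E ?d = Cod E ?f" "Cod E ?d = path (Dom E ?r)" "?d \<cdot> ?f = ?s" "exp_bot k ?r \<cdot> ?d = ?t"
    using fills_D[OF F0] B by simp_all
  have 1: "(ev (Dom E ?r) \<cdot> FA I ?d) \<cdot> FA I ?f = \<alpha>"
  proof -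
    have "FA I ?d \<cdot> FA I ?f = FA I ?s" using d C by (simp flip: I_simps(5))
    then show ?thesis using d C ta by simp
  qed
  have "endpoint k (Dom E ?r) \<cdot> ?d = xb2 k ?r \<cdot> exp_bot k ?r \<cdot> ?d"
    using B C(1-12) d(1-3) by (simp add: comp_eq_ext[OF B(5)])
  then have 2: "(ev (Dom E ?r) \<cdot> FA I ?d) \<cdot> \<delta> k (Cod E ?f) = \<beta>"
    using endpoint_comp[of k "Dom E ?r" ?d] d q C(1-12) by simp
  have "path_map ?r \<cdot> ?d = xb1 k ?r \<cdot> exp_bot k ?r \<cdot> ?d"
    using B C(1-12) d(1-3) by (simp add: comp_eq_ext[OF B(4)])
  then have "path_map ?r \<cdot> ?d = tr (Cod E ?f) y" using d q by simp
  then have "FA I (path_map ?r) \<cdot> FA I ?d = FA I (tr (Cod E ?f) y)"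
    using d C by (simp flip: I_simps(5))
  then have 3: "?r \<cdot> ev (Dom E ?r) \<cdot> FA I ?d = y"
    using ev_path_map_ext[OF C(3), of "FA I ?d"] d(1-3) C(1-12) ty by simp
  show ?thesis using 1 2 3 d(1-3) C(1-12) by (simp add: cyl_fills_def cyl_fill_def)
qed

lemma cyl_fill_natural:
  assumes c: "cmor c' a b c" and X: "rmor X m n X'" and s: "cyl_square k (fst c) \<alpha> \<beta> y (fst X)"
  shows "m \<cdot> cyl_fill k c X \<alpha> \<beta> y \<cdot> FA I b = cyl_fill k c' X' (m \<cdot> \<alpha> \<cdot> FA I a) (m \<cdot> \<beta> \<cdot> b) (n \<cdot> y \<cdot> FA I b)"
proof -
  let ?r = "fst X" and ?f = "fst c" and ?r' = "fst X'" and ?f' = "fst c'"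
  note cm = cmor_D[OF c, THEN conjunct1] cmor_D[OF c, THEN conjunct2, THEN conjunct1] cmor_D[OF c, THEN conjunct2, THEN conjunct2]
  note C = cyl_square_D(1-12)[OF s] and q = cyl_square_exp[OF s]
  note D = is_square_D(1-8)[OF cm(3)] is_square_D(1-8)[OF right_mor_D(3)[OF X]]
  note B = exp_bot(1-3)[OF C(1,3)]
  note A = exp_arr[OF C(1) right_mor_D(3)[OF X]]
  let ?s = "tr (Dom E ?f) \<alpha>" and ?t = "pair (endpoint k (Cod E ?r)) ?r (tr (Cod E ?f) y) \<beta>"
  let ?d = "cfill c (exp_map k X) ?s ?t"
  have F0: "fills E ?f ?s ?t (exp_bot k ?r) ?d"
    using cfill[OF cm(2) exp_map[OF C(1) right_mor_D(1)[OF X]], of ?s ?t] q(1) by simp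
  have ta: "ev (Dom E ?r) \<cdot> FA I ?s = \<alpha>" and ty: "ev (Cod E ?r) \<cdot> FA I (tr (Cod E ?f) y) = y"
    using ev_tr[of "Dom E ?f" \<alpha>] ev_tr[of "Cod E ?f" y] C by simp_all
  have d: "?d \<in> Ar E" "Dom E ?d = Cod E ?f" "Cod E ?d = path (Dom E ?r)"
    using fills_D[OF F0] B by simp_all
  note tt = is_square_D(4,7,8)[OF q(1)]
  have s': "tr (Dom E ?f') (m \<cdot> \<alpha> \<cdot> FA I a) = path_map m \<cdot> ?s \<cdot> a"
    by (rule tr_unique)
      (use C D ta in \<open>simp_all add: ev_path_map_ext[OF D(11), simplified D] comp_eq_ext[OF ta]\<close>)
  have y': "tr (Cod E ?f') (n \<cdot> y \<cdot> FA I b) = path_map n \<cdot> tr (Cod E ?f) y \<cdot> b"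
    by (rule tr_unique)
      (use C D ty in \<open>simp_all add: ev_path_map_ext[OF D(12), simplified D] comp_eq_ext[OF ty]\<close>)
  have t': "pair (endpoint k (Cod E ?r')) ?r' (tr (Cod E ?f') (n \<cdot> y \<cdot> FA I b)) (m \<cdot> \<beta> \<cdot> b) = exp_arr k ?r m n ?r' \<cdot> ?t \<cdot> b"
    by (rule pair_unique)
      (use C D A(1-3) tt B y' q(2,3) in \<open>simp_all add: comp_sq[OF A(4)] comp_sq[OF A(5)] comp_eq_ext[OF q(2)] comp_eq_ext[OF q(3)]\<close>)
  have "path_map m \<cdot> ?d \<cdot> b = cfill c' (exp_map k X') (path_map m \<cdot> ?s \<cdot> a) (exp_arr k ?r m n ?r' \<cdot> ?t \<cdot> b)"
    using cfill_natural[OF c exp_mor[OF C(1) X], of ?s ?t] q(1) by simp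
  then have "cyl_fill k c' X' (m \<cdot> \<alpha> \<cdot> FA I a) (m \<cdot> \<beta> \<cdot> b) (n \<cdot> y \<cdot> FA I b) = ev (Dom E ?r') \<cdot> FA I (path_map m \<cdot> ?d \<cdot> b)"
    unfolding cyl_fill_def s' t' by simp
  also have "\<dots> = m \<cdot> ev (Dom E ?r) \<cdot> FA I ?d \<cdot> FA I b"
    using ev_path_map_ext[OF D(11), of "FA I ?d \<cdot> FA I b"] d D C by simp
  finally show ?thesis using d D C by (simp add: cyl_fill_def)
qed

end

section \<open>Strong homotopy equivalences\<close>

(* With the default rule, 1 - k would become Suc 0 - k, and facts about the opposite endpoint
   would no longer match. *)
declare One_nat_def [simp del]

type_synonym 'a equiv_data = "'a \<times> 'a \<times> 'a"

context cylinder begin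

text \<open>A homotopy inverse \<open>g\<close> of \<open>f\<close>, a homotopy \<open>\<phi>\<close> from \<open>g f\<close> to the identity and a homotopy \<open>\<psi>\<close> from \<open>f g\<close> to
  the identity, compatible along \<open>f\<close>; for \<open>k = 1\<close>, the homotopies run backwards. Equivalently,
  \<open>[\<phi>, g]\<close> and \<open>\<psi>\<close> are the two sides of a retraction of the square from \<open>f\<close> to \<open>\<delta>\<^sup>k \<otimes> f\<close> that is induced by
  the opposite endpoint.\<close>

definition strong_equiv :: "nat \<Rightarrow> 'a \<Rightarrow> 'a equiv_data \<Rightarrow> bool" where
  "strong_equiv k f = (\<lambda>(g, \<phi>, \<psi>). k < 2 \<and> f \<in> Ar E \<and>
     g \<in> Ar E \<and> Dom E g = Cod E f \<and> Cod E g = Dom E f \<and>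
     \<phi> \<in> Ar E \<and> Dom E \<phi> = FO I (Dom E f) \<and> Cod E \<phi> = Dom E f \<and>
     \<psi> \<in> Ar E \<and> Dom E \<psi> = FO I (Cod E f) \<and> Cod E \<psi> = Cod E f \<and>
     \<phi> \<cdot> \<delta> k (Dom E f) = g \<cdot> f \<and> \<phi> \<cdot> \<delta> (1 - k) (Dom E f) = Id E (Dom E f) \<and>
     \<psi> \<cdot> \<delta> k (Cod E f) = f \<cdot> g \<and> \<psi> \<cdot> \<delta> (1 - k) (Cod E f) = Id E (Cod E f) \<and>
     f \<cdot> \<phi> = \<psi> \<cdot> FA I f)"

definition equiv_mor :: "'a equiv_data \<Rightarrow> 'a \<Rightarrow> 'a \<Rightarrow> 'a equiv_data \<Rightarrow> bool" where
  "equiv_mor = (\<lambda>(g, \<phi>, \<psi>) a b (g', \<phi>', \<psi>').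
     g' \<cdot> b = a \<cdot> g \<and> \<phi>' \<cdot> FA I a = a \<cdot> \<phi> \<and> \<psi>' \<cdot> FA I b = b \<cdot> \<psi>)"

lemma strong_equiv_D:
  assumes "strong_equiv k f (g, \<phi>, \<psi>)"
  shows "k < 2" "1 - k < 2" "f \<in> Ar E" "g \<in> Ar E" "Dom E g = Cod E f" "Cod E g = Dom E f"
     "\<phi> \<in> Ar E" "Dom E \<phi> = FO I (Dom E f)" "Cod E \<phi> = Dom E f"
     "\<psi> \<in> Ar E" "Dom E \<psi> = FO I (Cod E f)" "Cod E \<psi> = Cod E f"
     "\<phi> \<cdot> \<delta> k (Dom E f) = g \<cdot> f" "\<phi> \<cdot> \<delta> (1 - k) (Dom E f) = Id E (Dom E f)"
     "\<psi> \<cdot> \<delta> k (Cod E f) = f \<cdot> g" "\<psi> \<cdot> \<delta> (1 - k) (Cod E f) = Id E (Cod E f)"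
     "f \<cdot> \<phi> = \<psi> \<cdot> FA I f"
  using assms by (auto simp: strong_equiv_def)

end

locale connected_cylinder = cylinder E ch I \<delta>
  for E :: "('o, 'a) cat" (structure) and ch :: "('o, 'a) chosen" and I :: "('o, 'a, 'o, 'a) fctr" and \<delta> :: "nat \<Rightarrow> 'o \<Rightarrow> 'a" +
  fixes \<epsilon> :: "'o \<Rightarrow> 'a" and con :: "nat \<Rightarrow> 'o \<Rightarrow> 'a"
  assumes contr: "contraction E I \<delta> \<epsilon>" and conn: "connections E I \<delta> \<epsilon> con"
begin

lemma \<epsilon> [simp]:
  assumes "X \<in> Ob E"
  shows "\<epsilon> X \<in> Ar E" "Dom E (\<epsilon> X) = FO I X" "Cod E (\<epsilon> X) = X"
  using contr assms by (auto simp: contraction_def nat_trans_def hom_def)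

lemma \<epsilon>_natural: "f \<in> Ar E \<Longrightarrow> \<epsilon> (Cod E f) \<cdot> FA I f = f \<cdot> \<epsilon> (Dom E f)"
  using contr by (auto simp: contraction_def nat_trans_def)

lemma \<epsilon>_\<delta>: "k < 2 \<Longrightarrow> X \<in> Ob E \<Longrightarrow> \<epsilon> X \<cdot> \<delta> k X = Id E X"
  using contr by (auto simp: contraction_def less_2_cases_iff One_nat_def)

lemma con [simp]:
  assumes "k < 2" "X \<in> Ob E"
  shows "con k X \<in> Ar E" "Dom E (con k X) = FO I (FO I X)" "Cod E (con k X) = FO I X"
proof -
  have "k \<in> {0, 1}" using assms by auto
  then show "con k X \<in> Ar E" "Dom E (con k X) = FO I (FO I X)" "Cod E (con k X) = FO I X"
    using conn assms(2) by (auto simp: connections_def nat_trans_def hom_def)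
qed

lemma con_natural:
  assumes "k < 2" "f \<in> Ar E"
  shows "con k (Cod E f) \<cdot> FA I (FA I f) = FA I f \<cdot> con k (Dom E f)"
proof -
  have "k \<in> {0, 1}" using assms by auto
  then show ?thesis using conn assms(2) by (auto simp: connections_def nat_trans_def)
qed

lemma con_\<delta>:
  assumes "k < 2" "X \<in> Ob E"
  shows "con k X \<cdot> \<delta> k (FO I X) = \<delta> k X \<cdot> \<epsilon> X" "con k X \<cdot> FA I (\<delta> k X) = \<delta> k X \<cdot> \<epsilon> X"
    "con k X \<cdot> \<delta> (1 - k) (FO I X) = Id E (FO I X)"
proof -
  have "k \<in> {0, 1}" using assms by auto
  then show "con k X \<cdot> \<delta> k (FO I X) = \<delta> k X \<cdot> \<epsilon> X" "con k X \<cdot> FA I (\<delta> k X) = \<delta> k X \<cdot> \<epsilon> X"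
    "con k X \<cdot> \<delta> (1 - k) (FO I X) = Id E (FO I X)"
    using conn assms(2) unfolding connections_def by blast+
qed

text \<open>The codomain \<open>I \<otimes> B\<close> of \<open>\<delta>\<^sup>k \<otimes> f\<close> is contracted to its end \<open>k\<close> by the connection; the contraction
  restricts to the domain, where it is the connection on \<open>I \<otimes> A\<close> and constant on \<open>B\<close>. The homotopy
  inverse is the projection to that end.\<close>

definition leibniz_equiv :: "nat \<Rightarrow> 'a \<Rightarrow> 'a equiv_data" where
  "leibniz_equiv k f =
     (lq k f \<cdot> \<epsilon> (Cod E f),
      cyl_copair (\<delta> k (Dom E f)) f (lp k f \<cdot> con k (Dom E f)) (lq k f \<cdot> \<epsilon> (Cod E f)),
      con k (Cod E f))"

lemma leibniz_contraction:
  assumes k: "k < 2" and f: "f \<in> Ar E"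
  defines "\<phi> \<equiv> cyl_copair (\<delta> k (Dom E f)) f (lp k f \<cdot> con k (Dom E f)) (lq k f \<cdot> \<epsilon> (Cod E f))"
  shows "\<phi> \<in> Ar E" "Dom E \<phi> = FO I (Cod E (lp k f))" "Cod E \<phi> = Cod E (lp k f)"
    "\<phi> \<cdot> FA I (lp k f) = lp k f \<cdot> con k (Dom E f)" "\<phi> \<cdot> FA I (lq k f) = lq k f \<cdot> \<epsilon> (Cod E f)"
proof -
  have pc: "lp k f \<cdot> \<delta> k (Dom E f) = lq k f \<cdot> f" using po_comm[of "\<delta> k (Dom E f)" f] k f by simp
  have "(lp k f \<cdot> con k (Dom E f)) \<cdot> FA I (\<delta> k (Dom E f)) = lp k f \<cdot> \<delta> k (Dom E f) \<cdot> \<epsilon> (Dom E f)"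
    using k f con_\<delta>(2)[OF k, of "Dom E f"] by simp
  also have "\<dots> = lq k f \<cdot> f \<cdot> \<epsilon> (Dom E f)" using k f by (simp add: comp_sq[OF pc])
  also have "\<dots> = (lq k f \<cdot> \<epsilon> (Cod E f)) \<cdot> FA I f" using k f \<epsilon>_natural[OF f] by simp
  finally have c: "(lp k f \<cdot> con k (Dom E f)) \<cdot> FA I (\<delta> k (Dom E f)) = (lq k f \<cdot> \<epsilon> (Cod E f)) \<cdot> FA I f" .
  show "\<phi> \<in> Ar E" "Dom E \<phi> = FO I (Cod E (lp k f))" "Cod E \<phi> = Cod E (lp k f)"
    "\<phi> \<cdot> FA I (lp k f) = lp k f \<cdot> con k (Dom E f)" "\<phi> \<cdot> FA I (lq k f) = lq k f \<cdot> \<epsilon> (Cod E f)"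
    using cyl_copair[OF _ _ _ _ _ _ _ _ c] k f unfolding \<phi>_def by simp_all
qed

lemma leibniz_strong_equiv:
  assumes k: "k < 2" and f: "f \<in> Ar E"
  shows "strong_equiv k (FO (lei k) f) (leibniz_equiv k f)"
proof -
  have k': "1 - k < 2" using k by simp
  let ?l = "FO (lei k) f" and ?A = "Dom E f" and ?B = "Cod E f"
  define \<phi> where "\<phi> = cyl_copair (\<delta> k (Dom E f)) f (lp k f \<cdot> con k (Dom E f)) (lq k f \<cdot> \<epsilon> (Cod E f))"
  note F = leibniz_contraction[OF k f, folded \<phi>_def]
  note L = leibniz[OF k f]
  have A: "?A \<in> Ob E" "?B \<in> Ob E" using f by simp_all
  note T = k k' f A F(1-3) L(1-3)
  have pc: "lp k f \<cdot> \<delta> k (Dom E f) = lq k f \<cdot> f" using po_comm[of "\<delta> k (Dom E f)" f] k f by simp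
  have dn: "\<delta> j (Cod E (lp k f)) \<cdot> lp k f = FA I (lp k f) \<cdot> \<delta> j (FO I ?A)"
    "\<delta> j (Cod E (lp k f)) \<cdot> lq k f = FA I (lq k f) \<cdot> \<delta> j ?B" if "j < 2" for j
    using \<delta>_natural[OF that, of "lp k f"] \<delta>_natural[OF that, of "lq k f"] T by simp_all
  have 1: "\<phi> \<cdot> \<delta> k (Cod E (lp k f)) = (lq k f \<cdot> \<epsilon> ?B) \<cdot> ?l"
  proof (rule po_eqI[of "\<delta> k ?A" f])
    have "\<phi> \<cdot> FA I (lp k f) \<cdot> \<delta> k (FO I ?A) = lp k f \<cdot> \<delta> k ?A \<cdot> \<epsilon> ?A"
      using T con_\<delta>(1)[OF k A(1)] by (simp add: comp_eq_ext[OF F(4)])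
    also have "\<dots> = lq k f \<cdot> f \<cdot> \<epsilon> ?A" using T by (simp add: comp_sq[OF pc])
    also have "\<dots> = lq k f \<cdot> \<epsilon> ?B \<cdot> FA I f" using T \<epsilon>_natural[OF f] by simp
    finally show "(\<phi> \<cdot> \<delta> k (Cod E (lp k f))) \<cdot> lp k f = ((lq k f \<cdot> \<epsilon> ?B) \<cdot> ?l) \<cdot> lp k f"
      using T L(4) dn[OF k] by simp
    show "(\<phi> \<cdot> \<delta> k (Cod E (lp k f))) \<cdot> lq k f = ((lq k f \<cdot> \<epsilon> ?B) \<cdot> ?l) \<cdot> lq k f"
      using T L(5) dn[OF k] by (simp add: comp_eq_ext[OF F(5)])
  qed (use T in simp_all)
  have 2: "\<phi> \<cdot> \<delta> (1 - k) (Cod E (lp k f)) = Id E (Cod E (lp k f))"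
  proof (rule po_eqI[of "\<delta> k ?A" f])
    show "(\<phi> \<cdot> \<delta> (1 - k) (Cod E (lp k f))) \<cdot> lp k f = Id E (Cod E (lp k f)) \<cdot> lp k f"
      using T dn[OF k'] con_\<delta>(3)[OF k A(1)] by (simp add: comp_eq_ext[OF F(4)])
    show "(\<phi> \<cdot> \<delta> (1 - k) (Cod E (lp k f))) \<cdot> lq k f = Id E (Cod E (lp k f)) \<cdot> lq k f"
      using T dn[OF k'] \<epsilon>_\<delta>[OF k' A(2)] by (simp add: comp_eq_ext[OF F(5)])
  qed (use T in simp_all)
  have 3: "?l \<cdot> \<phi> = con k ?B \<cdot> FA I ?l"
  proof (rule cyl_po_eqI[of "\<delta> k ?A" f])
    have "FA I ?l \<cdot> FA I (lp k f) = FA I (FA I f)" using T L(4) by (simp flip: I_simps(5))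
    then show "(?l \<cdot> \<phi>) \<cdot> FA I (lp k f) = (con k ?B \<cdot> FA I ?l) \<cdot> FA I (lp k f)"
      using T F(4) con_natural[OF k f] by (simp add: comp_eq_ext[OF L(4)])
    have "FA I ?l \<cdot> FA I (lq k f) = FA I (\<delta> k ?B)" using T L(5) by (simp flip: I_simps(5))
    then show "(?l \<cdot> \<phi>) \<cdot> FA I (lq k f) = (con k ?B \<cdot> FA I ?l) \<cdot> FA I (lq k f)"
      using T F(5) con_\<delta>(2)[OF k A(2)] by (simp add: comp_eq_ext[OF L(5)])
  qed (use T in simp_all)
  have 4: "con k ?B \<cdot> \<delta> k (FO I ?B) = ?l \<cdot> lq k f \<cdot> \<epsilon> ?B"
    using T con_\<delta>(1)[OF k A(2)] by (simp add: comp_eq_ext[OF L(5)])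
  show ?thesis
    using T 1 2 3 4 con_\<delta>(3)[OF k A(2)] by (simp add: strong_equiv_def leibniz_equiv_def \<phi>_def)
qed

lemma leibniz_equiv_mor:
  assumes k: "k < 2" and q: "is_square E f s t g"
  shows "equiv_mor (leibniz_equiv k f) (leibniz_top k f s t g) (FA I t) (leibniz_equiv k g)"
proof -
  note D = is_square_D(1-8)[OF q]
  note T = leibniz_top[OF k q]
  let ?w = "leibniz_top k f s t g"
  define \<phi> where "\<phi> = cyl_copair (\<delta> k (Dom E f)) f (lp k f \<cdot> con k (Dom E f)) (lq k f \<cdot> \<epsilon> (Cod E f))"
  define \<phi>' where "\<phi>' = cyl_copair (\<delta> k (Dom E g)) g (lp k g \<cdot> con k (Dom E g)) (lq k g \<cdot> \<epsilon> (Cod E g))"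
  note F = leibniz_contraction[OF k D(1), folded \<phi>_def] and G = leibniz_contraction[OF k D(2), folded \<phi>'_def]
  note Y = k D T(1-3) F(1-3) G(1-3)
  have i: "FA I ?w \<cdot> FA I (lp k f) = FA I (lp k g) \<cdot> FA I (FA I s)" "FA I ?w \<cdot> FA I (lq k f) = FA I (lq k g) \<cdot> FA I t"
    using T(4,5) Y by (simp_all flip: I_simps(5))
  have en: "\<epsilon> (Cod E g) \<cdot> FA I t = t \<cdot> \<epsilon> (Cod E f)" using \<epsilon>_natural[OF D(4)] D by simp
  have cs: "con k (Dom E g) \<cdot> FA I (FA I s) = FA I s \<cdot> con k (Dom E f)" using con_natural[OF k D(3)] D by simp
  have 1: "(lq k g \<cdot> \<epsilon> (Cod E g)) \<cdot> FA I t = ?w \<cdot> lq k f \<cdot> \<epsilon> (Cod E f)"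
    using Y en by (simp add: comp_sq[OF T(5)])
  have 2: "\<phi>' \<cdot> FA I ?w = ?w \<cdot> \<phi>"
  proof (rule cyl_po_eqI[of "\<delta> k (Dom E f)" f])
    show "(\<phi>' \<cdot> FA I ?w) \<cdot> FA I (lp k f) = (?w \<cdot> \<phi>) \<cdot> FA I (lp k f)"
      using Y i(1) F(4) cs by (simp add: comp_sq[OF G(4)] comp_sq[OF T(4)])
    show "(\<phi>' \<cdot> FA I ?w) \<cdot> FA I (lq k f) = (?w \<cdot> \<phi>) \<cdot> FA I (lq k f)"
      using Y i(2) F(5) en by (simp add: comp_sq[OF G(5)] comp_sq[OF T(5)])
  qed (use Y in simp_all)
  have 3: "con k (Cod E g) \<cdot> FA I (FA I t) = FA I t \<cdot> con k (Cod E f)" using con_natural[OF k D(4)] D by simp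
  show ?thesis using 1 2 3 by (simp add: equiv_mor_def leibniz_equiv_def \<phi>_def \<phi>'_def)
qed

end

text \<open>What suitability provides: the maps \<open>u\<^sub>i\<close> and \<open>0 \<rightarrow> X\<close> are cofibrations, and pullbacks of cofibrations
  and their Leibniz products with endpoints are again cofibrations, all functorially.\<close>

locale cofibrations = cof_lifting E ch I \<delta> J u Cof cmor cfill + connected_cylinder E ch I \<delta> \<epsilon> con
  for E :: "('o, 'a) cat" (structure) and ch :: "('o, 'a) chosen" and I :: "('o, 'a, 'o, 'a) fctr" and \<delta> :: "nat \<Rightarrow> 'o \<Rightarrow> 'a"
    and J :: "('i, 'j) cat" and u :: "('i, 'j, 'a, 'a square) fctr"
    and Cof :: "('a \<times> 's) set" and cmor :: "'a \<times> 's \<Rightarrow> 'a \<Rightarrow> 'a \<Rightarrow> 'a \<times> 's \<Rightarrow> bool"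
    and cfill :: "'a \<times> 's \<Rightarrow> ('a, 'i) lifting_map \<Rightarrow> 'a \<Rightarrow> 'a \<Rightarrow> 'a"
    and \<epsilon> :: "'o \<Rightarrow> 'a" and con :: "nat \<Rightarrow> 'o \<Rightarrow> 'a" +
  fixes gen_cof :: "'i \<Rightarrow> 's" and ini_cof :: "'o \<Rightarrow> 's" and bang :: "'o \<Rightarrow> 'a" and pb_cof :: "'a \<times> 's \<Rightarrow> 'a \<Rightarrow> 's" and lei_cof :: "nat \<Rightarrow> 'a \<times> 's \<Rightarrow> 's"
  assumes gen: "i \<in> Ob J \<Longrightarrow> (FO u i, gen_cof i) \<in> Cof"
    and gen_mor: "\<sigma> \<in> Ar J \<Longrightarrow> cmor (FO u (Dom J \<sigma>), gen_cof (Dom J \<sigma>)) (top_of (FA u \<sigma>)) (bot_of (FA u \<sigma>)) (FO u (Cod J \<sigma>), gen_cof (Cod J \<sigma>))"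
    and bang: "X \<in> Ob E \<Longrightarrow> bang X \<in> hom E (zero ch) X"
    and ini: "X \<in> Ob E \<Longrightarrow> (bang X, ini_cof X) \<in> Cof"
    and ini_mor: "f \<in> Ar E \<Longrightarrow> cmor (bang (Dom E f), ini_cof (Dom E f)) (Id E (zero ch)) f (bang (Cod E f), ini_cof (Cod E f))"
    and pb_cof: "\<lbrakk>c \<in> Cof; h \<in> Ar E; Cod E (fst c) = Cod E h\<rbrakk> \<Longrightarrow> (pb2 ch (fst c) h, pb_cof c h) \<in> Cof"
    and pb_cof_mor: "\<lbrakk>cmor c a b c'; is_square E h y b h'; Cod E (fst c) = Cod E h\<rbrakk> \<Longrightarrow>
       cmor (pb2 ch (fst c) h, pb_cof c h) (pb_arr (fst c) h a y (fst c') h') y (pb2 ch (fst c') h', pb_cof c' h')"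
    and lei_cof: "\<lbrakk>k < 2; c \<in> Cof\<rbrakk> \<Longrightarrow> (FO (lei k) (fst c), lei_cof k c) \<in> Cof"
    and lei_cof_mor: "\<lbrakk>k < 2; cmor c a b c'\<rbrakk> \<Longrightarrow>
       cmor (FO (lei k) (fst c), lei_cof k c) (leibniz_top k (fst c) a b (fst c')) (FA I b) (FO (lei k) (fst c'), lei_cof k c')"
begin

lemma bang_simps [simp]:
  assumes "X \<in> Ob E"
  shows "bang X \<in> Ar E" "Dom E (bang X) = zero ch" "Cod E (bang X) = X"
  using bang[OF assms] by (auto simp: hom_def)

lemma zero_Ob [simp]: "zero ch \<in> Ob E"
  using ch by (auto simp: is_chosen_def is_initial_def)

subsection \<open>Pullback of strong homotopy equivalences along right maps\<close>

text \<open>The homotopy \<open>\<psi>\<close> on the codomain of \<open>P\<close>, restricted to the domain \<open>Y\<close> of \<open>P\<close>, is lifted to a homotopy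
  on \<open>Y\<close> that ends in the identity. The map \<open>bang Y \<cdot> \<epsilon> 0\<close> is just a name for the unique one on
  \<open>I \<otimes> 0\<close>, which is initial.\<close>

definition lift_homotopy :: "nat \<Rightarrow> 'a \<Rightarrow> ('a, 'i + 'i) lifting_map \<Rightarrow> 'a" where
  "lift_homotopy k \<psi> P = (let Y = Dom E (fst P) in
     cyl_fill (1 - k) (bang Y, ini_cof Y) P (bang Y \<cdot> \<epsilon> (zero ch)) (Id E Y) (\<psi> \<cdot> FA I (fst P)))"

context
  fixes k f g \<phi> \<psi> P
  assumes e: "strong_equiv k f (g, \<phi>, \<psi>)" and P: "P \<in> RM" and c: "Cod E f = Cod E (fst P)"
begin

lemma lift_homotopy_square:
  "cyl_square (1 - k) (bang (Dom E (fst P))) (bang (Dom E (fst P)) \<cdot> \<epsilon> (zero ch)) (Id E (Dom E (fst P))) (\<psi> \<cdot> FA I (fst P)) (fst P)"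
proof -
  note D = strong_equiv_D[OF e] c right_map_Ar[OF P]
  let ?Y = "Dom E (fst P)"
  have 1: "(bang ?Y \<cdot> \<epsilon> (zero ch)) \<cdot> \<delta> (1 - k) (zero ch) = Id E ?Y \<cdot> bang ?Y"
    by (rule initial_map[of ?Y]) (use D in simp_all)
  have 2: "fst P \<cdot> bang ?Y \<cdot> \<epsilon> (zero ch) = (\<psi> \<cdot> FA I (fst P)) \<cdot> FA I (bang ?Y)"
    by (rule cyl_initial_map) (use D in simp_all)
  have "(\<psi> \<cdot> FA I (fst P)) \<cdot> \<delta> (1 - k) ?Y = \<psi> \<cdot> \<delta> (1 - k) (Cod E f) \<cdot> fst P"
    using D(1-12,18-) \<delta>_natural[OF D(2), of "fst P"] by simp
  also have "\<dots> = fst P" using D by (simp add: comp_eq_ext[OF D(16)[unfolded c]])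
  finally have 3: "fst P \<cdot> Id E ?Y = (\<psi> \<cdot> FA I (fst P)) \<cdot> \<delta> (1 - k) ?Y" using D by simp
  show ?thesis using 1 2 3 D(1-12,18-) by (simp add: cyl_square_def)
qed

lemma lift_homotopy:
  "lift_homotopy k \<psi> P \<in> Ar E" "Dom E (lift_homotopy k \<psi> P) = FO I (Dom E (fst P))" "Cod E (lift_homotopy k \<psi> P) = Dom E (fst P)"
  "lift_homotopy k \<psi> P \<cdot> \<delta> (1 - k) (Dom E (fst P)) = Id E (Dom E (fst P))" "fst P \<cdot> lift_homotopy k \<psi> P = \<psi> \<cdot> FA I (fst P)"
  using cyl_fills_D[OF cyl_fill[OF ini P, of "Dom E (fst P)" "1 - k", simplified fst_conv, OF _ lift_homotopy_square]] right_map_Ar[OF P]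
  by (simp_all add: lift_homotopy_def Let_def)

end

text \<open>The second components of the new homotopy inverse and of the new homotopies come from the lifted
  homotopy \<open>\<theta>\<close>, and the first components from the old ones; they fit together because \<open>\<theta>\<close> lies over
  \<open>\<psi>\<close>.\<close>

definition pb_equiv :: "nat \<Rightarrow> 'a \<Rightarrow> 'a equiv_data \<Rightarrow> ('a, 'i + 'i) lifting_map \<Rightarrow> 'a equiv_data" where
  "pb_equiv k f = (\<lambda>(g, \<phi>, \<psi>) P. let p = fst P; \<theta> = lift_homotopy k \<psi> P in
     (pair f p (g \<cdot> p) (\<theta> \<cdot> \<delta> k (Dom E p)), pair f p (\<phi> \<cdot> FA I (pb1 ch f p)) (\<theta> \<cdot> FA I (pb2 ch f p)), \<theta>))"

context
  fixes k f g \<phi> \<psi> P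
  assumes e: "strong_equiv k f (g, \<phi>, \<psi>)" and P: "P \<in> RM" and c: "Cod E f = Cod E (fst P)"
begin

lemma pb_equiv_inverse:
  defines "g' \<equiv> pair f (fst P) (g \<cdot> fst P) (lift_homotopy k \<psi> P \<cdot> \<delta> k (Dom E (fst P)))"
  shows "g' \<in> Ar E" "Dom E g' = Dom E (fst P)" "Cod E g' = Dom E (pb1 ch f (fst P))"
    "pb1 ch f (fst P) \<cdot> g' = g \<cdot> fst P" "pb2 ch f (fst P) \<cdot> g' = lift_homotopy k \<psi> P \<cdot> \<delta> k (Dom E (fst P))"
proof -
  note D = strong_equiv_D[OF e] c right_map_Ar[OF P]
  note H = lift_homotopy[OF e P c]
  have "fst P \<cdot> lift_homotopy k \<psi> P \<cdot> \<delta> k (Dom E (fst P)) = \<psi> \<cdot> \<delta> k (Cod E f) \<cdot> fst P"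
    using D(1-12,18-) H(1-3) \<delta>_natural[OF D(1), of "fst P"] by (simp add: comp_eq_ext[OF H(5)])
  also have "\<dots> = f \<cdot> g \<cdot> fst P" using D(1-12,18-) by (simp add: comp_eq_ext[OF D(15)[unfolded c]])
  finally show "g' \<in> Ar E" "Dom E g' = Dom E (fst P)" "Cod E g' = Dom E (pb1 ch f (fst P))"
    "pb1 ch f (fst P) \<cdot> g' = g \<cdot> fst P" "pb2 ch f (fst P) \<cdot> g' = lift_homotopy k \<psi> P \<cdot> \<delta> k (Dom E (fst P))"
    using pair[of f "fst P" "g \<cdot> fst P" "lift_homotopy k \<psi> P \<cdot> \<delta> k (Dom E (fst P))"] D(1-12,18-) H(1-3)
    unfolding g'_def by simp_all
qed

lemma pb_equiv_homotopy:
  defines "\<phi>' \<equiv> pair f (fst P) (\<phi> \<cdot> FA I (pb1 ch f (fst P))) (lift_homotopy k \<psi> P \<cdot> FA I (pb2 ch f (fst P)))"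
  shows "\<phi>' \<in> Ar E" "Dom E \<phi>' = FO I (Dom E (pb1 ch f (fst P)))" "Cod E \<phi>' = Dom E (pb1 ch f (fst P))"
    "pb1 ch f (fst P) \<cdot> \<phi>' = \<phi> \<cdot> FA I (pb1 ch f (fst P))" "pb2 ch f (fst P) \<cdot> \<phi>' = lift_homotopy k \<psi> P \<cdot> FA I (pb2 ch f (fst P))"
proof -
  note D = strong_equiv_D[OF e] c right_map_Ar[OF P]
  note H = lift_homotopy[OF e P c]
  have i: "FA I f \<cdot> FA I (pb1 ch f (fst P)) = FA I (fst P) \<cdot> FA I (pb2 ch f (fst P))"
    using D(1-12,18-) pb_comm[of f "fst P"] by (simp flip: I_simps(5))
  have "f \<cdot> \<phi> \<cdot> FA I (pb1 ch f (fst P)) = \<psi> \<cdot> FA I (fst P) \<cdot> FA I (pb2 ch f (fst P))"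
    using D(1-12,18-) i by (simp add: comp_sq[OF D(17)])
  also have "\<dots> = fst P \<cdot> lift_homotopy k \<psi> P \<cdot> FA I (pb2 ch f (fst P))"
    using D(1-12,18-) H(1-3) by (simp add: comp_eq_ext[OF H(5)])
  finally show "\<phi>' \<in> Ar E" "Dom E \<phi>' = FO I (Dom E (pb1 ch f (fst P)))" "Cod E \<phi>' = Dom E (pb1 ch f (fst P))"
    "pb1 ch f (fst P) \<cdot> \<phi>' = \<phi> \<cdot> FA I (pb1 ch f (fst P))" "pb2 ch f (fst P) \<cdot> \<phi>' = lift_homotopy k \<psi> P \<cdot> FA I (pb2 ch f (fst P))"
    using pair[of f "fst P" "\<phi> \<cdot> FA I (pb1 ch f (fst P))" "lift_homotopy k \<psi> P \<cdot> FA I (pb2 ch f (fst P))"] D(1-12,18-) H(1-3)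
    unfolding \<phi>'_def by simp_all
qed

lemma pb_strong_equiv: "strong_equiv k (pb2 ch f (fst P)) (pb_equiv k f (g, \<phi>, \<psi>) P)"
proof -
  note D = strong_equiv_D[OF e] c right_map_Ar[OF P]
  note H = lift_homotopy[OF e P c] and G = pb_equiv_inverse and F = pb_equiv_homotopy
  let ?p = "fst P"
  let ?a = "pb1 ch f ?p" and ?f = "pb2 ch f ?p" and ?\<theta> = "lift_homotopy k \<psi> P"
  let ?g = "pair f ?p (g \<cdot> ?p) (?\<theta> \<cdot> \<delta> k (Dom E ?p))"
  let ?\<phi> = "pair f ?p (\<phi> \<cdot> FA I ?a) (?\<theta> \<cdot> FA I ?f)"
  note T = D(1-12,18-) H(1-3) G(1-3) F(1-3)
  have A: "Dom E ?a \<in> Ob E" using T by simp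
  have dn: "FA I ?a \<cdot> \<delta> j (Dom E ?a) = \<delta> j (Dom E f) \<cdot> ?a" "FA I ?f \<cdot> \<delta> j (Dom E ?a) = \<delta> j (Dom E ?p) \<cdot> ?f" if "j < 2" for j
    using \<delta>_natural[OF that, of ?a] \<delta>_natural[OF that, of ?f] T by simp_all
  have 1: "?\<phi> \<cdot> \<delta> k (Dom E ?a) = ?g \<cdot> ?f"
  proof (rule pb_eqI[of f ?p])
    have "g \<cdot> f \<cdot> ?a = g \<cdot> ?p \<cdot> ?f" using T pb_comm[of f ?p] by simp
    then show "?a \<cdot> ?\<phi> \<cdot> \<delta> k (Dom E ?a) = ?a \<cdot> ?g \<cdot> ?f"
      using T dn[OF D(1)] by (simp add: comp_eq_ext[OF F(4)] comp_eq_ext[OF G(4)] comp_sq[OF D(13)])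
    show "?f \<cdot> ?\<phi> \<cdot> \<delta> k (Dom E ?a) = ?f \<cdot> ?g \<cdot> ?f"
      using T dn[OF D(1)] by (simp add: comp_eq_ext[OF F(5)] comp_eq_ext[OF G(5)])
  qed (use T in simp_all)
  have 2: "?\<phi> \<cdot> \<delta> (1 - k) (Dom E ?a) = Id E (Dom E ?a)"
    by (rule pb_eqI[of f ?p])
      (use T A dn[OF D(2)] in \<open>simp_all add: comp_eq_ext[OF F(4)] comp_eq_ext[OF F(5)] comp_eq_ext[OF D(14)] comp_eq_ext[OF H(4)]\<close>)
  show ?thesis using T 1 2 H(4) G(5) F(5) by (simp add: strong_equiv_def pb_equiv_def Let_def)
qed

end

lemma pb_equiv_mor:
  assumes e: "strong_equiv k f (g, \<phi>, \<psi>)" and e': "strong_equiv k f' (g', \<phi>', \<psi>')"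
    and q: "is_square E f a b f'" and m: "equiv_mor (g, \<phi>, \<psi>) a b (g', \<phi>', \<psi>')" and P: "rmor P y b P'"
    and c: "Cod E f = Cod E (fst P)"
  shows "equiv_mor (pb_equiv k f (g, \<phi>, \<psi>) P) (pb_arr f (fst P) a y f' (fst P')) y (pb_equiv k f' (g', \<phi>', \<psi>') P')"
proof -
  note PD = right_mor_D[OF P]
  note D = is_square_D[OF q] is_square_D[OF PD(3)]
  have c': "Cod E f' = Cod E (fst P')" using D by simp
  note S = strong_equiv_D(1-12)[OF e] and S' = strong_equiv_D(1-12)[OF e']
  note H = lift_homotopy[OF e PD(1) c] and H' = lift_homotopy[OF e' PD(2) c']
  note G = pb_equiv_inverse[OF e PD(1) c] and G' = pb_equiv_inverse[OF e' PD(2) c']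
  note F = pb_equiv_homotopy[OF e PD(1) c] and F' = pb_equiv_homotopy[OF e' PD(2) c']
  note W = pb_arr[OF q PD(3) c]
  have me: "g' \<cdot> b = a \<cdot> g" "\<phi>' \<cdot> FA I a = a \<cdot> \<phi>" "\<psi>' \<cdot> FA I b = b \<cdot> \<psi>" using m by (auto simp: equiv_mor_def)
  let ?Y = "Dom E (fst P)" and ?Y' = "Dom E (fst P')"
  let ?\<theta> = "lift_homotopy k \<psi> P" and ?\<theta>' = "lift_homotopy k \<psi>' P'"
  have T: "k < 2" "1 - k < 2" "?Y \<in> Ob E" "?Y' \<in> Ob E" "y \<in> Ar E" "Dom E y = ?Y" "Cod E y = ?Y'" "zero ch \<in> Ob E"
    using S D by auto
  note TT = D(1-8,10-17) c c' S S' H(1-3) H'(1-3)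
  have th: "?\<theta>' \<cdot> FA I y = y \<cdot> ?\<theta>"
  proof -
    have "cmor (bang ?Y, ini_cof ?Y) (Id E (zero ch)) (Id E ?Y) (bang ?Y, ini_cof ?Y)"
      using ini_mor[of "Id E ?Y"] T by simp
    \<comment> \<open>naturality in the right map, with the cofibration fixed\<close>
    from cyl_fill_natural[OF this P, unfolded fst_conv, OF lift_homotopy_square[OF e PD(1) c]]
    have 1: "y \<cdot> ?\<theta> = cyl_fill (1 - k) (bang ?Y, ini_cof ?Y) P' (y \<cdot> (bang ?Y \<cdot> \<epsilon> (zero ch)) \<cdot> FA I (Id E (zero ch))) y (b \<cdot> \<psi> \<cdot> FA I (fst P))"
      using T TT by (simp add: lift_homotopy_def Let_def)
    have "cmor (bang ?Y, ini_cof ?Y) (Id E (zero ch)) y (bang ?Y', ini_cof ?Y')"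
      using ini_mor[of y] T by simp
    \<comment> \<open>naturality in the cofibration, with the right map fixed\<close>
    from cyl_fill_natural[OF this right_mor_id[OF PD(2) v], unfolded fst_conv, OF lift_homotopy_square[OF e' PD(2) c']]
    have 2: "?\<theta>' \<cdot> FA I y = cyl_fill (1 - k) (bang ?Y, ini_cof ?Y) P' ((bang ?Y' \<cdot> \<epsilon> (zero ch)) \<cdot> FA I (Id E (zero ch))) y (\<psi>' \<cdot> FA I (fst P') \<cdot> FA I y)"
      using T TT by (simp add: lift_homotopy_def Let_def)
    have 3: "y \<cdot> (bang ?Y \<cdot> \<epsilon> (zero ch)) \<cdot> FA I (Id E (zero ch)) = (bang ?Y' \<cdot> \<epsilon> (zero ch)) \<cdot> FA I (Id E (zero ch))"
      by (rule cyl_initial_map) (use T in simp_all)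
    have "FA I (fst P') \<cdot> FA I y = FA I b \<cdot> FA I (fst P)" using D by (simp flip: I_simps(5))
    then have 4: "\<psi>' \<cdot> FA I (fst P') \<cdot> FA I y = b \<cdot> \<psi> \<cdot> FA I (fst P)"
      using TT by (simp add: comp_sq[OF me(3)])
    show ?thesis using 1 2 3 4 by simp
  qed
  let ?w = "pb_arr f (fst P) a y f' (fst P')"
  let ?g = "pair f (fst P) (g \<cdot> fst P) (?\<theta> \<cdot> \<delta> k ?Y)" and ?g' = "pair f' (fst P') (g' \<cdot> fst P') (?\<theta>' \<cdot> \<delta> k ?Y')"
  let ?\<phi> = "pair f (fst P) (\<phi> \<cdot> FA I (pb1 ch f (fst P))) (?\<theta> \<cdot> FA I (pb2 ch f (fst P)))"
    and ?\<phi>' = "pair f' (fst P') (\<phi>' \<cdot> FA I (pb1 ch f' (fst P'))) (?\<theta>' \<cdot> FA I (pb2 ch f' (fst P')))"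
  have dn: "\<delta> k ?Y' \<cdot> y = FA I y \<cdot> \<delta> k ?Y" using \<delta>_natural[OF T(1,5)] T by simp
  note YY = TT T W(1-3) G(1-3) G'(1-3) F(1-3) F'(1-3)
  have 1: "?g' \<cdot> y = ?w \<cdot> ?g"
  proof (rule pb_eqI[of f' "fst P'"])
    show "pb1 ch f' (fst P') \<cdot> ?g' \<cdot> y = pb1 ch f' (fst P') \<cdot> ?w \<cdot> ?g"
      using YY G(4) D(18) by (simp add: comp_eq_ext[OF G'(4)] comp_sq[OF W(4)] comp_sq[OF me(1)])
    show "pb2 ch f' (fst P') \<cdot> ?g' \<cdot> y = pb2 ch f' (fst P') \<cdot> ?w \<cdot> ?g"
      using YY G(5) dn by (simp add: comp_eq_ext[OF G'(5)] comp_sq[OF W(5)] comp_sq[OF th])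
  qed (use YY in simp_all)
  have i: "FA I (pb1 ch f' (fst P')) \<cdot> FA I ?w = FA I a \<cdot> FA I (pb1 ch f (fst P))"
     "FA I (pb2 ch f' (fst P')) \<cdot> FA I ?w = FA I y \<cdot> FA I (pb2 ch f (fst P))"
    using W(4,5) YY by (simp_all flip: I_simps(5))
  have 2: "?\<phi>' \<cdot> FA I ?w = ?w \<cdot> ?\<phi>"
  proof (rule pb_eqI[of f' "fst P'"])
    show "pb1 ch f' (fst P') \<cdot> ?\<phi>' \<cdot> FA I ?w = pb1 ch f' (fst P') \<cdot> ?w \<cdot> ?\<phi>"
      using YY F(4) i(1) by (simp add: comp_eq_ext[OF F'(4)] comp_sq[OF W(4)] comp_sq[OF me(2)])
    show "pb2 ch f' (fst P') \<cdot> ?\<phi>' \<cdot> FA I ?w = pb2 ch f' (fst P') \<cdot> ?w \<cdot> ?\<phi>"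
      using YY F(5) i(2) by (simp add: comp_eq_ext[OF F'(5)] comp_sq[OF W(5)] comp_sq[OF th])
  qed (use YY in simp_all)
  show ?thesis using 1 2 th by (simp add: equiv_mor_def pb_equiv_def Let_def)
qed

subsection \<open>Cofibrations that are strong homotopy equivalences are left maps\<close>

text \<open>Since \<open>c\<close> is a retract of \<open>\<delta>\<^sup>k \<otimes> c\<close>, extend the square along the retraction, fill, and restrict the filler to
  the opposite endpoint.\<close>

definition equiv_fill :: "nat \<Rightarrow> 'a \<times> 's \<Rightarrow> 'a equiv_data \<Rightarrow> ('a, 'i + 'i) lifting_map \<Rightarrow> 'a \<Rightarrow> 'a \<Rightarrow> 'a" where
  "equiv_fill k c = (\<lambda>(g, \<phi>, \<psi>) X s t. cyl_fill k c X (s \<cdot> \<phi>) (s \<cdot> g) (t \<cdot> \<psi>) \<cdot> \<delta> (1 - k) (Cod E (fst c)))"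

lemma equiv_square:
  assumes e: "strong_equiv k f (g, \<phi>, \<psi>)" and q: "is_square E f s t r"
  shows "cyl_square k f (s \<cdot> \<phi>) (s \<cdot> g) (t \<cdot> \<psi>) r"
proof -
  note S = strong_equiv_D[OF e] and D = is_square_D[OF q]
  note T = S(1-12) D(1-8)
  have "r \<cdot> s \<cdot> \<phi> = t \<cdot> \<psi> \<cdot> FA I f" "r \<cdot> s \<cdot> g = t \<cdot> \<psi> \<cdot> \<delta> k (Cod E f)" "s \<cdot> \<phi> \<cdot> \<delta> k (Dom E f) = s \<cdot> g \<cdot> f"
    using T S(13,15,17) by (simp_all add: comp_sq[OF D(9)])
  then show ?thesis using T by (simp add: cyl_square_def)
qed

lemma equiv_fill:
  assumes c: "c \<in> Cof" and e: "strong_equiv k (fst c) S" and X: "X \<in> RM" and q: "is_square E (fst c) s t (fst X)"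
  shows "fills E (fst c) s t (fst X) (equiv_fill k c S X s t)"
proof -
  obtain g \<phi> \<psi> where S: "S = (g, \<phi>, \<psi>)" by (cases S)
  note E = strong_equiv_D[OF e[unfolded S]] and D = is_square_D[OF q]
  note F = cyl_fills_D[OF cyl_fill[OF c X equiv_square[OF e[unfolded S] q]]]
  note T = E(1-12) D(1-8) F(1-3)
  let ?\<theta> = "cyl_fill k c X (s \<cdot> \<phi>) (s \<cdot> g) (t \<cdot> \<psi>)"
  have "?\<theta> \<cdot> \<delta> (1 - k) (Cod E (fst c)) \<cdot> fst c = ?\<theta> \<cdot> FA I (fst c) \<cdot> \<delta> (1 - k) (Dom E (fst c))"
    using \<delta>_natural[OF E(2,3)] by simp
  also have "\<dots> = s" using T E(14) by (simp add: comp_eq_ext[OF F(4)])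
  finally have 1: "?\<theta> \<cdot> \<delta> (1 - k) (Cod E (fst c)) \<cdot> fst c = s" .
  have 2: "fst X \<cdot> ?\<theta> \<cdot> \<delta> (1 - k) (Cod E (fst c)) = t" using T E(16) by (simp add: comp_eq_ext[OF F(6)])
  show ?thesis unfolding equiv_fill_def S using T 1 2 by (intro fillsI) simp_all
qed

lemma equiv_fill_natural:
  assumes c: "cmor c' a b c" and e: "strong_equiv k (fst c) S" and e': "strong_equiv k (fst c') S'" and m: "equiv_mor S' a b S"
    and X: "rmor X m n X'" and q: "is_square E (fst c) s t (fst X)"
  shows "m \<cdot> equiv_fill k c S X s t \<cdot> b = equiv_fill k c' S' X' (m \<cdot> s \<cdot> a) (n \<cdot> t \<cdot> b)"
proof -
  obtain g \<phi> \<psi> g' \<phi>' \<psi>' where S: "S = (g, \<phi>, \<psi>)" "S' = (g', \<phi>', \<psi>')" by (cases S; cases S')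
  note cm = cmor_D[OF c, THEN conjunct1] cmor_D[OF c, THEN conjunct2, THEN conjunct1] cmor_D[OF c, THEN conjunct2, THEN conjunct2]
  note E = strong_equiv_D(1-12)[OF e[unfolded S]] and E' = strong_equiv_D(1-12)[OF e'[unfolded S]] 
  note D = is_square_D(1-8)[OF q] is_square_D(1-8)[OF cm(3)] is_square_D(1-8)[OF right_mor_D(3)[OF X]]
  note sq = equiv_square[OF e[unfolded S] q]
  note F = cyl_fills_D(1-3)[OF cyl_fill[OF cm(2) right_mor_D(1)[OF X] sq]]
  have me: "g \<cdot> b = a \<cdot> g'" "\<phi> \<cdot> FA I a = a \<cdot> \<phi>'" "\<psi> \<cdot> FA I b = b \<cdot> \<psi>'" using m S by (auto simp: equiv_mor_def)
  note T = E E' D F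
  let ?\<theta> = "cyl_fill k c X (s \<cdot> \<phi>) (s \<cdot> g) (t \<cdot> \<psi>)"
  have "m \<cdot> equiv_fill k c S X s t \<cdot> b = (m \<cdot> ?\<theta> \<cdot> FA I b) \<cdot> \<delta> (1 - k) (Cod E (fst c'))"
    unfolding equiv_fill_def S using T \<delta>_natural[OF E(2) D(12)] by simp
  also have "m \<cdot> ?\<theta> \<cdot> FA I b = cyl_fill k c' X' (m \<cdot> (s \<cdot> \<phi>) \<cdot> FA I a) (m \<cdot> (s \<cdot> g) \<cdot> b) (n \<cdot> (t \<cdot> \<psi>) \<cdot> FA I b)"
    by (rule cyl_fill_natural[OF c X sq])
  also have "m \<cdot> (s \<cdot> \<phi>) \<cdot> FA I a = (m \<cdot> s \<cdot> a) \<cdot> \<phi>'" using T me by simp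
  also have "m \<cdot> (s \<cdot> g) \<cdot> b = (m \<cdot> s \<cdot> a) \<cdot> g'" using T me by simp
  also have "n \<cdot> (t \<cdot> \<psi>) \<cdot> FA I b = (n \<cdot> t \<cdot> b) \<cdot> \<psi>'" using T me by simp
  finally show ?thesis by (simp add: equiv_fill_def S)
qed

subsection \<open>Pullbacks of the generators\<close>

definition side :: "'i + 'i \<Rightarrow> nat" where "side x = (case x of Inl i \<Rightarrow> 0 | Inr i \<Rightarrow> 1)"

definition base :: "'x + 'x \<Rightarrow> 'x" where "base x = (case x of Inl i \<Rightarrow> i | Inr i \<Rightarrow> i)"

lemma side_base: "side x < 2" "inj_at (side x) (base x) = x"
  by (cases x; simp add: side_def base_def inj_at_def)+

definition gens_cof :: "'i + 'i \<Rightarrow> 'a \<times> 's" where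
  "gens_cof x = (FO gens x, lei_cof (side x) (FO u (base x), gen_cof (base x)))"

definition gens_equiv :: "'i + 'i \<Rightarrow> 'a equiv_data" where
  "gens_equiv x = leibniz_equiv (side x) (FO u (base x))"

definition gens_fill :: "'i + 'i \<Rightarrow> ('a, 'i + 'i) lifting_map \<Rightarrow> ('a, 'i + 'i) lifting_map \<Rightarrow> 'a \<Rightarrow> 'a \<Rightarrow> 'a" where
  "gens_fill x P = equiv_fill (side x) (pb2 ch (FO gens x) (fst P), pb_cof (gens_cof x) (fst P)) (pb_equiv (side x) (FO gens x) (gens_equiv x) P)"

lemma gens_side: "FO gens x = FO (lei (side x)) (FO u (base x))" "FO gens x = fst (gens_cof x)"
  using gens_FO[OF side_base(1), of x "base x"] side_base(2)[of x] by (simp_all add: gens_cof_def)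

lemma base_Ob: "x \<in> Ob JJ \<Longrightarrow> base x \<in> Ob J"
  using JJ_inj(1)[of "side x" "base x"] by (simp add: side_base)

lemma gens_cof: "x \<in> Ob JJ \<Longrightarrow> gens_cof x \<in> Cof"
  using lei_cof[OF side_base(1) gen[OF base_Ob], of x x] by (simp add: gens_cof_def gens_side(1))

lemma gens_strong_equiv: "x \<in> Ob JJ \<Longrightarrow> strong_equiv (side x) (FO gens x) (gens_equiv x)"
  unfolding gens_equiv_def gens_side(1) by (rule leibniz_strong_equiv[OF side_base(1) u_Ar[OF base_Ob]])

lemma gens_mor:
  assumes "\<sigma> \<in> Ar JJ"
  shows "side (Dom JJ \<sigma>) = side (Cod JJ \<sigma>)"
    and "cmor (gens_cof (Dom JJ \<sigma>)) (top_of (FA gens \<sigma>)) (bot_of (FA gens \<sigma>)) (gens_cof (Cod JJ \<sigma>))"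
    and "equiv_mor (gens_equiv (Dom JJ \<sigma>)) (top_of (FA gens \<sigma>)) (bot_of (FA gens \<sigma>)) (gens_equiv (Cod JJ \<sigma>))"
proof -
  obtain k s where k: "k < 2" and s: "\<sigma> = inj_at k s" "s \<in> Ar J"
    using assms by (cases \<sigma>) (auto simp: inj_at_def intro: that[of 0] that[of 1])
  have sb: "side (inj_at k i) = k" "base (inj_at k j) = j" for i and j :: 'x
    using k by (auto simp: side_def base_def inj_at_def less_2_cases_iff)
  note V = functor_square[OF u s(2)]
  have FA: "top_of (FA gens \<sigma>) = leibniz_top k (FO u (Dom J s)) (top_of (FA u s)) (bot_of (FA u s)) (FO u (Cod J s))"
    "bot_of (FA gens \<sigma>) = FA I (bot_of (FA u s))"
    using gens_FA[OF k, of s] leibniz_FA[OF k V(1)] V(2) s(1) by simp_all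
  show "side (Dom JJ \<sigma>) = side (Cod JJ \<sigma>)" using s sb by simp
  show "cmor (gens_cof (Dom JJ \<sigma>)) (top_of (FA gens \<sigma>)) (bot_of (FA gens \<sigma>)) (gens_cof (Cod JJ \<sigma>))"
    using lei_cof_mor[OF k gen_mor[OF s(2)]] FA s(1) by (simp add: gens_cof_def sb gens_FO[OF k])
  show "equiv_mor (gens_equiv (Dom JJ \<sigma>)) (top_of (FA gens \<sigma>)) (bot_of (FA gens \<sigma>)) (gens_equiv (Cod JJ \<sigma>))"
    using leibniz_equiv_mor[OF k V(1)] FA s(1) by (simp add: gens_equiv_def sb)
qed

lemma pb_gens:
  assumes x: "x \<in> Ob JJ" and P: "P \<in> RM" and c: "Cod E (FO gens x) = Cod E (fst P)"
  shows "(pb2 ch (FO gens x) (fst P), pb_cof (gens_cof x) (fst P)) \<in> Cof"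
    and "strong_equiv (side x) (pb2 ch (FO gens x) (fst P)) (pb_equiv (side x) (FO gens x) (gens_equiv x) P)"
proof -
  show "(pb2 ch (FO gens x) (fst P), pb_cof (gens_cof x) (fst P)) \<in> Cof"
    using pb_cof[OF gens_cof[OF x] right_map_Ar[OF P]] c unfolding gens_side(2) by simp
  show "strong_equiv (side x) (pb2 ch (FO gens x) (fst P)) (pb_equiv (side x) (FO gens x) (gens_equiv x) P)"
    using pb_strong_equiv[OF _ P c] gens_strong_equiv[OF x] by (cases "gens_equiv x") auto
qed

sublocale gen_frobenius E "pb1 ch" "pb2 ch" JJ gens gens_fill
proof
  interpret JJ: category JJ by (fact K)
  fix x P X s t assume x: "x \<in> Ob JJ" and P: "P \<in> RM" and X: "X \<in> RM" and c: "Cod E (FO gens x) = Cod E (fst P)"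
    and q: "is_square E (pb2 ch (FO gens x) (fst P)) s t (fst X)"
  show "fills E (pb2 ch (FO gens x) (fst P)) s t (fst X) (gens_fill x P X s t)"
    using equiv_fill[OF pb_gens(1)[OF x P c] _ X] pb_gens(2)[OF x P c] q by (simp add: gens_fill_def)
next
  interpret JJ: category JJ by (fact K)
  fix \<sigma> P y P' X' m n X s t
  assume s: "\<sigma> \<in> Ar JJ" and P: "rmor P y (bot_of (FA gens \<sigma>)) P'" and X: "rmor X' m n X"
    and c: "Cod E (FO gens (Dom JJ \<sigma>)) = Cod E (fst P)" and q: "is_square E (pb2 ch (FO gens (Cod JJ \<sigma>)) (fst P')) s t (fst X')"
  have o: "Dom JJ \<sigma> \<in> Ob JJ" "Cod JJ \<sigma> \<in> Ob JJ" using s by auto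
  note V = functor_square(1)[OF v s] and PD = right_mor_D[OF P]
  have c': "Cod E (FO gens (Cod JJ \<sigma>)) = Cod E (fst P')" using is_square_D(8)[OF V] is_square_D(8)[OF PD(3)] by simp
  note M = gens_mor[OF s]
  note E1 = pb_gens(2)[OF o(1) PD(1) c] and E2 = pb_gens(2)[OF o(2) PD(2) c']
  have cm: "cmor (pb2 ch (FO gens (Dom JJ \<sigma>)) (fst P), pb_cof (gens_cof (Dom JJ \<sigma>)) (fst P))
      (pb_arr (FO gens (Dom JJ \<sigma>)) (fst P) (top_of (FA gens \<sigma>)) y (FO gens (Cod JJ \<sigma>)) (fst P')) y
      (pb2 ch (FO gens (Cod JJ \<sigma>)) (fst P'), pb_cof (gens_cof (Cod JJ \<sigma>)) (fst P'))"
    using pb_cof_mor[OF M(2) PD(3)] c unfolding gens_side(2) by simp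
  have em: "equiv_mor (pb_equiv (side (Cod JJ \<sigma>)) (FO gens (Dom JJ \<sigma>)) (gens_equiv (Dom JJ \<sigma>)) P)
     (pb_arr (FO gens (Dom JJ \<sigma>)) (fst P) (top_of (FA gens \<sigma>)) y (FO gens (Cod JJ \<sigma>)) (fst P')) y
     (pb_equiv (side (Cod JJ \<sigma>)) (FO gens (Cod JJ \<sigma>)) (gens_equiv (Cod JJ \<sigma>)) P')"
    using pb_equiv_mor[OF _ _ V _ P c] gens_strong_equiv[OF o(1)] gens_strong_equiv[OF o(2)] M(1,3)
    by (cases "gens_equiv (Dom JJ \<sigma>)"; cases "gens_equiv (Cod JJ \<sigma>)") auto
  show "m \<cdot> gens_fill (Cod JJ \<sigma>) P' X' s t \<cdot> y =
     gens_fill (Dom JJ \<sigma>) P X (m \<cdot> s \<cdot> pb_arr (FO gens (Dom JJ \<sigma>)) (fst P) (top_of (FA gens \<sigma>)) y (FO gens (Cod JJ \<sigma>)) (fst P')) (n \<cdot> t \<cdot> y)"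
    using equiv_fill_natural[OF cm _ _ em X] E1 E2 q M(1) by (simp add: gens_fill_def)
qed

end

section \<open>Lifting in an algebraic weak factorization system\<close>

lemmas L_maps_str = L_maps_def[unfolded copointed_coalgs_def]
lemmas R_Maps_str = R_Maps_def[unfolded monad_algs_def]

locale awfs_category = category E for E :: "('o, 'a) cat" (structure) +
  fixes W :: "'a awfs_data"
  assumes awfs: "awfs E W"
begin

lemma fac:
  assumes "f \<in> Ar E"
  shows "facL W f \<in> Ar E" "facR W f \<in> Ar E" "Dom E (facL W f) = Dom E f" "Cod E (facL W f) = Dom E (facR W f)"
    "Cod E (facR W f) = Cod E f" "facR W f \<cdot> facL W f = f"
  using awfs assms by (auto simp: awfs_def functorial_factorization_def)

lemma facK:
  assumes q: "is_square E f s t g"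
  shows "facK W (f, (s, t), g) \<in> Ar E" "Dom E (facK W (f, (s, t), g)) = Dom E (facR W f)"
    "Cod E (facK W (f, (s, t), g)) = Dom E (facR W g)"
    "facK W (f, (s, t), g) \<cdot> facL W f = facL W g \<cdot> s" "facR W g \<cdot> facK W (f, (s, t), g) = t \<cdot> facR W f"
proof -
  have L: "is_functor (arrow_cat E) (arrow_cat E) (L_fun W)" and R: "is_functor (arrow_cat E) (arrow_cat E) (R_fun W)"
    using awfs by (auto simp: awfs_def functorial_factorization_def)
  have "(f, (s, t), g) \<in> Ar (arrow_cat E)" using q by simp
  from functor_Ar[OF L this] functor_Ar[OF R this]
  have l: "is_square E (facL W f) s (facK W (f, (s, t), g)) (facL W g)"
    and r: "is_square E (facR W f) (facK W (f, (s, t), g)) t (facR W g)"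
    by (simp_all add: L_fun_def R_fun_def)
  show "facK W (f, (s, t), g) \<in> Ar E" "Dom E (facK W (f, (s, t), g)) = Dom E (facR W f)"
    "Cod E (facK W (f, (s, t), g)) = Dom E (facR W g)"
    "facK W (f, (s, t), g) \<cdot> facL W f = facL W g \<cdot> s" "facR W g \<cdot> facK W (f, (s, t), g) = t \<cdot> facR W f"
    using is_square_D[OF l] is_square_D[OF r] by simp_all
qed

lemma facK_comp:
  assumes q: "is_square E f s t g" and q': "is_square E g s' t' h"
  shows "facK W (f, (s' \<cdot> s, t' \<cdot> t), h) = facK W (g, (s', t'), h) \<cdot> facK W (f, (s, t), g)"
proof -
  have L: "is_functor (arrow_cat E) (arrow_cat E) (L_fun W)"
    using awfs by (auto simp: awfs_def functorial_factorization_def)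
  have "(f, (s, t), g) \<in> Ar (arrow_cat E)" "(g, (s', t'), h) \<in> Ar (arrow_cat E)" using q q' by simp_all
  then have "FA (L_fun W) ((g, (s', t'), h) \<cdot>\<^bsub>arrow_cat E\<^esub> (f, (s, t), g)) =
      FA (L_fun W) (g, (s', t'), h) \<cdot>\<^bsub>arrow_cat E\<^esub> FA (L_fun W) (f, (s, t), g)"
    by (intro functor_comp_eq[OF L]) simp_all
  then show ?thesis by (simp add: L_fun_def)
qed

text \<open>Only one side of a coalgebra or algebra structure carries information: a section of the right
  factor, respectively a retraction of the left factor; the other side is an identity.\<close>

lemma L_map_Ob: "c \<in> Ob (L_maps E W) \<longleftrightarrow> fst c \<in> Ar E \<and>
   (\<exists>l. snd c = (fst c, (Id E (Dom E (fst c)), l), facL W (fst c)) \<and> l \<in> Ar E \<and> Dom E l = Cod E (fst c) \<and>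
      Cod E l = Dom E (facR W (fst c)) \<and> l \<cdot> fst c = facL W (fst c) \<and> facR W (fst c) \<cdot> l = Id E (Cod E (fst c)))"
  (is "_ \<longleftrightarrow> ?R")
proof
  assume c: "c \<in> Ob (L_maps E W)"
  then have f: "fst c \<in> Ar E" and h: "snd c \<in> hom (arrow_cat E) (fst c) (facL W (fst c))"
    and e: "counit E W (fst c) \<cdot>\<^bsub>arrow_cat E\<^esub> snd c = Id (arrow_cat E) (fst c)"
    by (auto simp: L_maps_def copointed_coalgs_def L_fun_def)
  from h obtain a l where s: "snd c = (fst c, (a, l), facL W (fst c))" and q: "is_square E (fst c) a l (facL W (fst c))"
    by (elim arrow_cat_homE)
  note D = is_square_D[OF q] fac[OF f]
  have "Id E (Dom E (fst c)) \<cdot> a = Id E (Dom E (fst c))" "facR W (fst c) \<cdot> l = Id E (Cod E (fst c))"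
    using e s by (simp_all add: counit_def)
  then show ?R using f s D by auto
next
  assume ?R
  then obtain l where f: "fst c \<in> Ar E" and l: "snd c = (fst c, (Id E (Dom E (fst c)), l), facL W (fst c))" "l \<in> Ar E" "Dom E l = Cod E (fst c)"
      "Cod E l = Dom E (facR W (fst c))" "l \<cdot> fst c = facL W (fst c)" "facR W (fst c) \<cdot> l = Id E (Cod E (fst c))" by blast
  have "is_square E (fst c) (Id E (Dom E (fst c))) l (facL W (fst c))" using f l fac[OF f] by (intro is_squareI) simp_all
  then show "c \<in> Ob (L_maps E W)"
    using f l by (cases c) (simp add: L_maps_def copointed_coalgs_def L_fun_def arrow_cat_hom counit_def)
qed

lemma L_map_D:
  assumes "c \<in> Ob (L_maps E W)"
  shows "fst c \<in> Ar E" "bot_of (snd c) \<in> Ar E" "Dom E (bot_of (snd c)) = Cod E (fst c)" "Cod E (bot_of (snd c)) = Dom E (facR W (fst c))"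
    "bot_of (snd c) \<cdot> fst c = facL W (fst c)" "facR W (fst c) \<cdot> bot_of (snd c) = Id E (Cod E (fst c))"
    "snd c = (fst c, (Id E (Dom E (fst c)), bot_of (snd c)), facL W (fst c))"
  using assms unfolding L_map_Ob by (auto simp: bot_of_def)

lemma L_map_Ar:
  "(c, m, c') \<in> Ar (L_maps E W) \<longleftrightarrow> c \<in> Ob (L_maps E W) \<and> c' \<in> Ob (L_maps E W) \<and>
    (\<exists>s t. m = (fst c, (s, t), fst c') \<and> is_square E (fst c) s t (fst c') \<and>
       facK W (fst c, (s, t), fst c') \<cdot> bot_of (snd c) = bot_of (snd c') \<cdot> t)"
proof -
  have eqv: "FA (L_fun W) m \<cdot>\<^bsub>arrow_cat E\<^esub> snd c = snd c' \<cdot>\<^bsub>arrow_cat E\<^esub> m \<longleftrightarrow>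
      facK W (fst c, (s, t), fst c') \<cdot> bot_of (snd c) = bot_of (snd c') \<cdot> t"
    if c: "c \<in> Ob (L_maps E W)" "c' \<in> Ob (L_maps E W)" and m: "m = (fst c, (s, t), fst c')" and q: "is_square E (fst c) s t (fst c')" for s t
  proof -
    note D = is_square_D[OF q]
    show ?thesis
      unfolding m by (subst L_map_D(7)[OF c(1)], subst L_map_D(7)[OF c(2)]) (use D in \<open>simp add: L_fun_def\<close>)
  qed
  have ar: "(c, m, c') \<in> Ar (L_maps E W) \<longleftrightarrow> c \<in> Ob (L_maps E W) \<and> c' \<in> Ob (L_maps E W) \<and>
      m \<in> hom (arrow_cat E) (fst c) (fst c') \<and> FA (L_fun W) m \<cdot>\<^bsub>arrow_cat E\<^esub> snd c = snd c' \<cdot>\<^bsub>arrow_cat E\<^esub> m"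
    by (cases c; cases c') (simp add: L_maps_def copointed_coalgs_def)
  show ?thesis
  proof
    assume l: "(c, m, c') \<in> Ar (L_maps E W)"
    then have "m \<in> hom (arrow_cat E) (fst c) (fst c')" using ar by blast
    then obtain s t where m: "m = (fst c, (s, t), fst c')" "is_square E (fst c) s t (fst c')" by (rule arrow_cat_homE)
    show "c \<in> Ob (L_maps E W) \<and> c' \<in> Ob (L_maps E W) \<and> (\<exists>s t. m = (fst c, (s, t), fst c') \<and> is_square E (fst c) s t (fst c') \<and>
       facK W (fst c, (s, t), fst c') \<cdot> bot_of (snd c) = bot_of (snd c') \<cdot> t)"
      using l ar eqv[OF _ _ m] m by blast
  next
    assume r: "c \<in> Ob (L_maps E W) \<and> c' \<in> Ob (L_maps E W) \<and> (\<exists>s t. m = (fst c, (s, t), fst c') \<and> is_square E (fst c) s t (fst c') \<and>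
       facK W (fst c, (s, t), fst c') \<cdot> bot_of (snd c) = bot_of (snd c') \<cdot> t)"
    then obtain s t where m: "m = (fst c, (s, t), fst c')" "is_square E (fst c) s t (fst c')"
      "facK W (fst c, (s, t), fst c') \<cdot> bot_of (snd c) = bot_of (snd c') \<cdot> t" by blast
    have "m \<in> hom (arrow_cat E) (fst c) (fst c')" unfolding m(1) arrow_cat_hom using m(2) by simp
    then show "(c, m, c') \<in> Ar (L_maps E W)" using ar eqv[OF _ _ m(1,2)] m(3) r by blast
  qed
qed

lemma R_map_Ob:
  assumes "c \<in> Ob (R_maps E W)"
  shows "fst c \<in> Ar E" "top_of (snd c) \<in> Ar E" "Dom E (top_of (snd c)) = Dom E (facR W (fst c))" "Cod E (top_of (snd c)) = Dom E (fst c)"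
    "top_of (snd c) \<cdot> facL W (fst c) = Id E (Dom E (fst c))" "fst c \<cdot> top_of (snd c) = facR W (fst c)"
    "snd c = (facR W (fst c), (top_of (snd c), Id E (Cod E (fst c))), fst c)"
proof -
  from assms have f: "fst c \<in> Ar E" and h: "snd c \<in> hom (arrow_cat E) (facR W (fst c)) (fst c)"
    and e: "snd c \<cdot>\<^bsub>arrow_cat E\<^esub> unit E W (fst c) = Id (arrow_cat E) (fst c)"
    by (auto simp: R_maps_def pointed_algs_def R_fun_def)
  from h obtain a b where s: "snd c = (facR W (fst c), (a, b), fst c)" and q: "is_square E (facR W (fst c)) a b (fst c)"
    by (elim arrow_cat_homE)
  note D = is_square_D[OF q] fac[OF f]
  have "a \<cdot> facL W (fst c) = Id E (Dom E (fst c))" "b \<cdot> Id E (Cod E (fst c)) = Id E (Cod E (fst c))"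
    using e s by (simp_all add: unit_def)
  then show "fst c \<in> Ar E" "top_of (snd c) \<in> Ar E" "Dom E (top_of (snd c)) = Dom E (facR W (fst c))" "Cod E (top_of (snd c)) = Dom E (fst c)"
    "top_of (snd c) \<cdot> facL W (fst c) = Id E (Dom E (fst c))" "fst c \<cdot> top_of (snd c) = facR W (fst c)"
    "snd c = (facR W (fst c), (top_of (snd c), Id E (Cod E (fst c))), fst c)"
    using f s D by auto
qed

lemma R_map_Ar:
  assumes "(c, m, c') \<in> Ar (R_maps E W)"
  obtains s t where "c \<in> Ob (R_maps E W)" "c' \<in> Ob (R_maps E W)" "m = (fst c, (s, t), fst c')" "is_square E (fst c) s t (fst c')"
    "s \<cdot> top_of (snd c) = top_of (snd c') \<cdot> facK W (fst c, (s, t), fst c')"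
proof -
  from assms have c: "c \<in> Ob (R_maps E W)" "c' \<in> Ob (R_maps E W)" and h: "m \<in> hom (arrow_cat E) (fst c) (fst c')"
    and e: "m \<cdot>\<^bsub>arrow_cat E\<^esub> snd c = snd c' \<cdot>\<^bsub>arrow_cat E\<^esub> FA (R_fun W) m"
    by (auto simp: R_maps_def pointed_algs_def)
  from h obtain s t where m: "m = (fst c, (s, t), fst c')" "is_square E (fst c) s t (fst c')" by (elim arrow_cat_homE)
  have "s \<cdot> top_of (snd c) = top_of (snd c') \<cdot> facK W (fst c, (s, t), fst c')"
    using e unfolding m(1) by (subst (asm) R_map_Ob(7)[OF c(1)], subst (asm) R_map_Ob(7)[OF c(2)]) (simp add: R_fun_def)
  with c m that show thesis by blast
qed

lemma R_Maps_R_maps: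
  "c \<in> Ob (R_Maps E W) \<Longrightarrow> c \<in> Ob (R_maps E W)"
  "(c, m, c') \<in> Ar (R_Maps E W) \<Longrightarrow> (c, m, c') \<in> Ar (R_maps E W)"
  by (auto simp: R_Maps_def R_maps_def monad_algs_def pointed_algs_def)

text \<open>The filler of the factored square, from the section to the retraction.\<close>

definition awfs_fill :: "'a \<times> 'a square \<Rightarrow> 'a \<times> 'a square \<Rightarrow> 'a \<Rightarrow> 'a \<Rightarrow> 'a" where
  "awfs_fill c d s t = top_of (snd d) \<cdot> facK W (fst c, (s, t), fst d) \<cdot> bot_of (snd c)"

lemma awfs_fill:
  assumes c: "c \<in> Ob (L_maps E W)" and d: "d \<in> Ob (R_maps E W)" and q: "is_square E (fst c) s t (fst d)"
  shows "fills E (fst c) s t (fst d) (awfs_fill c d s t)"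
proof -
  note C = L_map_D(1-6)[OF c] and R = R_map_Ob(1-6)[OF d] and K = facK[OF q] and D = is_square_D[OF q]
  note F = fac[OF C(1)] fac[OF R(1)]
  have "facK W (fst c, (s, t), fst d) \<cdot> bot_of (snd c) \<cdot> fst c = facL W (fst d) \<cdot> s" using C K by simp
  then have 1: "top_of (snd d) \<cdot> facK W (fst c, (s, t), fst d) \<cdot> bot_of (snd c) \<cdot> fst c = s"
    using C R K(1-3) D F by (simp add: comp_eq_ext[OF R(5)])
  have 2: "fst d \<cdot> top_of (snd d) \<cdot> facK W (fst c, (s, t), fst d) \<cdot> bot_of (snd c) = t"
    using C R(1-4) K(1-3) D F by (simp add: comp_eq_ext[OF R(6)] comp_sq[OF K(5)])
  show ?thesis unfolding awfs_fill_def using C R K D F 1 2 by (intro fillsI) simp_all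
qed

lemma awfs_fill_natural:
  assumes c: "(c', (fst c', (a, b), fst c), c) \<in> Ar (L_maps E W)" and d: "(d, (fst d, (m, n), fst d'), d') \<in> Ar (R_maps E W)"
    and q: "is_square E (fst c) s t (fst d)"
  shows "m \<cdot> awfs_fill c d s t \<cdot> b = awfs_fill c' d' (m \<cdot> s \<cdot> a) (n \<cdot> t \<cdot> b)"
proof -
  from c have co: "c' \<in> Ob (L_maps E W)" "c \<in> Ob (L_maps E W)" and qc: "is_square E (fst c') a b (fst c)"
    and ec: "facK W (fst c', (a, b), fst c) \<cdot> bot_of (snd c') = bot_of (snd c) \<cdot> b"
    by (auto simp: L_map_Ar)
  from d have do: "d \<in> Ob (R_maps E W)" "d' \<in> Ob (R_maps E W)" and qd: "is_square E (fst d) m n (fst d')"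
    and ed: "m \<cdot> top_of (snd d) = top_of (snd d') \<cdot> facK W (fst d, (m, n), fst d')"
    by (auto elim!: R_map_Ar)
  note q2 = square_comp[OF qc q]
  have kk: "facK W (fst c', (m \<cdot> s \<cdot> a, n \<cdot> t \<cdot> b), fst d') =
      facK W (fst d, (m, n), fst d') \<cdot> facK W (fst c, (s, t), fst d) \<cdot> facK W (fst c', (a, b), fst c)"
    using facK_comp[OF q2 qd] facK_comp[OF qc q] by simp
  note T = L_map_D(1-4)[OF co(1)] L_map_D(1-4)[OF co(2)] R_map_Ob(1-4)[OF do(1)] R_map_Ob(1-4)[OF do(2)]
    facK(1-3)[OF q] facK(1-3)[OF qc] facK(1-3)[OF qd] is_square_D(1-8)[OF q] is_square_D(1-8)[OF qc] is_square_D(1-8)[OF qd]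
    fac(1-5)[OF is_square_D(1)[OF q]] fac(1-5)[OF is_square_D(1)[OF qc]] fac(1-5)[OF is_square_D(1)[OF qd]] fac(1-5)[OF is_square_D(2)[OF qd]]
  show ?thesis unfolding awfs_fill_def kk using T ec by (simp add: comp_sq[OF ed])
qed

lemma free_algebra:
  assumes "f \<in> Ar E"
  shows "(facR W f, mult W f) \<in> Ob (R_Maps E W)"
proof -
  have M: "monad (arrow_cat E) (R_fun W) (unit E W) (mult W)" using awfs by (simp add: awfs_def)
  have "mult W f \<in> hom (arrow_cat E) (FO (R_fun W) (facR W f)) (facR W f)"
    using M assms by (auto simp: monad_def nat_trans_def R_fun_def)
  then show ?thesis
    using M assms fac[OF assms] by (auto simp: R_Maps_def monad_algs_def monad_def R_fun_def)
qed

lemma free_algebra_mor: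
  assumes q: "is_square E f s t g"
  shows "((facR W f, mult W f), (facR W f, (facK W (f, (s, t), g), t), facR W g), (facR W g, mult W g)) \<in> Ar (R_Maps E W)"
proof -
  have M: "nat_trans (arrow_cat E) (arrow_cat E) (fcomp (R_fun W) (R_fun W)) (R_fun W) (mult W)"
    and R: "is_functor (arrow_cat E) (arrow_cat E) (R_fun W)" using awfs by (auto simp: awfs_def monad_def)
  have a: "(f, (s, t), g) \<in> Ar (arrow_cat E)" using q by simp
  have e: "FA (R_fun W) (f, (s, t), g) = (facR W f, (facK W (f, (s, t), g), t), facR W g)" by (simp add: R_fun_def)
  have "mult W g \<cdot>\<^bsub>arrow_cat E\<^esub> FA (R_fun W) (FA (R_fun W) (f, (s, t), g)) = FA (R_fun W) (f, (s, t), g) \<cdot>\<^bsub>arrow_cat E\<^esub> mult W f"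
    using nat_trans_eq[OF M a] by simp
  moreover have "is_square E (facR W f) (facK W (f, (s, t), g)) t (facR W g)"
    using functor_Ar[OF R a] e by simp
  ultimately show ?thesis
    using free_algebra[OF is_square_D(1)[OF q]] free_algebra[OF is_square_D(2)[OF q]] e
    by (simp add: R_Maps_def monad_algs_def arrow_cat_hom)
qed

text \<open>The right factor of \<open>u\<^sub>i\<close> underlies a free algebra, so it is a right map and has a filler for the
  square from \<open>u\<^sub>i\<close> with top the left factor and bottom the identity. This filler is a section of the
  right factor as required of a coalgebra, and it is natural because free algebras are functorial.\<close>

lemma generator_L_map:
  assumes J: "category J" and u: "is_functor J (arrow_cat E) u" and af: "algebraically_free E W J u"
  obtains \<Lambda> where "\<And>i. i \<in> Ob J \<Longrightarrow> (FO u i, \<Lambda> i) \<in> Ob (L_maps E W)"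
    and "\<And>\<sigma>. \<sigma> \<in> Ar J \<Longrightarrow> ((FO u (Dom J \<sigma>), \<Lambda> (Dom J \<sigma>)), FA u \<sigma>, (FO u (Cod J \<sigma>), \<Lambda> (Cod J \<sigma>))) \<in> Ar (L_maps E W)"
proof -
  interpret J: category J by fact
  have lf: "lifts (R_Maps E W) (right_maps E J u) forget forget fid"
    using iso_over_lifts(1)[OF af[unfolded algebraically_free_def]] .
  obtain \<Phi> where P: "\<And>X. X \<in> Ob (R_Maps E W) \<Longrightarrow> (fst X, \<Phi> X) \<in> Ob (right_maps E J u)"
    and Q: "\<And>X m Y. (X, m, Y) \<in> Ar (R_Maps E W) \<Longrightarrow> ((fst X, \<Phi> X), m, (fst Y, \<Phi> Y)) \<in> Ar (right_maps E J u)"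
    using lifts_between_str_cats_ex[OF lf R_Maps_str right_maps_def, unfolded fid_simps] by blast
  define F where "F f = (facR W f, \<Phi> (facR W f, mult W f))" for f
  define d where "d i = snd (F (FO u i)) i (facL W (FO u i)) (Id E (Cod E (FO u i)))" for i
  have FO: "F f \<in> Ob (right_maps E J u)" if "f \<in> Ar E" for f
    using P[OF free_algebra[OF that]] by (simp add: F_def)
  have FM: "right_mor E J u (F f) (facK W (f, (s, t), g)) t (F g)" if "is_square E f s t g" for f s t g
    using Q[OF free_algebra_mor[OF that]] by (auto simp: F_def right_maps_Ar)
  have uA: "FO u i \<in> Ar E" if "i \<in> Ob J" for i using functor_Ob[OF u that] by simp
  have sq: "is_square E (FO u i) (facL W (FO u i)) (Id E (Cod E (FO u i))) (fst (F (FO u i)))" if "i \<in> Ob J" for i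
    using fac[OF uA[OF that]] uA[OF that] by (intro is_squareI) (simp_all add: F_def)
  have d: "fills E (FO u i) (facL W (FO u i)) (Id E (Cod E (FO u i))) (facR W (FO u i)) (d i)" if i: "i \<in> Ob J" for i
    using right_map_fills[OF FO[OF uA[OF i]] i sq[OF i]] by (simp add: d_def F_def)
  let ?l = "\<lambda>i. (FO u i, (Id E (Dom E (FO u i)), d i), facL W (FO u i))"
  have Ob: "(FO u i, ?l i) \<in> Ob (L_maps E W)" if "i \<in> Ob J" for i
    using fills_D[OF d[OF that]] uA[OF that] by (simp add: L_map_Ob)
  show thesis
  proof (rule that[of ?l])
    show "(FO u i, ?l i) \<in> Ob (L_maps E W)" if "i \<in> Ob J" for i using Ob[OF that] .
    fix \<sigma> assume s: "\<sigma> \<in> Ar J"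
    have o: "Dom J \<sigma> \<in> Ob J" "Cod J \<sigma> \<in> Ob J" using s by auto
    note V = functor_square[OF u s]
    let ?f = "FO u (Dom J \<sigma>)" and ?g = "FO u (Cod J \<sigma>)" and ?s = "top_of (FA u \<sigma>)" and ?t = "bot_of (FA u \<sigma>)"
    note D = is_square_D[OF V(1)] and K = facK[OF V(1)]
    have "d (Cod J \<sigma>) \<cdot> ?t = snd (F ?g) (Dom J \<sigma>) (facL W ?g \<cdot> ?s) (Id E (Cod E ?g) \<cdot> ?t)"
      using right_map_natural[OF FO[OF uA[OF o(2)]] s sq[OF o(2)]] by (simp add: d_def)
    also have "\<dots> = snd (F ?g) (Dom J \<sigma>) (facK W (?f, (?s, ?t), ?g) \<cdot> facL W ?f) (?t \<cdot> Id E (Cod E ?f))"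
      using K(4) D by simp
    also have "\<dots> = facK W (?f, (?s, ?t), ?g) \<cdot> d (Dom J \<sigma>)"
      using right_mor_fill[OF FM[OF V(1)] o(1) sq[OF o(1)]] by (simp add: d_def)
    finally have "facK W (?f, (?s, ?t), ?g) \<cdot> d (Dom J \<sigma>) = d (Cod J \<sigma>) \<cdot> ?t" by simp
    then show "((FO u (Dom J \<sigma>), ?l (Dom J \<sigma>)), FA u \<sigma>, (FO u (Cod J \<sigma>), ?l (Cod J \<sigma>))) \<in> Ar (L_maps E W)"
      unfolding L_map_Ar using Ob[OF o(1)] Ob[OF o(2)] V(1)
      by (intro conjI exI[of _ ?s] exI[of _ ?t]) (simp_all flip: V(2))
  qed
qed

lemma L_maps_forget: "is_functor (L_maps E W) (arrow_cat E) forget"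
  unfolding L_maps_def copointed_coalgs_def by (rule functor_forget) auto

lemma R_maps_forget: "is_functor (R_maps E W) (arrow_cat E) forget"
  unfolding R_maps_def pointed_algs_def by (rule functor_forget) auto

lemma L_maps_typed [simp]: "typed_cat (L_maps E W)" "typed_cat (R_maps E W)" "typed_cat (R_Maps E W)"
  by (simp_all add: L_maps_def copointed_coalgs_def R_maps_def pointed_algs_def R_Maps_def monad_algs_def)

lemma L_maps_Dom_Cod [simp]:
  "Dom (L_maps E W) (c, m, c') = c" "Cod (L_maps E W) (c, m, c') = c'"
  "Dom (R_maps E W) (c, m, c') = c" "Cod (R_maps E W) (c, m, c') = c'"
  "Dom (R_Maps E W) (c, m, c') = c" "Cod (R_Maps E W) (c, m, c') = c'"
  by (simp_all add: L_maps_def copointed_coalgs_def R_maps_def pointed_algs_def R_Maps_def monad_algs_def)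

text \<open>Evaluation at \<open>v\<^sub>i\<close> makes \<open>v\<^sub>i\<close> a left map, by assumption a coalgebra. Therefore it has fillers
  against all algebras, and these are the structure of a right map.\<close>

lemma R_maps_right_maps:
  assumes K: "category K" and v: "is_functor K (arrow_cat E) v"
    and lf: "lifts (left_maps E (right_maps E K v) forget) (L_maps E W) forget forget fid"
  shows "lifts (R_maps E W) (right_maps E K v) forget forget fid"
proof -
  interpret K: category K by fact
  obtain N where N: "\<And>X. X \<in> Ob (left_maps E (right_maps E K v) forget) \<Longrightarrow> (fst X, N X) \<in> Ob (L_maps E W)"
    and NM: "\<And>X m Y. (X, m, Y) \<in> Ar (left_maps E (right_maps E K v) forget) \<Longrightarrow> ((fst X, N X), m, (fst Y, N Y)) \<in> Ar (L_maps E W)"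
    using lifts_between_str_cats_ex[OF lf left_maps_def L_maps_str, unfolded fid_simps] by blast
  have vA: "FO v i \<in> Ar E" if "i \<in> Ob K" for i using functor_Ob[OF v that] by simp
  define G where "G i = (FO v i, left_restr E (right_maps E K v) forget (FO v i) (\<lambda>X s t. snd X i s t))" for i
  have fG: "fst (G i) = FO v i" for i by (simp add: G_def)
  have rt: "typed_cat (right_maps E K v)" by (simp add: right_maps_def)
  have rf: "is_functor (right_maps E K v) (arrow_cat E) forget"
    unfolding right_maps_def by (rule functor_forget) auto
  have G: "G i \<in> Ob (left_maps E (right_maps E K v) forget)" if i: "i \<in> Ob K" for i
    unfolding G_def
  proof (rule left_map_restrI[OF rt rf vA[OF i]])
    show "fills E (FO v i) s t (FO forget X) (snd X i s t)"
      if "X \<in> Ob (right_maps E K v)" "is_square E (FO v i) s t (FO forget X)" for X s t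
      using right_map_fills[OF that(1) i, of s t] that(2) by simp
    fix w s t assume w: "w \<in> Ar (right_maps E K v)" and q: "is_square E (FO v i) s t (FO forget (Dom (right_maps E K v) w))"
    obtain X mm Y where e: "w = (X, mm, Y)" by (cases w)
    from w e obtain m n where mm: "mm = (fst X, (m, n), fst Y)" and r: "right_mor E K v X m n Y" by (auto simp: right_maps_Ar)
    have "is_square E (FO v i) s t (fst X)" using q e by simp
    from right_mor_fill[OF r i this]
    show "top_of (FA forget w) \<cdot> snd (Dom (right_maps E K v) w) i s t =
        snd (Cod (right_maps E K v) w) i (top_of (FA forget w) \<cdot> s) (bot_of (FA forget w) \<cdot> t)"
      unfolding e mm by simp
  qed
  have GM: "left_mor E (right_maps E K v) forget (G (Dom K \<sigma>)) (top_of (FA v \<sigma>)) (bot_of (FA v \<sigma>)) (G (Cod K \<sigma>))"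
    if s: "\<sigma> \<in> Ar K" for \<sigma>
    unfolding left_mor_def
  proof (intro conjI ballI allI impI)
    show "G (Dom K \<sigma>) \<in> Ob (left_maps E (right_maps E K v) forget)" "G (Cod K \<sigma>) \<in> Ob (left_maps E (right_maps E K v) forget)"
      using G s by auto
    note V = functor_square(1)[OF v s]
    show "is_square E (fst (G (Dom K \<sigma>))) (top_of (FA v \<sigma>)) (bot_of (FA v \<sigma>)) (fst (G (Cod K \<sigma>)))" using V by (simp add: fG)
    fix X s' t' assume X: "X \<in> Ob (right_maps E K v)" and q: "is_square E (fst (G (Cod K \<sigma>))) s' t' (FO forget X)"
    have q': "is_square E (FO v (Cod K \<sigma>)) s' t' (fst X)" using q by (simp add: fG)
    show "snd (G (Cod K \<sigma>)) X s' t' \<cdot> bot_of (FA v \<sigma>) = snd (G (Dom K \<sigma>)) X (s' \<cdot> top_of (FA v \<sigma>)) (t' \<cdot> bot_of (FA v \<sigma>))"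
      using right_map_natural[OF X s q'] X q' square_comp[OF V q'] by (simp add: G_def left_restr_def)
  qed
  define c where "c i = (FO v i, N (G i))" for i
  have fc: "fst (c i) = FO v i" for i by (simp add: c_def)
  have c: "c i \<in> Ob (L_maps E W)" if "i \<in> Ob K" for i using N[OF G[OF that]] by (simp add: c_def fG)
  have cM: "(c (Dom K \<sigma>), (fst (c (Dom K \<sigma>)), (top_of (FA v \<sigma>), bot_of (FA v \<sigma>)), fst (c (Cod K \<sigma>))), c (Cod K \<sigma>)) \<in> Ar (L_maps E W)"
    if "\<sigma> \<in> Ar K" for \<sigma>
  proof -
    have "(G (Dom K \<sigma>), (fst (G (Dom K \<sigma>)), (top_of (FA v \<sigma>), bot_of (FA v \<sigma>)), fst (G (Cod K \<sigma>))), G (Cod K \<sigma>))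
      \<in> Ar (left_maps E (right_maps E K v) forget)" using GM[OF that] by (auto simp: left_maps_Ar)
    from NM[OF this] show ?thesis by (simp add: c_def fG)
  qed
  have cid: "(c i, (fst (c i), (Id E (Dom E (fst (c i))), Id E (Cod E (fst (c i)))), fst (c i)), c i) \<in> Ar (L_maps E W)" if i: "i \<in> Ob K" for i
    using cM[of "Id K i"] i v by (simp add: is_functor_def fc)
  have R_id: "(d, (fst d, (Id E (Dom E (fst d)), Id E (Cod E (fst d))), fst d), d) \<in> Ar (R_maps E W)" if d: "d \<in> Ob (R_maps E W)" for d
  proof -
    interpret A: category "arrow_cat E" by (rule category_arrow_cat)
    have R: "is_functor (arrow_cat E) (arrow_cat E) (R_fun W)" using awfs by (auto simp: awfs_def monad_def)
    have f: "fst d \<in> Ob (arrow_cat E)" and h: "snd d \<in> hom (arrow_cat E) (FO (R_fun W) (fst d)) (fst d)"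
      using d by (auto simp: R_maps_def pointed_algs_def)
    have "Id (arrow_cat E) (fst d) \<cdot>\<^bsub>arrow_cat E\<^esub> snd d = snd d \<cdot>\<^bsub>arrow_cat E\<^esub> FA (R_fun W) (Id (arrow_cat E) (fst d))"
      using R f A.Id_left[OF h] A.Id_right[OF h] by (simp add: is_functor_def del: arrow_cat_simps)
    then show ?thesis using d f square_id[of "fst d"] by (cases d) (simp add: R_maps_def pointed_algs_def arrow_cat_hom)
  qed
  let ?\<phi> = "\<lambda>d. right_restr E K v (fst d) (\<lambda>i s t. awfs_fill (c i) d s t)"
  have Ob: "(fst d, ?\<phi> d) \<in> Ob (right_maps E K v)" if d: "d \<in> Ob (R_maps E W)" for d
  proof (rule right_map_restrI[OF K v])
    show "fst d \<in> Ar E" using R_map_Ob(1)[OF d] .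
    show "fills E (FO v i) s t (fst d) (awfs_fill (c i) d s t)" if "i \<in> Ob K" "is_square E (FO v i) s t (fst d)" for i s t
      using awfs_fill[OF c[OF that(1)] d, of s t] that(2) by (simp add: fc)
    fix \<sigma> s t assume s: "\<sigma> \<in> Ar K" and q: "is_square E (FO v (Cod K \<sigma>)) s t (fst d)"
    have o: "Cod K \<sigma> \<in> Ob K" using s by simp
    note f = fills_D[OF awfs_fill[OF c[OF o] d, of s t, unfolded fc, OF q]]
    note D = is_square_D(1-8)[OF q] is_square_D(1-8)[OF functor_square(1)[OF v s]]
    show "awfs_fill (c (Cod K \<sigma>)) d s t \<cdot> bot_of (FA v \<sigma>) = awfs_fill (c (Dom K \<sigma>)) d (s \<cdot> top_of (FA v \<sigma>)) (t \<cdot> bot_of (FA v \<sigma>))"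
      using awfs_fill_natural[OF cM[OF s] R_id[OF d], of s t] q f D by (simp add: fc)
  qed
  show ?thesis
  proof (rule lifts_right_mapsI[where \<Phi> = ?\<phi>])
    show "is_functor (R_maps E W) (arrow_cat E) (fcomp fid forget)"
      using R_maps_forget by (simp add: is_functor_def)
    show "typed_cat (R_maps E W)" by simp
    show "(FO fid (FO forget X), ?\<phi> X) \<in> Ob (right_maps E K v)" if "X \<in> Ob (R_maps E W)" for X using Ob[OF that] by simp
    fix w assume w: "w \<in> Ar (R_maps E W)"
    obtain d mm d' where e: "w = (d, mm, d')" by (cases w)
    obtain m n where d: "d \<in> Ob (R_maps E W)" "d' \<in> Ob (R_maps E W)" and mm: "mm = (fst d, (m, n), fst d')" and q: "is_square E (fst d) m n (fst d')"
      using w unfolding e by (rule R_map_Ar) blast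
    have "m \<cdot> ?\<phi> d i s t = ?\<phi> d' i (m \<cdot> s) (n \<cdot> t)" if i: "i \<in> Ob K" and sq: "is_square E (FO v i) s t (fst d)" for i s t
    proof -
      note f = fills_D[OF awfs_fill[OF c[OF i] d(1), of s t, unfolded fc, OF sq]]
      note D = is_square_D(1-8)[OF q] is_square_D(1-8)[OF sq]
      have "m \<cdot> awfs_fill (c i) d s t = awfs_fill (c i) d' (m \<cdot> s) (n \<cdot> t)"
        using awfs_fill_natural[OF cid[OF i] w[unfolded e mm], of s t] sq f D by (simp add: fc)
      then show ?thesis using i sq square_comp[OF sq q] by (simp add: right_restr_def)
    qed
    then have "right_mor E K v (fst d, ?\<phi> d) m n (fst d', ?\<phi> d')"
      using Ob[OF d(1)] Ob[OF d(2)] q by (simp add: right_mor_def)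
    then show "right_mor E K v (FO fid (FO forget (Dom (R_maps E W) w)), ?\<phi> (Dom (R_maps E W) w)) (top_of (FA fid (FA forget w)))
      (bot_of (FA fid (FA forget w))) (FO fid (FO forget (Cod (R_maps E W) w)), ?\<phi> (Cod (R_maps E W) w))"
      unfolding e mm by simp
  qed
qed

end

section \<open>The Frobenius condition\<close>

theorem theorem7p8:
  fixes \<kappa> :: "'k rel"
    and E :: "('o, 'a) cat"
    and ch :: "('o, 'a) chosen"
    and I :: "('o, 'a, 'o, 'a) fctr"
    and \<delta> c :: "nat \<Rightarrow> 'o \<Rightarrow> 'a"
    and \<epsilon> :: "'o \<Rightarrow> 'a"
    and CFt CtF :: "'a awfs_data"
    and J :: "('i, 'j) cat"
    and u :: "('i, 'j, 'a, 'a square) fctr"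
  assumes "universe_card \<kappa>"
    and "locally_presentable \<kappa> E"
    and "locally_cartesian_closed E"
    and "is_chosen E ch"
    and "functorial_cylinder E I \<delta>"
    and "contraction E I \<delta> \<epsilon>"
    and "connections E I \<delta> \<epsilon> c"
    and "has_right_adjoint E E I"
    and "awfs E CFt"
    and "suitable \<kappa> E ch I \<delta> CFt"
    and "generates \<kappa> E CFt J u"
    and "awfs E CtF"
    and "algebraically_free E CtF (sum_cat J J) (tensor_gen E ch I \<delta> u)"
    and "iso_over (L_maps E CtF)
           (left_maps E (right_maps E (sum_cat J J) (tensor_gen E ch I \<delta> u)) forget) forget forget"
  shows "functorial_frobenius E ch CtF"
proof -
  interpret category E using assms(3) by (simp add: locally_cartesian_closed_def)
  have J: "category J" and u: "is_functor J (arrow_cat E) u" and af: "algebraically_free E CFt J u"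
    using assms(11) by (auto simp: generates_def small_cat_def)
  interpret cylinder E ch I \<delta>
    by unfold_locales (use assms(4,5,8) in \<open>auto simp: is_chosen_def\<close>)
  interpret connected_cylinder E ch I \<delta> \<epsilon> c
    by unfold_locales (fact assms)+
  interpret W: awfs_category E CFt by unfold_locales (fact assms)
  interpret W': awfs_category E CtF by unfold_locales (fact assms)
  let ?L = "L_maps E CFt" and ?v = "tensor_gen E ch I \<delta> u" and ?K = "sum_cat J J"
  let ?cmor = "\<lambda>c a b c'. (c, (fst c, (a, b), fst c'), c') \<in> Ar ?L"

  \<comment> \<open>right \<open>J\<close>-maps are algebras and so have fillers for all cofibrations\<close>
  have lf: "lifts (right_maps E J u) (R_Maps E CFt) forget forget fid"
    using iso_over_lifts(2)[OF af[unfolded algebraically_free_def]] .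
  obtain \<Theta> where \<Theta>: "\<And>X. X \<in> Ob (right_maps E J u) \<Longrightarrow> (fst X, \<Theta> X) \<in> Ob (R_Maps E CFt)"
    and \<Theta>m: "\<And>X m Y. (X, m, Y) \<in> Ar (right_maps E J u) \<Longrightarrow> ((fst X, \<Theta> X), m, (fst Y, \<Theta> Y)) \<in> Ar (R_Maps E CFt)"
    using lifts_between_str_cats_ex[OF lf right_maps_def R_Maps_str, unfolded fid_simps] by blast
  define cfill where "cfill c Y s t = W.awfs_fill c (fst Y, \<Theta> Y) s t" for c Y s t

  obtain gen where gen: "\<And>i. i \<in> Ob J \<Longrightarrow> (FO u i, gen i) \<in> Ob ?L"
    and genm: "\<And>\<sigma>. \<sigma> \<in> Ar J \<Longrightarrow> ((FO u (Dom J \<sigma>), gen (Dom J \<sigma>)), FA u \<sigma>, (FO u (Cod J \<sigma>), gen (Cod J \<sigma>))) \<in> Ar ?L"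
    using W.generator_L_map[OF J u af] by blast

  have z: "is_initial E (zero ch)" using assms(4) by (simp add: is_chosen_def)
  define bang where "bang X = (THE m. m \<in> hom E (zero ch) X)" for X
  have bang: "bang X \<in> hom E (zero ch) X" if "X \<in> Ob E" for X
    using theI'[of "\<lambda>m. m \<in> hom E (zero ch) X"] z that by (auto simp: is_initial_def bang_def)
  \<comment> \<open>the structures provided by (S2), (S3) and (S4)\<close>
  have s2: "lifts E ?L fid forget (initial_fun E (zero ch))"
    using assms(10) unfolding suitable_def lifts_def by (auto simp: feq_def)
  obtain ini where ini: "\<And>X. X \<in> Ob E \<Longrightarrow> (bang X, ini X) \<in> Ob ?L"
    and inim: "\<And>f. f \<in> Ar E \<Longrightarrow> ((bang (Dom E f), ini (Dom E f)),
        (bang (Dom E f), (Id E (zero ch), f), bang (Cod E f)), (bang (Cod E f), ini (Cod E f))) \<in> Ar ?L"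
  proof -
    from lifts_str_cat_ex[OF s2 L_maps_str typed_cat, unfolded fid_simps] obtain \<Phi> where "\<forall>X\<in>Ob E. (FO (initial_fun E (zero ch)) (X), \<Phi> X) \<in> Ob ?L"
      "\<forall>f\<in>Ar E. ((FO (initial_fun E (zero ch)) (Dom E f), \<Phi> (Dom E f)), FA (initial_fun E (zero ch)) f,
         (FO (initial_fun E (zero ch)) (Cod E f), \<Phi> (Cod E f))) \<in> Ar ?L" by blast
    then show thesis
      by (intro that[of \<Phi>]) (simp_all add: initial_fun_def bang_def Let_def)
  qed

  let ?B = "fib_prod ?L (arrow_cat E) (cod_of E forget) (cod_fun E)"
  let ?U = "fprod forget fid :: (('a \<times> 'a square) \<times> 'a, ('a, 'a square, 'a square) str_arr \<times> 'a square,
    'a \<times> 'a, 'a square \<times> 'a square) fctr"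
  have s3: "lifts ?B ?L ?U forget (pullback_fun E (pb1 ch) (pb2 ch))"
    using assms(10) unfolding suitable_def by blast
  have B: "typed_cat ?B"
  proof (rule typed_cat_fib_prod)
    show "typed_cat (arrow_cat E)" using category.typed_cat[OF category_arrow_cat] .
    show "FA (cod_of E forget) f \<in> hom E (FO (cod_of E forget) (Dom ?L f)) (FO (cod_of E forget) (Cod ?L f))" if "f \<in> Ar ?L" for f
      using functor_bot[OF W.L_maps_forget that] .
    show "FA (cod_fun E) q \<in> hom E (FO (cod_fun E) (Dom (arrow_cat E) q)) (FO (cod_fun E) (Cod (arrow_cat E) q))"
      if "q \<in> Ar (arrow_cat E)" for q
    proof -
      obtain f s t g where q: "q = (f, (s, t), g)" by (cases q) auto
      show ?thesis using is_square_D[of E f s t g] that unfolding q by (simp add: hom_def)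
    qed
  qed simp
  obtain pbc where pbc: "\<And>X. X \<in> Ob ?B \<Longrightarrow> (FO (pullback_fun E (pb1 ch) (pb2 ch)) (FO ?U X), pbc X) \<in> Ob ?L"
    and pbcm: "\<And>w. w \<in> Ar ?B \<Longrightarrow> ((FO (pullback_fun E (pb1 ch) (pb2 ch)) (FO ?U (Dom ?B w)), pbc (Dom ?B w)),
       FA (pullback_fun E (pb1 ch) (pb2 ch)) (FA ?U w),
       (FO (pullback_fun E (pb1 ch) (pb2 ch)) (FO ?U (Cod ?B w)), pbc (Cod ?B w))) \<in> Ar ?L"
    using lifts_str_cat_ex[OF s3 L_maps_str B] by blast

  have "\<exists>l. (\<forall>c\<in>Ob ?L. (FO (leibniz E ch I (\<delta> k)) (fst c), l c) \<in> Ob ?L) \<and>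
     (\<forall>c m c'. (c, m, c') \<in> Ar ?L \<longrightarrow> ((FO (leibniz E ch I (\<delta> k)) (fst c), l c), FA (leibniz E ch I (\<delta> k)) m,
        (FO (leibniz E ch I (\<delta> k)) (fst c'), l c')) \<in> Ar ?L)" if "k < 2" for k
  proof -
    have "lifts ?L ?L forget forget (leibniz E ch I (\<delta> k))"
      using assms(10) that unfolding suitable_def by (auto simp: less_2_cases_iff One_nat_def)
    from lifts_between_str_cats_ex[OF this L_maps_str L_maps_str] show ?thesis .
  qed
  then obtain lei where lei: "\<And>k c. \<lbrakk>k < 2; c \<in> Ob ?L\<rbrakk> \<Longrightarrow> (FO (leibniz E ch I (\<delta> k)) (fst c), lei k c) \<in> Ob ?L"
    and leim: "\<And>k c m c'. \<lbrakk>k < 2; (c, m, c') \<in> Ar ?L\<rbrakk> \<Longrightarrow> ((FO (leibniz E ch I (\<delta> k)) (fst c), lei k c), FA (leibniz E ch I (\<delta> k)) m,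
        (FO (leibniz E ch I (\<delta> k)) (fst c'), lei k c')) \<in> Ar ?L"
    by metis

  interpret J: category J by (fact J)
  interpret cofibrations E ch I \<delta> J u "Ob ?L" ?cmor cfill \<epsilon> c gen ini bang "\<lambda>c h. pbc (c, h)" lei
  proof unfold_locales
    show "is_functor J (arrow_cat E) u" by (fact u)
    show "fst d \<in> Ar E" if "d \<in> Ob ?L" for d using W.L_map_D(1)[OF that] .
    show "d \<in> Ob ?L \<and> d' \<in> Ob ?L \<and> is_square E (fst d) a b (fst d')" if "?cmor d a b d'" for d a b d'
      using that by (simp add: W.L_map_Ar)
    show "fills E (fst d) s t (fst Y) (cfill d Y s t)"
      if "d \<in> Ob ?L" "Y \<in> Ob (right_maps E J u)" "is_square E (fst d) s t (fst Y)" for d Y s t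
      using W.awfs_fill[OF that(1) W.R_Maps_R_maps(1)[OF \<Theta>[OF that(2)]]] that(3) by (simp add: cfill_def)
    show "m \<cdot>\<^bsub>E\<^esub> cfill d Y s t \<cdot>\<^bsub>E\<^esub> b = cfill d' Y' (m \<cdot>\<^bsub>E\<^esub> s \<cdot>\<^bsub>E\<^esub> a) (n \<cdot>\<^bsub>E\<^esub> t \<cdot>\<^bsub>E\<^esub> b)"
      if "?cmor d' a b d" "right_mor E J u Y m n Y'" "is_square E (fst d) s t (fst Y)" for d' a b d Y m n Y' s t
    proof -
      have "(Y, (fst Y, (m, n), fst Y'), Y') \<in> Ar (right_maps E J u)" using that(2) by (auto simp: right_maps_Ar)
      from W.awfs_fill_natural[OF that(1), of "(fst Y, \<Theta> Y)" m n "(fst Y', \<Theta> Y')" s t] W.R_Maps_R_maps(2)[OF \<Theta>m[OF this]] that(3)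
      show ?thesis by (simp add: cfill_def)
    qed
    show "(FO u i, gen i) \<in> Ob ?L" if "i \<in> Ob J" for i using gen[OF that] .
    show "?cmor (FO u (Dom J \<sigma>), gen (Dom J \<sigma>)) (top_of (FA u \<sigma>)) (bot_of (FA u \<sigma>)) (FO u (Cod J \<sigma>), gen (Cod J \<sigma>))" if "\<sigma> \<in> Ar J" for \<sigma>
      using genm[OF that] functor_square(2)[OF u that] by simp
    show "bang X \<in> hom E (zero ch) X" if "X \<in> Ob E" for X using bang[OF that] .
    show "(bang X, ini X) \<in> Ob ?L" if "X \<in> Ob E" for X using ini[OF that] .
    show "?cmor (bang (Dom E f), ini (Dom E f)) (Id E (zero ch)) f (bang (Cod E f), ini (Cod E f))" if "f \<in> Ar E" for f
      using inim[OF that] by simp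
    show "(pb2 ch (fst d) h, pbc (d, h)) \<in> Ob ?L" if "d \<in> Ob ?L" "h \<in> Ar E" "Cod E (fst d) = Cod E h" for d h
      using pbc[of "(d, h)"] that by simp
    show "?cmor (pb2 ch (fst d) h, pbc (d, h)) (pb_arr (fst d) h a y (fst d') h') y (pb2 ch (fst d') h', pbc (d', h'))"
      if "?cmor d a b d'" "is_square E h y b h'" "Cod E (fst d) = Cod E h" for d a b d' h y h'
    proof -
      have q: "is_square E (fst d) a b (fst d')" using that(1) by (simp add: W.L_map_Ar)
      have "((d, (fst d, (a, b), fst d'), d'), (h, (y, b), h')) \<in> Ar ?B" using that by simp
      from pbcm[OF this] show ?thesis using pullback_fun_FA[OF q that(2,3)] by simp
    qed
    show "(FO (leibniz E ch I (\<delta> k)) (fst d), lei k d) \<in> Ob ?L" if "k < 2" "d \<in> Ob ?L" for k d using lei[OF that] .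
    show "?cmor (FO (leibniz E ch I (\<delta> k)) (fst d), lei k d) (leibniz_top k (fst d) a b (fst d')) (FA I b) (FO (leibniz E ch I (\<delta> k)) (fst d'), lei k d')"
      if "k < 2" "?cmor d a b d'" for k d a b d'
    proof -
      have q: "is_square E (fst d) a b (fst d')" using that(2) by (simp add: W.L_map_Ar)
      show ?thesis using leim[OF that] leibniz_FA[OF that(1) q] by simp
    qed
  qed

  interpret lcc_gen_frobenius E "pb1 ch" "pb2 ch" ?K ?v gens_fill
    by unfold_locales (fact assms)
  have N: "lifts (left_maps E (right_maps E ?K ?v) forget) (L_maps E CtF) forget forget fid"
    and N': "lifts (L_maps E CtF) (left_maps E (right_maps E ?K ?v) forget) forget forget fid"
    using iso_over_lifts[OF assms(14)] by simp_all
  have R: "lifts (R_maps E CtF) (right_maps E ?K ?v) forget forget fid"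
    by (rule W'.R_maps_right_maps[OF K v N])
  show ?thesis
    unfolding functorial_frobenius_def
    by (rule lifts_fib_prod_transfer[OF frobenius_lifts N' R N])
qed

end
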